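(* Let $n\ge1$ and let $f\in W^{1,\infty}(\mathbb{H}^{n})$, i.e. let $f:\mathbb{H}^n\to\mathbb{R}$ be bounded and Lipschitz with respect to $d$. Then the limit $$T^{1/2}f(z,t):=\lim_{\varepsilon\to0}\int_{|r|>\varepsilon}\frac{f(z,t+r)-f(z,t)}{|r|^{3/2}}\,dr$$ exists for a.e. $(z,t)\in\mathbb{R}^{2n}\times\mathbb{R}$; $T^{1/2}f$ is also a derivative in the distributional sense that $$\int_{\mathbb{H}^n}\varphi\cdot T^{1/2}f=\int_{\mathbb{H}^n}f\cdot T^{1/2}\varphi\qquad\text{for all }\varphi\in\mathcal{D};$$ and $T^{1/2}f\in\mathrm{BMO}(\mathbb{H}^{n})$ with $\|T^{1/2}f\|_{\mathrm{BMO}}\le C\,\|\nabla_{\mathbb{H}}f\|_{\infty}$, where $C$ depends only on $n$.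
   Context: Heisenberg group: $\mathbb{H}^n=\mathbb{R}^{2n+1}=\mathbb{R}^{2n}\times\mathbb{R}$ with points $(z,t)$, $z=(x,y)\in\mathbb{R}^n\times\mathbb{R}^n$, and product $(x,y,t)\cdot(x',y',t')=(x+x',y+y',t+t'+\tfrac12\sum_{i=1}^n(x_iy_i'-y_ix_i'))$. The metric is the Korányi distance $d(p,q)=\|q^{-1}\cdot p\|_{\mathbb{H}}$, $\|(z,t)\|_{\mathbb{H}}=(|z|^4+16t^2)^{1/4}$. Integration is with respect to Lebesgue measure. $\mathcal{D}$ denotes the smooth compactly supported functions on $\mathbb{R}^{2n+1}$; for $\varphi\in\mathcal{D}$, $T^{1/2}\varphi$ is defined by the same limit and lies in $L^1\cap L^\infty$. With $X_i=\partial_{x_i}-\tfrac{y_i}{2}\partial_t$ and $Y_i=\partial_{y_i}+\tfrac{x_i}{2}\partial_t$, the horizontal gradient is $\nabla_{\mathbb{H}}f=(X_1f,\dots,X_nf,Y_1f,\dots,Y_nf)$; for a Lipschitz function it exists a.e. and lies in $L^\infty(\mathbb{H}^n)$. $\mathrm{BMO}(\mathbb{H}^n)$ is the space of $g\in L^1_{loc}(\mathbb{H}^n)$ with $\|g\|_{\mathrm{BMO}}:=\sup_B\frac{1}{|B|}\int_B|g-g_B|\,dx<\infty$, the supremum being over all balls $B$ of $(\mathbb{H}^n,d)$ and $g_B=\frac1{|B|}\int_Bg$. *)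

theory Defs
  imports "HOL-Probability.Essential_Supremum"
begin

text \<open>Points of the Heisenberg group are \<open>((x, y), t)\<close> with \<open>x, y\<close> in \<open>real ^ 'n\<close>, so that
  \<open>n = CARD('n) \<ge> 1\<close>, and \<open>norm (x, y)\<close> is the Euclidean norm on \<open>\<real>\<^sup>2\<^sup>n\<close>. The class
  instances of the product type (\<^const>\<open>dist\<close>, \<^const>\<open>ball\<close>, \<^const>\<open>lebesgue\<close>) are the
  Euclidean ones; the Koranyi distance and its balls are the separate constants \<open>hdist\<close>
  and \<open>hball\<close>.\<close>

type_synonym 'n heis = "((real ^ 'n) \<times> (real ^ 'n)) \<times> real"

definition hmult :: "'n::finite heis \<Rightarrow> 'n heis \<Rightarrow> 'n heis" where
  "hmult = (\<lambda>((x, y), t) ((x', y'), t').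
     ((x + x', y + y'), t + t' + (1/2) * (\<Sum>i\<in>UNIV. x $ i * y' $ i - y $ i * x' $ i)))"

definition hinv :: "'n::finite heis \<Rightarrow> 'n heis" where
  "hinv = (\<lambda>((x, y), t). ((- x, - y), - t))"

lemma hmult_hinv: "hmult (hinv p) p = 0" "hmult p (hinv p) = 0"
  by (simp_all add: hmult_def hinv_def case_prod_beta zero_prod_def mult.commute)

definition hnorm :: "'n::finite heis \<Rightarrow> real" where
  "hnorm = (\<lambda>(z, t). root 4 (norm z ^ 4 + 16 * t ^ 2))"

definition hdist :: "'n::finite heis \<Rightarrow> 'n heis \<Rightarrow> real" where
  "hdist p q = hnorm (hmult (hinv q) p)"

definition hball :: "'n::finite heis \<Rightarrow> real \<Rightarrow> 'n heis set" where
  "hball p r = {q. hdist q p < r}"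

definition W1inf :: "('n::finite heis \<Rightarrow> real) set" where
  "W1inf = {f. bounded (range f) \<and> (\<exists>L. \<forall>p q. \<bar>f p - f q\<bar> \<le> L * hdist p q)}"

definition T_half_trunc :: "('n::finite heis \<Rightarrow> real) \<Rightarrow> 'n heis \<Rightarrow> real \<Rightarrow> real" where
  "T_half_trunc f = (\<lambda>(z, t) \<epsilon>.
     LINT r:{r. \<bar>r\<bar> > \<epsilon>}|lborel. (f (z, t + r) - f (z, t)) / \<bar>r\<bar> powr (3/2))"

text \<open>\<open>T_half f p\<close> is meaningful only where the limit exists; elsewhere it is an unspecified
  constant.\<close>

definition T_half :: "('n::finite heis \<Rightarrow> real) \<Rightarrow> 'n heis \<Rightarrow> real" where
  "T_half f p = Lim (at_right 0) (T_half_trunc f p)"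

text \<open>\<open>X i p\<close> and \<open>Y i p\<close> are the values at \<open>p\<close> of the vector fields
  \<open>\<partial>\<^sub>x\<^sub>i - (y\<^sub>i/2) \<partial>\<^sub>t\<close> and \<open>\<partial>\<^sub>y\<^sub>i + (x\<^sub>i/2) \<partial>\<^sub>t\<close>.
  A function that is Lipschitz for \<open>hdist\<close> need not have a derivative in \<open>t\<close>, so
  the field acts on it as a whole, by differentiation at \<open>p\<close> along the line
  \<open>s \<mapsto> p + s X\<^sub>i(p)\<close>, which is its integral curve through \<open>p\<close>.\<close>

definition X_field :: "'n::finite \<Rightarrow> 'n heis \<Rightarrow> 'n heis" where
  "X_field i = (\<lambda>((x, y), t). ((axis i 1, 0), - (y $ i / 2)))"

definition Y_field :: "'n::finite \<Rightarrow> 'n heis \<Rightarrow> 'n heis" where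
  "Y_field i = (\<lambda>((x, y), t). ((0, axis i 1), x $ i / 2))"

definition along :: "('n::finite heis \<Rightarrow> 'n heis) \<Rightarrow> ('n heis \<Rightarrow> real) \<Rightarrow> 'n heis \<Rightarrow> real" where
  "along V f p = deriv (\<lambda>s. f (p + s *\<^sub>R V p)) 0"

lemma along_eq_derivative:
  assumes "(f has_derivative f') (at p)"
  shows "along V f p = f' (V p)"
proof -
  interpret bounded_linear f'
    using assms by (rule has_derivative_bounded_linear)
  have "(f has_derivative f') (at (p + 0 *\<^sub>R V p))"
    using assms by simp
  then have "((\<lambda>s. f (p + s *\<^sub>R V p)) has_derivative (\<lambda>s. f' (s *\<^sub>R V p))) (at (0::real))"
    by (rule has_derivative_compose[rotated]) (auto intro!: derivative_eq_intros)
  then have "((\<lambda>s. f (p + s *\<^sub>R V p)) has_field_derivative f' (V p)) (at (0::real))"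
    by (rule has_derivative_imp_has_field_derivative) (simp add: scaleR)
  then show ?thesis
    unfolding along_def by (rule DERIV_imp_deriv)
qed

lemma X_Y_of_differentiable:
  assumes "(f has_derivative f') (at ((x, y), t))"
  shows "along (X_field i) f ((x, y), t) = f' ((axis i 1, 0), 0) - y $ i / 2 * f' ((0, 0), 1)"
    and "along (Y_field i) f ((x, y), t) = f' ((0, axis i 1), 0) + x $ i / 2 * f' ((0, 0), 1)"
proof -
  interpret bounded_linear f'
    using assms by (rule has_derivative_bounded_linear)
  have "f' (z, c) = f' (z, 0) + c * f' ((0, 0), 1)" for z c
    using add[of "(z, 0)" "c *\<^sub>R ((0, 0), 1)"] scaleR[of c "((0, 0), 1)"]
    by (simp add: zero_prod_def[symmetric])
  from this[of _ "- (y $ i / 2)"] this[of _ "x $ i / 2"]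
  show "along (X_field i) f ((x, y), t) = f' ((axis i 1, 0), 0) - y $ i / 2 * f' ((0, 0), 1)"
    and "along (Y_field i) f ((x, y), t) = f' ((0, axis i 1), 0) + x $ i / 2 * f' ((0, 0), 1)"
    by (simp_all add: along_eq_derivative[OF assms] X_field_def Y_field_def)
qed

definition hgrad :: "('n::finite heis \<Rightarrow> real) \<Rightarrow> 'n heis \<Rightarrow> (real ^ 'n) \<times> (real ^ 'n)" where
  "hgrad f p = ((\<chi> i. along (X_field i) f p), (\<chi> i. along (Y_field i) f p))"

definition hgrad_Linf :: "('n::finite heis \<Rightarrow> real) \<Rightarrow> ennreal" where
  "hgrad_Linf f = esssup lebesgue (\<lambda>p. ennreal (norm (hgrad f p)))"

primrec C_k :: "nat \<Rightarrow> ('a::real_normed_vector \<Rightarrow> real) \<Rightarrow> bool" where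
  "C_k 0 f \<longleftrightarrow> continuous_on UNIV f"
| "C_k (Suc k) f \<longleftrightarrow> f differentiable_on UNIV \<and> (\<forall>v. C_k k (\<lambda>x. frechet_derivative f (at x) v))"

definition test_functions :: "('n::finite heis \<Rightarrow> real) set" where
  "test_functions = {\<phi>. (\<forall>k. C_k k \<phi>) \<and> compact (closure (support_on UNIV \<phi>))}"

definition L1_loc :: "('n::finite heis \<Rightarrow> real) set" where
  "L1_loc = {g. \<forall>K. compact K \<longrightarrow> set_integrable lebesgue K g}"

definition average :: "('n::finite heis \<Rightarrow> real) \<Rightarrow> 'n heis set \<Rightarrow> real" where
  "average g B = (LINT q:B|lebesgue. g q) / measure lebesgue B"

definition bmo_norm :: "('n::finite heis \<Rightarrow> real) \<Rightarrow> ennreal" where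
  "bmo_norm g = (SUP B \<in> {hball p r | p r. r > 0}.
     (\<integral>\<^sup>+ q\<in>B. ennreal \<bar>g q - average g B\<bar> \<partial>lebesgue) / emeasure lebesgue B)"

definition BMO :: "('n::finite heis \<Rightarrow> real) set" where
  "BMO = {g \<in> L1_loc. bmo_norm g < \<infinity>}"

end

theory Submission
 imports Defs "HOL-Real_Asymp.Real_Asymp" "HOL-Probability.Sinc_Integral"
begin

text \<open>A vertical translation by \<open>s\<^sup>2\<close> is the commutator of two horizontal translations
by \<open>s\<close>. Pairing \<open>f (z, t + s\<^sup>2) - f (z, t)\<close> with a skew-symmetric vertical convolution of
\<open>f\<close> whose kernel approximates \<open>1 / t\<close>, and moving horizontal translations from one factor to the
other, turns each factor into a horizontal difference of size \<open>L s\<close>; as the convolution is bounded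
on \<open>L\<^sup>2\<close>, the pairing is at most a constant times \<open>L\<^sup>2 s\<^sup>2 |supp f|\<close>. For the vertical Abel
transform \<open>J f = f * t\<^sub>+ powr (-1/2)\<close> the \<open>L\<^sup>2\<close> norm of a difference quotient is a logarithmic energy,
hence an average of such pairings. So \<open>J f\<close> has a vertical derivative \<open>g\<close> in \<open>L\<^sup>2\<close> on almost
every line. Inverting \<open>J\<close> writes the truncated integrals of \<open>f\<close> as averages of \<open>g\<close> against
an integrable kernel at scale \<open>\<epsilon>\<close>, which converge almost everywhere and weakly by Lebesgue's
differentiation theorem.

For a bounded Lipschitz \<open>f\<close> one cuts \<open>f - f 0\<close> off at scale \<open>R\<close>: the local part is small in \<open>L\<^sup>2\<close>
by the above, and the tail of the integral oscillates by at most a constant times \<open>L\<close> on a ball of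
radius \<open>R\<close>. Left translations reduce all balls to those centred at \<open>0\<close>.\<close>

text \<open>The difficulty is borderline. A function that is Lipschitz for the Koranyi distance is
  only Hoelder of order 1/2 in \<open>t\<close>, so the integrand of the half-derivative may be as
  large as \<open>1 / |r|\<close>, and this regularity on a single vertical line does not decide
  convergence. What is gained comes from the horizontal directions, after integration over
  \<open>z\<close>. The kernel \<open>1 / t\<close> has the following origin. The correlation of
  \<open>abel\<close> with itself is \<open>- ln |x - y|\<close> plus a divergent constant; a
  difference quotient has mean zero, which removes the constant, and putting its difference on the
  logarithm produces a mean of smoothed kernels \<open>1 / r\<close>. Their L2 bound comes from an
  explicit correlation integral of mass \<open>pi^2\<close>. The derivative \<open>g\<close> is
  chosen line by line, without control of measurability in \<open>z\<close>; for the integration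
  over \<open>z\<close> its square is recovered as a liminf of difference quotients. The gradient
  enters at the end: along almost every integral curve of a horizontal field it bounds the
  increments of \<open>f\<close>, and \<open>2 * n + 4\<close> such moves, none longer than the
  distance, join any two points, so it controls the Lipschitz constant.\<close>

type_synonym 'n plane = "(real ^ 'n) \<times> (real ^ 'n)"

abbreviation borel_fun :: "('a::topological_space \<Rightarrow> 'b::topological_space) set"
 where "borel_fun \<equiv> borel_measurable borel"

abbreviation nn_integral_lborel :: "('a::euclidean_space \<Rightarrow> ennreal) \<Rightarrow> ennreal" (binder "NN " [60] 60)
 where "nn_integral_lborel f \<equiv> nn_integral lborel f"

abbreviation integral_lborel :: "('a::euclidean_space \<Rightarrow> real) \<Rightarrow> real" (binder "LB " [60] 60)
 where "integral_lborel f \<equiv> lebesgue_integral lborel f"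

section \<open>Differentiation of indefinite integrals\<close>

text \<open>Henstock's lemma bounds the total error of a fine partial division. On intervals whose
  mean misses \<open>g t\<close> by at least \<open>1 / Suc m\<close> this error controls the total
  length, and Vitali's covering lemma passes from a disjoint subfamily to all of
  \<open>bad m\<close>.\<close>

lemma negligible_not_DERIV_indefinite_integral:
 fixes g :: "real \<Rightarrow> real"
 assumes g: "g integrable_on {a..b}"
 shows "negligible {t \<in> {a<..<b}. \<not> ((\<lambda>x. integral {a..x} g) has_real_derivative g t) (at t)}"
proof -
 define bad where "bad m = {t \<in> {a<..<b}. \<forall>d>0. \<exists>u v. a \<le> u \<and> v \<le> b \<and> u < v \<and> u \<le> t \<and> t \<le> v \<and> v - u < d \<and>
  \<bar>(v - u) * g t - integral {u..v} g\<bar> \<ge> (v - u) / real (Suc m)}" for m :: nat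
 have neg: "negligible (bad m)" for m
  unfolding negligible_outer_le
 proof (intro allI impI)
  fix e :: real assume e: "0 < e"
  \<comment> \<open>\<open>Suc m\<close> converts error into length; 5 is the enlargement factor in
    Vitali's lemma.\<close>
  define e' where "e' = e / (5 * real (Suc m))"
  have e': "e' > 0" using e by (simp add: e'_def)
  from Henstock_lemma[of g a b e'] g e' obtain \<gamma> where \<gamma>: "gauge \<gamma>"
   "\<And>p. \<lbrakk>p tagged_partial_division_of (cbox a b); \<gamma> fine p\<rbrakk> \<Longrightarrow>
       sum (\<lambda>(x,k). norm(measure lborel k *\<^sub>R g x - integral k g)) p < e'"
   by (auto simp: cbox_interval)
  \<comment> \<open>The bound \<open>v - u < 2\<close> keeps the radii of the covering intervals at
    most 1.\<close>
  have "\<exists>u v. a \<le> u \<and> v \<le> b \<and> u < v \<and> u \<le> t \<and> t \<le> v \<and> v - u < 2 \<and> {u..v} \<subseteq> \<gamma> t \<and>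
    \<bar>(v - u) * g t - integral {u..v} g\<bar> \<ge> (v - u) / real (Suc m)" if t: "t \<in> bad m" for t
  proof -
   obtain d where d: "d > 0" "ball t d \<subseteq> \<gamma> t"
    using \<gamma>(1) by (metis gauge_def open_contains_ball)
   from t d(1) obtain u v where "a \<le> u \<and> v \<le> b \<and> u < v \<and> u \<le> t \<and> t \<le> v \<and> v - u < min d 2 \<and>
    \<bar>(v - u) * g t - integral {u..v} g\<bar> \<ge> (v - u) / real (Suc m)"
    unfolding bad_def mem_Collect_eq by (metis min_less_iff_conj zero_less_numeral)
   moreover from this have "{u..v} \<subseteq> ball t d" by (auto simp: dist_real_def)
   ultimately show ?thesis using d(2) by (intro exI[of _ u] exI[of _ v]) auto
  qed
  then obtain u v where uv: "\<And>t. t \<in> bad m \<Longrightarrow> a \<le> u t \<and> v t \<le> b \<and> u t < v t \<and> u t \<le> t \<and> t \<le> v t \<and>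
    v t - u t < 2 \<and> {u t..v t} \<subseteq> \<gamma> t \<and>
    \<bar>(v t - u t) * g t - integral {u t..v t} g\<bar> \<ge> (v t - u t) / real (Suc m)"
   by metis
  define c r where "c t = (u t + v t) / 2" and "r t = (v t - u t) / 2" for t
  have cb: "cball (c t) (r t) = {u t..v t}" for t
   by (auto simp: c_def r_def cball_def dist_real_def abs_le_iff field_simps)
  obtain C where C: "countable C" "C \<subseteq> bad m"
   "pairwise (\<lambda>i j. disjnt (cball (c i) (r i)) (cball (c j) (r j))) C"
   "bad m \<subseteq> (\<Union>i\<in>C. cball (c i) (5 * r i))"
  proof (rule Vitali_covering_lemma_cballs[where S="bad m" and K="bad m" and a=c and r=r and B=1])
   show "bad m \<subseteq> (\<Union>i\<in>bad m. cball (c i) (r i))" using uv by (fastforce simp: cb)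
   show "\<And>i. i \<in> bad m \<Longrightarrow> 0 < r i \<and> r i \<le> 1" using uv by (fastforce simp: r_def)
  qed
  have fin: "(\<Sum>t\<in>F. v t - u t) \<le> e / 5" if F: "finite F" "F \<subseteq> C" for F
  proof -
   define p where "p = (\<lambda>t. (t, {u t..v t})) ` F"
   have Fb: "t \<in> bad m" if "t \<in> F" for t using that F C(2) by auto
   have dis: "{u t..v t} \<inter> {u s..v s} = {}" if "t \<in> F" "s \<in> F" "t \<noteq> s" for t s
    using C(3) that F(2) by (auto simp: pairwise_def disjnt_def cb subset_iff)
   have "p tagged_partial_division_of (cbox a b)"
    unfolding tagged_partial_division_of_def
   proof (intro conjI allI impI)
    show "finite p" using F by (simp add: p_def)
    fix x K assume "(x, K) \<in> p"
    then have x: "x \<in> F" "K = {u x..v x}" by (auto simp: p_def)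
    show "x \<in> K" "K \<subseteq> cbox a b" using uv[OF Fb[OF x(1)]] x(2) by auto
    show "\<exists>a b. K = cbox a b" using x(2) by (metis cbox_interval)
   next
    fix x K y L assume "(x, K) \<in> p \<and> (y, L) \<in> p \<and> (x, K) \<noteq> (y, L)"
    then have x: "x \<in> F" "K = {u x..v x}" and y: "y \<in> F" "L = {u y..v y}" "x \<noteq> y"
     by (auto simp: p_def)
    show "interior K \<inter> interior L = {}"
     using dis[OF x(1) y(1,3)] x(2) y(2) interior_subset[of K] interior_subset[of L] by blast
   qed
   moreover have "\<gamma> fine p" using uv Fb by (fastforce simp: fine_def p_def)
   ultimately have "sum (\<lambda>(x,k). norm(measure lborel k *\<^sub>R g x - integral k g)) p < e'" by (rule \<gamma>(2))
   also have "sum (\<lambda>(x,k). norm(measure lborel k *\<^sub>R g x - integral k g)) p =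
     (\<Sum>t\<in>F. \<bar>(v t - u t) * g t - integral {u t..v t} g\<bar>)"
    unfolding p_def using uv[OF Fb] by (subst sum.reindex) (fastforce simp: inj_on_def intro!: sum.cong)+
   finally have "(\<Sum>t\<in>F. \<bar>(v t - u t) * g t - integral {u t..v t} g\<bar>) < e'" .
   moreover have "(\<Sum>t\<in>F. (v t - u t) / real (Suc m)) \<le> (\<Sum>t\<in>F. \<bar>(v t - u t) * g t - integral {u t..v t} g\<bar>)"
    using uv[OF Fb] by (intro sum_mono) auto
   ultimately have "(\<Sum>t\<in>F. (v t - u t)) / real (Suc m) \<le> e'" by (simp add: sum_divide_distrib)
   then have "(\<Sum>t\<in>F. (v t - u t)) / real (Suc m) * real (Suc m) \<le> e' * real (Suc m)"
    by (intro mult_right_mono) auto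
   then show ?thesis by (simp add: e'_def del: of_nat_Suc)
  qed
  have bd: "measure lebesgue (\<Union>i\<in>F. cball (c i) (5 * r i)) \<le> e" if F: "F \<subseteq> C" "finite F" for F
  proof -
   have "measure lebesgue (\<Union>i\<in>F. cball (c i) (5 * r i)) \<le> (\<Sum>i\<in>F. measure lebesgue (cball (c i) (5 * r i)))"
    using F by (intro measure_UNION_le) auto
   also have "\<dots> = (\<Sum>i\<in>F. 5 * (v i - u i))"
   proof (rule sum.cong[OF refl])
    fix i assume "i \<in> F"
    then have "u i < v i" using uv F C(2) by blast
    then have "0 \<le> r i" by (simp add: r_def)
    then have "measure lebesgue (cball (c i) (5 * r i)) = (c i + 5 * r i) - (c i - 5 * r i)"
     by (simp add: cball_eq_atLeastAtMost)
    then show "measure lebesgue (cball (c i) (5 * r i)) = 5 * (v i - u i)"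
     by (simp add: r_def)
   qed
   also have "\<dots> \<le> e" using fin[OF F(2,1)] unfolding sum_distrib_left[symmetric] by linarith
   finally show ?thesis .
  qed
  show "\<exists>T. bad m \<subseteq> T \<and> T \<in> lmeasurable \<and> measure lebesgue T \<le> e"
   using C(4) fmeasurable_UN_bound[OF C(1) _ bd] measure_UN_bound[OF C(1) _ bd]
   by (intro exI[of _ "\<Union>i\<in>C. cball (c i) (5 * r i)"]) auto
 qed
 have "((\<lambda>x. integral {a..x} g) has_real_derivative g t) (at t)"
  if t: "t \<in> {a<..<b}" and nb: "\<And>m. t \<notin> bad m" for t
  unfolding has_field_derivative_iff tendsto_iff eventually_at dist_real_def
 proof (intro allI impI)
  fix e :: real assume e: "0 < e"
  then obtain m where m: "1 / real (Suc m) < e" using nat_approx_posE by blast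
  from nb[of m] t obtain d where d: "d > 0"
   "\<And>u v. \<lbrakk>a \<le> u; v \<le> b; u < v; u \<le> t; t \<le> v; v - u < d\<rbrakk> \<Longrightarrow>
     \<bar>(v - u) * g t - integral {u..v} g\<bar> < (v - u) / real (Suc m)"
   unfolding bad_def by (auto simp: not_le) (metis not_le)
  show "\<exists>d>0. \<forall>x\<in>UNIV. x \<noteq> t \<and> \<bar>x - t\<bar> < d \<longrightarrow>
    \<bar>(integral {a..x} g - integral {a..t} g) / (x - t) - g t\<bar> < e"
  proof (intro exI[of _ "min d (min (t - a) (b - t))"] conjI ballI impI)
   show "0 < min d (min (t - a) (b - t))" using d t by auto
   fix x assume x: "x \<noteq> t \<and> \<bar>x - t\<bar> < min d (min (t - a) (b - t))"
   define u v where "u = min x t" and "v = max x t"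
   have uv: "a \<le> u" "v \<le> b" "u < v" "u \<le> t" "t \<le> v" "v - u < d" "v - u = \<bar>x - t\<bar>"
    using x t by (auto simp: u_def v_def)
   have int: "integral {a..u} g + integral {u..v} g = integral {a..v} g"
    using uv t by (intro Henstock_Kurzweil_Integration.integral_combine integrable_on_subinterval[OF g]) auto
   have "(integral {a..x} g - integral {a..t} g) / (x - t) = integral {u..v} g / (v - u)"
   proof (cases "x < t")
    case True
    then have "integral {a..x} g - integral {a..t} g = - integral {u..v} g" "x - t = - (v - u)"
     using int by (auto simp: u_def v_def)
    then show ?thesis using minus_divide_divide by metis
   next
    case False
    then have "integral {a..x} g - integral {a..t} g = integral {u..v} g" "x - t = v - u"
     using int by (auto simp: u_def v_def)
    then show ?thesis by (simp only:)
   qed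
   then have "\<bar>(integral {a..x} g - integral {a..t} g) / (x - t) - g t\<bar> = \<bar>(v - u) * g t - integral {u..v} g\<bar> / (v - u)"
   proof -
    have "integral {u..v} g / (v - u) - g t = (integral {u..v} g - (v - u) * g t) / (v - u)"
     using uv(3) by (simp add: diff_divide_distrib)
    then show ?thesis using uv(3) \<open>_ = integral {u..v} g / (v - u)\<close>
     by (simp add: abs_divide abs_minus_commute)
   qed
   also have "\<dots> < 1 / real (Suc m)"
    using d(2)[OF uv(1-6)] uv(3) by (simp add: field_simps)
   finally show "\<bar>(integral {a..x} g - integral {a..t} g) / (x - t) - g t\<bar> < e" using m by simp
  qed
 qed
 then have "{t \<in> {a<..<b}. \<not> ((\<lambda>x. integral {a..x} g) has_real_derivative g t) (at t)} \<subseteq> (\<Union>m. bad m)"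
  by blast
 moreover have "negligible (\<Union>m. bad m)" using neg by (intro negligible_countable_Union) auto
 ultimately show ?thesis by (rule negligible_subset[rotated])
qed

lemma AE_DERIV_indefinite_integral:
 fixes g :: "real \<Rightarrow> real"
 assumes g: "set_integrable lborel {a..b} g"
 shows "AE t in lborel. a < t \<and> t < b \<longrightarrow> ((\<lambda>x. LINT s:{a..x}|lborel. g s) has_real_derivative g t) (at t)"
proof -
 have eq: "(LINT s:{a..x}|lborel. g s) = integral {a..x} g" if "x \<le> b" for x
  by (rule set_borel_integral_eq_integral(2)) (rule set_integrable_subset[OF g], use that in auto)
 have "negligible {t \<in> {a<..<b}. \<not> ((\<lambda>x. integral {a..x} g) has_real_derivative g t) (at t)}"
  by (intro negligible_not_DERIV_indefinite_integral set_borel_integral_eq_integral g)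
 then have "AE t in lebesgue. t \<notin> {t \<in> {a<..<b}. \<not> ((\<lambda>x. integral {a..x} g) has_real_derivative g t) (at t)}"
  by (intro AE_not_in) (simp add: negligible_iff_null_sets)
 then have "AE t in lborel. t \<notin> {t \<in> {a<..<b}. \<not> ((\<lambda>x. integral {a..x} g) has_real_derivative g t) (at t)}"
  by (simp add: AE_completion_iff)
 then show ?thesis
 proof eventually_elim
  case (elim t)
  show ?case
  proof
   assume t: "a < t \<and> t < b"
   with elim have "((\<lambda>x. integral {a..x} g) has_real_derivative g t) (at t)" by auto
   then show "((\<lambda>x. LINT s:{a..x}|lborel. g s) has_real_derivative g t) (at t)"
    by (rule has_field_derivative_transform_within_open[of _ _ _ "{a<..<b}"]) (use t eq in auto)
  qed
 qed
qed

text \<open>Riesz-Fischer: a subsequence whose increments have summable L1 norms converges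
  absolutely almost everywhere and is dominated by \<open>w\<close>; the Cauchy property then
  carries the limit over to the whole sequence.\<close>

lemma L1_Cauchy_imp_convergent:
 fixes v :: "nat \<Rightarrow> 'a \<Rightarrow> real"
 assumes int: "\<And>n. integrable M (v n)"
  and C: "\<And>e. e > 0 \<Longrightarrow> \<exists>N. \<forall>m\<ge>N. \<forall>n\<ge>N. (LINT x|M. \<bar>v m x - v n x\<bar>) < e"
 shows "\<exists>g. integrable M g \<and> (\<lambda>n. LINT x|M. \<bar>v n x - g x\<bar>) \<longlonglongrightarrow> 0"
proof -
 note [measurable] = borel_measurable_integrable[OF int]
 have "\<forall>j. \<exists>N. \<forall>m\<ge>N. \<forall>n\<ge>N. (LINT x|M. \<bar>v m x - v n x\<bar>) < (1/2)^j" using C by simp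
 then obtain N where N: "\<And>j m n. m \<ge> N j \<Longrightarrow> n \<ge> N j \<Longrightarrow> (LINT x|M. \<bar>v m x - v n x\<bar>) < (1/2)^j" by metis
 define k where "k j = (\<Sum>i\<le>j. N i)" for j
 have kN: "k j \<ge> N j" for j by (simp add: k_def member_le_sum)
 have kS: "k (Suc j) \<ge> k j" for j by (simp add: k_def)
 define u where "u j x = v (k (Suc j)) x - v (k j) x" for j x
 have uint: "integrable M (u j)" for j unfolding u_def by (intro Bochner_Integration.integrable_diff int)
 note [measurable] = borel_measurable_integrable[OF uint]
 have ub: "(LINT x|M. \<bar>u j x\<bar>) \<le> (1/2)^j" for j
  unfolding u_def using N[of j "k (Suc j)" "k j"] kN[of j] kS[of j] by simp
 have sm: "summable (\<lambda>j. LINT x|M. \<bar>u j x\<bar>)"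
  by (rule summable_comparison_test'[of "\<lambda>j. (1/2::real)^j" 0]) (use ub in \<open>auto intro: summable_geometric\<close>)
 have "(\<integral>\<^sup>+x. (\<Sum>j. ennreal \<bar>u j x\<bar>) \<partial>M) = (\<Sum>j. ennreal (LINT x|M. \<bar>u j x\<bar>))"
  by (subst nn_integral_suminf) (auto simp: nn_integral_eq_integral[OF integrable_abs[OF uint]])
 also have "\<dots> \<noteq> \<infinity>" using sm by (simp add: suminf_ennreal2)
 finally have "AE x in M. (\<Sum>j. ennreal \<bar>u j x\<bar>) \<noteq> \<infinity>" by (intro nn_integral_PInf_AE) auto
 then have AEs: "AE x in M. summable (\<lambda>j. \<bar>u j x\<bar>)"
  by eventually_elim (rule summable_suminf_not_top, auto)
 define g where "g x = v (k 0) x + (\<Sum>j. u j x)" for x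
 define w where "w x = 2 * (\<bar>v (k 0) x\<bar> + (\<Sum>j. \<bar>u j x\<bar>))" for x
 have gint: "integrable M g"
  unfolding g_def by (intro Bochner_Integration.integrable_add int integrable_suminf uint) (use AEs sm in auto)
 have wint: "integrable M w"
  unfolding w_def by (intro integrable_mult_right Bochner_Integration.integrable_add integrable_abs int integrable_suminf uint) (use AEs sm in auto)
 note [measurable] = borel_measurable_integrable[OF gint]
 have tel: "(\<Sum>j<n. u j x) = v (k n) x - v (k 0) x" for n x
  unfolding u_def by (rule sum_lessThan_telescope)
 have lim: "(\<lambda>j. LINT x|M. \<bar>v (k j) x - g x\<bar>) \<longlonglongrightarrow> (LINT x|M. 0)"
 proof (rule integral_dominated_convergence[where w=w])
  show "AE x in M. (\<lambda>j. \<bar>v (k j) x - g x\<bar>) \<longlonglongrightarrow> 0"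
   using AEs
  proof eventually_elim
   case (elim x)
   then have "(\<lambda>n. \<Sum>j<n. u j x) \<longlonglongrightarrow> (\<Sum>j. u j x)" by (intro summable_LIMSEQ) (rule summable_rabs_cancel)
   then have "(\<lambda>n. v (k n) x - v (k 0) x) \<longlonglongrightarrow> (\<Sum>j. u j x)" by (simp add: tel)
   then have "(\<lambda>n. v (k n) x - v (k 0) x - (\<Sum>j. u j x)) \<longlonglongrightarrow> 0" by (rule LIM_zero)
   then show ?case by (intro tendsto_rabs_zero) (simp add: g_def algebra_simps)
  qed
  show "AE x in M. norm \<bar>v (k j) x - g x\<bar> \<le> w x" for j
   using AEs
  proof eventually_elim
   case (elim x)
   have "\<bar>v (k j) x - v (k 0) x\<bar> \<le> (\<Sum>i<j. \<bar>u i x\<bar>)" unfolding tel[symmetric] by (rule sum_abs)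
   also have "\<dots> \<le> (\<Sum>j. \<bar>u j x\<bar>)" by (intro sum_le_suminf elim) auto
   finally have "\<bar>v (k j) x - v (k 0) x\<bar> \<le> (\<Sum>j. \<bar>u j x\<bar>)" .
   moreover have "\<bar>\<Sum>j. u j x\<bar> \<le> (\<Sum>j. \<bar>u j x\<bar>)" by (intro summable_rabs elim)
   ultimately show ?case by (simp add: g_def w_def)
  qed
 qed (use wint in auto)
 show ?thesis
 proof (intro exI[of _ g] conjI gint)
  show "(\<lambda>n. LINT x|M. \<bar>v n x - g x\<bar>) \<longlonglongrightarrow> 0"
  proof (rule LIMSEQ_I)
   fix e :: real assume e: "e > 0"
   obtain j0 where j0: "\<And>m n. m \<ge> j0 \<Longrightarrow> n \<ge> j0 \<Longrightarrow> (LINT x|M. \<bar>v m x - v n x\<bar>) < e / 2"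
    using C[of "e/2"] e by auto
   have "(\<lambda>j. LINT x|M. \<bar>v (k j) x - g x\<bar>) \<longlonglongrightarrow> 0" using lim by simp
   from LIMSEQ_D[OF this, of "e/2"] e obtain j1 where j1: "\<And>j. j \<ge> j1 \<Longrightarrow> \<bar>LINT x|M. \<bar>v (k j) x - g x\<bar>\<bar> < e / 2" by auto
   obtain i where i: "(1/2::real)^i < e / 2" using real_arch_pow_inv[of "e/2" "1/2"] e by auto
   define j where "j = max i j1"
   have ji: "(1/2::real)^j \<le> (1/2)^i" unfolding j_def by (intro power_decreasing) auto
   show "\<exists>no. \<forall>n\<ge>no. norm ((LINT x|M. \<bar>v n x - g x\<bar>) - 0) < e"
   proof (intro exI allI impI)
    fix n assume n: "n \<ge> k j"
    have "(LINT x|M. \<bar>v n x - g x\<bar>) \<le> (LINT x|M. \<bar>v n x - v (k j) x\<bar> + \<bar>v (k j) x - g x\<bar>)"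
     by (intro integral_mono Bochner_Integration.integrable_add integrable_abs Bochner_Integration.integrable_diff int gint) auto
    also have "\<dots> = (LINT x|M. \<bar>v n x - v (k j) x\<bar>) + (LINT x|M. \<bar>v (k j) x - g x\<bar>)"
     by (intro Bochner_Integration.integral_add integrable_abs Bochner_Integration.integrable_diff int gint)
    also have "\<dots> < e"
    proof -
     have "(LINT x|M. \<bar>v n x - v (k j) x\<bar>) < (1/2)^j" using N[of j n "k j"] n kN[of j] by simp
     moreover have "(LINT x|M. \<bar>v (k j) x - g x\<bar>) < e / 2" using j1[of j] by (simp add: j_def)
     ultimately show ?thesis using i ji by linarith
    qed
    finally show "norm ((LINT x|M. \<bar>v n x - g x\<bar>) - 0) < e" by simp
   qed
  qed
 qed
qed

lemma integrable_indicator_Icc: "integrable lborel (indicator {a..b::real} :: real \<Rightarrow> real)"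
 by (rule integrable_real_indicator) (auto simp: emeasure_lborel_Icc_eq)

text \<open>Plays the role of weak compactness in L2. The functions admissible with error
  \<open>e\<close> form convex sets that shrink with \<open>e\<close>, and their minimal squared
  norms increase to a finite limit. Since midpoints stay admissible, the parallelogram law makes
  near-minimisers Cauchy. The limit is taken in L1, where integrals over subintervals
  converge.\<close>

lemma weak_L2_derivative:
 fixes F :: "real \<Rightarrow> real"
 assumes ab: "a < b"
  and approx: "\<And>e. e > 0 \<Longrightarrow> \<exists>v. v \<in> borel_fun \<and> integrable lborel (\<lambda>t. (v t)\<^sup>2) \<and>
   (LB t. (v t)\<^sup>2) \<le> M \<and> (\<forall>t. t \<notin> {a..b} \<longrightarrow> v t = 0) \<and>
   (\<forall>x y. a \<le> x \<longrightarrow> x \<le> y \<longrightarrow> y \<le> b \<longrightarrow> \<bar>(LINT t:{x..y}|lborel. v t) - (F y - F x)\<bar> \<le> e)"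
 shows "\<exists>g. integrable lborel g \<and> (\<forall>t. t \<notin> {a..b} \<longrightarrow> g t = 0) \<and>
   (\<forall>x y. a \<le> x \<longrightarrow> x \<le> y \<longrightarrow> y \<le> b \<longrightarrow> (LINT t:{x..y}|lborel. g t) = F y - F x)"
proof -
 define \<C> where "\<C> e = {v. v \<in> borel_fun \<and> integrable lborel (\<lambda>t. (v t)\<^sup>2) \<and>
   (\<forall>t. t \<notin> {a..b} \<longrightarrow> v t = 0) \<and>
   (\<forall>x y. a \<le> x \<longrightarrow> x \<le> y \<longrightarrow> y \<le> b \<longrightarrow> \<bar>(LINT t:{x..y}|lborel. v t) - (F y - F x)\<bar> \<le> e)}" for e :: real
 define N where "N v = (LB t. (v t)\<^sup>2)" for v :: "real \<Rightarrow> real"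
 define d where "d n = Inf (N ` \<C> (1 / real (Suc n)))" for n
 have meas: "v \<in> borel_fun" if "v \<in> \<C> e" for v e using that by (simp add: \<C>_def)
 have sq: "integrable lborel (\<lambda>t. (v t)\<^sup>2)" if "v \<in> \<C> e" for v e using that by (simp add: \<C>_def)
 have van: "v t = 0" if "v \<in> \<C> e" "t \<notin> {a..b}" for v e t using that by (simp add: \<C>_def)
 have int1: "integrable lborel (v :: real \<Rightarrow> real)" if "v \<in> \<C> e" for v e
 proof (rule Bochner_Integration.integrable_bound)
  show "integrable lborel (\<lambda>t. indicator {a..b} t + (v t)\<^sup>2)"
   by (intro Bochner_Integration.integrable_add sq[OF that] integrable_indicator_Icc)
  show "v \<in> borel_measurable lborel" using meas[OF that] by simp
  have "\<bar>r\<bar> \<le> 1 + r\<^sup>2" for r :: real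
  proof -
   have "0 \<le> (\<bar>r\<bar> - 1)\<^sup>2" by simp
   then have "2 * \<bar>r\<bar> \<le> 1 + r\<^sup>2" by (simp add: power2_diff)
   then show ?thesis using abs_ge_zero[of r] by linarith
  qed
  then show "AE t in lborel. norm (v t) \<le> norm (indicator {a..b} t + (v t)\<^sup>2)"
   using van[OF that] by (intro always_eventually allI) (auto simp: indicator_def)
 qed
 have N0: "0 \<le> N v" for v by (simp add: N_def)
 have bdd: "bdd_below (N ` X)" for X using N0 by (meson bdd_belowI2)
 have dM: "d n \<le> M" for n
 proof -
  obtain v where "v \<in> \<C> (1 / real (Suc n))" "N v \<le> M"
   using approx[of "1 / real (Suc n)"] by (auto simp: \<C>_def N_def)
  then show ?thesis unfolding d_def using cINF_lower2[OF bdd] by blast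
 qed
 have ne: "\<C> (1 / real (Suc n)) \<noteq> {}" for n using approx[of "1 / real (Suc n)"] by (auto simp: \<C>_def)
 have sub: "\<C> (1 / real (Suc m)) \<subseteq> \<C> (1 / real (Suc n))" if "n \<le> m" for n m
 proof -
  have "1 / real (Suc m) \<le> 1 / real (Suc n)" using that by (simp add: frac_le)
  then show ?thesis unfolding \<C>_def by (auto intro: order_trans)
 qed
 have dmono: "incseq d" unfolding incseq_def d_def using sub ne by (intro allI impI cInf_superset_mono bdd image_mono) auto
 obtain l where l: "d \<longlonglongrightarrow> l" "\<And>i. d i \<le> l" using incseq_convergent[OF dmono] dM by metis
 have "\<exists>v \<in> \<C> (1 / real (Suc n)). N v < d n + 1 / real (Suc n)" for n
  using cInf_lessD[of "N ` \<C> (1 / real (Suc n))" "d n + 1 / real (Suc n)"] ne[of n] by (auto simp: d_def)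
 then obtain v where v: "\<And>n. v n \<in> \<C> (1 / real (Suc n))" "\<And>n. N (v n) < d n + 1 / real (Suc n)" by metis
 note [measurable] = meas[OF v(1)]
 have diff: "integrable lborel (\<lambda>t. (v n t - v m t)\<^sup>2) \<and> N (\<lambda>t. v n t - v m t) \<le> 2 * (d m - d n) + 4 / real (Suc n)" if nm: "n \<le> m" for n m
 proof -
  have vm: "v m \<in> \<C> (1 / real (Suc n))" using v(1)[of m] sub[OF nm] by blast
  define w where "w t = (v n t + v m t) / 2" for t
  have [measurable]: "w \<in> borel_fun" unfolding w_def by simp
  have pt: "(p - q)\<^sup>2 = 2 * p\<^sup>2 + 2 * q\<^sup>2 - 4 * ((p + q) / 2)\<^sup>2" for p q :: real by (simp add: power2_eq_square field_simps)
  have pt2: "((p + q) / 2)\<^sup>2 \<le> p\<^sup>2 + q\<^sup>2" for p q :: real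
   using zero_le_power2[of "p - q"] zero_le_power2[of "p + q"] by (simp add: power2_eq_square field_simps)
  have wsq: "integrable lborel (\<lambda>t. (w t)\<^sup>2)"
   by (rule Bochner_Integration.integrable_bound[OF Bochner_Integration.integrable_add[OF sq[OF v(1)[of n]] sq[OF v(1)[of m]]]])
    (use pt2 in \<open>auto simp: w_def\<close>)
  have avg: "\<bar>p - c\<bar> \<le> r \<Longrightarrow> \<bar>q - c\<bar> \<le> r \<Longrightarrow> \<bar>(p + q) / 2 - c\<bar> \<le> r" for p q c r :: real
   by (auto simp: abs_le_iff field_simps)
  have wC: "w \<in> \<C> (1 / real (Suc n))"
   unfolding \<C>_def mem_Collect_eq
  proof (intro conjI allI impI)
   show "w t = 0" if "t \<notin> {a..b}" for t using van[OF v(1) that] by (simp add: w_def)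
   fix x y assume xy: "a \<le> x" "x \<le> y" "y \<le> b"
   have si: "set_integrable lborel {x..y} (v k)" for k
    using int1[OF v(1)[of k]] unfolding set_integrable_def by (intro integrable_mult_indicator) auto
   have "(LINT t:{x..y}|lborel. w t) = ((LINT t:{x..y}|lborel. v n t) + (LINT t:{x..y}|lborel. v m t)) / 2"
    unfolding w_def by (simp add: set_integral_add[OF si si])
   moreover have "\<bar>(LINT t:{x..y}|lborel. v n t) - (F y - F x)\<bar> \<le> 1 / real (Suc n)"
    using v(1)[of n] xy unfolding \<C>_def by blast
   moreover have "\<bar>(LINT t:{x..y}|lborel. v m t) - (F y - F x)\<bar> \<le> 1 / real (Suc n)"
    using vm xy unfolding \<C>_def by blast
   ultimately show "\<bar>(LINT t:{x..y}|lborel. w t) - (F y - F x)\<bar> \<le> 1 / real (Suc n)"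
    by (simp only: avg)
  qed (use wsq in auto)
  have "d n \<le> N w" unfolding d_def using wC by (intro cINF_lower bdd)
  moreover have "N (\<lambda>t. v n t - v m t) = 2 * N (v n) + 2 * N (v m) - 4 * N w"
   unfolding N_def pt w_def[symmetric] using sq[OF v(1)[of n]] sq[OF v(1)[of m]] wsq by simp
  moreover have "integrable lborel (\<lambda>t. (v n t - v m t)\<^sup>2)"
   unfolding pt w_def[symmetric] using sq[OF v(1)[of n]] sq[OF v(1)[of m]] wsq by simp
  moreover have "1 / real (Suc m) \<le> 1 / real (Suc n)" using nm by (simp add: frac_le)
  moreover have "4 / real (Suc n) = 4 * (1 / real (Suc n))" by simp
  moreover have arith: "\<lbrakk>D \<le> Nw; X = 2 * p + 2 * q - 4 * Nw; s \<le> r; r4 = 4 * r; p < D + r; q < D' + s\<rbrakk> \<Longrightarrow> X \<le> 2 * (D' - D) + r4"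
   for D Nw X p q s r r4 D' :: real unfolding ring_distribs by linarith
  ultimately show ?thesis using v(2)[of n] v(2)[of m] by blast
 qed
 have "\<exists>g. integrable lborel g \<and> (\<lambda>n. LB x. \<bar>v n x - g x\<bar>) \<longlonglongrightarrow> 0"
 proof (rule L1_Cauchy_imp_convergent)
  show "integrable lborel (v n)" for n using int1[OF v(1)] .
  fix e :: real assume e: "e > 0"
  \<comment> \<open>With \<open>\<eta> = e / (b - a)\<close>, the inequality
    \<open>2 * |x| \<le> \<eta> + x^2 / \<eta>\<close> on an interval of length \<open>b - a\<close>
    turns a squared L2 error below \<open>\<theta>\<close> into an L1 error below
    \<open>e\<close>.\<close>
  define \<theta> where "\<theta> = e\<^sup>2 / (b - a)"
  have \<theta>: "\<theta> > 0" using e ab by (simp add: \<theta>_def)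
  from LIMSEQ_D[OF l(1), of "\<theta>/4"] \<theta> obtain n0 where n0: "\<And>n. n \<ge> n0 \<Longrightarrow> \<bar>d n - l\<bar> < \<theta> / 4" by auto
  obtain n1 where n1: "1 / real (Suc n1) < \<theta> / 8" using \<theta> nat_approx_posE[of "\<theta>/8"] by auto
  define n2 where "n2 = max n0 n1"
  have A: "(LB x. \<bar>v n x - v m x\<bar>) < e" if "n \<ge> n2" "n \<le> m" for n m
  proof -
   have "1 / real (Suc n) \<le> 1 / real (Suc n1)" using that by (simp add: frac_le n2_def)
   then have "4 / real (Suc n) < \<theta> / 2" using n1 by simp
   moreover have "l - d n < \<theta> / 4"
    using abs_ge_minus_self[of "d n - l"] n0[of n] that by (auto simp: n2_def)
   then have "d m - d n < \<theta> / 4" using l(2)[of m] by linarith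
   moreover have arith: "z < \<theta> / 2 \<Longrightarrow> D < \<theta> / 4 \<Longrightarrow> X \<le> 2 * D + z \<Longrightarrow> X < \<theta>" for z D X :: real
    by linarith
   ultimately have *: "N (\<lambda>t. v n t - v m t) < \<theta>" using diff[OF that(2)] by blast
   define \<eta> where "\<eta> = e / (b - a)"
   have \<eta>: "\<eta> > 0" using e ab by (simp add: \<eta>_def)
   have i1: "integrable lborel (\<lambda>x. \<eta> * indicator {a..b} x)"
    by (intro integrable_mult_right integrable_indicator_Icc)
   have i2: "integrable lborel (\<lambda>x. (v n x - v m x)\<^sup>2 / \<eta>)" using diff[OF that(2)] by simp
   have "(LB x. \<bar>v n x - v m x\<bar>) \<le> (LB x. (\<eta> * indicator {a..b} x + (v n x - v m x)\<^sup>2 / \<eta>) / 2)"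
   proof (rule integral_mono)
    show "integrable lborel (\<lambda>x. \<bar>v n x - v m x\<bar>)" using int1[OF v(1)] by simp
    show "integrable lborel (\<lambda>x. (\<eta> * indicator {a..b} x + (v n x - v m x)\<^sup>2 / \<eta>) / 2)"
     by (intro integrable_divide Bochner_Integration.integrable_add i1 i2)
    show "\<bar>v n x - v m x\<bar> \<le> (\<eta> * indicator {a..b} x + (v n x - v m x)\<^sup>2 / \<eta>) / 2" for x
    proof (cases "x \<in> {a..b}")
     case True
     have "2 * \<eta> * \<bar>v n x - v m x\<bar> \<le> \<eta>\<^sup>2 + (v n x - v m x)\<^sup>2"
      using zero_le_power2[of "\<eta> - \<bar>v n x - v m x\<bar>"] by (simp add: power2_diff)
     then show ?thesis using True \<eta> by (simp add: field_simps power2_eq_square)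
    qed (use van[OF v(1)] in auto)
   qed
   also have "\<dots> = (\<eta> * (b - a) + N (\<lambda>t. v n t - v m t) / \<eta>) / 2"
    using ab by (simp add: Bochner_Integration.integral_add[OF i1 i2] N_def)
   also have "\<dots> < (\<eta> * (b - a) + \<theta> / \<eta>) / 2" using * \<eta> by (simp add: divide_strict_right_mono)
   also have "\<dots> = e" using e ab by (simp add: \<eta>_def \<theta>_def power2_eq_square)
   finally show ?thesis .
  qed
  show "\<exists>N. \<forall>m\<ge>N. \<forall>n\<ge>N. (LB x. \<bar>v m x - v n x\<bar>) < e"
  proof (intro exI[of _ n2] allI impI)
   fix m n assume "n2 \<le> m" "n2 \<le> n"
   then show "(LB x. \<bar>v m x - v n x\<bar>) < e"
    using A[of m n] A[of n m] by (cases "m \<le> n") (auto simp: abs_minus_commute)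
  qed
 qed
 then obtain g where g: "integrable lborel g" "(\<lambda>n. LB x. \<bar>v n x - g x\<bar>) \<longlonglongrightarrow> 0" by auto
 show ?thesis
 proof (intro exI[of _ "\<lambda>t. indicator {a..b} t * g t"] conjI allI impI)
  show "integrable lborel (\<lambda>t. indicator {a..b} t * g t)" using integrable_mult_indicator[of "{a..b}" lborel g] g(1) by simp
  fix x y assume xy: "a \<le> x" "x \<le> y" "y \<le> b"
  have eq: "(LINT t:{x..y}|lborel. indicator {a..b} t * g t) = (LINT t:{x..y}|lborel. g t)"
   by (rule set_lebesgue_integral_cong) (use xy in auto)
  have si: "set_integrable lborel {x..y} (v k)" "set_integrable lborel {x..y} g" for k
   using int1[OF v(1)[of k]] g(1) unfolding set_integrable_def by (intro integrable_mult_indicator; simp)+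
  have "(\<lambda>n. LINT t:{x..y}|lborel. v n t) \<longlonglongrightarrow> (LINT t:{x..y}|lborel. g t)"
  proof (rule LIM_zero_cancel, rule Lim_null_comparison[OF always_eventually g(2)], rule allI)
   fix n
   have "norm ((LINT t:{x..y}|lborel. v n t) - (LINT t:{x..y}|lborel. g t)) = \<bar>LINT t:{x..y}|lborel. v n t - g t\<bar>"
    by (simp add: set_integral_diff[OF si])
   also have "\<dots> \<le> (LB t. \<bar>indicator {x..y} t *\<^sub>R (v n t - g t)\<bar>)"
    unfolding set_lebesgue_integral_def by (rule integral_abs_bound)
   also have "\<dots> \<le> (LB t. \<bar>v n t - g t\<bar>)"
    by (intro integral_mono integrable_abs integrable_mult_indicator Bochner_Integration.integrable_diff int1[OF v(1)] g(1))
      (auto simp: indicator_def)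
   finally show "norm ((LINT t:{x..y}|lborel. v n t) - (LINT t:{x..y}|lborel. g t)) \<le> (LB t. \<bar>v n t - g t\<bar>)" .
  qed
  moreover have "(\<lambda>n. LINT t:{x..y}|lborel. v n t) \<longlonglongrightarrow> F y - F x"
  proof (rule LIM_zero_cancel, rule Lim_null_comparison[OF always_eventually LIMSEQ_inverse_real_of_nat], rule allI)
   fix n show "norm ((LINT t:{x..y}|lborel. v n t) - (F y - F x)) \<le> inverse (real (Suc n))"
    using v(1)[of n] xy unfolding \<C>_def by (simp add: inverse_eq_divide)
  qed
  ultimately show "(LINT t:{x..y}|lborel. indicator {a..b} t * g t) = F y - F x"
   unfolding eq by (rule LIMSEQ_unique)
 qed auto
qed

text \<open>The quotients themselves serve as approximate derivatives: the integral of one over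
  \<open>{x..y}\<close> is the mean of \<open>F\<close> over \<open>{y..y + h}\<close> minus its
  mean over \<open>{x..x + h}\<close>, which is close to \<open>F y - F x\<close> by uniform
  continuity. A bound along infinitely many steps is what a finite liminf provides later.\<close>

lemma bounded_difference_quotients_imp_integral:
 fixes F :: "real \<Rightarrow> real"
 assumes cont: "continuous_on UNIV F" and ab: "a < b"
  and freq: "\<exists>\<^sub>F n in sequentially. (LINT t:{a..b}|lborel. (real (Suc n) * (F (t + 1 / real (Suc n)) - F t))\<^sup>2) \<le> M"
 shows "\<exists>g. integrable lborel g \<and> (\<forall>t. t \<notin> {a..b} \<longrightarrow> g t = 0) \<and>
   (\<forall>x y. a \<le> x \<longrightarrow> x \<le> y \<longrightarrow> y \<le> b \<longrightarrow> (LINT t:{x..y}|lborel. g t) = F y - F x)"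
proof (rule weak_L2_derivative[OF ab, of M])
 fix e :: real assume e: "e > 0"
 have cF: "continuous_on S F" for S using cont continuous_on_subset by blast
 have "uniformly_continuous_on {a..b+1} F" by (intro compact_uniformly_continuous cF) auto
 then obtain \<delta> where \<delta>: "\<delta> > 0" "\<And>x y. \<lbrakk>x \<in> {a..b+1}; y \<in> {a..b+1}; \<bar>y - x\<bar> < \<delta>\<rbrakk> \<Longrightarrow> \<bar>F y - F x\<bar> < e / 2"
  using e unfolding uniformly_continuous_on_def dist_real_def by (metis half_gt_zero)
 have "\<forall>\<^sub>F n in sequentially. 1 / real (Suc n) < min \<delta> 1"
  using \<delta>(1) by (intro order_tendstoD(2)[OF LIMSEQ_inverse_real_of_nat[unfolded inverse_eq_divide]]) auto
 from frequently_ex[OF frequently_eventually_conj[OF freq this]] obtain n where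
  n: "(LINT t:{a..b}|lborel. (real (Suc n) * (F (t + 1 / real (Suc n)) - F t))\<^sup>2) \<le> M"
  "1 / real (Suc n) < \<delta>" "1 / real (Suc n) < 1" by auto
 define h where "h = 1 / real (Suc n)"
 have h: "h > 0" "h < \<delta>" "h < 1" using n by (auto simp: h_def)
 define P where "P x = integral {a-1..x} F" for x
 have P: "(P has_real_derivative F x) (at x)" if "x \<in> {a-1<..<b+2}" for x
 proof -
  have "(P has_real_derivative F x) (at x within {a-1..b+2})"
   unfolding P_def using that by (intro integral_has_real_derivative cF) auto
  then have "(P has_real_derivative F x) (at x within {a-1<..<b+2})"
   by (rule has_field_derivative_subset) auto
  then show ?thesis using that by (simp add: at_within_open[OF that])
 qed
 define w where "w t = (F (t + h) - F t) / h" for t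
 have wcont: "continuous_on UNIV w" unfolding w_def using h by (intro continuous_intros continuous_on_compose2[OF cont]) auto
 define v where "v t = indicator {a..b} t * w t" for t
 have [measurable]: "w \<in> borel_fun" using wcont by (rule borel_measurable_continuous_onI)
 have vsq: "(v t)\<^sup>2 = indicator {a..b} t *\<^sub>R (w t)\<^sup>2" for t by (simp add: v_def power_mult_distrib indicator_def)
 have int: "(LINT t:{x..y}|lborel. v t) = (P (y + h) - P y) / h - (P (x + h) - P x) / h"
  if xy: "a \<le> x" "x \<le> y" "y \<le> b" for x y
 proof -
  have "(LINT t:{x..y}|lborel. v t) = (LB t. w t * indicator {x..y} t)"
   unfolding set_lebesgue_integral_def v_def using xy by (intro Bochner_Integration.integral_cong) (auto simp: indicator_def)
  also have "\<dots> = (P (y + h) - P y) / h - (P (x + h) - P x) / h"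
  proof (rule integral_FTC_Icc_real[OF xy(2)])
   fix t assume t: "x \<le> t" "t \<le> y"
   have "((\<lambda>t. P (t + h)) has_real_derivative F (t + h)) (at t)"
    using P[of "t + h"] t xy h by (subst DERIV_shift[symmetric]) auto
   then show "((\<lambda>t. (P (t + h) - P t) / h) has_real_derivative w t) (at t)"
    unfolding w_def using h t xy by (intro DERIV_cdivide DERIV_diff P) auto
   show "isCont w t" using wcont by (simp add: continuous_on_eq_continuous_at)
  qed
  finally show ?thesis .
 qed
 have mv: "\<bar>(P (x + h) - P x) / h - F x\<bar> \<le> e / 2" if "a \<le> x" "x \<le> b" for x
 proof -
  have "\<exists>z>x. z < x + h \<and> P (x + h) - P x = (x + h - x) * F z"
   by (rule MVT2) (use that h in \<open>auto intro!: P\<close>)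
  then obtain z where z: "x < z" "z < x + h" "P (x + h) - P x = h * F z" by auto
  then have "(P (x + h) - P x) / h = F z" using h by simp
  then show ?thesis using \<delta>(2)[of x z] that z h by auto
 qed
 have dif: "\<bar>p - c\<bar> \<le> e / 2 \<Longrightarrow> \<bar>q - d\<bar> \<le> e / 2 \<Longrightarrow> \<bar>q - p - (d - c)\<bar> \<le> e" for p q c d :: real
  by linarith
 show "\<exists>v. v \<in> borel_fun \<and> integrable lborel (\<lambda>t. (v t)\<^sup>2) \<and>
   (LB t. (v t)\<^sup>2) \<le> M \<and> (\<forall>t. t \<notin> {a..b} \<longrightarrow> v t = 0) \<and>
   (\<forall>x y. a \<le> x \<longrightarrow> x \<le> y \<longrightarrow> y \<le> b \<longrightarrow> \<bar>(LINT t:{x..y}|lborel. v t) - (F y - F x)\<bar> \<le> e)"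
 proof (intro exI[of _ v] conjI allI impI)
  show "v \<in> borel_fun" unfolding v_def by measurable
  show "integrable lborel (\<lambda>t. (v t)\<^sup>2)"
   unfolding vsq using borel_integrable_atLeastAtMost'[of a b "\<lambda>t. (w t)\<^sup>2"] wcont
   by (auto simp: set_integrable_def intro!: continuous_intros intro: continuous_on_subset)
  show "(LB t. (v t)\<^sup>2) \<le> M"
   using n(1) unfolding vsq by (simp add: set_lebesgue_integral_def w_def h_def mult.commute)
  show "v t = 0" if "t \<notin> {a..b}" for t using that by (simp add: v_def)
  fix x y assume "a \<le> x" "x \<le> y" "y \<le> b"
  then show "\<bar>(LINT t:{x..y}|lborel. v t) - (F y - F x)\<bar> \<le> e"
   using mv[of x] mv[of y] unfolding int[OF \<open>a \<le> x\<close> \<open>x \<le> y\<close> \<open>y \<le> b\<close>] by (intro dif) auto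
 qed
qed

text \<open>The crude constant \<open>L\<close> only bounds the difference quotients and so makes
  \<open>F\<close> an indefinite integral. Its density equals \<open>deriv F\<close> almost
  everywhere, and integrating it gives the sharper \<open>M\<close>. Points where \<open>F\<close>
  has no derivative, and \<open>deriv\<close> is arbitrary, form a null set.\<close>

lemma lipschitz_le_AE_deriv_bound:
 fixes F :: "real \<Rightarrow> real"
 assumes lip: "\<And>x y. \<bar>F x - F y\<bar> \<le> L * \<bar>x - y\<bar>"
  and D: "AE t in lborel. \<bar>deriv F t\<bar> \<le> M"
  and xy: "x \<le> y"
 shows "\<bar>F y - F x\<bar> \<le> M * (y - x)"
proof (cases "x = y")
 case False
 with xy have xy: "x < y" by simp
 have L: "L \<ge> 0" using lip[of 0 1] by (simp add: order_trans[OF abs_ge_zero])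
 have cont: "continuous_on UNIV F"
  using L by (intro lipschitz_on_continuous_on[of L]) (auto simp: lipschitz_on_def dist_real_def lip)
 have [measurable]: "F \<in> borel_fun" using cont by (rule borel_measurable_continuous_onI)
 have "(LINT t:{x..y}|lborel. (real (Suc n) * (F (t + 1 / real (Suc n)) - F t))\<^sup>2) \<le> (LINT t:{x..y}|lborel. L\<^sup>2)" for n
 proof -
  have cont2: "continuous_on {x..y} (\<lambda>t. (real (Suc n) * (F (t + 1 / real (Suc n)) - F t))\<^sup>2)"
   by (intro continuous_intros continuous_on_compose2[OF cont]) auto
  have "(real (Suc n) * (F (t + 1 / real (Suc n)) - F t))\<^sup>2 \<le> L\<^sup>2" for t
  proof -
   have "\<bar>F (t + 1 / real (Suc n)) - F t\<bar> \<le> L * (1 / real (Suc n))" using lip[of "t + 1 / real (Suc n)" t] by simp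
   then have "real (Suc n) * \<bar>F (t + 1 / real (Suc n)) - F t\<bar> \<le> real (Suc n) * (L * (1 / real (Suc n)))"
    by (intro mult_left_mono) auto
   then have "\<bar>real (Suc n) * (F (t + 1 / real (Suc n)) - F t)\<bar> \<le> \<bar>L\<bar>" using L by (simp add: abs_mult)
   then show ?thesis by (rule abs_le_square_iff[THEN iffD1])
  qed
  then show ?thesis
   by (intro set_integral_mono borel_integrable_atLeastAtMost' cont2) (auto intro: continuous_intros)
 qed
 then have "\<exists>\<^sub>F n in sequentially. (LINT t:{x..y}|lborel. (real (Suc n) * (F (t + 1 / real (Suc n)) - F t))\<^sup>2) \<le> (LINT t:{x..y}|lborel. L\<^sup>2)"
  by (intro eventually_frequently always_eventually) auto
 from bounded_difference_quotients_imp_integral[OF cont xy this] obtain g where g: "integrable lborel g"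
  "\<And>s. x \<le> s \<Longrightarrow> s \<le> y \<Longrightarrow> (LINT t:{x..s}|lborel. g t) = F s - F x" by auto
 have si: "set_integrable lborel {x..y} g" unfolding set_integrable_def using g(1) by (intro integrable_mult_indicator) auto
 have "AE t in lborel. t \<in> {x..y} \<longrightarrow> \<bar>g t\<bar> \<le> M"
  using AE_DERIV_indefinite_integral[OF si] D AE_lborel_singleton[of x] AE_lborel_singleton[of y]
 proof eventually_elim
  case (elim t)
  show ?case
  proof
   assume "t \<in> {x..y}"
   with elim have t: "x < t" "t < y" by auto
   with elim have "((\<lambda>s. LINT t:{x..s}|lborel. g t) has_real_derivative g t) (at t)" by auto
   then have "((\<lambda>s. F s - F x) has_real_derivative g t) (at t)"
    by (rule has_field_derivative_transform_within_open[of _ _ _ "{x<..<y}"]) (use t g(2) in auto)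
   then have "((\<lambda>s. F s - F x + F x) has_real_derivative g t + 0) (at t)" by (intro DERIV_add DERIV_const)
   then have "(F has_real_derivative g t) (at t)" by simp
   then show "\<bar>g t\<bar> \<le> M" using elim by (simp add: DERIV_imp_deriv)
  qed
 qed
 then have "AE t in lborel. \<bar>indicator {x..y} t *\<^sub>R g t\<bar> \<le> indicator {x..y} t *\<^sub>R M" by eventually_elim (auto simp: indicator_def)
 then have "(LB t. \<bar>indicator {x..y} t *\<^sub>R g t\<bar>) \<le> (LB t. indicator {x..y} t *\<^sub>R M)"
 proof (rule integral_mono_AE[rotated 2])
  show "integrable lborel (\<lambda>t. \<bar>indicator {x..y} t *\<^sub>R g t\<bar>)"
   using si unfolding set_integrable_def by (rule integrable_abs)
  show "integrable lborel (\<lambda>t. indicator {x..y} t *\<^sub>R M)"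
   unfolding real_scaleR_def by (intro integrable_mult_left integrable_indicator_Icc)
 qed
 also have "\<dots> = M * (y - x)" using xy by simp
 finally have "\<bar>LINT t:{x..y}|lborel. g t\<bar> \<le> M * (y - x)"
  using integral_abs_bound[of lborel "\<lambda>t. indicator {x..y} t *\<^sub>R g t"]
  unfolding set_lebesgue_integral_def by linarith
 then show ?thesis using g(2)[of y] xy by simp
qed simp

section \<open>The Abel and Marchaud kernels\<close>

text \<open>The kernels to be integrated are singular at end points, so there only the primitive has
  to be continuous; \<open>f0\<close> extends the integrand by 0.\<close>

lemma nn_integral_FTC_interior:
 fixes F f :: "real \<Rightarrow> real"
 assumes "finite S" "a \<le> b" and F: "\<And>x. a < x \<Longrightarrow> x < b \<Longrightarrow> x \<notin> S \<Longrightarrow> (F has_real_derivative f x) (at x)"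
  and nn: "\<And>x. a < x \<Longrightarrow> x < b \<Longrightarrow> 0 \<le> f x" and cont: "continuous_on {a..b} F"
 shows "(NN x. ennreal (f x) * indicator {a<..<b} x) = ennreal (F b - F a)"
proof -
 define f0 where "f0 x = (if a < x \<and> x < b then f x else 0)" for x
 have "(f0 has_integral (F b - F a)) {a..b}"
  by (rule fundamental_theorem_of_calculus_interior_strong[OF assms(1,2) _ cont])
    (use F in \<open>auto simp: f0_def has_real_derivative_iff_has_vector_derivative\<close>)
 then have "(NN x. ennreal (f0 x) * indicator {a..b} x) = ennreal (F b - F a)"
  by (rule nn_integral_has_integral_lebesgue'[rotated]) (use nn in \<open>auto simp: f0_def\<close>)
 moreover have "(NN x. ennreal (f0 x) * indicator {a..b} x) = (NN x. ennreal (f x) * indicator {a<..<b} x)"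
  by (intro nn_integral_cong) (auto simp: f0_def indicator_def)
 ultimately show ?thesis by simp
qed

lemma nn_integral_FTC_at_top:
 fixes F f :: "real \<Rightarrow> real"
 assumes S: "finite S" and F: "\<And>x. a < x \<Longrightarrow> x \<notin> S \<Longrightarrow> (F has_real_derivative f x) (at x)"
  and nn: "\<And>x. a < x \<Longrightarrow> 0 \<le> f x" and cont: "continuous_on {a..} F" and lim: "(F \<longlongrightarrow> T) at_top"
  and [measurable]: "f \<in> borel_fun"
 shows "(NN x. ennreal (f x) * indicator {a<..} x) = ennreal (T - F a)"
proof -
 have 1: "(NN x. ennreal (f x) * indicator {a<..<a + real n} x) = ennreal (F (a + real n) - F a)" for n
  by (rule nn_integral_FTC_interior[OF S]) (use F nn cont in \<open>auto intro: continuous_on_subset\<close>)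
 have "(\<lambda>n. \<integral>\<^sup>+x. ennreal (f x) * indicator {a<..<a + real n} x \<partial>lborel) \<longlonglongrightarrow> (NN x. ennreal (f x) * indicator {a<..} x)"
 proof (rule nn_integral_LIMSEQ)
  show "incseq (\<lambda>n x. ennreal (f x) * indicator {a<..<a + real n} x)"
   by (auto simp: incseq_def le_fun_def indicator_def)
  fix x
  obtain n0 where n0: "x - a < real n0" using reals_Archimedean2 by blast
  have "\<forall>\<^sub>F n in sequentially. ennreal (f x) * indicator {a<..} x = ennreal (f x) * indicator {a<..<a + real n} x"
   using eventually_ge_at_top[of n0] by eventually_elim (use n0 in \<open>auto simp: indicator_def\<close>)
  then show "(\<lambda>n. ennreal (f x) * indicator {a<..<a + real n} x) \<longlonglongrightarrow> ennreal (f x) * indicator {a<..} x"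
   by (rule Lim_transform_eventually[OF tendsto_const])
 qed auto
 moreover have "(\<lambda>n. ennreal (F (a + real n) - F a)) \<longlonglongrightarrow> ennreal (T - F a)"
  by (intro tendsto_ennrealI tendsto_diff tendsto_const filterlim_compose[OF lim]) real_asymp
 ultimately show ?thesis unfolding 1 by (rule LIMSEQ_unique)
qed

definition conv :: "(real \<Rightarrow> real) \<Rightarrow> (real \<Rightarrow> real) \<Rightarrow> real \<Rightarrow> real" where
 "conv u v t = (LB s. u (t - s) * v s)"

definition step :: "real \<Rightarrow> real" where "step = indicator {0<..}"

text \<open>Kernel of the Abel transform: convolution with it is Gamma(1/2) times the
  half-integral.\<close>

definition abel :: "real \<Rightarrow> real" where "abel s = (if s > 0 then 1 / sqrt s else 0)"

text \<open>One side of the truncated kernel. Integrating \<open>h t - h (t - r)\<close> against it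
  gives, up to a constant factor, the truncated Marchaud derivative of order 1/2.\<close>

definition marchaud :: "real \<Rightarrow> real \<Rightarrow> real" where "marchaud eps r = (if r > eps then 1 / (r * sqrt r) else 0)"

text \<open>The difference of \<open>2 * abel\<close> and the convolution of \<open>abel\<close>
  with \<open>marchaud 1\<close>: the slowly decaying tails cancel and an integrable kernel is
  left.\<close>

definition trunc_kernel :: "real \<Rightarrow> real" where
 "trunc_kernel v = (if v > 0 then 2 / sqrt v - (if v > 1 then 2 / v * sqrt (v - 1) else 0) else 0)"

text \<open>Minus the derivative of \<open>trunc_kernel\<close>. It is nonnegative, so the kernel is
  a mixture of indicators of the intervals \<open>{0<..<w}\<close>, which links it to means over
  intervals.\<close>

definition trunc_density :: "real \<Rightarrow> real" where
 "trunc_density w = (if w > 0 then 1 / (w * sqrt w) + (if w > 1 then (2 - w) / (w\<^sup>2 * sqrt (w - 1)) else 0) else 0)"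

lemma kernel_measurable [measurable]:
 "step \<in> borel_fun" "abel \<in> borel_fun" "marchaud eps \<in> borel_fun"
 "trunc_kernel \<in> borel_fun" "trunc_density \<in> borel_fun"
 unfolding step_def abel_def [abs_def] marchaud_def [abs_def] trunc_kernel_def [abs_def] trunc_density_def [abs_def]
 by measurable

lemma conv_measurable [measurable]:
 assumes [measurable]: "u \<in> borel_fun" "v \<in> borel_fun"
 shows "conv u v \<in> borel_fun"
 unfolding conv_def [abs_def] by measurable

lemma abel_nonneg: "0 \<le> abel s" and marchaud_nonneg: "0 \<le> eps \<Longrightarrow> 0 \<le> marchaud eps s" and step_nonneg: "0 \<le> step s"
 by (auto simp: abel_def marchaud_def step_def)

lemma trunc_kernel_nonneg: "0 \<le> trunc_kernel v"
proof (cases "v > 1")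
 case True
 have "sqrt (v - 1) \<le> sqrt v" by simp
 then have "sqrt (v - 1) / v \<le> sqrt v / v" using True by (intro divide_right_mono) auto
 also have "sqrt v / v = 1 / sqrt v" using True by (simp add: field_simps)
 finally show ?thesis using True by (simp add: trunc_kernel_def)
qed (auto simp: trunc_kernel_def)

lemma trunc_kernel_le: "trunc_kernel v \<le> 2 * abel v"
 by (auto simp: trunc_kernel_def abel_def)

text \<open>Rationalising the difference of square roots yields the decay of order -3/2 that makes
  the kernel integrable at infinity.\<close>

lemma trunc_kernel_le2:
 assumes "v > 1" shows "trunc_kernel v \<le> 2 / (v * sqrt v)"
proof -
 have "(sqrt v - sqrt (v - 1)) * sqrt v \<le> (sqrt v - sqrt (v - 1)) * (sqrt v + sqrt (v - 1))"
  using assms by (intro mult_left_mono) auto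
 also have "\<dots> = 1" using assms by (simp add: algebra_simps)
 finally have "(sqrt v - sqrt (v - 1)) \<le> 1 / sqrt v" using assms by (simp add: field_simps)
 then have "(sqrt v - sqrt (v - 1)) / v * 2 \<le> 1 / sqrt v / v * 2" using assms by (intro divide_right_mono mult_right_mono) auto
 moreover have "(sqrt v - sqrt (v - 1)) / v * 2 = trunc_kernel v"
  using assms real_div_sqrt[of v] by (simp add: trunc_kernel_def diff_divide_distrib) (simp add: field_simps)
 ultimately show ?thesis by (simp add: mult.commute)
qed

text \<open>Beyond 1 the claim reduces to \<open>w - 2 \<le> sqrt (w * (w - 1))\<close>.\<close>

lemma trunc_density_nonneg: "0 \<le> trunc_density w"
proof (cases "w > 1")
 case True
 have "(w - 2) \<le> sqrt (w * (w - 1))"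
 proof (cases "w \<ge> 2")
  case True
  then show ?thesis by (intro real_le_rsqrt) (simp add: power2_eq_square algebra_simps)
 next
  case False
  moreover have "0 \<le> sqrt (w * (w - 1))" using \<open>w > 1\<close> by simp
  ultimately show ?thesis by linarith
 qed
 then have "(w - 2) / (w\<^sup>2 * sqrt (w - 1)) \<le> sqrt (w * (w - 1)) / (w\<^sup>2 * sqrt (w - 1))"
  using True by (intro divide_right_mono) auto
 also have "\<dots> = 1 / (w * sqrt w)"
 proof -
  define q where "q = sqrt w"
  have q: "q > 0" "w = q * q" using True by (auto simp: q_def)
  have "sqrt (w * (w - 1)) / (w\<^sup>2 * sqrt (w - 1)) = q / (w * w)"
   using True by (simp add: real_sqrt_mult q_def power2_eq_square)
  also have "\<dots> = 1 / (w * q)" using q(1) by (simp add: q(2))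
  finally show ?thesis by (simp add: q_def)
 qed
 moreover have "(2 - w) / (w\<^sup>2 * sqrt (w - 1)) = - ((w - 2) / (w\<^sup>2 * sqrt (w - 1)))"
  by (metis minus_diff_eq minus_divide_left)
 ultimately show ?thesis using True by (simp add: trunc_density_def)
qed (auto simp: trunc_density_def)

lemma nn_integral_abel:
 assumes "s > 0"
 shows "(NN y. ennreal (abel y) * indicator {0<..<s} y) = ennreal (2 * sqrt s)"
proof -
 have "(NN y. ennreal (abel y) * indicator {0<..<s} y) = ennreal (2 * sqrt s - 2 * sqrt 0)"
  by (rule nn_integral_FTC_interior[of "{}"])
    (use assms in \<open>auto simp: abel_def inverse_eq_divide intro!: derivative_eq_intros continuous_intros\<close>)
 then show ?thesis by simp
qed

text \<open>Euler's Beta integral B(1/2, 1/2) = pi, with an arcsine as primitive: two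
  half-integrations make one integration.\<close>

lemma nn_integral_abel_abel:
 "(NN y. ennreal (abel (s - y) * abel y)) = ennreal (pi * step s)"
proof (cases "s > 0")
 case True
 have D: "((\<lambda>y. arcsin ((2 * y - s) / s)) has_real_derivative abel (s - y) * abel y) (at y)" if y: "0 < y" "y < s" for y
 proof -
  have b: "-1 < (2 * y - s) / s" "(2 * y - s) / s < 1" using y by (auto simp: field_simps)
  have D0: "((\<lambda>y. arcsin ((2 * y - s) / s)) has_real_derivative inverse (sqrt (1 - ((2 * y - s) / s)\<^sup>2)) * (2 / s)) (at y)"
   using b y by (auto intro!: derivative_eq_intros)
  have e1: "1 - ((2 * y - s) / s)\<^sup>2 = (2 / s)\<^sup>2 * ((s - y) * y)"
  proof -
   have "s \<noteq> 0" using y by simp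
   then have "s * s \<noteq> 0" "s\<^sup>2 \<noteq> 0" by auto
   then show ?thesis by (simp add: divide_simps) (simp add: power2_eq_square algebra_simps)
  qed
  have e2: "sqrt ((2 / s)\<^sup>2 * ((s - y) * y)) = (2 / s) * (sqrt (s - y) * sqrt y)"
   using True by (simp add: real_sqrt_mult)
  have e3: "inverse ((2 / s) * (sqrt (s - y) * sqrt y)) * (2 / s) = abel (s - y) * abel y"
   using True y by (simp add: abel_def)
  show ?thesis using D0 unfolding e1 e2 e3 .
 qed
 have "(NN y. ennreal (abel (s - y) * abel y) * indicator {0<..<s} y) =
   ennreal (arcsin ((2 * s - s) / s) - arcsin ((2 * 0 - s) / s))"
  by (rule nn_integral_FTC_interior[of "{}"])
    (use True D in \<open>auto intro!: mult_nonneg_nonneg abel_nonneg continuous_intros simp: field_simps\<close>)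
 also have "\<dots> = ennreal pi" using True by simp
 finally have "(NN y. ennreal (abel (s - y) * abel y) * indicator {0<..<s} y) = ennreal pi" .
 moreover have "(NN y. ennreal (abel (s - y) * abel y)) = (NN y. ennreal (abel (s - y) * abel y) * indicator {0<..<s} y)"
  by (intro nn_integral_cong) (auto simp: abel_def indicator_def)
 ultimately show ?thesis using True by (simp add: step_def)
next
 case False
 then have "(NN y. ennreal (abel (s - y) * abel y)) = (\<integral>\<^sup>+y. 0 \<partial>(lborel :: real measure))"
  by (intro nn_integral_cong) (auto simp: abel_def)
 then show ?thesis using False by (simp add: step_def)
qed

lemma nn_integral_step_abel:
 "(NN y. ennreal (step (s - y) * abel y)) = ennreal (2 * sqrt s * step s)"
proof (cases "s > 0")
 case True
 have "(NN y. ennreal (step (s - y) * abel y)) = (NN y. ennreal (abel y) * indicator {0<..<s} y)"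
  by (intro nn_integral_cong) (auto simp: step_def abel_def indicator_def)
 then show ?thesis using True nn_integral_abel by (simp add: step_def)
next
 case False
 then have "(NN y. ennreal (step (s - y) * abel y)) = (\<integral>\<^sup>+y. 0 \<partial>(lborel :: real measure))"
  by (intro nn_integral_cong) (auto simp: abel_def step_def)
 then show ?thesis using False by (simp add: step_def)
qed

lemma nn_integral_abel_marchaud:
 assumes e: "eps > 0"
 shows "(NN y. ennreal (abel (s - y) * marchaud eps y)) = ennreal (if s > eps then 2 / s * sqrt (s / eps - 1) else 0)"
proof (cases "s > eps")
 case True
 have s: "s > 0" using True e by simp
 have D: "((\<lambda>y. - (2 / s * sqrt (s / y - 1))) has_real_derivative abel (s - y) * marchaud eps y) (at y)" if y: "eps < y" "y < s" for y
 proof -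
  have p: "0 < s / y - 1" using y e by (simp add: field_simps)
  have "((\<lambda>y. - (2 / s * sqrt (s / y - 1))) has_real_derivative - (2 / s * (inverse (sqrt (s / y - 1)) / 2 * (- s / y\<^sup>2)))) (at y)"
   using p y e by (auto intro!: derivative_eq_intros simp: power2_eq_square)
  moreover have "s / y - 1 = (s - y) / y" using y e by (simp add: field_simps)
  moreover have "- (2 / s * (inverse (sqrt (s - y) / sqrt y) / 2 * (- s / y\<^sup>2))) = abel (s - y) * marchaud eps y"
  proof -
   have "- (2 / s * (inverse (sqrt (s - y) / sqrt y) / 2 * (- s / y\<^sup>2))) = sqrt y / (sqrt (s - y) * (y * y))"
    using s y e by (simp add: field_simps power2_eq_square)
   also have "\<dots> = sqrt y / (sqrt (s - y) * (y * (sqrt y * sqrt y)))" using y e by simp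
   also have "\<dots> = abel (s - y) * marchaud eps y" using y e by (simp add: abel_def marchaud_def field_simps del: real_sqrt_mult_self)
   finally show ?thesis .
  qed
  ultimately show ?thesis by (simp add: real_sqrt_divide)
 qed
 have "(NN y. ennreal (abel (s - y) * marchaud eps y) * indicator {eps<..<s} y) =
   ennreal (- (2 / s * sqrt (s / s - 1)) - - (2 / s * sqrt (s / eps - 1)))"
  by (rule nn_integral_FTC_interior[of "{}"])
    (use True e D in \<open>auto intro!: mult_nonneg_nonneg abel_nonneg marchaud_nonneg continuous_intros\<close>)
 also have "\<dots> = ennreal (2 / s * sqrt (s / eps - 1))" using s by simp
 finally have "(NN y. ennreal (abel (s - y) * marchaud eps y) * indicator {eps<..<s} y) = ennreal (2 / s * sqrt (s / eps - 1))" .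
 moreover have "(NN y. ennreal (abel (s - y) * marchaud eps y)) = (NN y. ennreal (abel (s - y) * marchaud eps y) * indicator {eps<..<s} y)"
  by (intro nn_integral_cong) (auto simp: abel_def marchaud_def indicator_def)
 ultimately show ?thesis using True by simp
next
 case False
 then have "(NN y. ennreal (abel (s - y) * marchaud eps y)) = (\<integral>\<^sup>+y. 0 \<partial>(lborel :: real measure))"
  by (intro nn_integral_cong) (auto simp: abel_def marchaud_def)
 then show ?thesis using False by simp
qed

lemma nn_integral_marchaud:
 assumes e: "eps > 0"
 shows "(NN y. ennreal (marchaud eps y)) = ennreal (2 / sqrt eps)"
proof -
 have "(NN y. ennreal (marchaud eps y) * indicator {eps<..} y) = ennreal (0 - (- 2 / sqrt eps))"
 proof (rule nn_integral_FTC_at_top[of "{}"])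
  fix x assume x: "eps < x"
  have "((\<lambda>x. - 2 / sqrt x) has_real_derivative 2 * (inverse (sqrt x) / 2) / (sqrt x * sqrt x)) (at x)"
   using x e by (auto intro!: derivative_eq_intros simp: field_simps)
  moreover have "2 * (inverse (sqrt x) / 2) / (sqrt x * sqrt x) = marchaud eps x" using x e by (simp add: marchaud_def field_simps)
  ultimately show "((\<lambda>x. - 2 / sqrt x) has_real_derivative marchaud eps x) (at x)" by simp
  show "0 \<le> marchaud eps x" using e by (simp add: marchaud_nonneg)
 next
  show "((\<lambda>x::real. - 2 / sqrt x) \<longlongrightarrow> 0) at_top" by real_asymp
 qed (use e in \<open>auto intro!: continuous_intros\<close>)
 moreover have "(NN y. ennreal (marchaud eps y)) = (NN y. ennreal (marchaud eps y) * indicator {eps<..} y)"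
  by (intro nn_integral_cong) (auto simp: marchaud_def indicator_def)
 ultimately show ?thesis by simp
qed

lemma nn_integral_trunc_density:
 assumes v: "v > 0"
 shows "(NN w. ennreal (trunc_density w) * indicator {v<..} w) = ennreal (trunc_kernel v)"
proof -
 have K: "trunc_kernel x = 2 / sqrt x - 2 / x * sqrt (max 0 (x - 1))" if "x > 0" for x
  using that by (auto simp: trunc_kernel_def max_def)
 have "(NN w. ennreal (trunc_density w) * indicator {v<..} w) = ennreal (0 - (- trunc_kernel v))"
 proof (rule nn_integral_FTC_at_top[of "{1}" v "\<lambda>v. - trunc_kernel v"])
  fix x :: real assume x: "v < x" "x \<notin> {1}"
  then have x0: "x > 0" using v by simp
  have D1: "((\<lambda>x. 2 / sqrt x) has_real_derivative - (1 / (x * sqrt x))) (at x)"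
  proof -
   have "((\<lambda>x. 2 / sqrt x) has_real_derivative - (2 * (inverse (sqrt x) / 2)) / (sqrt x * sqrt x)) (at x)"
    using x0 by (auto intro!: derivative_eq_intros simp: field_simps)
   then show ?thesis using x0 by (simp add: field_simps)
  qed
  show "((\<lambda>v. - trunc_kernel v) has_real_derivative trunc_density x) (at x)"
  proof (cases "x < 1")
   case True
   have "((\<lambda>x. - (2 / sqrt x)) has_real_derivative trunc_density x) (at x)"
    using DERIV_minus[OF D1] True x0 by (simp add: trunc_density_def)
   then show ?thesis
    by (rule has_field_derivative_transform_within_open[of _ _ _ "{0<..<1}"]) (use True x0 in \<open>auto simp: trunc_kernel_def\<close>)
  next
   case False
   with x have x1: "x > 1" by simp
   have D2: "((\<lambda>x. 2 / x * sqrt (x - 1)) has_real_derivative (2 - x) / (x\<^sup>2 * sqrt (x - 1))) (at x)"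
   proof -
    define q where "q = sqrt (x - 1)"
    have q: "q > 0" "x = q * q + 1" using x1 by (auto simp: q_def)
    have "inverse q * x - 2 * q = (2 - x) / q" using q(1) by (simp add: q(2) field_simps)
    then have eq: "(inverse q * x - 2 * q) / (x * x) = (2 - x) / (x\<^sup>2 * q)" by (simp add: power2_eq_square)
    have "((\<lambda>x. 2 * sqrt (x - 1) / x) has_real_derivative (2 * (inverse (sqrt (x - 1)) / 2) * x - 2 * sqrt (x - 1) * 1) / (x * x)) (at x)"
     using x1 by (intro DERIV_divide DERIV_cmult DERIV_ident) (auto intro!: derivative_eq_intros)
    then show ?thesis using eq unfolding q_def[symmetric] by simp
   qed
   have "((\<lambda>x. - (2 / sqrt x - 2 / x * sqrt (x - 1))) has_real_derivative trunc_density x) (at x)"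
    using DERIV_minus[OF DERIV_diff[OF D1 D2]] x1 by (simp add: trunc_density_def add.commute)
   then show ?thesis
    by (rule has_field_derivative_transform_within_open[of _ _ _ "{1<..}"]) (use x1 in \<open>auto simp: trunc_kernel_def\<close>)
  qed
 next
  have "((\<lambda>v::real. - (2 / sqrt v - 2 / v * sqrt (v - 1))) \<longlongrightarrow> 0) at_top" by real_asymp
  moreover have "\<forall>\<^sub>F v in at_top. - (2 / sqrt v - 2 / v * sqrt (v - 1)) = - trunc_kernel v"
   using eventually_gt_at_top[of 1] by eventually_elim (simp add: trunc_kernel_def)
  ultimately show "((\<lambda>v. - trunc_kernel v) \<longlongrightarrow> 0) at_top" by (rule Lim_transform_eventually)
 next
  have "continuous_on {v..} (\<lambda>x. - (2 / sqrt x - 2 / x * sqrt (max 0 (x - 1))))"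
   using v by (intro continuous_intros) auto
  then show "continuous_on {v..} (\<lambda>v. - trunc_kernel v)"
   by (subst continuous_on_cong[OF refl, of _ _ "\<lambda>x. - (2 / sqrt x - 2 / x * sqrt (max 0 (x - 1)))"]) (use v K in auto)
 qed (use trunc_density_nonneg in auto)
 then show ?thesis by simp
qed

text \<open>The inverse square root below 1 and the decay above 1 contribute 4 each.\<close>

lemma nn_integral_trunc_kernel: "(NN v. ennreal (trunc_kernel v)) \<le> ennreal 8"
proof -
 have "(NN v. ennreal (trunc_kernel v)) \<le> (NN v. 2 * (ennreal (abel v) * indicator {0<..<1} v) + 2 * ennreal (marchaud 1 v))"
 proof (rule nn_integral_mono_AE)
  show "AE v in lborel. ennreal (trunc_kernel v) \<le> 2 * (ennreal (abel v) * indicator {0<..<1} v) + 2 * ennreal (marchaud 1 v)"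
   using AE_lborel_singleton[of "1::real"]
  proof eventually_elim
   case (elim v)
   consider "v \<le> 0" | "0 < v" "v < 1" | "v > 1" using elim by linarith
   then show ?case
   proof cases
    case 2
    then have "ennreal (trunc_kernel v) \<le> ennreal (2 * abel v)" by (intro ennreal_leI trunc_kernel_le)
    then show ?thesis using 2 by (simp add: ennreal_mult abel_nonneg marchaud_def)
   next
    case 3
    then have "ennreal (trunc_kernel v) \<le> ennreal (2 * marchaud 1 v)"
     using trunc_kernel_le2[of v] by (intro ennreal_leI) (simp add: marchaud_def)
    then show ?thesis using 3 by (simp add: ennreal_mult marchaud_nonneg)
   qed (simp add: trunc_kernel_def)
  qed
 qed
 also have "\<dots> = 2 * (NN v. ennreal (abel v) * indicator {0<..<1} v) + 2 * (NN v. ennreal (marchaud 1 v))"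
  by (subst nn_integral_add) (auto simp: nn_integral_cmult)
 also have "\<dots> = 2 * ennreal 2 + 2 * ennreal 2"
  by (simp add: nn_integral_abel nn_integral_marchaud)
 also have "\<dots> = ennreal 8" by (simp flip: ennreal_numeral ennreal_plus ennreal_mult)
 finally show ?thesis .
qed

lemma integrable_trunc_kernel: "integrable lborel trunc_kernel"
 by (rule integrableI_nonneg) (use nn_integral_trunc_kernel trunc_kernel_nonneg in \<open>auto simp: le_less_trans\<close>)

text \<open>Tonelli on the region \<open>0 < v < w\<close>. This first moment is the weight with
  which means over intervals of length proportional to \<open>w\<close> enter later.\<close>

lemma nn_integral_trunc_density_moment:
 "(NN w. ennreal (trunc_density w * w)) = (NN v. ennreal (trunc_kernel v))"
proof -
 have "(NN w. ennreal (trunc_density w * w)) = (NN w. (NN v. ennreal (trunc_density w) * indicator {0<..<w} v))"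
 proof (rule nn_integral_cong)
  fix w :: real
  show "ennreal (trunc_density w * w) = (NN v. ennreal (trunc_density w) * indicator {0<..<w} v)"
  proof (cases "w > 0")
   case False
   then show ?thesis by (simp add: trunc_density_def)
  qed (simp add: nn_integral_cmult_indicator ennreal_mult trunc_density_nonneg)
 qed
 also have "\<dots> = (NN v. (NN w. ennreal (trunc_density w) * indicator {0<..<w} v))"
 proof (rule lborel_pair.Fubini')
  have "(\<lambda>(v, w). ennreal (trunc_density w) * (if 0 < v \<and> v < w then 1 else 0)) \<in> borel_measurable (lborel \<Otimes>\<^sub>M lborel)"
   by measurable
  then show "(\<lambda>(v, w). ennreal (trunc_density w) * indicator {0<..<w} v) \<in> borel_measurable (lborel \<Otimes>\<^sub>M lborel)"
   by (rule measurable_cong[THEN iffD1, rotated]) (auto simp: indicator_def)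
 qed
 also have "\<dots> = (NN v. ennreal (trunc_kernel v))"
 proof (rule nn_integral_cong)
  fix v :: real
  show "(NN w. ennreal (trunc_density w) * indicator {0<..<w} v) = ennreal (trunc_kernel v)"
  proof (cases "v > 0")
   case True
   have "(NN w. ennreal (trunc_density w) * indicator {0<..<w} v) = (NN w. ennreal (trunc_density w) * indicator {v<..} w)"
    using True by (intro nn_integral_cong) (auto simp: indicator_def)
   then show ?thesis using nn_integral_trunc_density[OF True] by simp
  qed (simp add: trunc_kernel_def)
 qed
 finally show ?thesis .
qed

definition trunc_const :: real where "trunc_const = (LB v. trunc_kernel v)"

lemma trunc_density_moment:
 "integrable lborel (\<lambda>w. trunc_density w * w)" "(LB w. trunc_density w * w) = trunc_const"
proof -
 have nn: "0 \<le> trunc_density w * w" for w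
  using trunc_density_nonneg[of w] by (cases "w > 0") (auto simp: trunc_density_def)
 show "integrable lborel (\<lambda>w. trunc_density w * w)"
  by (rule integrableI_nonneg) (use nn nn_integral_trunc_density_moment nn_integral_trunc_kernel in \<open>auto simp: le_less_trans\<close>)
 show "(LB w. trunc_density w * w) = trunc_const"
  unfolding trunc_const_def using nn trunc_kernel_nonneg
  by (simp add: integral_eq_nn_integral nn_integral_trunc_density_moment)
qed

section \<open>Algebra of convolutions\<close>

lemma conv_commute: "conv u v = conv v u"
proof
 fix t show "conv u v t = conv v u t"
  unfolding conv_def
  by (subst lborel_integral_real_affine[of "-1" _ t]) (auto intro!: Bochner_Integration.integral_cong)
qed

lemma nn_conv_commute:
 fixes u v :: "real \<Rightarrow> real"
 assumes [measurable]: "u \<in> borel_fun" "v \<in> borel_fun"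
 shows "(NN y. ennreal (u (s - y) * v y)) = (NN y. ennreal (v (s - y) * u y))"
 by (subst nn_integral_real_affine[of _ "-1" s]) (auto intro!: nn_integral_cong simp: mult.commute)

lemma nn_integral_reflect_shift:
 fixes g :: "real \<Rightarrow> ennreal"
 assumes [measurable]: "g \<in> borel_fun"
 shows "(NN s. g (t - s)) = (NN s. g s)"
 by (subst (2) nn_integral_real_affine[of _ "-1" t]) auto

text \<open>\<open>v\<close> and \<open>w\<close> are nonnegative, so that one finiteness condition
  at the point \<open>t\<close> yields the absolute integrability for Fubini; \<open>u\<close> may
  change sign.\<close>

lemma conv_assoc:
 assumes [measurable]: "u \<in> borel_fun" "v \<in> borel_fun" "w \<in> borel_fun"
  and nn: "\<And>x. 0 \<le> v x" "\<And>x. 0 \<le> w x"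
  and fin: "(NN s. ennreal \<bar>u (t - s)\<bar> * (NN y. ennreal (v (s - y) * w y))) < \<infinity>"
 shows "conv (conv u v) w t = conv u (conv v w) t"
proof -
 have G: "integrable (lborel \<Otimes>\<^sub>M lborel) (\<lambda>(s, y). u (t - s) * v (s - y) * w y)"
 proof (rule integrableI_bounded)
  have "(\<integral>\<^sup>+x. ennreal (norm (case x of (s, y) \<Rightarrow> u (t - s) * v (s - y) * w y)) \<partial>(lborel \<Otimes>\<^sub>M lborel)) =
   (NN s. (NN y. ennreal \<bar>u (t - s) * v (s - y) * w y\<bar>))"
   by (subst lborel.nn_integral_fst[symmetric]) auto
  also have "\<dots> = (NN s. ennreal \<bar>u (t - s)\<bar> * (NN y. ennreal (v (s - y) * w y)))"
   by (subst nn_integral_cmult[symmetric])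
     (auto intro!: nn_integral_cong simp: nn abs_mult mult.assoc simp flip: ennreal_mult)
  finally show "(\<integral>\<^sup>+x. ennreal (norm (case x of (s, y) \<Rightarrow> u (t - s) * v (s - y) * w y)) \<partial>(lborel \<Otimes>\<^sub>M lborel)) < \<infinity>"
   using fin by simp
 qed measurable
 have inner: "conv u v (t - y) = (LB s. u (t - s) * v (s - y))" for y
  unfolding conv_def
  by (subst lborel_integral_real_affine[of 1 _ "- y"]) (auto intro!: Bochner_Integration.integral_cong)
 have "conv (conv u v) w t = (LB y. (LB s. u (t - s) * v (s - y) * w y))"
  unfolding conv_def[of "conv u v"] inner by simp
 also have "\<dots> = (LB s. (LB y. u (t - s) * v (s - y) * w y))"
  by (rule lborel_pair.Fubini_integral[OF G])
 also have "\<dots> = conv u (conv v w) t"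
  unfolding conv_def by (simp add: mult.assoc)
 finally show ?thesis .
qed

lemma conv_eq_nn_integral:
 assumes [measurable]: "u \<in> borel_fun" "v \<in> borel_fun"
  and nn: "\<And>x. 0 \<le> u x" "\<And>x. 0 \<le> v x" "0 \<le> c"
  and eq: "(NN y. ennreal (u (s - y) * v y)) = ennreal c"
 shows "conv u v s = c"
 unfolding conv_def using nn by (subst integral_eq_nn_integral) (auto simp: eq)

lemma conv_abel_abel: "conv abel abel s = pi * step s"
 by (rule conv_eq_nn_integral) (auto simp: abel_nonneg step_nonneg nn_integral_abel_abel)

lemma conv_abel_marchaud:
 "eps > 0 \<Longrightarrow> conv abel (marchaud eps) s = (if s > eps then 2 / s * sqrt (s / eps - 1) else 0)"
 by (rule conv_eq_nn_integral) (auto simp: abel_nonneg marchaud_nonneg nn_integral_abel_marchaud)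

lemma conv_step:
 assumes [measurable]: "u \<in> borel_fun" and u0: "\<And>t. t < a \<Longrightarrow> u t = 0"
 shows "conv u step T = (LINT t:{a..T}|lborel. u t)"
 unfolding conv_commute[of u] conv_def set_lebesgue_integral_def
proof (rule integral_cong_AE)
 show "AE x in lborel. step (T - x) * u x = indicator {a..T} x *\<^sub>R u x"
  using AE_lborel_singleton[of T] by eventually_elim (auto simp: step_def indicator_def u0)
qed (auto simp: step_def)

lemma integrable_marchaud:
 assumes "eps > 0"
 shows "integrable lborel (marchaud eps)" "(LB r. marchaud eps r) = 2 / sqrt eps"
proof -
 show "integrable lborel (marchaud eps)"
  by (rule integrableI_nonneg) (use assms nn_integral_marchaud marchaud_nonneg in auto)
 show "(LB r. marchaud eps r) = 2 / sqrt eps"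
  using assms by (subst integral_eq_nn_integral) (auto simp: marchaud_nonneg nn_integral_marchaud)
qed

section \<open>Inversion of the Abel transform\<close>

text \<open>The convolution of an L1 function with \<open>abel\<close> may diverge at some points.
  Integrating its absolute version over \<open>t < c\<close> first shows that it converges almost
  everywhere there and is locally integrable.\<close>

lemma nn_integral_abs_conv_abel:
 assumes [measurable]: "g \<in> borel_fun" and g0: "\<And>t. t < a \<Longrightarrow> g t = 0"
 shows "(NN t. ennreal (step (c - t)) * (NN s. ennreal \<bar>g (t - s) * abel s\<bar>))
  \<le> ennreal (2 * sqrt \<bar>c - a\<bar>) * (NN s. ennreal \<bar>g s\<bar>)"
proof -
 have "(NN t. ennreal (step (c - t)) * (NN s. ennreal \<bar>g (t - s) * abel s\<bar>)) =
   (NN t. (NN s. ennreal (step (c - t)) * ennreal \<bar>g s * abel (t - s)\<bar>))"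
 proof (intro nn_integral_cong)
  fix t
  have "(NN s. ennreal \<bar>g (t - s) * abel s\<bar>) = (NN s. ennreal \<bar>g s * abel (t - s)\<bar>)"
   by (subst nn_integral_reflect_shift[of _ t, symmetric]) auto
  then show "ennreal (step (c - t)) * (NN s. ennreal \<bar>g (t - s) * abel s\<bar>) =
    (NN s. ennreal (step (c - t)) * ennreal \<bar>g s * abel (t - s)\<bar>)"
   by (simp add: nn_integral_cmult)
 qed
 also have "\<dots> = (NN s. (NN t. ennreal (step (c - t)) * ennreal \<bar>g s * abel (t - s)\<bar>))"
  by (rule lborel_pair.Fubini') measurable
 also have "\<dots> \<le> (NN s. ennreal (2 * sqrt \<bar>c - a\<bar>) * ennreal \<bar>g s\<bar>)"
 proof (rule nn_integral_mono)
  fix s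
  have "(NN t. ennreal (step (c - t)) * ennreal \<bar>g s * abel (t - s)\<bar>) =
   (NN t. ennreal \<bar>g s\<bar> * ennreal (step (c - t) * abel (t - s)))"
   by (intro nn_integral_cong) (simp add: abs_mult abel_nonneg step_nonneg ennreal_mult mult_ac)
  also have "\<dots> = ennreal \<bar>g s\<bar> * (NN t. ennreal (step (c - t) * abel (t - s)))"
   by (rule nn_integral_cmult) measurable
  also have "(NN t. ennreal (step (c - t) * abel (t - s))) = (NN y. ennreal (step (c - s - y) * abel y))"
   by (subst nn_integral_real_affine[of _ 1 s]) (auto simp: diff_diff_add)
  also have "\<dots> = ennreal (2 * sqrt (c - s) * step (c - s))" by (rule nn_integral_step_abel)
  also have "ennreal \<bar>g s\<bar> * \<dots> \<le> ennreal (2 * sqrt \<bar>c - a\<bar>) * ennreal \<bar>g s\<bar>"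
  proof (cases "s < a")
   case False
   then have "2 * sqrt (c - s) * step (c - s) \<le> 2 * sqrt \<bar>c - a\<bar>" by (auto simp: step_def indicator_def)
   then show ?thesis by (subst mult.commute) (intro mult_right_mono ennreal_leI, auto)
  qed (simp add: g0)
  finally show "(NN t. ennreal (step (c - t)) * ennreal \<bar>g s * abel (t - s)\<bar>)
    \<le> ennreal (2 * sqrt \<bar>c - a\<bar>) * ennreal \<bar>g s\<bar>" .
 qed
 also have "\<dots> = ennreal (2 * sqrt \<bar>c - a\<bar>) * (NN s. ennreal \<bar>g s\<bar>)" by (rule nn_integral_cmult) simp
 finally show ?thesis .
qed

text \<open>Writing convolution as a product, the hypothesis reads h abel = g step. Multiplying by
  abel and using abel abel = pi step gives g abel step = pi h step: the functions g abel and pi h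
  have the same primitives on the interval and agree almost everywhere.\<close>

lemma abel_inversion_AE:
 fixes h g :: "real \<Rightarrow> real"
 assumes h [measurable]: "h \<in> borel_fun" and hB: "\<And>t. \<bar>h t\<bar> \<le> B" and h0: "\<And>t. t < a \<Longrightarrow> h t = 0"
  and g: "integrable lborel g" and g0: "\<And>t. t \<notin> {a..c} \<Longrightarrow> g t = 0"
  and J: "\<And>T. a \<le> T \<Longrightarrow> T \<le> c \<Longrightarrow> conv h abel T = (LINT t:{a..T}|lborel. g t)"
 shows "AE t in lborel. a < t \<and> t < c \<longrightarrow> integrable lborel (\<lambda>s. g (t - s) * abel s) \<and> conv g abel t = pi * h t"
proof -
 note [measurable] = borel_measurable_integrable[OF g, simplified]
 have B: "B \<ge> 0" using hB[of 0] by (simp add: order_trans[OF abs_ge_zero])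
 have gfin: "(NN s. ennreal \<bar>g s\<bar>) < \<infinity>" using g by (simp add: integrable_iff_bounded)
 have vanish: "conv u abel T = 0" if "\<And>t. t < a \<Longrightarrow> u t = 0" "T < a" for u T
 proof -
  have "conv u abel T = (LINT s|(lborel :: real measure). 0)"
   unfolding conv_def by (intro Bochner_Integration.integral_cong) (use that in \<open>auto simp: abel_def\<close>)
  then show ?thesis by simp
 qed
 have hJ: "conv h abel T = conv g step T" if "T \<le> c" for T
 proof (cases "T < a")
  case True
  then show ?thesis using vanish[of h T] h0 conv_step[of g a T] g0 by (simp add: set_lebesgue_integral_def)
 next
  case False
  then show ?thesis using J[of T] that conv_step[of g a T] g0 by auto
 qed
 have fing: "(NN s. ennreal \<bar>g (T - s)\<bar> * ennreal (2 * sqrt s * step s)) < \<infinity>" for T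
 proof -
  have "(NN s. ennreal \<bar>g (T - s)\<bar> * ennreal (2 * sqrt s * step s)) \<le> (NN s. ennreal \<bar>g (T - s)\<bar> * ennreal (2 * sqrt \<bar>T - a\<bar>))"
  proof (rule nn_integral_mono)
   fix s show "ennreal \<bar>g (T - s)\<bar> * ennreal (2 * sqrt s * step s) \<le> ennreal \<bar>g (T - s)\<bar> * ennreal (2 * sqrt \<bar>T - a\<bar>)"
   proof (cases "T - s < a")
    case False
    then show ?thesis by (intro mult_left_mono ennreal_leI) (auto simp: step_def indicator_def)
   qed (simp add: g0)
  qed
  also have "\<dots> = (NN s. ennreal \<bar>g s\<bar>) * ennreal (2 * sqrt \<bar>T - a\<bar>)"
   by (subst nn_integral_multc) (auto simp: nn_integral_reflect_shift[of "\<lambda>s. ennreal \<bar>g s\<bar>"])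
  also have "\<dots> < \<infinity>" using gfin by (simp add: ennreal_mult_less_top)
  finally show ?thesis .
 qed
 have key: "conv (conv g abel) step T = pi * conv h step T" if T: "T \<le> c" for T
 proof -
  have "conv (conv g abel) step T = conv g (conv abel step) T"
   using fing[of T] by (intro conv_assoc) (auto simp: abel_nonneg step_nonneg nn_conv_commute[of abel step] nn_integral_step_abel)
  also have "\<dots> = conv g (conv step abel) T" by (simp add: conv_commute[of abel step])
  also have "\<dots> = conv (conv g step) abel T"
   using fing[of T] by (intro conv_assoc[symmetric]) (auto simp: abel_nonneg step_nonneg nn_integral_step_abel)
  also have "\<dots> = conv (conv h abel) abel T"
  proof -
   \<comment> \<open>\<open>hJ\<close> is available only up to \<open>c\<close>, but
     \<open>abel s\<close> vanishes unless \<open>s > 0\<close>, and then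
     \<open>T - s < c\<close>.\<close>
   have eq: "conv g step (T - s) * abel s = conv h abel (T - s) * abel s" for s
    using hJ[of "T - s"] T by (cases "s > 0") (auto simp: abel_def[of s])
   then show ?thesis unfolding conv_def[of "conv g step"] conv_def[of "conv h abel"] by (simp only: eq)
  qed
  also have "\<dots> = conv h (conv abel abel) T"
  proof (rule conv_assoc)
   have "(NN s. ennreal \<bar>h (T - s)\<bar> * (NN y. ennreal (abel (s - y) * abel y)))
    \<le> (NN s. ennreal (B * pi) * indicator {0..\<bar>T - a\<bar>} s)"
   proof (rule nn_integral_mono)
    fix s
    show "ennreal \<bar>h (T - s)\<bar> * (NN y. ennreal (abel (s - y) * abel y)) \<le> ennreal (B * pi) * indicator {0..\<bar>T - a\<bar>} s"
    proof (cases "0 < s \<and> a \<le> T - s")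
     case True
     then have "ennreal \<bar>h (T - s)\<bar> * ennreal (pi * step s) \<le> ennreal B * ennreal pi"
      using hB by (intro mult_mono ennreal_leI) (auto simp: step_def)
     then show ?thesis using True B by (simp add: nn_integral_abel_abel ennreal_mult)
    qed (auto simp: nn_integral_abel_abel step_def h0)
   qed
   also have "\<dots> = ennreal (B * pi) * ennreal \<bar>T - a\<bar>" by (simp add: nn_integral_cmult_indicator)
   also have "\<dots> < \<infinity>" by (simp add: ennreal_mult_less_top)
   finally show "(NN s. ennreal \<bar>h (T - s)\<bar> * (NN y. ennreal (abel (s - y) * abel y))) < \<infinity>" .
  qed (auto simp: abel_nonneg)
  also have "\<dots> = pi * conv h step T"
   unfolding conv_def[of h "conv abel abel"] conv_abel_abel by (simp add: conv_def mult.left_commute)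
  finally show ?thesis .
 qed
 define A where "A t = (NN s. ennreal \<bar>g (t - s) * abel s\<bar>)" for t
 have [measurable]: "A \<in> borel_fun" unfolding A_def [abs_def] by measurable
 have Afin: "(NN t. ennreal (step (c - t)) * A t) < \<infinity>"
  using nn_integral_abs_conv_abel[of g a c] g0 gfin unfolding A_def
  by (auto intro: le_less_trans simp: ennreal_mult_less_top)
 have "AE t in lborel. ennreal (step (c - t)) * A t \<noteq> \<infinity>"
  by (rule nn_integral_PInf_AE) (use Afin in auto)
 then have Aint: "AE t in lborel. t < c \<longrightarrow> integrable lborel (\<lambda>s. g (t - s) * abel s)"
 proof eventually_elim
  case (elim t)
  show ?case
  proof
   assume "t < c"
   with elim have "A t < \<infinity>" by (simp add: step_def less_top)
   then show "integrable lborel (\<lambda>s. g (t - s) * abel s)"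
    unfolding A_def by (intro integrableI_bounded) auto
  qed
 qed
 have absA: "ennreal \<bar>conv g abel t\<bar> \<le> A t" for t
 proof (cases "integrable lborel (\<lambda>s. g (t - s) * abel s)")
  case True
  then show ?thesis using integral_norm_bound_ennreal[OF True] by (simp add: A_def conv_def)
 qed (simp add: conv_def not_integrable_integral_eq)
 have si1: "set_integrable lborel {a..c} (conv g abel)"
  unfolding set_integrable_def
 proof (rule integrableI_bounded)
  have "(NN t. ennreal (norm (indicator {a..c} t *\<^sub>R conv g abel t))) \<le> (NN t. ennreal (step (c - t)) * A t)"
  proof (rule nn_integral_mono_AE)
   show "AE t in lborel. ennreal (norm (indicator {a..c} t *\<^sub>R conv g abel t)) \<le> ennreal (step (c - t)) * A t"
    using AE_lborel_singleton[of c] by eventually_elim (use absA in \<open>auto simp: indicator_def step_def\<close>)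
  qed
  then show "(NN t. ennreal (norm (indicator {a..c} t *\<^sub>R conv g abel t))) < \<infinity>"
   using Afin by simp
 qed measurable
 have si2: "set_integrable lborel {a..c} (\<lambda>t. pi * h t)"
  unfolding set_integrable_def
  by (rule Bochner_Integration.integrable_bound[OF integrable_mult_right[OF integrable_indicator_Icc[of a c], of "pi * B"]])
    (use hB in \<open>auto simp: indicator_def abs_mult abs_of_nonneg[OF B]\<close>)
 define D where "D t = conv g abel t - pi * h t" for t
 have siD: "set_integrable lborel {a..c} D" unfolding D_def [abs_def] by (intro set_integral_diff si1 si2)
 have D0: "(LINT t:{a..T}|lborel. D t) = 0" if T: "a < T" "T < c" for T
 proof -
  have "(LINT t:{a..T}|lborel. D t) = (LINT t:{a..T}|lborel. conv g abel t) - (LINT t:{a..T}|lborel. pi * h t)"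
   unfolding D_def using T by (intro set_integral_diff set_integrable_subset[OF si1] set_integrable_subset[OF si2]) auto
  also have "(LINT t:{a..T}|lborel. conv g abel t) = conv (conv g abel) step T"
   using vanish g0 by (intro conv_step[symmetric]) auto
  also have "(LINT t:{a..T}|lborel. pi * h t) = pi * conv h step T"
   using conv_step[OF h, of a T] h0 by simp
  finally show ?thesis using key[of T] T by simp
 qed
 show ?thesis using AE_DERIV_indefinite_integral[OF siD] Aint
 proof eventually_elim
  case (elim t)
  show ?case
  proof
   assume t: "a < t \<and> t < c"
   with elim have "((\<lambda>x. LINT s:{a..x}|lborel. D s) has_real_derivative D t) (at t)" by blast
   then have "((\<lambda>x. 0) has_real_derivative D t) (at t)"
    by (rule has_field_derivative_transform_within_open[of _ _ _ "{a<..<c}"]) (use t D0 in auto)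
   then have "D t = 0" using DERIV_const DERIV_unique by blast
   then show "integrable lborel (\<lambda>s. g (t - s) * abel s) \<and> conv g abel t = pi * h t"
    using elim t by (simp add: D_def)
  qed
 qed
qed

lemma trunc_kernel_scaled:
 assumes e: "eps > 0"
 shows "2 / sqrt eps * abel u - conv abel (marchaud eps) u = 1 / eps * trunc_kernel (u / eps)"
proof -
 have 1: "1 / eps * (2 / sqrt (u / eps)) = 2 / sqrt eps * (1 / sqrt u)" if "u > 0"
 proof -
  have "1 / eps * (2 / sqrt (u / eps)) = 2 * (sqrt eps / eps) / sqrt u" by (simp add: real_sqrt_divide)
  also have "sqrt eps / eps = 1 / sqrt eps" using e by (simp add: field_simps)
  finally show ?thesis by simp
 qed
 have 2: "2 / u * sqrt (u / eps - 1) = 1 / eps * (2 / (u / eps) * sqrt (u / eps - 1))" using e by simp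
 show ?thesis
 proof (cases "u > 0")
  case True
  then show ?thesis using e 1 unfolding conv_abel_marchaud[OF e] trunc_kernel_def abel_def
   by (simp add: right_diff_distrib)
 next
  case False
  then show ?thesis using e unfolding conv_abel_marchaud[OF e] trunc_kernel_def abel_def
   by (simp add: zero_less_divide_iff)
 qed
qed

text \<open>Replacing \<open>pi * h\<close> by \<open>conv g abel\<close>, at \<open>t\<close> and
  at almost every earlier point, and reassociating leaves \<open>g\<close> convolved with
  \<open>2 / sqrt eps * abel - conv abel (marchaud eps)\<close>, which is the rescaled
  \<open>trunc_kernel\<close>. The factor \<open>2 / sqrt eps\<close> is the mass of
  \<open>marchaud eps\<close>.\<close>

lemma truncated_marchaud_eq:
 fixes h g :: "real \<Rightarrow> real"
 assumes h [measurable]: "h \<in> borel_fun" and hB: "\<And>t. \<bar>h t\<bar> \<le> B" and h0: "\<And>t. t < a \<Longrightarrow> h t = 0"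
  and g: "integrable lborel g" and g0: "\<And>t. t < a \<Longrightarrow> g t = 0"
  and ae: "AE t in lborel. a < t \<and> t < c \<longrightarrow> conv g abel t = pi * h t"
  and t: "t < c" and eq: "conv g abel t = pi * h t" and int: "integrable lborel (\<lambda>s. g (t - s) * abel s)" and e: "eps > 0"
 shows "pi * (LB r. (h t - h (t - r)) * marchaud eps r) = (LB v. g (t - eps * v) * trunc_kernel v)"
proof -
 note [measurable] = borel_measurable_integrable[OF g, simplified]
 have B: "B \<ge> 0" using hB[of 0] by (simp add: order_trans[OF abs_ge_zero])
 have hm: "integrable lborel (\<lambda>r. h (t - r) * marchaud eps r)"
  by (rule Bochner_Integration.integrable_bound[OF integrable_mult_right[OF integrable_marchaud(1)[OF e], of B]])
    (use hB B e in \<open>auto simp: abs_mult marchaud_nonneg intro!: mult_right_mono\<close>)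
 have "(LB r. (h t - h (t - r)) * marchaud eps r) = h t * (2 / sqrt eps) - conv h (marchaud eps) t"
  unfolding conv_def left_diff_distrib
  by (subst Bochner_Integration.integral_diff) (use hm integrable_marchaud[OF e] in auto)
 moreover have "pi * conv h (marchaud eps) t = conv (conv g abel) (marchaud eps) t"
 proof -
  have ae2: "AE r in lborel. a < t + (-1) * r \<and> t + (-1) * r < c \<longrightarrow> conv g abel (t + (-1) * r) = pi * h (t + (-1) * r)"
   by (rule AE_borel_affine[OF _ _ ae]) auto
  have van: "conv g abel x = 0" if "x < a" for x
  proof -
   have "conv g abel x = (LINT s|(lborel :: real measure). 0)"
    unfolding conv_def by (intro Bochner_Integration.integral_cong) (use that g0 in \<open>auto simp: abel_def\<close>)
   then show ?thesis by simp
  qed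
  have "AE r in lborel. pi * (h (t - r) * marchaud eps r) = conv g abel (t - r) * marchaud eps r"
   using ae2 AE_lborel_singleton[of "t - a"]
  proof eventually_elim
   case (elim r)
   consider "r \<le> eps" | "t - r < a" | "r > eps" "a < t - r" using elim by linarith
   then show ?case using elim h0[of "t - r"] van[of "t - r"] t e by cases (auto simp: marchaud_def)
  qed
  then have "(LB r. pi * (h (t - r) * marchaud eps r)) = (LB r. conv g abel (t - r) * marchaud eps r)"
   by (intro integral_cong_AE) auto
  then show ?thesis by (simp add: conv_def[of _ "marchaud eps"])
 qed
 moreover have "conv (conv g abel) (marchaud eps) t = conv g (conv abel (marchaud eps)) t"
  and int2: "integrable lborel (\<lambda>s. g (t - s) * conv abel (marchaud eps) s)"
 proof -
  have bd: "2 / s * sqrt (s / eps - 1) \<le> 2 / eps" if "s > eps" for s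
  proof -
   have s: "s > 0" using that e by simp
   have "1 \<le> s / eps" using that e by simp
   moreover have "sqrt (x - 1) \<le> x" if "1 \<le> x" for x :: real
    using that self_le_power[of x 2] by (intro real_le_lsqrt) auto
   ultimately have "sqrt (s / eps - 1) \<le> s / eps" by blast
   then have "2 / s * sqrt (s / eps - 1) \<le> 2 / s * (s / eps)" using s by (intro mult_left_mono) auto
   then show ?thesis using s by simp
  qed
  have gt: "integrable lborel (\<lambda>s. g (t - s))"
   using lborel_integrable_real_affine_iff[of "-1" g t] g by simp
  have "(NN s. ennreal \<bar>g (t - s)\<bar> * (NN y. ennreal (abel (s - y) * marchaud eps y)))
    \<le> (NN s. ennreal \<bar>g (t - s)\<bar> * ennreal (2 / eps))"
   unfolding nn_integral_abel_marchaud[OF e] using bd by (intro nn_integral_mono mult_left_mono ennreal_leI) (use e in auto)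
  also have "\<dots> = (NN s. ennreal \<bar>g (t - s)\<bar>) * ennreal (2 / eps)" by (rule nn_integral_multc) simp
  also have "\<dots> < \<infinity>" using gt by (simp add: ennreal_mult_less_top integrable_iff_bounded)
  finally show "conv (conv g abel) (marchaud eps) t = conv g (conv abel (marchaud eps)) t"
   using e by (intro conv_assoc) (auto simp: abel_nonneg marchaud_nonneg)
  show "integrable lborel (\<lambda>s. g (t - s) * conv abel (marchaud eps) s)"
  proof (rule Bochner_Integration.integrable_bound[OF integrable_mult_left[OF integrable_abs[OF gt], of "2 / eps"]])
   show "AE s in lborel. norm (g (t - s) * conv abel (marchaud eps) s) \<le> norm (\<bar>g (t - s)\<bar> * (2 / eps))"
   proof (intro always_eventually allI)
    fix s
    have "\<bar>conv abel (marchaud eps) s\<bar> \<le> 2 / eps"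
     using bd[of s] e unfolding conv_abel_marchaud[OF e] by auto
    then show "norm (g (t - s) * conv abel (marchaud eps) s) \<le> norm (\<bar>g (t - s)\<bar> * (2 / eps))"
     using mult_left_mono[of _ "2 / eps" "\<bar>g (t - s)\<bar>"] e by (simp add: abs_mult)
   qed
  qed auto
 qed
 ultimately have "pi * (LB r. (h t - h (t - r)) * marchaud eps r) =
   conv g abel t * (2 / sqrt eps) - conv g (conv abel (marchaud eps)) t"
  by (simp add: eq right_diff_distrib)
 also have "\<dots> = (LB s. g (t - s) * abel s * (2 / sqrt eps) - g (t - s) * conv abel (marchaud eps) s)"
  unfolding conv_def[of g] using int int2 by (subst Bochner_Integration.integral_diff) auto
 also have "\<dots> = (LB s. g (t - s) * (1 / eps * trunc_kernel (s / eps)))"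
  unfolding trunc_kernel_scaled[OF e, symmetric] by (intro Bochner_Integration.integral_cong) (auto simp: algebra_simps)
 also have "\<dots> = (LB v. g (t - eps * v) * trunc_kernel v)"
  using e by (subst lborel_integral_real_affine[of eps _ 0]) auto
 finally show ?thesis .
qed

lemma integrable_scaled_abel:
 assumes int: "integrable lborel (\<lambda>s. g (t - s) * abel s)" and e: "eps > (0::real)"
 shows "integrable lborel (\<lambda>v. g (t - eps * v) * abel v)"
proof -
 have "integrable lborel (\<lambda>v. g (t - (0 + eps * v)) * abel (0 + eps * v))"
  using e int by (subst lborel_integrable_real_affine_iff) auto
 then have "integrable lborel (\<lambda>v. sqrt eps * (g (t - eps * v) * abel (eps * v)))" by simp
 moreover have "sqrt eps * (g (t - eps * v) * abel (eps * v)) = g (t - eps * v) * abel v" for v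
  using e by (simp add: abel_def real_sqrt_mult zero_less_mult_iff)
 ultimately show ?thesis by simp
qed

lemma set_integral_increment:
 fixes g :: "real \<Rightarrow> real"
 assumes g: "integrable lborel g" and g0: "\<And>t. t < a \<Longrightarrow> g t = 0" and y: "y \<le> t"
 shows "(LINT s:{a..t}|lborel. g s) - (LINT s:{a..y}|lborel. g s) = (LB s. g s * indicator {y<..<t} s)"
proof -
 have si: "integrable lborel (\<lambda>s. indicator {a..x} s *\<^sub>R g s)" for x by (intro integrable_mult_indicator g) auto
 have "(LINT s:{a..t}|lborel. g s) - (LINT s:{a..y}|lborel. g s) = (LB s. indicator {a..t} s *\<^sub>R g s - indicator {a..y} s *\<^sub>R g s)"
  unfolding set_lebesgue_integral_def by (simp only: Bochner_Integration.integral_diff[OF si si])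
 also have "\<dots> = (LB s. g s * indicator {y<..<t} s)"
 proof (rule integral_cong_AE)
  show "AE s in lborel. indicator {a..t} s *\<^sub>R g s - indicator {a..y} s *\<^sub>R g s = g s * indicator {y<..<t} s"
   using AE_lborel_singleton[of t] by eventually_elim (use y g0 in \<open>auto simp: indicator_def\<close>)
 qed (use borel_measurable_integrable[OF g] in auto)
 finally show ?thesis .
qed

text \<open>As the kernel is a mixture of interval indicators, the integral becomes a mixture of the
  left-sided means \<open>A (eps * w)\<close> of \<open>g\<close> with the integrable weight
  \<open>trunc_density w * w\<close>. These means are bounded and tend to \<open>g t\<close>, so
  dominated convergence applies.\<close>

lemma trunc_kernel_limit:
 fixes g :: "real \<Rightarrow> real"
 assumes g: "integrable lborel g" and g0: "\<And>t. t < a \<Longrightarrow> g t = 0"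
  and int: "integrable lborel (\<lambda>s. g (t - s) * abel s)"
  and D: "((\<lambda>x. LINT s:{a..x}|lborel. g s) has_real_derivative g t) (at t)"
 shows "((\<lambda>eps. LB v. g (t - eps * v) * trunc_kernel v) \<longlongrightarrow> trunc_const * g t) (at_right 0)"
proof -
 note [measurable] = borel_measurable_integrable[OF g, simplified]
 define G where "G x = (LINT s:{a..x}|lborel. g s)" for x
 define A where "A x = (G t - G (t - x)) / x" for x
 have [measurable]: "G \<in> borel_fun"
 proof -
  have eq: "G x = (LB s. (if a \<le> s \<and> s \<le> x then g s else 0))" for x
   unfolding G_def set_lebesgue_integral_def by (intro Bochner_Integration.integral_cong) (auto simp: indicator_def)
  show ?thesis unfolding eq [abs_def] by measurable
 qed
 have Ameas [measurable]: "A \<in> borel_fun" unfolding A_def [abs_def] by measurable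
 have inner: "(LB v. g (t - eps * v) * indicator {0<..<w} v) = w * A (eps * w)" if e: "eps > 0" and w: "w > 0" for eps w
 proof -
  have "G t - G (t - eps * w) = (LB s. g s * indicator {t - eps * w<..<t} s)"
   unfolding G_def using e w by (intro set_integral_increment g g0) auto
  also have "\<dots> = eps * (LB v. g (t - eps * v) * indicator {t - eps * w<..<t} (t - eps * v))"
   using e by (subst lborel_integral_real_affine[of "- eps" _ t]) auto
  also have "(\<lambda>v. g (t - eps * v) * indicator {t - eps * w<..<t} (t - eps * v)) = (\<lambda>v. g (t - eps * v) * indicator {0<..<w} v)"
   using e by (auto simp: indicator_def zero_less_mult_iff)
  finally show ?thesis using e w by (simp add: A_def)
 qed
 have rep: "(LB v. g (t - eps * v) * trunc_kernel v) = (LB w. trunc_density w * w * A (eps * w))" if e: "eps > 0" for eps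
 proof -
  define F where "F v w = g (t - eps * v) * trunc_density w * (if 0 < v \<and> v < w then 1 else 0)" for v w :: real
  have Fint: "integrable (lborel \<Otimes>\<^sub>M lborel) (case_prod F)"
  proof (rule integrableI_bounded)
   show "case_prod F \<in> borel_measurable (lborel \<Otimes>\<^sub>M lborel)" unfolding F_def by measurable
   then have "(\<integral>\<^sup>+x. ennreal (norm (case_prod F x)) \<partial>(lborel \<Otimes>\<^sub>M lborel)) = (NN v. (NN w. ennreal \<bar>F v w\<bar>))"
    by (subst lborel.nn_integral_fst[symmetric]) auto
   also have "\<dots> \<le> (NN v. ennreal (2 * \<bar>g (t - eps * v) * abel v\<bar>))"
   proof (rule nn_integral_mono)
    fix v :: real
    show "(NN w. ennreal \<bar>F v w\<bar>) \<le> ennreal (2 * \<bar>g (t - eps * v) * abel v\<bar>)"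
    proof (cases "v > 0")
     case True
     have "(NN w. ennreal \<bar>F v w\<bar>) = (NN w. ennreal \<bar>g (t - eps * v)\<bar> * (ennreal (trunc_density w) * indicator {v<..} w))"
      using True by (intro nn_integral_cong) (auto simp: F_def abs_mult ennreal_mult trunc_density_nonneg indicator_def)
     also have "\<dots> = ennreal \<bar>g (t - eps * v)\<bar> * ennreal (trunc_kernel v)"
      by (subst nn_integral_cmult) (auto simp: nn_integral_trunc_density[OF True])
     also have "\<dots> \<le> ennreal \<bar>g (t - eps * v)\<bar> * ennreal (2 * abel v)"
      by (intro mult_left_mono ennreal_leI trunc_kernel_le) auto
     also have "\<dots> = ennreal (2 * \<bar>g (t - eps * v) * abel v\<bar>)"
      by (simp add: abs_mult abel_nonneg mult_ac flip: ennreal_mult)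
     finally show ?thesis .
    qed (simp add: F_def)
   qed
   also have "\<dots> < \<infinity>"
   proof -
    have "integrable lborel (\<lambda>v. 2 * \<bar>g (t - eps * v) * abel v\<bar>)"
     by (intro integrable_mult_right integrable_abs integrable_scaled_abel int e)
    then show ?thesis unfolding integrable_iff_bounded by (simp add: abs_mult)
   qed
   finally show "(\<integral>\<^sup>+x. ennreal (norm (case_prod F x)) \<partial>(lborel \<Otimes>\<^sub>M lborel)) < \<infinity>" .
  qed
  have "(LB v. g (t - eps * v) * trunc_kernel v) = (LB v. (LB w. F v w))"
  proof (intro Bochner_Integration.integral_cong refl)
   fix v :: real
   show "g (t - eps * v) * trunc_kernel v = (LB w. F v w)"
   proof (cases "v > 0")
    case True
    have "(LB w. F v w) = (LB w. g (t - eps * v) * (trunc_density w * indicator {v<..} w))"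
     using True by (intro Bochner_Integration.integral_cong) (auto simp: F_def indicator_def)
    also have "\<dots> = g (t - eps * v) * (LB w. trunc_density w * indicator {v<..} w)" by simp
    also have "(LB w. trunc_density w * indicator {v<..} w) = enn2real (NN w. ennreal (trunc_density w) * indicator {v<..} w)"
     by (subst integral_eq_nn_integral)
       (auto simp: trunc_density_nonneg indicator_def intro!: arg_cong[where f=enn2real] nn_integral_cong)
    also have "\<dots> = trunc_kernel v" by (simp add: nn_integral_trunc_density[OF True] trunc_kernel_nonneg)
    finally show ?thesis by simp
   qed (simp add: F_def trunc_kernel_def)
  qed
  also have "\<dots> = (LB w. (LB v. F v w))"
   by (rule lborel_pair.Fubini_integral[OF Fint, symmetric])
  also have "\<dots> = (LB w. trunc_density w * w * A (eps * w))"
  proof (intro Bochner_Integration.integral_cong refl)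
   fix w :: real
   show "(LB v. F v w) = trunc_density w * w * A (eps * w)"
   proof (cases "w > 0")
    case True
    have "(LB v. F v w) = (LB v. trunc_density w * (g (t - eps * v) * indicator {0<..<w} v))"
     by (intro Bochner_Integration.integral_cong) (auto simp: F_def indicator_def)
    then show ?thesis by (simp add: inner[OF e True])
   qed (simp add: F_def trunc_density_def)
  qed
  finally show ?thesis .
 qed
 have Alim: "(A \<longlongrightarrow> g t) (at_right 0)"
 proof -
  have "((\<lambda>h. (G (t + h) - G t) / h) \<longlongrightarrow> g t) (at 0)" using D unfolding G_def DERIV_def .
  moreover have "filterlim uminus (at 0) (at_right (0::real))"
   unfolding filterlim_at by (auto intro!: tendsto_eq_intros simp: eventually_at_filter)
  ultimately have "((\<lambda>x. (G (t + - x) - G t) / - x) \<longlongrightarrow> g t) (at_right 0)" by (rule filterlim_compose)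
  moreover have "(\<lambda>x. (G (t + - x) - G t) / - x) = A" by (auto simp: A_def minus_divide_right[symmetric] minus_divide_left)
  ultimately show ?thesis by simp
 qed
 \<comment> \<open>Near 0 the means are bounded because they converge, away from 0 because
   \<open>g\<close> has finite L1 norm.\<close>
 obtain C where C: "\<And>x. x > 0 \<Longrightarrow> \<bar>A x\<bar> \<le> C"
 proof -
  from Alim have "\<forall>\<^sub>F x in at_right 0. dist (A x) (g t) < 1" by (rule tendstoD) simp
  then obtain \<delta> where \<delta>: "\<delta> > 0" "\<And>x. 0 < x \<Longrightarrow> x < \<delta> \<Longrightarrow> dist (A x) (g t) < 1"
   by (auto simp: eventually_at_right_field)
  define N where "N = (LB s. \<bar>g s\<bar>)"
  have N: "N \<ge> 0" by (simp add: N_def)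
  have "\<bar>A x\<bar> \<le> max (\<bar>g t\<bar> + 1) (N / \<delta>)" if x: "x > 0" for x
  proof (cases "x < \<delta>")
   case True
   then show ?thesis using \<delta>(2)[OF x True] by (auto simp: dist_real_def)
  next
   case False
   have "\<bar>G t - G (t - x)\<bar> \<le> N"
   proof -
    have "\<bar>G t - G (t - x)\<bar> = \<bar>LB s. g s * indicator {t - x<..<t} s\<bar>"
     unfolding G_def using x g0 by (subst set_integral_increment[OF g]) auto
    also have "\<dots> \<le> (LB s. \<bar>g s * indicator {t - x<..<t} s\<bar>)" by (rule integral_abs_bound)
    also have "\<dots> \<le> N" unfolding N_def
     using integrable_abs[OF integrable_mult_indicator[of "{t - x<..<t}" lborel g]] g
     by (intro integral_mono) (auto simp: mult.commute indicator_def)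
    finally show ?thesis .
   qed
   then have "\<bar>A x\<bar> \<le> N / x" using x by (simp add: A_def abs_divide divide_right_mono)
   also have "\<dots> \<le> N / \<delta>" using False \<delta> N by (intro divide_left_mono) auto
   finally show ?thesis by simp
  qed
  then show ?thesis by (rule that)
 qed
 show ?thesis
  unfolding tendsto_at_iff_sequentially
 proof (intro allI impI)
  fix X :: "nat \<Rightarrow> real" assume X: "\<forall>i. X i \<in> {0<..} - {0}" "X \<longlonglongrightarrow> 0"
  then have Xp: "X i > 0" for i by auto
  have "(\<lambda>i. LB w. trunc_density w * w * A (X i * w)) \<longlonglongrightarrow> (LB w. trunc_density w * w * g t)"
  proof (rule integral_dominated_convergence[where w="\<lambda>w. trunc_density w * w * C"])
   show "integrable lborel (\<lambda>w. trunc_density w * w * C)" using trunc_density_moment(1) by simp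
   show "AE w in lborel. (\<lambda>i. trunc_density w * w * A (X i * w)) \<longlonglongrightarrow> trunc_density w * w * g t"
   proof (intro always_eventually allI)
    fix w :: real
    show "(\<lambda>i. trunc_density w * w * A (X i * w)) \<longlonglongrightarrow> trunc_density w * w * g t"
    proof (cases "w > 0")
     case True
     have "filterlim (\<lambda>i. X i * w) (at_right 0) sequentially"
      unfolding filterlim_at using Xp Xp[THEN less_imp_neq, THEN not_sym] True tendsto_mult_left_zero[OF X(2), of w] by auto
     then show ?thesis by (intro tendsto_mult tendsto_const filterlim_compose[OF Alim])
    qed (simp add: trunc_density_def)
   qed
   show "AE w in lborel. norm (trunc_density w * w * A (X i * w)) \<le> trunc_density w * w * C" for i
   proof (intro always_eventually allI)
    fix w :: real
    show "norm (trunc_density w * w * A (X i * w)) \<le> trunc_density w * w * C"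
    proof (cases "w > 0")
     case True
     then show ?thesis using C[of "X i * w"] Xp[of i] trunc_density_nonneg[of w]
      by (auto simp: abs_mult intro!: mult_left_mono)
    qed (simp add: trunc_density_def)
   qed
  qed measurable
  also have "(LB w. trunc_density w * w * g t) = trunc_const * g t"
   by (simp add: trunc_density_moment)
  finally show "((\<lambda>eps. LB v. g (t - eps * v) * trunc_kernel v) \<circ> X) \<longlonglongrightarrow> trunc_const * g t"
   unfolding comp_def rep[OF Xp] .
 qed
qed

text \<open>The pointwise limit comes without a majorant in \<open>t\<close>, so the weak limit
  needs its own argument: Fubini moves the shift by \<open>eps * v\<close> from \<open>g\<close>
  onto the continuous bounded \<open>\<phi>\<close>.\<close>

lemma trunc_kernel_weak_limit:
 fixes g \<phi> :: "real \<Rightarrow> real"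
 assumes g: "integrable lborel g" and cont: "continuous_on UNIV \<phi>" and C: "\<And>t. \<bar>\<phi> t\<bar> \<le> C"
 shows "((\<lambda>eps. LB t. \<phi> t * (LB v. g (t - eps * v) * trunc_kernel v)) \<longlongrightarrow> trunc_const * (LB t. \<phi> t * g t)) (at_right 0)"
proof -
 note [measurable] = borel_measurable_integrable[OF g, simplified]
 have [measurable]: "\<phi> \<in> borel_fun" using cont by (rule borel_measurable_continuous_onI)
 have C0: "C \<ge> 0" using C[of 0] by (simp add: order_trans[OF abs_ge_zero])
 define N where "N = (LB s. \<bar>g s\<bar>)"
 have gC: "integrable lborel (\<lambda>s. C * \<bar>g s\<bar>)" using g by simp
 have shift: "integrable lborel (\<lambda>t. g (t - x))" for x
  using lborel_integrable_real_affine_iff[of 1 g "- x"] g by simp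
 have rep: "(LB t. \<phi> t * (LB v. g (t - eps * v) * trunc_kernel v)) =
   (LB v. trunc_kernel v * (LB s. \<phi> (s + eps * v) * g s))" for eps
 proof -
  have Fint: "integrable (lborel \<Otimes>\<^sub>M lborel) (\<lambda>(v, t). \<phi> t * (g (t - eps * v) * trunc_kernel v))"
  proof (rule integrableI_bounded)
   have "(\<integral>\<^sup>+x. ennreal (norm (case x of (v, t) \<Rightarrow> \<phi> t * (g (t - eps * v) * trunc_kernel v))) \<partial>(lborel \<Otimes>\<^sub>M lborel)) =
     (NN v. (NN t. ennreal \<bar>\<phi> t * (g (t - eps * v) * trunc_kernel v)\<bar>))"
    by (subst lborel.nn_integral_fst[symmetric]) auto
   also have "\<dots> \<le> (NN v. (NN t. ennreal (C * trunc_kernel v) * ennreal \<bar>g (t - eps * v)\<bar>))"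
   proof (intro nn_integral_mono)
    fix v t
    have "\<bar>\<phi> t * (g (t - eps * v) * trunc_kernel v)\<bar> = \<bar>\<phi> t\<bar> * (trunc_kernel v * \<bar>g (t - eps * v)\<bar>)"
     by (simp add: abs_mult trunc_kernel_nonneg)
    also have "\<dots> \<le> C * (trunc_kernel v * \<bar>g (t - eps * v)\<bar>)" by (intro mult_right_mono C) (simp add: trunc_kernel_nonneg)
    finally show "ennreal \<bar>\<phi> t * (g (t - eps * v) * trunc_kernel v)\<bar> \<le> ennreal (C * trunc_kernel v) * ennreal \<bar>g (t - eps * v)\<bar>"
     by (simp add: C0 trunc_kernel_nonneg mult.assoc ennreal_leI flip: ennreal_mult)
   qed
   also have "\<dots> = (NN v. ennreal (C * trunc_kernel v) * (NN t. ennreal \<bar>g t\<bar>))"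
   proof (intro nn_integral_cong)
    fix v
    have "(NN t. ennreal \<bar>g (t - eps * v)\<bar>) = (NN t. ennreal \<bar>g t\<bar>)"
     by (subst (2) nn_integral_real_affine[of _ 1 "- (eps * v)"]) auto
    then show "(NN t. ennreal (C * trunc_kernel v) * ennreal \<bar>g (t - eps * v)\<bar>) = ennreal (C * trunc_kernel v) * (NN t. ennreal \<bar>g t\<bar>)"
     by (subst nn_integral_cmult) auto
   qed
   also have "\<dots> = (NN v. ennreal C * ennreal (trunc_kernel v)) * (NN t. ennreal \<bar>g t\<bar>)"
    by (subst nn_integral_multc) (auto simp: ennreal_mult C0 trunc_kernel_nonneg)
   also have "\<dots> = ennreal C * (NN v. ennreal (trunc_kernel v)) * (NN t. ennreal \<bar>g t\<bar>)"
    by (subst nn_integral_cmult) auto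
   also have "\<dots> < \<infinity>"
    using le_less_trans[OF nn_integral_trunc_kernel, of \<infinity>] g by (simp add: ennreal_mult_less_top integrable_iff_bounded)
   finally show "(\<integral>\<^sup>+x. ennreal (norm (case x of (v, t) \<Rightarrow> \<phi> t * (g (t - eps * v) * trunc_kernel v))) \<partial>(lborel \<Otimes>\<^sub>M lborel)) < \<infinity>" .
  qed measurable
  have "(LB t. \<phi> t * (LB v. g (t - eps * v) * trunc_kernel v)) =
    (LB t. (LB v. \<phi> t * (g (t - eps * v) * trunc_kernel v)))" by simp
  also have "\<dots> = (LB v. (LB t. \<phi> t * (g (t - eps * v) * trunc_kernel v)))"
   by (rule lborel_pair.Fubini_integral[OF Fint])
  also have "\<dots> = (LB v. trunc_kernel v * (LB s. \<phi> (s + eps * v) * g s))"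
  proof (intro Bochner_Integration.integral_cong refl)
   fix v
   have "(LB t. \<phi> t * (g (t - eps * v) * trunc_kernel v)) = (LB t. trunc_kernel v * (\<phi> t * g (t - eps * v)))"
    by (simp add: mult_ac)
   also have "\<dots> = trunc_kernel v * (LB t. \<phi> t * g (t - eps * v))" by simp
   also have "(LB t. \<phi> t * g (t - eps * v)) = (LB s. \<phi> (s + eps * v) * g s)"
    by (subst lborel_integral_real_affine[of 1 _ "eps * v"]) (auto simp: add.commute)
   finally show "(LB t. \<phi> t * (g (t - eps * v) * trunc_kernel v)) = trunc_kernel v * (LB s. \<phi> (s + eps * v) * g s)" .
  qed
  finally show ?thesis .
 qed
 have bnd: "\<bar>LB s. \<phi> (s + x) * g s\<bar> \<le> C * N" for x
 proof -
  have "\<bar>LB s. \<phi> (s + x) * g s\<bar> \<le> (LB s. \<bar>\<phi> (s + x) * g s\<bar>)" by (rule integral_abs_bound)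
  also have "\<dots> \<le> (LB s. C * \<bar>g s\<bar>)"
  proof (rule integral_mono[OF _ gC])
   show "\<bar>\<phi> (s + x) * g s\<bar> \<le> C * \<bar>g s\<bar>" for s using C by (auto simp: abs_mult intro!: mult_right_mono)
   then show "integrable lborel (\<lambda>s. \<bar>\<phi> (s + x) * g s\<bar>)"
    by (intro Bochner_Integration.integrable_bound[OF gC]) (use C0 in \<open>auto simp: abs_mult\<close>)
  qed
  finally show ?thesis by (simp add: N_def)
 qed
 show ?thesis
  unfolding tendsto_at_iff_sequentially
 proof (intro allI impI)
  fix X :: "nat \<Rightarrow> real" assume X: "\<forall>i. X i \<in> {0<..} - {0}" "X \<longlonglongrightarrow> 0"
  have "(\<lambda>i. LB v. trunc_kernel v * (LB s. \<phi> (s + X i * v) * g s)) \<longlonglongrightarrow> (LB v. trunc_kernel v * (LB s. \<phi> s * g s))"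
  proof (rule integral_dominated_convergence[where w="\<lambda>v. trunc_kernel v * (C * N)"])
   show "integrable lborel (\<lambda>v. trunc_kernel v * (C * N))" using integrable_trunc_kernel by simp
   show "AE v in lborel. norm (trunc_kernel v * (LB s. \<phi> (s + X i * v) * g s)) \<le> trunc_kernel v * (C * N)" for i
    using bnd trunc_kernel_nonneg by (intro always_eventually allI) (auto simp: abs_mult intro!: mult_left_mono)
   show "AE v in lborel. (\<lambda>i. trunc_kernel v * (LB s. \<phi> (s + X i * v) * g s)) \<longlonglongrightarrow> trunc_kernel v * (LB s. \<phi> s * g s)"
   proof (intro always_eventually allI tendsto_mult tendsto_const)
    fix v :: real
    show "(\<lambda>i. LB s. \<phi> (s + X i * v) * g s) \<longlonglongrightarrow> (LB s. \<phi> s * g s)"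
    proof (rule integral_dominated_convergence[OF _ _ gC])
     show "AE s in lborel. norm (\<phi> (s + X i * v) * g s) \<le> C * \<bar>g s\<bar>" for i
      using C by (intro always_eventually allI) (auto simp: abs_mult intro!: mult_right_mono)
     show "AE s in lborel. (\<lambda>i. \<phi> (s + X i * v) * g s) \<longlonglongrightarrow> \<phi> s * g s"
     proof (intro always_eventually allI tendsto_mult tendsto_const)
      fix s
      have "(\<lambda>i. s + X i * v) \<longlonglongrightarrow> s" by (rule tendsto_eq_intros X(2) refl)+ simp
      then show "(\<lambda>i. \<phi> (s + X i * v)) \<longlonglongrightarrow> \<phi> s"
       by (rule continuous_on_tendsto_compose[OF cont]) auto
     qed
    qed auto
   qed
  qed measurable
  then show "((\<lambda>eps. LB t. \<phi> t * (LB v. g (t - eps * v) * trunc_kernel v)) \<circ> X) \<longlonglongrightarrow> trunc_const * (LB t. \<phi> t * g t)"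
   unfolding comp_def rep by (simp add: trunc_const_def)
 qed
qed

section \<open>Truncated half-derivatives on the line\<close>

definition half_trunc :: "(real \<Rightarrow> real) \<Rightarrow> real \<Rightarrow> real \<Rightarrow> real" where
 "half_trunc h t eps = (LINT r:{r. \<bar>r\<bar> > eps}|lborel. (h (t + r) - h t) / \<bar>r\<bar> powr (3/2))"

definition sym_marchaud :: "real \<Rightarrow> real \<Rightarrow> real" where
 "sym_marchaud eps r = marchaud eps r + marchaud eps (- r)"

lemma sym_marchaud_measurable [measurable]: "sym_marchaud eps \<in> borel_fun"
 unfolding sym_marchaud_def [abs_def] by measurable

lemma sym_marchaud_nonneg: "0 \<le> eps \<Longrightarrow> 0 \<le> sym_marchaud eps r"
 by (simp add: sym_marchaud_def marchaud_nonneg)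

lemma sym_marchaud_minus: "sym_marchaud eps (- r) = sym_marchaud eps r"
 by (simp add: sym_marchaud_def)

lemma integrable_marchaud_minus:
 assumes "eps > 0"
 shows "integrable lborel (\<lambda>r. marchaud eps (- r))" "(LB r. marchaud eps (- r)) = 2 / sqrt eps"
proof -
 show "integrable lborel (\<lambda>r. marchaud eps (- r))"
  using lborel_integrable_real_affine_iff[of "-1" "marchaud eps" 0] integrable_marchaud[OF assms] by simp
 show "(LB r. marchaud eps (- r)) = 2 / sqrt eps"
  using lborel_integral_real_affine[of "-1" "marchaud eps" 0] integrable_marchaud[OF assms] by simp
qed

lemma integrable_sym_marchaud:
 assumes "eps > 0"
 shows "integrable lborel (sym_marchaud eps)" "(LB r. sym_marchaud eps r) = 4 / sqrt eps"
 unfolding sym_marchaud_def [abs_def] using integrable_marchaud[OF assms] integrable_marchaud_minus[OF assms] by auto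

lemma indicator_powr_eq_sym_marchaud:
 assumes "eps > 0"
 shows "indicator {r. \<bar>r\<bar> > eps} r *\<^sub>R (x / \<bar>r\<bar> powr (3/2)) = x * sym_marchaud eps r"
proof -
 have "y powr (3/2) = y * sqrt y" if "y > 0" for y :: real
  using that powr_add[of y 1 "1/2"] by (simp add: powr_half_sqrt)
 then show ?thesis using assms by (auto simp: sym_marchaud_def marchaud_def indicator_def abs_if)
qed

lemma half_trunc_eq_sym_marchaud:
 "eps > 0 \<Longrightarrow> half_trunc h t eps = (LB r. (h (t + r) - h t) * sym_marchaud eps r)"
 unfolding half_trunc_def set_lebesgue_integral_def by (simp only: indicator_powr_eq_sym_marchaud)

lemma integrable_mult_bounded:
 fixes u k :: "'a \<Rightarrow> real"
 assumes "integrable M k" "u \<in> borel_measurable M" "\<And>x. \<bar>u x\<bar> \<le> C"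
 shows "integrable M (\<lambda>x. u x * k x)"
proof (rule Bochner_Integration.integrable_bound)
 show "integrable M (\<lambda>x. C * k x)" using assms by simp
 have "\<bar>u x\<bar> * \<bar>k x\<bar> \<le> \<bar>C\<bar> * \<bar>k x\<bar>" for x
  using assms(3)[of x] by (intro mult_right_mono) auto
 then show "AE x in M. norm (u x * k x) \<le> norm (C * k x)" by (simp add: abs_mult)
qed (use assms in auto)

lemma half_trunc_integrable:
 assumes [measurable]: "h \<in> borel_fun" and B: "\<And>t. \<bar>h t\<bar> \<le> B" and e: "eps > 0"
 shows "integrable lborel (\<lambda>r. (h (t + r) - h t) * sym_marchaud eps r)"
proof (rule integrable_mult_bounded[OF integrable_sym_marchaud(1)[OF e]])
 show "\<bar>h (t + r) - h t\<bar> \<le> 2 * B" for r using B[of "t + r"] B[of t] by linarith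
qed auto

text \<open>The two sides of the symmetric truncation are Marchaud integrals of \<open>h\<close> and
  of its reflection, so each one-sided result is used twice.\<close>

lemma half_trunc_split:
 assumes [measurable]: "h \<in> borel_fun" and B: "\<And>t. \<bar>h t\<bar> \<le> B" and e: "eps > 0"
 shows "half_trunc h t eps = - (LB r. (h t - h (t - r)) * marchaud eps r) - (LB r. (h t - h (t + r)) * marchaud eps r)"
proof -
 have b: "\<bar>h x - h y\<bar> \<le> 2 * B" for x y using B[of x] B[of y] by linarith
 have i1: "integrable lborel (\<lambda>r. (h (t + r) - h t) * marchaud eps r)"
  by (rule integrable_mult_bounded[OF integrable_marchaud(1)[OF e]]) (use b in auto)
 have i2: "integrable lborel (\<lambda>r. (h (t + r) - h t) * marchaud eps (- r))"
  by (rule integrable_mult_bounded[OF integrable_marchaud_minus(1)[OF e]]) (use b in auto)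
 have "half_trunc h t eps = (LB r. (h (t + r) - h t) * marchaud eps r) + (LB r. (h (t + r) - h t) * marchaud eps (- r))"
  unfolding half_trunc_eq_sym_marchaud[OF e] sym_marchaud_def distrib_left
  by (rule Bochner_Integration.integral_add[OF i1 i2])
 also have "(LB r. (h (t + r) - h t) * marchaud eps (- r)) = (LB r. (h (t - r) - h t) * marchaud eps r)"
  by (subst lborel_integral_real_affine[of "-1" _ 0]) auto
 finally have "half_trunc h t eps = (LB r. - ((h t - h (t + r)) * marchaud eps r)) + (LB r. - ((h t - h (t - r)) * marchaud eps r))"
  by (simp add: minus_mult_left del: mult_minus_left Bochner_Integration.integral_minus)
 then show ?thesis by simp
qed

lemma half_trunc_abs_le:
 assumes [measurable]: "h \<in> borel_fun" and e: "eps > 0"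
  and c: "\<And>r. \<bar>h (t + r) - h t\<bar> \<le> c"
 shows "\<bar>half_trunc h t eps\<bar> \<le> 4 * c / sqrt eps"
proof -
 have "\<bar>half_trunc h t eps\<bar> \<le> (LB r. \<bar>(h (t + r) - h t) * sym_marchaud eps r\<bar>)"
  unfolding half_trunc_eq_sym_marchaud[OF e] by (rule integral_abs_bound)
 also have "\<dots> \<le> (LB r. c * sym_marchaud eps r)"
 proof (rule integral_mono)
  show "integrable lborel (\<lambda>r. \<bar>(h (t + r) - h t) * sym_marchaud eps r\<bar>)"
   by (intro integrable_abs integrable_mult_bounded[OF integrable_sym_marchaud(1)[OF e]]) (use c in auto)
  show "\<bar>(h (t + r) - h t) * sym_marchaud eps r\<bar> \<le> c * sym_marchaud eps r" for r
   using c[of r] sym_marchaud_nonneg[of eps r] e by (simp add: abs_mult mult_right_mono)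
 qed (use integrable_sym_marchaud[OF e] in simp)
 also have "\<dots> = 4 * c / sqrt eps" using integrable_sym_marchaud[OF e] by simp
 finally show ?thesis .
qed

lemma AE_lborel_uminus:
 fixes P :: "real \<Rightarrow> bool"
 assumes "AE x in lborel. P x"
 shows "AE x in lborel. P (- x)"
proof -
 obtain N where N: "{x. \<not> P x} \<subseteq> N" "N \<in> null_sets lborel" using assms by (auto elim!: eventually_ae_filter[THEN iffD1, THEN bexE])
 have [measurable]: "N \<in> sets borel" using N(2) by auto
 have "AE x in lborel. x \<notin> N" by (rule AE_not_in[OF N(2)])
 then have "AE x in lborel. 0 + (-1) * x \<notin> N" by (rule AE_borel_affine[rotated 2]) auto
 then show ?thesis by eventually_elim (use N in auto)
qed

text \<open>\<open>g\<close> is the density on \<open>{-c..c}\<close> of the Abel transform of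
  \<open>h\<close>, hence, up to a constant, the half-derivative of \<open>h\<close> there. It is
  set to 0 outside, whereas the Abel transform itself continues beyond \<open>c\<close>.\<close>

definition half_primitive :: "real \<Rightarrow> (real \<Rightarrow> real) \<Rightarrow> (real \<Rightarrow> real) \<Rightarrow> bool" where
 "half_primitive c h g \<longleftrightarrow> integrable lborel g \<and> (\<forall>t. t \<notin> {-c..c} \<longrightarrow> g t = 0) \<and>
   (\<forall>T. -c \<le> T \<longrightarrow> T \<le> c \<longrightarrow> conv h abel T = (LINT t:{-c..T}|lborel. g t))"

text \<open>The derivative clause recovers \<open>g t\<close> from \<open>h\<close> alone; this
  later replaces a measurable choice of \<open>g\<close> along the slices.\<close>

lemma half_primitive_AE:
 assumes h [measurable]: "h \<in> borel_fun" and hB: "\<And>t. \<bar>h t\<bar> \<le> B" and h0: "\<forall>t. t \<notin> {-c..c} \<longrightarrow> h t = 0"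
  and g: "half_primitive c h g"
 shows "AE t in lborel. -c < t \<and> t < c \<longrightarrow>
   (\<forall>eps>0. pi * (LB r. (h t - h (t - r)) * marchaud eps r) = (LB v. g (t - eps * v) * trunc_kernel v)) \<and>
   ((\<lambda>eps. LB r. (h t - h (t - r)) * marchaud eps r) \<longlongrightarrow> trunc_const / pi * g t) (at_right 0) \<and>
   (conv h abel has_real_derivative g t) (at t)"
proof -
 have gi: "integrable lborel g" and g0: "\<And>t. t \<notin> {-c..c} \<Longrightarrow> g t = 0"
  and J: "\<And>T. -c \<le> T \<Longrightarrow> T \<le> c \<Longrightarrow> conv h abel T = (LINT t:{-c..T}|lborel. g t)"
  using g by (auto simp: half_primitive_def)
 have si: "set_integrable lborel {-c..c} g" unfolding set_integrable_def by (intro integrable_mult_indicator gi) auto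
 have inv: "AE t in lborel. -c < t \<and> t < c \<longrightarrow> integrable lborel (\<lambda>s. g (t - s) * abel s) \<and> conv g abel t = pi * h t"
  by (rule abel_inversion_AE[OF h hB _ gi g0 J]) (use h0 in auto)
 then have inv': "AE t in lborel. -c < t \<and> t < c \<longrightarrow> conv g abel t = pi * h t" by eventually_elim auto
 show ?thesis using inv AE_DERIV_indefinite_integral[OF si]
 proof eventually_elim
  case (elim t)
  show ?case
  proof
   assume t: "-c < t \<and> t < c"
   have int: "integrable lborel (\<lambda>s. g (t - s) * abel s)" and eq: "conv g abel t = pi * h t"
    and D: "((\<lambda>x. LINT s:{-c..x}|lborel. g s) has_real_derivative g t) (at t)" using elim t by auto
   have A: "pi * (LB r. (h t - h (t - r)) * marchaud eps r) = (LB v. g (t - eps * v) * trunc_kernel v)" if "eps > 0" for eps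
    by (rule truncated_marchaud_eq[OF h hB _ gi _ inv' _ eq int that]) (use h0 g0 t in auto)
   have "((\<lambda>eps. (LB v. g (t - eps * v) * trunc_kernel v) / pi) \<longlongrightarrow> trunc_const * g t / pi) (at_right 0)"
    by (intro tendsto_divide tendsto_const trunc_kernel_limit[OF gi _ int D]) (use g0 in auto)
   moreover have "\<forall>\<^sub>F eps in at_right 0. (LB v. g (t - eps * v) * trunc_kernel v) / pi = (LB r. (h t - h (t - r)) * marchaud eps r)"
    unfolding eventually_at_right_field using A[symmetric] by (intro exI[of _ 1]) auto
   ultimately have "((\<lambda>eps. LB r. (h t - h (t - r)) * marchaud eps r) \<longlongrightarrow> trunc_const * g t / pi) (at_right 0)"
    by (rule Lim_transform_eventually)
   moreover have "(conv h abel has_real_derivative g t) (at t)"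
    using D by (rule has_field_derivative_transform_within_open[of _ _ _ "{-c<..<c}"]) (use t J in auto)
   ultimately show "(\<forall>eps>0. pi * (LB r. (h t - h (t - r)) * marchaud eps r) = (LB v. g (t - eps * v) * trunc_kernel v)) \<and>
    ((\<lambda>eps. LB r. (h t - h (t - r)) * marchaud eps r) \<longlongrightarrow> trunc_const / pi * g t) (at_right 0) \<and>
    (conv h abel has_real_derivative g t) (at t)"
    using A by simp
  qed
 qed
qed

text \<open>Reflection turns forward increments of \<open>h\<close> at \<open>t\<close> into
  backward increments of the reflected function at \<open>- t\<close>, which is why
  \<open>g'\<close> appears at \<open>- t\<close>.\<close>

lemma half_trunc_limit_AE:
 assumes h [measurable]: "h \<in> borel_fun" and hB: "\<And>t. \<bar>h t\<bar> \<le> B" and h0: "\<forall>t. t \<notin> {-c..c} \<longrightarrow> h t = 0"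
  and g: "half_primitive c h g" and g': "half_primitive c (\<lambda>t. h (- t)) g'"
 shows "AE t in lborel. -c < t \<and> t < c \<longrightarrow>
   (half_trunc h t \<longlongrightarrow> - (trunc_const / pi) * (g t + g' (- t))) (at_right 0) \<and>
   (conv h abel has_real_derivative g t) (at t) \<and>
   (conv (\<lambda>t. h (- t)) abel has_real_derivative g' (- t)) (at (- t))"
proof -
 have hm: "(\<lambda>t. h (- t)) \<in> borel_fun" by measurable
 have h0': "\<forall>t. t \<notin> {-c..c} \<longrightarrow> h (- t) = 0"
 proof (intro allI impI)
  fix t :: real assume "t \<notin> {-c..c}"
  then have "- t \<notin> {-c..c}" by auto
  then show "h (- t) = 0" using h0 by blast
 qed
 have "AE t in lborel. -c < t \<and> t < c \<longrightarrow>
   ((\<lambda>eps. LB r. (h (- t) - h (- (t - r))) * marchaud eps r) \<longlongrightarrow> trunc_const / pi * g' t) (at_right 0) \<and>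
   (conv (\<lambda>t. h (- t)) abel has_real_derivative g' t) (at t)"
  using half_primitive_AE[of "\<lambda>t. h (- t)" B c g', OF hm hB h0' g'] by eventually_elim auto
 from AE_lborel_uminus[OF this] half_primitive_AE[OF h hB h0 g] show ?thesis
 proof eventually_elim
  case (elim t)
  show ?case
  proof
   assume t: "-c < t \<and> t < c"
   have "((\<lambda>eps. LB r. (h t - h (t + r)) * marchaud eps r) \<longlongrightarrow> trunc_const / pi * g' (- t)) (at_right 0)"
    using elim t by (simp add: add.commute)
   moreover have "((\<lambda>eps. LB r. (h t - h (t - r)) * marchaud eps r) \<longlongrightarrow> trunc_const / pi * g t) (at_right 0)"
    using elim t by simp
   ultimately have "((\<lambda>eps. - (LB r. (h t - h (t - r)) * marchaud eps r) - (LB r. (h t - h (t + r)) * marchaud eps r)) \<longlongrightarrow>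
     - (trunc_const / pi * g t) - trunc_const / pi * g' (- t)) (at_right 0)"
    by (intro tendsto_diff tendsto_minus)
   moreover have "\<forall>\<^sub>F eps in at_right 0. - (LB r. (h t - h (t - r)) * marchaud eps r) - (LB r. (h t - h (t + r)) * marchaud eps r) = half_trunc h t eps"
    unfolding eventually_at_right_field using half_trunc_split[OF h hB] by (intro exI[of _ 1]) auto
   ultimately have "(half_trunc h t \<longlongrightarrow> - (trunc_const / pi * g t) - trunc_const / pi * g' (- t)) (at_right 0)"
    by (rule Lim_transform_eventually)
   moreover have "- (trunc_const / pi * g t) - trunc_const / pi * g' (- t) = - (trunc_const / pi) * (g t + g' (- t))"
    by (simp add: algebra_simps)
   ultimately show "(half_trunc h t \<longlongrightarrow> - (trunc_const / pi) * (g t + g' (- t))) (at_right 0) \<and>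
    (conv h abel has_real_derivative g t) (at t) \<and>
    (conv (\<lambda>t. h (- t)) abel has_real_derivative g' (- t)) (at (- t))"
    using elim t by simp
  qed
 qed
qed

lemma marchaud_weak_limit:
 assumes h [measurable]: "h \<in> borel_fun" and hB: "\<And>t. \<bar>h t\<bar> \<le> B" and h0: "\<forall>t. t \<notin> {-c..c} \<longrightarrow> h t = 0"
  and g: "half_primitive c h g"
  and cont: "continuous_on UNIV \<phi>" and C: "\<And>t. \<bar>\<phi> t\<bar> \<le> C" and \<phi>0: "\<forall>t. t \<notin> {-c<..<c} \<longrightarrow> \<phi> t = 0"
 shows "((\<lambda>eps. LB t. \<phi> t * (LB r. (h t - h (t - r)) * marchaud eps r)) \<longlongrightarrow> (LB t. \<phi> t * (trunc_const / pi * g t))) (at_right 0)"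
proof -
 have gi: "integrable lborel g" using g by (auto simp: half_primitive_def)
 note [measurable] = borel_measurable_integrable[OF gi, simplified]
 have [measurable]: "\<phi> \<in> borel_fun" using cont by (rule borel_measurable_continuous_onI)
 have "((\<lambda>eps. (LB t. \<phi> t * (LB v. g (t - eps * v) * trunc_kernel v)) / pi) \<longlongrightarrow> trunc_const * (LB t. \<phi> t * g t) / pi) (at_right 0)"
  by (intro tendsto_divide tendsto_const trunc_kernel_weak_limit[OF gi cont C]) auto
 moreover have "\<forall>\<^sub>F eps in at_right 0. (LB t. \<phi> t * (LB v. g (t - eps * v) * trunc_kernel v)) / pi =
   (LB t. \<phi> t * (LB r. (h t - h (t - r)) * marchaud eps r))"
  unfolding eventually_at_right_field
 proof (intro exI[of _ 1] conjI allI impI)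
  fix eps :: real assume e: "0 < eps"
  have "(LB t. \<phi> t * (LB v. g (t - eps * v) * trunc_kernel v)) = (LB t. \<phi> t * (pi * (LB r. (h t - h (t - r)) * marchaud eps r)))"
  proof (rule integral_cong_AE)
   show "AE t in lborel. \<phi> t * (LB v. g (t - eps * v) * trunc_kernel v) = \<phi> t * (pi * (LB r. (h t - h (t - r)) * marchaud eps r))"
    using half_primitive_AE[OF h hB h0 g]
   proof eventually_elim
    case (elim t)
    show ?case
    proof (cases "t \<in> {-c<..<c}")
     case True
     with elim e have "pi * (LB r. (h t - h (t - r)) * marchaud eps r) = (LB v. g (t - eps * v) * trunc_kernel v)" by auto
     then show ?thesis by simp
    qed (simp add: \<phi>0)
   qed
  qed measurable
  then show "(LB t. \<phi> t * (LB v. g (t - eps * v) * trunc_kernel v)) / pi = (LB t. \<phi> t * (LB r. (h t - h (t - r)) * marchaud eps r))"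
   by (simp add: mult.left_commute)
 qed auto
 ultimately have "((\<lambda>eps. LB t. \<phi> t * (LB r. (h t - h (t - r)) * marchaud eps r)) \<longlongrightarrow> trunc_const * (LB t. \<phi> t * g t) / pi) (at_right 0)"
  by (rule Lim_transform_eventually)
 moreover have "trunc_const * (LB t. \<phi> t * g t) / pi = (LB t. \<phi> t * (trunc_const / pi * g t))"
  by (simp add: mult.left_commute)
 ultimately show ?thesis by simp
qed

text \<open>The forward half is the backward weak limit for the reflected function, tested against
  the reflected \<open>\<phi>\<close>.\<close>

lemma half_trunc_weak_limit:
 assumes h [measurable]: "h \<in> borel_fun" and hB: "\<And>t. \<bar>h t\<bar> \<le> B" and h0: "\<forall>t. t \<notin> {-c..c} \<longrightarrow> h t = 0"
  and g: "half_primitive c h g" and g': "half_primitive c (\<lambda>t. h (- t)) g'"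
  and cont: "continuous_on UNIV \<phi>" and C: "\<And>t. \<bar>\<phi> t\<bar> \<le> C" and \<phi>0: "\<forall>t. t \<notin> {-c<..<c} \<longrightarrow> \<phi> t = 0"
 shows "((\<lambda>eps. LB t. \<phi> t * half_trunc h t eps) \<longlongrightarrow> (LB t. \<phi> t * (- (trunc_const / pi) * (g t + g' (- t))))) (at_right 0)"
proof -
 have gi: "integrable lborel g" "integrable lborel g'" using g g' by (auto simp: half_primitive_def)
 have [measurable]: "\<phi> \<in> borel_fun" using cont by (rule borel_measurable_continuous_onI)
 have ind: "integrable lborel (\<lambda>t. C * indicator {-c..c} t :: real)" using integrable_indicator_Icc by (rule integrable_mult_right)
 have \<phi>i: "integrable lborel \<phi>"
  by (rule Bochner_Integration.integrable_bound[OF ind]) (use C \<phi>0 order_trans[OF abs_ge_zero C] in \<open>auto simp: indicator_def\<close>)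
 define D1 where "D1 eps t = (LB r. (h t - h (t - r)) * marchaud eps r)" for eps t
 define D2 where "D2 eps t = (LB r. (h t - h (t + r)) * marchaud eps r)" for eps t
 have [measurable]: "D1 eps \<in> borel_fun" "D2 eps \<in> borel_fun" for eps
  unfolding D1_def [abs_def] D2_def [abs_def] by measurable
 have cont': "continuous_on UNIV (\<lambda>t. \<phi> (- t))" by (intro continuous_on_compose2[OF cont] continuous_intros) auto
 have l1: "((\<lambda>eps. LB t. \<phi> t * D1 eps t) \<longlongrightarrow> (LB t. \<phi> t * (trunc_const / pi * g t))) (at_right 0)"
  unfolding D1_def by (rule marchaud_weak_limit[OF h hB h0 g cont C \<phi>0])
 have "((\<lambda>eps. LB t. \<phi> (- t) * (LB r. (h (- t) - h (- (t - r))) * marchaud eps r)) \<longlongrightarrow> (LB t. \<phi> (- t) * (trunc_const / pi * g' t))) (at_right 0)"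
  by (rule marchaud_weak_limit[OF _ _ _ g' cont', of B C]) (use hB h0 C \<phi>0 in auto)
 moreover have "(LB t. \<phi> (- t) * (LB r. (h (- t) - h (- (t - r))) * marchaud eps r)) = (LB t. \<phi> t * D2 eps t)" for eps
  by (subst lborel_integral_real_affine[of "-1" _ 0]) (auto simp: D2_def)
 moreover have "(LB t. \<phi> (- t) * (trunc_const / pi * g' t)) = (LB t. \<phi> t * (trunc_const / pi * g' (- t)))"
  by (subst lborel_integral_real_affine[of "-1" _ 0]) auto
 ultimately have l2: "((\<lambda>eps. LB t. \<phi> t * D2 eps t) \<longlongrightarrow> (LB t. \<phi> t * (trunc_const / pi * g' (- t)))) (at_right 0)" by simp
 have Db: "\<bar>D1 eps t\<bar> \<le> 2 * B * (2 / sqrt eps)" "\<bar>D2 eps t\<bar> \<le> 2 * B * (2 / sqrt eps)" if e: "eps > 0" for eps t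
 proof -
  have *: "\<bar>LB r. u r * marchaud eps r\<bar> \<le> 2 * B * (2 / sqrt eps)" if [measurable]: "u \<in> borel_fun" and u: "\<And>r. \<bar>u r\<bar> \<le> 2 * B" for u
  proof -
   have "\<bar>LB r. u r * marchaud eps r\<bar> \<le> (LB r. \<bar>u r * marchaud eps r\<bar>)" by (rule integral_abs_bound)
   also have "\<dots> \<le> (LB r. 2 * B * marchaud eps r)"
    by (intro integral_mono integrable_abs integrable_mult_bounded[OF integrable_marchaud(1)[OF e]] integrable_mult_right integrable_marchaud e)
      (use u e in \<open>auto simp: abs_mult marchaud_nonneg intro!: mult_right_mono\<close>)
   finally show ?thesis by (simp add: integrable_marchaud[OF e])
  qed
  have b: "\<bar>h x - h y\<bar> \<le> 2 * B" for x y using hB[of x] hB[of y] by linarith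
  show "\<bar>D1 eps t\<bar> \<le> 2 * B * (2 / sqrt eps)" "\<bar>D2 eps t\<bar> \<le> 2 * B * (2 / sqrt eps)"
   unfolding D1_def D2_def by (rule *; use b in auto)+
 qed
 have "((\<lambda>eps. - (LB t. \<phi> t * D1 eps t) - (LB t. \<phi> t * D2 eps t)) \<longlongrightarrow>
   - (LB t. \<phi> t * (trunc_const / pi * g t)) - (LB t. \<phi> t * (trunc_const / pi * g' (- t)))) (at_right 0)"
  by (intro tendsto_diff tendsto_minus l1 l2)
 moreover have "\<forall>\<^sub>F eps in at_right 0. - (LB t. \<phi> t * D1 eps t) - (LB t. \<phi> t * D2 eps t) = (LB t. \<phi> t * half_trunc h t eps)"
  unfolding eventually_at_right_field
 proof (intro exI[of _ 1] conjI allI impI)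
  fix eps :: real assume e: "0 < eps"
  have i: "integrable lborel (\<lambda>t. \<phi> t * D1 eps t)" "integrable lborel (\<lambda>t. \<phi> t * D2 eps t)"
   using integrable_mult_bounded[OF \<phi>i _ Db(1)[OF e]] integrable_mult_bounded[OF \<phi>i _ Db(2)[OF e]]
   by (simp_all add: mult.commute)
  have "(LB t. \<phi> t * half_trunc h t eps) = (LB t. - (\<phi> t * D1 eps t) - \<phi> t * D2 eps t)"
   unfolding half_trunc_split[OF h hB e] D1_def D2_def by (intro Bochner_Integration.integral_cong) (auto simp: algebra_simps)
  then show "- (LB t. \<phi> t * D1 eps t) - (LB t. \<phi> t * D2 eps t) = (LB t. \<phi> t * half_trunc h t eps)"
   using i by simp
 qed auto
 ultimately have "((\<lambda>eps. LB t. \<phi> t * half_trunc h t eps) \<longlongrightarrow>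
   - (LB t. \<phi> t * (trunc_const / pi * g t)) - (LB t. \<phi> t * (trunc_const / pi * g' (- t)))) (at_right 0)"
  by (rule Lim_transform_eventually)
 moreover have "(LB t. \<phi> t * (- (trunc_const / pi) * (g t + g' (- t)))) =
   - (LB t. \<phi> t * (trunc_const / pi * g t)) - (LB t. \<phi> t * (trunc_const / pi * g' (- t)))"
 proof -
  have gm: "integrable lborel (\<lambda>t. g' (- t))"
   using lborel_integrable_real_affine_iff[of "-1" g' 0] gi by simp
  have i: "integrable lborel (\<lambda>t. \<phi> t * (trunc_const / pi * g t))" "integrable lborel (\<lambda>t. \<phi> t * (trunc_const / pi * g' (- t)))"
   by (intro integrable_mult_bounded[of _ _ _ C] integrable_mult_right gi gm C; simp)+
  have "(LB t. \<phi> t * (- (trunc_const / pi) * (g t + g' (- t)))) = (LB t. - (\<phi> t * (trunc_const / pi * g t)) - \<phi> t * (trunc_const / pi * g' (- t)))"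
   by (intro Bochner_Integration.integral_cong) (auto simp: algebra_simps)
  then show ?thesis using i by simp
 qed
 ultimately show ?thesis by simp
qed

section \<open>Logarithmic energy and the conjugate Poisson kernel\<close>

text \<open>The conjugate Poisson kernel at height \<open>e\<close> without its factor 1/pi: a
  bounded odd approximation of \<open>1 / r\<close>, the kernel of the Hilbert transform.\<close>

definition conj_poisson :: "real \<Rightarrow> real \<Rightarrow> real" where "conj_poisson e r = r / (r\<^sup>2 + e\<^sup>2)"

lemma conj_poisson_measurable [measurable]: "conj_poisson e \<in> borel_fun"
 unfolding conj_poisson_def [abs_def] by measurable

lemma sum_squares_pos: "e > 0 \<Longrightarrow> 0 < (r :: real)\<^sup>2 + e\<^sup>2"
 by (intro add_nonneg_pos) auto

lemma conj_poisson_continuous: "e > 0 \<Longrightarrow> continuous_on S (conj_poisson e)"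
 unfolding conj_poisson_def [abs_def] using sum_squares_pos[of e]
 by (intro continuous_intros) (metis less_irrefl)

lemma conj_poisson_abs_le: assumes "e > 0" shows "\<bar>conj_poisson e r\<bar> \<le> 1 / e"
proof -
 have "2 * (\<bar>r\<bar> * e) \<le> r\<^sup>2 + e\<^sup>2" using sum_squares_bound[of "\<bar>r\<bar>" e] by (simp add: mult.assoc)
 moreover have "0 \<le> \<bar>r\<bar> * e" using assms by simp
 ultimately have "\<bar>r\<bar> * e \<le> r\<^sup>2 + e\<^sup>2" by linarith
 then show ?thesis using assms sum_squares_pos[OF assms, of r] by (simp add: conj_poisson_def abs_divide field_simps)
qed

lemma conj_poisson_square_le: assumes "e > 0" shows "(conj_poisson e r)\<^sup>2 \<le> 1 / (r\<^sup>2 + e\<^sup>2)"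
proof -
 have "(conj_poisson e r)\<^sup>2 = r\<^sup>2 / (r\<^sup>2 + e\<^sup>2) * (1 / (r\<^sup>2 + e\<^sup>2))"
  by (simp add: conj_poisson_def power2_eq_square)
 also have "\<dots> \<le> 1 * (1 / (r\<^sup>2 + e\<^sup>2))"
  using sum_squares_pos[OF assms, of r] by (intro mult_right_mono) auto
 finally show ?thesis by simp
qed

lemma integrable_inverse_sum_squares:
 assumes e: "e > (0::real)"
 shows "integrable lborel (\<lambda>r. 1 / (r\<^sup>2 + e\<^sup>2))" "(LB r. 1 / (r\<^sup>2 + e\<^sup>2)) = pi / e"
proof -
 have U: "einterval (- \<infinity>) \<infinity> = (UNIV :: real set)" by (auto simp: einterval_def)
 have i: "integrable lborel (\<lambda>x::real. inverse (1 + x\<^sup>2))" "(LB x. inverse (1 + (x::real)\<^sup>2)) = pi"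
  using integrable_inverse_1_plus_square LBINT_inverse_1_plus_square
  unfolding U interval_lebesgue_integral_def by (auto simp: set_integrable_def set_lebesgue_integral_def)
 have eq: "1 / e\<^sup>2 * inverse (1 + (0 + 1 / e * r)\<^sup>2) = 1 / (r\<^sup>2 + e\<^sup>2)" for r
  using e by (simp add: field_simps power2_eq_square)
 have "integrable lborel (\<lambda>r. 1 / e\<^sup>2 * inverse (1 + (0 + 1 / e * r)\<^sup>2))"
  using e i(1) by (intro integrable_mult_right lborel_integrable_real_affine) auto
 then show "integrable lborel (\<lambda>r. 1 / (r\<^sup>2 + e\<^sup>2))" unfolding eq .
 have "pi = \<bar>1 / e\<bar> *\<^sub>R (LB r. inverse (1 + (0 + 1 / e * r)\<^sup>2))"
  using e by (subst i(2)[symmetric], subst lborel_integral_real_affine[of "1 / e" _ 0]) auto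
 then have "(LB r. inverse (1 + (0 + 1 / e * r)\<^sup>2)) = pi * e" using e by (simp add: field_simps)
 then have "(LB r. 1 / e\<^sup>2 * inverse (1 + (0 + 1 / e * r)\<^sup>2)) = pi / e"
  using e by (simp add: power2_eq_square)
 then show "(LB r. 1 / (r\<^sup>2 + e\<^sup>2)) = pi / e" unfolding eq .
qed

lemma integral_FTC_UNIV:
 fixes F f :: "real \<Rightarrow> real"
 assumes int: "integrable lborel f" and F: "\<And>x. (F has_real_derivative f x) (at x)" and cont: "\<And>x. isCont f x"
  and top: "(F \<longlongrightarrow> B) at_top" and bot: "(F \<longlongrightarrow> A) at_bot"
 shows "(LB x. f x) = B - A"
proof -
 have eq: "(LB x. f x * indicator {- real n..real n} x) = F (real n) - F (- real n)" for n
  by (rule integral_FTC_Icc_real) (use F cont in auto)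
 have "(\<lambda>n. LB x. f x * indicator {- real n..real n} x) \<longlonglongrightarrow> (LB x. f x)"
 proof (rule integral_dominated_convergence[OF _ _ integrable_abs[OF int]])
  show "AE x in lborel. (\<lambda>n. f x * indicator {- real n..real n} x) \<longlonglongrightarrow> f x"
  proof (intro always_eventually allI)
   fix x :: real
   obtain n0 where n0: "\<bar>x\<bar> < real n0" using reals_Archimedean2 by blast
   have "\<forall>\<^sub>F n in sequentially. f x = f x * indicator {- real n..real n} x"
    using eventually_ge_at_top[of n0] by eventually_elim (use n0 in \<open>auto simp: indicator_def\<close>)
   then show "(\<lambda>n. f x * indicator {- real n..real n} x) \<longlonglongrightarrow> f x" by (rule Lim_transform_eventually[OF tendsto_const])
  qed
 qed (use borel_measurable_integrable[OF int] in \<open>auto simp: indicator_def\<close>)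
 moreover have "(\<lambda>n. F (real n) - F (- real n)) \<longlonglongrightarrow> B - A"
  by (intro tendsto_diff filterlim_compose[OF top] filterlim_compose[OF bot] filterlim_real_sequentially)
    (simp add: filterlim_uminus_at_bot filterlim_real_sequentially)
 ultimately show ?thesis unfolding eq using LIMSEQ_unique by blast
qed

text \<open>Partial fractions give a primitive made of logarithms, which cancel at both ends, and
  arctangents, which produce the value. The result is \<open>pi^2\<close> times the Poisson kernel
  at height \<open>2 * e\<close>, hence positive with integral \<open>pi^2\<close>. The coefficient
  \<open>\<alpha>\<close> has \<open>d\<close> in its denominator.\<close>

lemma conj_poisson_correlation:
 assumes e: "e > 0" and d: "d \<noteq> 0"
 shows "(LB t. conj_poisson e t * conj_poisson e (t + d)) = 2 * pi * e / (d\<^sup>2 + 4 * e\<^sup>2)"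
proof -
 define D where "D = d\<^sup>2 + 4 * e\<^sup>2"
 define \<alpha> where "\<alpha> = (d\<^sup>2 + 2 * e\<^sup>2) / (d * D)"
 define \<beta> where "\<beta> = e\<^sup>2 / D"
 define F where "F t = \<alpha> / 2 * (ln (t\<^sup>2 + e\<^sup>2) - ln ((t + d)\<^sup>2 + e\<^sup>2)) + \<beta> / e * (arctan (t / e) + arctan ((t + d) / e))" for t
 have D0: "D > 0" using e by (auto simp: D_def intro: add_nonneg_pos)
 have int: "integrable lborel (\<lambda>t. conj_poisson e t * conj_poisson e (t + d))"
 proof (rule Bochner_Integration.integrable_bound)
  have "integrable lborel (\<lambda>t. 1 / ((d + 1 * t)\<^sup>2 + e\<^sup>2))"
   by (rule lborel_integrable_real_affine[OF integrable_inverse_sum_squares(1)[OF e]]) simp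
  then show "integrable lborel (\<lambda>t. 1 / (t\<^sup>2 + e\<^sup>2) + 1 / ((t + d)\<^sup>2 + e\<^sup>2))"
   using integrable_inverse_sum_squares(1)[OF e] by (simp add: add.commute)
  show "AE t in lborel. norm (conj_poisson e t * conj_poisson e (t + d)) \<le> norm (1 / (t\<^sup>2 + e\<^sup>2) + 1 / ((t + d)\<^sup>2 + e\<^sup>2))"
  proof (intro always_eventually allI)
   fix t
   define p q where "p = \<bar>conj_poisson e t\<bar>" and "q = \<bar>conj_poisson e (t + d)\<bar>"
   have "2 * (p * q) \<le> p\<^sup>2 + q\<^sup>2" using sum_squares_bound[of p q] by (simp add: mult.assoc)
   moreover have "0 \<le> p * q" by (simp add: p_def q_def)
   ultimately have "p * q \<le> p\<^sup>2 + q\<^sup>2" by linarith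
   then show "norm (conj_poisson e t * conj_poisson e (t + d)) \<le> norm (1 / (t\<^sup>2 + e\<^sup>2) + 1 / ((t + d)\<^sup>2 + e\<^sup>2))"
    using conj_poisson_square_le[OF e, of t] conj_poisson_square_le[OF e, of "t + d"]
    by (simp add: p_def q_def abs_mult)
  qed
 qed measurable
 have deriv: "(F has_real_derivative conj_poisson e t * conj_poisson e (t + d)) (at t)" for t
 proof -
  define A B where "A = t\<^sup>2 + e\<^sup>2" and "B = (t + d)\<^sup>2 + e\<^sup>2"
  have AB: "A > 0" "B > 0" using sum_squares_pos[OF e] by (auto simp: A_def B_def)
  have D1: "((\<lambda>t. ln (t\<^sup>2 + e\<^sup>2)) has_real_derivative 2 * (t / A)) (at t)"
   using AB by (auto intro!: derivative_eq_intros simp: A_def)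
  have D2: "((\<lambda>t. ln ((t + d)\<^sup>2 + e\<^sup>2)) has_real_derivative 2 * ((t + d) / B)) (at t)"
   using AB by (auto intro!: derivative_eq_intros simp: B_def)
  have at: "inverse (1 + (x / e)\<^sup>2) * (1 / e) = e * (1 / (x\<^sup>2 + e\<^sup>2))" for x
   using e sum_squares_pos[OF e, of x] by (simp add: field_simps power2_eq_square)
  have D3: "((\<lambda>t. arctan (t / e)) has_real_derivative e * (1 / A)) (at t)"
   unfolding A_def at[symmetric] using e by (auto intro!: derivative_eq_intros)
  have D4: "((\<lambda>t. arctan ((t + d) / e)) has_real_derivative e * (1 / B)) (at t)"
   unfolding B_def at[symmetric] using e by (auto intro!: derivative_eq_intros)
  have "(F has_real_derivative \<alpha> / 2 * (2 * (t / A) - 2 * ((t + d) / B)) + \<beta> / e * (e * (1 / A) + e * (1 / B))) (at t)"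
   unfolding F_def by (intro DERIV_add DERIV_cmult DERIV_diff D1 D2 D3 D4)
  moreover have "\<alpha> / 2 * (2 * (t / A) - 2 * ((t + d) / B)) + \<beta> / e * (e * (1 / A) + e * (1 / B)) =
    ((d\<^sup>2 + 2 * e\<^sup>2) * (t * B - (t + d) * A) + e\<^sup>2 * d * (A + B)) / (d * D * A * B)"
   unfolding \<alpha>_def \<beta>_def using AB D0 d e by (simp add: divide_simps) (simp add: algebra_simps)
  moreover have "(d\<^sup>2 + 2 * e\<^sup>2) * (t * B - (t + d) * A) + e\<^sup>2 * d * (A + B) = t * (t + d) * (d * D)"
   unfolding A_def B_def D_def by (simp add: algebra_simps power2_eq_square)
  moreover have "t * (t + d) * (d * D) / (d * D * A * B) = conj_poisson e t * conj_poisson e (t + d)"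
   using D0 d by (simp add: conj_poisson_def A_def B_def)
  ultimately show ?thesis by simp
 qed
 have "(LB t. conj_poisson e t * conj_poisson e (t + d)) = \<beta> / e * (pi / 2 + pi / 2) - \<beta> / e * (- pi / 2 + - pi / 2)"
 proof (rule integral_FTC_UNIV[OF int deriv])
  show "isCont (\<lambda>t. conj_poisson e t * conj_poisson e (t + d)) x" for x
  proof -
   have "continuous_on UNIV (\<lambda>t. conj_poisson e t * conj_poisson e (t + d))"
    by (intro continuous_intros conj_poisson_continuous[OF e] continuous_on_compose2[OF conj_poisson_continuous[OF e, of UNIV]]) auto
   then show ?thesis by (simp add: continuous_on_eq_continuous_at)
  qed
  have l1: "((\<lambda>t. ln (t\<^sup>2 + e\<^sup>2) - ln ((t + d)\<^sup>2 + e\<^sup>2)) \<longlongrightarrow> 0) at_top" by real_asymp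
  have l2: "((\<lambda>t. ln (t\<^sup>2 + e\<^sup>2) - ln ((t + d)\<^sup>2 + e\<^sup>2)) \<longlongrightarrow> 0) at_bot" by real_asymp
  have a1: "filterlim (\<lambda>t. (t + x) / e) at_top at_top" "filterlim (\<lambda>t. (t + x) / e) at_bot at_bot" for x
   using e by real_asymp+
  have t: "((\<lambda>t. arctan (t / e) + arctan ((t + d) / e)) \<longlongrightarrow> pi / 2 + pi / 2) at_top"
   using filterlim_compose[OF tendsto_arctan_at_top a1(1)[of 0]] filterlim_compose[OF tendsto_arctan_at_top a1(1)[of d]]
   by (intro tendsto_add) auto
  have b: "((\<lambda>t. arctan (t / e) + arctan ((t + d) / e)) \<longlongrightarrow> - pi / 2 + - pi / 2) at_bot"
   using filterlim_compose[OF tendsto_arctan_at_bot a1(2)[of 0]] filterlim_compose[OF tendsto_arctan_at_bot a1(2)[of d]]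
   by (intro tendsto_add) auto
  show "(F \<longlongrightarrow> \<beta> / e * (pi / 2 + pi / 2)) at_top"
   using tendsto_add[OF tendsto_mult_left[OF l1, of "\<alpha> / 2"] tendsto_mult_left[OF t, of "\<beta> / e"]] unfolding F_def by simp
  show "(F \<longlongrightarrow> \<beta> / e * (- pi / 2 + - pi / 2)) at_bot"
   using tendsto_add[OF tendsto_mult_left[OF l2, of "\<alpha> / 2"] tendsto_mult_left[OF b, of "\<beta> / e"]] unfolding F_def by simp
 qed
 also have "\<dots> = 2 * pi * e / D" using e by (simp add: \<beta>_def power2_eq_square)
 finally show ?thesis by (simp add: D_def)
qed

section \<open>L2 norms of convolutions as double integrals\<close>

abbreviation lborel2 :: "(real \<times> real) measure" where "lborel2 \<equiv> lborel \<Otimes>\<^sub>M lborel"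

lemma sigma_finite_lborel2: "sigma_finite_measure lborel2"
 by (rule sigma_finite_pair_measure) (rule sigma_finite_lborel)+

lemma AE_lborel2_neq: "AE p in lborel2. fst p \<noteq> snd p"
proof -
 have "AE y in lborel. x \<noteq> y" for x :: real
  using AE_lborel_singleton[of x] by eventually_elim auto
 then have "AE x in lborel. AE y in lborel. fst (x, y) \<noteq> snd (x :: real, y)" by simp
 moreover have "{p \<in> space lborel2. fst p \<noteq> snd p} \<in> sets lborel2" by measurable
 ultimately show ?thesis by (rule lborel_pair.AE_pair_measure[rotated])
qed

lemma integrable_lborel2_mult:
 fixes u v :: "real \<Rightarrow> real"
 assumes u: "integrable lborel u" and v: "integrable lborel v"
 shows "integrable lborel2 (\<lambda>p. u (fst p) * v (snd p))" "(LINT p|lborel2. u (fst p) * v (snd p)) = (LB x. u x) * (LB x. v x)"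
proof -
 note [measurable] = borel_measurable_integrable[OF u, simplified] borel_measurable_integrable[OF v, simplified]
 show i: "integrable lborel2 (\<lambda>p. u (fst p) * v (snd p))"
 proof (rule integrableI_bounded)
  have "(\<integral>\<^sup>+p. ennreal (norm (u (fst p) * v (snd p))) \<partial>lborel2) = (NN x. (NN y. ennreal \<bar>u x\<bar> * ennreal \<bar>v y\<bar>))"
   by (subst lborel.nn_integral_fst[symmetric]) (auto simp: abs_mult ennreal_mult)
  also have "\<dots> = (NN x. ennreal \<bar>u x\<bar>) * (NN y. ennreal \<bar>v y\<bar>)"
   by (simp add: nn_integral_cmult nn_integral_multc)
  also have "\<dots> < \<infinity>" using u v by (simp add: integrable_iff_bounded ennreal_mult_less_top)
  finally show "(\<integral>\<^sup>+p. ennreal (norm (u (fst p) * v (snd p))) \<partial>lborel2) < \<infinity>" .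
 qed measurable
 show "(LINT p|lborel2. u (fst p) * v (snd p)) = (LB x. u x) * (LB x. v x)"
  using lborel_pair.integral_fst'[OF i] by simp
qed

text \<open>The square of a convolution is an integral over pairs of points; integrating over
  \<open>t\<close> first leaves the correlation of the kernel. The window \<open>A\<close> serves
  \<open>abel\<close>, whose correlation over the whole line diverges.\<close>

lemma conv_square_integral:
 fixes k w :: "real \<Rightarrow> real"
 assumes [measurable]: "k \<in> borel_fun" "w \<in> borel_fun" "A \<in> sets borel"
  and kint: "\<And>t. t \<in> A \<Longrightarrow> integrable lborel (\<lambda>x. k (t - x) * w x)"
  and fin: "(\<integral>\<^sup>+p. ennreal \<bar>w (fst p) * w (snd p)\<bar> * (NN t. ennreal \<bar>k (t - fst p) * k (t - snd p)\<bar> * indicator A t) \<partial>lborel2) < \<infinity>"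
 shows "(NN t. ennreal ((conv k w t)\<^sup>2) * indicator A t) =
   ennreal (LINT p|lborel2. w (fst p) * w (snd p) * (LB t. k (t - fst p) * k (t - snd p) * indicator A t))"
  and "0 \<le> (LINT p|lborel2. w (fst p) * w (snd p) * (LB t. k (t - fst p) * k (t - snd p) * indicator A t))"
proof -
 interpret PP: pair_sigma_finite lborel2 "lborel :: real measure"
  using sigma_finite_lborel2 sigma_finite_lborel by (rule pair_sigma_finite.intro)
 define F where "F p t = w (fst p) * w (snd p) * (k (t - fst p) * k (t - snd p) * indicator A t)" for p t
 have F: "integrable (lborel2 \<Otimes>\<^sub>M lborel) (case_prod F)"
 proof (rule integrableI_bounded)
  show [measurable]: "case_prod F \<in> borel_measurable (lborel2 \<Otimes>\<^sub>M lborel)" unfolding F_def by measurable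
  have "(\<integral>\<^sup>+x. ennreal (norm (case_prod F x)) \<partial>(lborel2 \<Otimes>\<^sub>M lborel)) = (\<integral>\<^sup>+p. (NN t. ennreal \<bar>F p t\<bar>) \<partial>lborel2)"
   by (subst lborel.nn_integral_fst[symmetric]) auto
  also have "\<dots> = (\<integral>\<^sup>+p. ennreal \<bar>w (fst p) * w (snd p)\<bar> * (NN t. ennreal \<bar>k (t - fst p) * k (t - snd p)\<bar> * indicator A t) \<partial>lborel2)"
   by (subst nn_integral_cmult[symmetric])
     (auto intro!: nn_integral_cong simp: F_def abs_mult indicator_def simp flip: ennreal_mult)
  also have "\<dots> < \<infinity>" by (rule fin)
  finally show "(\<integral>\<^sup>+x. ennreal (norm (case_prod F x)) \<partial>(lborel2 \<Otimes>\<^sub>M lborel)) < \<infinity>" .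
 qed
 have inner: "(LINT p|lborel2. F p t) = (conv k w t)\<^sup>2 * indicator A t" for t
 proof (cases "t \<in> A")
  case True
  have "(LINT p|lborel2. F p t) = (LINT p|lborel2. (k (t - fst p) * w (fst p)) * (k (t - snd p) * w (snd p)))"
   using True by (intro Bochner_Integration.integral_cong) (auto simp: F_def)
  also have "\<dots> = (conv k w t)\<^sup>2"
   unfolding integrable_lborel2_mult(2)[OF kint[OF True] kint[OF True]] by (simp add: conv_def power2_eq_square)
  finally show ?thesis using True by simp
 qed (simp add: F_def)
 have i: "integrable lborel (\<lambda>t. (conv k w t)\<^sup>2 * indicator A t)"
  using PP.integrable_snd[OF F] unfolding inner .
 have eq: "(LB t. (conv k w t)\<^sup>2 * indicator A t) = (LINT p|lborel2. w (fst p) * w (snd p) * (LB t. k (t - fst p) * k (t - snd p) * indicator A t))"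
  using PP.Fubini_integral[OF F] unfolding inner by (simp add: F_def)
 show "0 \<le> (LINT p|lborel2. w (fst p) * w (snd p) * (LB t. k (t - fst p) * k (t - snd p) * indicator A t))"
  unfolding eq[symmetric] by simp
 have "(NN t. ennreal ((conv k w t)\<^sup>2 * indicator A t)) = ennreal (LB t. (conv k w t)\<^sup>2 * indicator A t)"
  by (intro nn_integral_eq_integral i) auto
 moreover have "ennreal ((conv k w t)\<^sup>2) * indicator A t = ennreal ((conv k w t)\<^sup>2 * indicator A t)" for t
  by (cases "t \<in> A") auto
 ultimately show "(NN t. ennreal ((conv k w t)\<^sup>2) * indicator A t) =
   ennreal (LINT p|lborel2. w (fst p) * w (snd p) * (LB t. k (t - fst p) * k (t - snd p) * indicator A t))"
  by (simp add: eq)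
qed

lemma integrable_bounded_support:
 fixes w :: "real \<Rightarrow> real"
 assumes [measurable]: "w \<in> borel_fun" and W: "\<And>t. \<bar>w t\<bar> \<le> W" and w0: "\<forall>t. t \<notin> {a..b} \<longrightarrow> w t = 0"
 shows "integrable lborel w"
proof -
 have "integrable lborel (\<lambda>x. w x * indicator {a..b} x)"
  by (rule integrable_mult_bounded[OF integrable_indicator_Icc _ W]) simp
 moreover have "w x * indicator {a..b} x = w x" for x using w0 by (auto simp: indicator_def)
 ultimately show ?thesis by simp
qed

lemma integrable_continuous_mult:
 fixes k w :: "real \<Rightarrow> real"
 assumes k: "continuous_on UNIV k" and w: "w \<in> borel_fun" "\<And>t. \<bar>w t\<bar> \<le> W" "\<forall>t. t \<notin> {a..b} \<longrightarrow> w t = 0"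
 shows "integrable lborel (\<lambda>s. k s * w s)"
proof -
 have "set_integrable lborel {a..b} k"
  by (rule borel_integrable_atLeastAtMost') (rule continuous_on_subset[OF k], simp)
 then have "integrable lborel (\<lambda>s. w s * (indicator {a..b} s * k s))"
  unfolding set_integrable_def by (intro integrable_mult_bounded[OF _ _ w(2)]) (use w in auto)
 moreover have "w s * (indicator {a..b} s * k s) = k s * w s" for s using w(3) by (auto simp: indicator_def)
 ultimately show ?thesis by simp
qed

lemma nn_integral_conj_poisson_correlation:
 assumes e: "e > 0"
 shows "(NN t. ennreal \<bar>conj_poisson e (t - x) * conj_poisson e (t - y)\<bar>) \<le> ennreal (2 * pi / e)"
proof -
 have int: "integrable lborel (\<lambda>t. 1 / ((t - x)\<^sup>2 + e\<^sup>2))" and val: "(LB t. 1 / ((t - x)\<^sup>2 + e\<^sup>2)) = pi / e" for x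
 proof -
  show "integrable lborel (\<lambda>t. 1 / ((t - x)\<^sup>2 + e\<^sup>2))"
   using lborel_integrable_real_affine[OF integrable_inverse_sum_squares(1)[OF e], of 1 "- x"] by (simp add: algebra_simps)
  show "(LB t. 1 / ((t - x)\<^sup>2 + e\<^sup>2)) = pi / e"
   using lborel_integral_real_affine[of 1 "\<lambda>r. 1 / (r\<^sup>2 + e\<^sup>2)" "- x"] integrable_inverse_sum_squares(2)[OF e] by (simp add: algebra_simps)
 qed
 have "(NN t. ennreal \<bar>conj_poisson e (t - x) * conj_poisson e (t - y)\<bar>) \<le> (NN t. ennreal (1 / ((t - x)\<^sup>2 + e\<^sup>2) + 1 / ((t - y)\<^sup>2 + e\<^sup>2)))"
 proof (intro nn_integral_mono ennreal_leI)
  fix t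
  define p q where "p = \<bar>conj_poisson e (t - x)\<bar>" and "q = \<bar>conj_poisson e (t - y)\<bar>"
  have "2 * (p * q) \<le> p\<^sup>2 + q\<^sup>2" using sum_squares_bound[of p q] by (simp add: mult.assoc)
  moreover have "0 \<le> p * q" by (simp add: p_def q_def)
  ultimately have "p * q \<le> p\<^sup>2 + q\<^sup>2" by linarith
  then show "\<bar>conj_poisson e (t - x) * conj_poisson e (t - y)\<bar> \<le> 1 / ((t - x)\<^sup>2 + e\<^sup>2) + 1 / ((t - y)\<^sup>2 + e\<^sup>2)"
   using conj_poisson_square_le[OF e, of "t - x"] conj_poisson_square_le[OF e, of "t - y"]
   by (simp add: p_def q_def abs_mult)
 qed
 also have "\<dots> = ennreal (LB t. 1 / ((t - x)\<^sup>2 + e\<^sup>2) + 1 / ((t - y)\<^sup>2 + e\<^sup>2))"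
  using int by (intro nn_integral_eq_integral) auto
 also have "(LB t. 1 / ((t - x)\<^sup>2 + e\<^sup>2) + 1 / ((t - y)\<^sup>2 + e\<^sup>2)) = 2 * pi / e"
  using int val by simp
 finally show ?thesis .
qed

text \<open>Schur's test: off the diagonal the correlation kernel is nonnegative, symmetric and of
  mass \<open>pi^2\<close> in each variable, so bounding the product \<open>w x * w y\<close> by
  half the sum of squares suffices. This is the L2 bound of the Hilbert transform, uniform in
  \<open>e\<close>.\<close>

lemma conv_conj_poisson_L2:
 fixes w :: "real \<Rightarrow> real"
 assumes e: "e > 0" and w [measurable]: "w \<in> borel_fun" and W: "\<And>t. \<bar>w t\<bar> \<le> W" and w0: "\<forall>t. t \<notin> {a..b} \<longrightarrow> w t = 0"
 shows "(NN t. ennreal ((conv (conj_poisson e) w t)\<^sup>2)) \<le> ennreal (pi\<^sup>2) * (NN t. ennreal ((w t)\<^sup>2))"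
proof -
 have wi: "integrable lborel w" by (rule integrable_bounded_support[OF w W w0])
 define c where "c x y = (LB t. conj_poisson e (t - x) * conj_poisson e (t - y))" for x y
 define c' where "c' r = 2 * pi * e / (r\<^sup>2 + (2 * e)\<^sup>2)" for r
 have c'nn: "0 \<le> c' r" for r using e by (simp add: c'_def)
 have [measurable]: "c' \<in> borel_fun" unfolding c'_def [abs_def] by measurable
 have cc': "c x y = c' (x - y)" if "x \<noteq> y" for x y
 proof -
  have "c x y = (LB t. conj_poisson e t * conj_poisson e (t + (x - y)))"
   unfolding c_def by (subst lborel_integral_real_affine[of 1 _ x]) (auto simp: algebra_simps)
  then show ?thesis using conj_poisson_correlation[OF e, of "x - y"] that by (simp add: c'_def power_mult_distrib)
 qed
 have c'int: "(NN y. ennreal (c' (x - y))) = ennreal (pi\<^sup>2)" for x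
 proof -
  have "(NN y. ennreal (c' (x - y))) = (NN y. ennreal (c' y))"
   by (rule nn_integral_reflect_shift) measurable
  also have "\<dots> = ennreal (LB y. 2 * pi * e * (1 / (y\<^sup>2 + (2 * e)\<^sup>2)))"
  proof -
   have "integrable lborel (\<lambda>y. 2 * pi * e * (1 / (y\<^sup>2 + (2 * e)\<^sup>2)))"
    using e by (intro integrable_mult_right integrable_inverse_sum_squares(1)) simp
   from nn_integral_eq_integral[OF this] show ?thesis using e by (simp add: c'_def)
  qed
  also have "\<dots> = ennreal (pi\<^sup>2)"
  proof -
   have "(LB y. 2 * pi * e * (1 / (y\<^sup>2 + (2 * e)\<^sup>2))) = 2 * pi * e * (pi / (2 * e))"
    using e by (subst integral_mult_right_zero, subst integrable_inverse_sum_squares(2)) auto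
   then show ?thesis using e by (simp add: power2_eq_square)
  qed
  finally show ?thesis .
 qed
 have sq: "ennreal ((w x)\<^sup>2 / 2 * c' r) = ennreal ((w x)\<^sup>2 / 2) * ennreal (c' r)" for x r
  by (rule ennreal_mult) (auto simp: c'nn)
 have fin: "(\<integral>\<^sup>+p. ennreal \<bar>w (fst p) * w (snd p)\<bar> * (NN t. ennreal \<bar>conj_poisson e (t - fst p) * conj_poisson e (t - snd p)\<bar> * indicator UNIV t) \<partial>lborel2) < \<infinity>"
 proof -
  have "(\<integral>\<^sup>+p. ennreal \<bar>w (fst p) * w (snd p)\<bar> * (NN t. ennreal \<bar>conj_poisson e (t - fst p) * conj_poisson e (t - snd p)\<bar> * indicator UNIV t) \<partial>lborel2)
    \<le> (\<integral>\<^sup>+p. ennreal \<bar>w (fst p) * w (snd p)\<bar> * ennreal (2 * pi / e) \<partial>lborel2)"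
   using nn_integral_conj_poisson_correlation[OF e] by (intro nn_integral_mono mult_left_mono) auto
  also have "\<dots> = (\<integral>\<^sup>+p. ennreal \<bar>w (fst p) * w (snd p)\<bar> \<partial>lborel2) * ennreal (2 * pi / e)" by (rule nn_integral_multc) measurable
  also have "\<dots> < \<infinity>" using integrable_lborel2_mult(1)[OF wi wi] by (simp add: integrable_iff_bounded ennreal_mult_less_top)
  finally show ?thesis .
 qed
 have kint: "integrable lborel (\<lambda>x. conj_poisson e (t - x) * w x)" for t
  by (rule integrable_mult_bounded[OF wi _ conj_poisson_abs_le[OF e]]) auto
 have "(NN t. ennreal ((conv (conj_poisson e) w t)\<^sup>2)) = ennreal (LINT p|lborel2. w (fst p) * w (snd p) * c (fst p) (snd p))"
  using conv_square_integral(1)[OF conj_poisson_measurable w _ kint fin] by (simp add: c_def)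
 also have "\<dots> \<le> (\<integral>\<^sup>+p. ennreal \<bar>w (fst p) * w (snd p) * c (fst p) (snd p)\<bar> \<partial>lborel2)"
 proof (cases "integrable lborel2 (\<lambda>p. w (fst p) * w (snd p) * c (fst p) (snd p))")
  case True
  show ?thesis using integral_norm_bound_ennreal[OF True] by (simp add: order_trans[OF ennreal_leI[OF abs_ge_self]])
 qed (simp add: not_integrable_integral_eq)
 also have "\<dots> \<le> (\<integral>\<^sup>+p. ennreal ((w (fst p))\<^sup>2 / 2 * c' (fst p - snd p)) + ennreal ((w (snd p))\<^sup>2 / 2 * c' (fst p - snd p)) \<partial>lborel2)"
 proof (rule nn_integral_mono_AE)
  show "AE p in lborel2. ennreal \<bar>w (fst p) * w (snd p) * c (fst p) (snd p)\<bar> \<le> ennreal ((w (fst p))\<^sup>2 / 2 * c' (fst p - snd p)) + ennreal ((w (snd p))\<^sup>2 / 2 * c' (fst p - snd p))"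
   using AE_lborel2_neq
  proof eventually_elim
   case (elim p)
   have "\<bar>w (fst p) * w (snd p)\<bar> \<le> (w (fst p))\<^sup>2 / 2 + (w (snd p))\<^sup>2 / 2"
    using sum_squares_bound[of "\<bar>w (fst p)\<bar>" "\<bar>w (snd p)\<bar>"] by (simp add: abs_mult mult.assoc)
   then have "\<bar>w (fst p) * w (snd p)\<bar> * c' (fst p - snd p) \<le> ((w (fst p))\<^sup>2 / 2 + (w (snd p))\<^sup>2 / 2) * c' (fst p - snd p)"
    by (intro mult_right_mono c'nn)
   then show ?case using cc'[OF elim] c'nn by (simp add: abs_mult ennreal_leI distrib_right flip: ennreal_plus)
  qed
 qed
 also have "\<dots> = (\<integral>\<^sup>+p. ennreal ((w (fst p))\<^sup>2 / 2 * c' (fst p - snd p)) \<partial>lborel2) + (\<integral>\<^sup>+p. ennreal ((w (snd p))\<^sup>2 / 2 * c' (fst p - snd p)) \<partial>lborel2)"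
  by (rule nn_integral_add) measurable
 also have "(\<integral>\<^sup>+p. ennreal ((w (fst p))\<^sup>2 / 2 * c' (fst p - snd p)) \<partial>lborel2) = (NN x. ennreal ((w x)\<^sup>2 / 2) * ennreal (pi\<^sup>2))"
 proof -
  have "(\<integral>\<^sup>+p. ennreal ((w (fst p))\<^sup>2 / 2 * c' (fst p - snd p)) \<partial>lborel2) = (NN x. (NN y. ennreal ((w x)\<^sup>2 / 2) * ennreal (c' (x - y))))"
   by (subst lborel.nn_integral_fst[symmetric]) (measurable, simp only: sq fst_conv snd_conv)
  then show ?thesis by (simp add: nn_integral_cmult c'int)
 qed
 also have "(\<integral>\<^sup>+p. ennreal ((w (snd p))\<^sup>2 / 2 * c' (fst p - snd p)) \<partial>lborel2) = (NN y. (NN x. ennreal ((w y)\<^sup>2 / 2) * ennreal (c' (x - y))))"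
  by (subst lborel_pair.nn_integral_snd[symmetric]) (measurable, simp only: sq fst_conv snd_conv split_beta)
 also have "\<dots> = (NN x. ennreal ((w x)\<^sup>2 / 2) * ennreal (pi\<^sup>2))"
 proof (intro nn_integral_cong)
  fix y
  have "c' (x - y) = c' (y - x)" for x by (simp add: c'_def power2_commute)
  then show "(NN x. ennreal ((w y)\<^sup>2 / 2) * ennreal (c' (x - y))) = ennreal ((w y)\<^sup>2 / 2) * ennreal (pi\<^sup>2)"
   by (simp add: nn_integral_cmult c'int)
 qed
 also have "(NN x. ennreal ((w x)\<^sup>2 / 2) * ennreal (pi\<^sup>2)) + (NN x. ennreal ((w x)\<^sup>2 / 2) * ennreal (pi\<^sup>2)) =
   (NN x. ennreal (pi\<^sup>2) * ennreal ((w x)\<^sup>2))"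
  by (subst nn_integral_add[symmetric]) (auto intro!: nn_integral_cong simp flip: ennreal_mult ennreal_plus)
 also have "\<dots> = ennreal (pi\<^sup>2) * (NN t. ennreal ((w t)\<^sup>2))" by (rule nn_integral_cmult) measurable
 finally show ?thesis .
qed

text \<open>A smooth version of \<open>ln |r|\<close>, with derivative
  \<open>conj_poisson e\<close>.\<close>

definition log_kernel :: "real \<Rightarrow> real \<Rightarrow> real" where "log_kernel e r = ln (r\<^sup>2 + e\<^sup>2) / 2"

text \<open>Equals the mean of \<open>conj_poisson e\<close> over shifts in
  \<open>{0..\<delta>}\<close>. It arises when the difference quotient in one factor of a
  logarithmic energy is moved onto the kernel.\<close>

definition diff_log_kernel :: "real \<Rightarrow> real \<Rightarrow> real \<Rightarrow> real" where
 "diff_log_kernel \<delta> e r = (log_kernel e (r + \<delta>) - log_kernel e r) / \<delta>"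

lemma log_kernel_measurable [measurable]: "log_kernel e \<in> borel_fun" "diff_log_kernel \<delta> e \<in> borel_fun"
 unfolding log_kernel_def [abs_def] diff_log_kernel_def [abs_def] by measurable

lemma DERIV_log_kernel:
 assumes "e > 0" shows "(log_kernel e has_real_derivative conj_poisson e r) (at r)"
proof -
 have "((\<lambda>r. ln (r\<^sup>2 + e\<^sup>2)) has_real_derivative 2 * (r / (r\<^sup>2 + e\<^sup>2))) (at r)"
  using sum_squares_pos[OF assms, of r] by (auto intro!: derivative_eq_intros)
 then have "((\<lambda>r. ln (r\<^sup>2 + e\<^sup>2) / 2) has_real_derivative 2 * (r / (r\<^sup>2 + e\<^sup>2)) / 2) (at r)"
  by (rule DERIV_cdivide)
 moreover have "2 * x / 2 = x" for x :: real by simp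
 ultimately show ?thesis unfolding log_kernel_def [abs_def] conj_poisson_def by metis
qed

lemma log_kernel_continuous: "e > 0 \<Longrightarrow> continuous_on UNIV (log_kernel e)"
 by (meson DERIV_log_kernel DERIV_isCont continuous_at_imp_continuous_on)

lemma diff_log_kernel_continuous:
 assumes "e > 0" "\<delta> > 0" shows "continuous_on UNIV (diff_log_kernel \<delta> e)"
 unfolding diff_log_kernel_def [abs_def] using assms
 by (intro continuous_intros log_kernel_continuous continuous_on_compose2[OF log_kernel_continuous[OF assms(1)]]) auto

lemma conv_diff_log_kernel:
 fixes w :: "real \<Rightarrow> real"
 assumes e: "e > 0" and d: "\<delta> > 0" and w [measurable]: "w \<in> borel_fun" and W: "\<And>t. \<bar>w t\<bar> \<le> W" and w0: "\<forall>t. t \<notin> {a..b} \<longrightarrow> w t = 0"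
 shows "conv (diff_log_kernel \<delta> e) w t = (LINT \<theta>:{0..\<delta>}|lborel. conv (conj_poisson e) w (t + \<theta>)) / \<delta>"
proof -
 have wi: "integrable lborel w" by (rule integrable_bounded_support[OF w W w0])
 have q: "diff_log_kernel \<delta> e r = (LB \<theta>. conj_poisson e (r + \<theta>) * indicator {0..\<delta>} \<theta>) / \<delta>" for r
 proof -
  have "(LB \<theta>. conj_poisson e (r + \<theta>) * indicator {0..\<delta>} \<theta>) = log_kernel e (r + \<delta>) - log_kernel e (r + 0)"
  proof (rule integral_FTC_Icc_real)
   show "((\<lambda>\<theta>. log_kernel e (r + \<theta>)) has_real_derivative conj_poisson e (r + \<theta>)) (at \<theta>)" for \<theta>
    using DERIV_shift[of "log_kernel e" "conj_poisson e (r + \<theta>)" \<theta> r] DERIV_log_kernel[OF e, of "\<theta> + r"]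
    by (simp add: add.commute)
   have "continuous_on UNIV (\<lambda>\<theta>. conj_poisson e (r + \<theta>))"
    by (intro continuous_on_compose2[OF conj_poisson_continuous[OF e, of UNIV]] continuous_intros) auto
   then show "isCont (\<lambda>\<theta>. conj_poisson e (r + \<theta>)) \<theta>" for \<theta> by (simp add: continuous_on_eq_continuous_at)
  qed (use d in simp)
  then show ?thesis by (simp add: diff_log_kernel_def)
 qed
 have F: "integrable lborel2 (\<lambda>(\<theta>, s). conj_poisson e (t - s + \<theta>) * indicator {0..\<delta>} \<theta> * w s)"
 proof -
  have "integrable lborel2 (\<lambda>p. conj_poisson e (t - snd p + fst p) * (indicator {0..\<delta>} (fst p) * w (snd p)))"
   by (rule integrable_mult_bounded[OF integrable_lborel2_mult(1)[OF integrable_indicator_Icc wi] _ conj_poisson_abs_le[OF e]]) measurable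
  then show ?thesis by (simp add: split_beta' mult.assoc)
 qed
 have "conv (diff_log_kernel \<delta> e) w t = (LB s. (LB \<theta>. conj_poisson e (t - s + \<theta>) * indicator {0..\<delta>} \<theta> * w s)) / \<delta>"
  unfolding conv_def q by simp
 also have "(LB s. (LB \<theta>. conj_poisson e (t - s + \<theta>) * indicator {0..\<delta>} \<theta> * w s)) =
   (LB \<theta>. (LB s. conj_poisson e (t - s + \<theta>) * indicator {0..\<delta>} \<theta> * w s))"
  by (rule lborel_pair.Fubini_integral[OF F])
 also have "\<dots> = (LINT \<theta>:{0..\<delta>}|lborel. conv (conj_poisson e) w (t + \<theta>))"
  unfolding set_lebesgue_integral_def conv_def
  by (intro Bochner_Integration.integral_cong refl) (simp add: algebra_simps flip: integral_mult_right_zero)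
 finally show ?thesis .
qed

text \<open>A mean of translates has no larger L2 norm, by Cauchy-Schwarz over the shifts, so
  \<open>pi^2\<close> survives for all \<open>\<delta>\<close> and \<open>e\<close>.\<close>

lemma conv_diff_log_kernel_L2:
 fixes w :: "real \<Rightarrow> real"
 assumes e: "e > 0" and d: "\<delta> > 0" and w [measurable]: "w \<in> borel_fun" and W: "\<And>t. \<bar>w t\<bar> \<le> W" and w0: "\<forall>t. t \<notin> {a..b} \<longrightarrow> w t = 0"
 shows "(NN t. ennreal ((conv (diff_log_kernel \<delta> e) w t)\<^sup>2)) \<le> ennreal (pi\<^sup>2) * (NN t. ennreal ((w t)\<^sup>2))"
proof -
 define V where "V = conv (conj_poisson e) w"
 have [measurable]: "V \<in> borel_fun" unfolding V_def by measurable
 have pt: "ennreal ((conv (diff_log_kernel \<delta> e) w t)\<^sup>2) \<le> ennreal (1 / \<delta>) * (NN \<theta>. ennreal ((V (t + \<theta>))\<^sup>2) * indicator {0..\<delta>} \<theta>)" for t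
 proof -
  have "ennreal \<bar>LINT \<theta>:{0..\<delta>}|lborel. V (t + \<theta>)\<bar> \<le> (NN \<theta>. ennreal \<bar>V (t + \<theta>)\<bar> * indicator {0..\<delta>} \<theta>)"
  proof (cases "set_integrable lborel {0..\<delta>} (\<lambda>\<theta>. V (t + \<theta>))")
   case True
   have "ennreal \<bar>LINT \<theta>:{0..\<delta>}|lborel. V (t + \<theta>)\<bar> \<le> (NN \<theta>. ennreal (norm (indicator {0..\<delta>} \<theta> *\<^sub>R V (t + \<theta>))))"
    using integral_norm_bound_ennreal[OF True[unfolded set_integrable_def]] by (simp add: set_lebesgue_integral_def)
   also have "\<dots> = (NN \<theta>. ennreal \<bar>V (t + \<theta>)\<bar> * indicator {0..\<delta>} \<theta>)"
    by (intro nn_integral_cong) (auto simp: indicator_def)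
   finally show ?thesis .
  qed (simp add: set_integrable_def set_lebesgue_integral_def not_integrable_integral_eq)
  then have "(ennreal \<bar>LINT \<theta>:{0..\<delta>}|lborel. V (t + \<theta>)\<bar>)\<^sup>2 \<le> (NN \<theta>. ennreal \<bar>V (t + \<theta>)\<bar> * indicator {0..\<delta>} \<theta>)\<^sup>2"
   by (rule power_mono) simp
  also have "\<dots> = (NN \<theta>. (ennreal \<bar>V (t + \<theta>)\<bar> * indicator {0..\<delta>} \<theta>) * indicator {0..\<delta>} \<theta>)\<^sup>2"
   by (intro arg_cong[where f="\<lambda>x. x\<^sup>2"] nn_integral_cong) (auto simp: indicator_def)
  also have "\<dots> \<le> (NN \<theta>. (ennreal \<bar>V (t + \<theta>)\<bar> * indicator {0..\<delta>} \<theta>)\<^sup>2) * (NN \<theta>. (indicator {0..\<delta>} \<theta>)\<^sup>2)"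
   by (rule Cauchy_Schwarz_nn_integral) measurable
  also have "(NN \<theta>. (indicator {0..\<delta>} \<theta>)\<^sup>2) = (NN \<theta>. indicator {0..\<delta>} \<theta>)"
   by (intro nn_integral_cong) (auto simp: indicator_def)
  also have "\<dots> = ennreal \<delta>" using d by simp
  also have "(NN \<theta>. (ennreal \<bar>V (t + \<theta>)\<bar> * indicator {0..\<delta>} \<theta>)\<^sup>2) = (NN \<theta>. ennreal ((V (t + \<theta>))\<^sup>2) * indicator {0..\<delta>} \<theta>)"
   by (intro nn_integral_cong) (auto simp: indicator_def ennreal_power)
  finally have *: "ennreal ((LINT \<theta>:{0..\<delta>}|lborel. V (t + \<theta>))\<^sup>2) \<le> (NN \<theta>. ennreal ((V (t + \<theta>))\<^sup>2) * indicator {0..\<delta>} \<theta>) * ennreal \<delta>"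
   by (simp add: ennreal_power)
  have "ennreal ((conv (diff_log_kernel \<delta> e) w t)\<^sup>2) = ennreal (1 / \<delta>\<^sup>2) * ennreal ((LINT \<theta>:{0..\<delta>}|lborel. V (t + \<theta>))\<^sup>2)"
   unfolding conv_diff_log_kernel[OF e d w W w0] V_def by (simp add: power_divide flip: ennreal_mult)
  also have "\<dots> \<le> ennreal (1 / \<delta>\<^sup>2) * ((NN \<theta>. ennreal ((V (t + \<theta>))\<^sup>2) * indicator {0..\<delta>} \<theta>) * ennreal \<delta>)"
   by (intro mult_left_mono *) simp
  also have "\<dots> = (ennreal (1 / \<delta>\<^sup>2) * ennreal \<delta>) * (NN \<theta>. ennreal ((V (t + \<theta>))\<^sup>2) * indicator {0..\<delta>} \<theta>)"
   by (simp only: mult_ac)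
  also have "ennreal (1 / \<delta>\<^sup>2) * ennreal \<delta> = ennreal (1 / \<delta>)" using d by (simp add: power2_eq_square flip: ennreal_mult)
  finally show ?thesis .
 qed
 have "(NN t. ennreal ((conv (diff_log_kernel \<delta> e) w t)\<^sup>2)) \<le> (NN t. ennreal (1 / \<delta>) * (NN \<theta>. ennreal ((V (t + \<theta>))\<^sup>2) * indicator {0..\<delta>} \<theta>))"
  by (intro nn_integral_mono pt)
 also have "\<dots> = ennreal (1 / \<delta>) * (NN t. (NN \<theta>. ennreal ((V (t + \<theta>))\<^sup>2) * indicator {0..\<delta>} \<theta>))"
  by (rule nn_integral_cmult) measurable
 also have "(NN t. (NN \<theta>. ennreal ((V (t + \<theta>))\<^sup>2) * indicator {0..\<delta>} \<theta>)) =
   (NN \<theta>. (NN t. ennreal ((V (t + \<theta>))\<^sup>2) * indicator {0..\<delta>} \<theta>))"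
  by (rule lborel_pair.Fubini') measurable
 also have "\<dots> = (NN \<theta>. (NN t. ennreal ((V t)\<^sup>2)) * indicator {0..\<delta>} \<theta>)"
 proof (intro nn_integral_cong)
  fix \<theta>
  have "(NN t. ennreal ((V (t + \<theta>))\<^sup>2)) = (NN t. ennreal ((V t)\<^sup>2))"
   by (subst (2) nn_integral_real_affine[of _ 1 \<theta>]) (auto simp: add.commute)
  then show "(NN t. ennreal ((V (t + \<theta>))\<^sup>2) * indicator {0..\<delta>} \<theta>) = (NN t. ennreal ((V t)\<^sup>2)) * indicator {0..\<delta>} \<theta>"
   by (simp add: nn_integral_multc)
 qed
 also have "\<dots> = (NN t. ennreal ((V t)\<^sup>2)) * ennreal \<delta>" using d by (simp add: nn_integral_cmult)
 also have "ennreal (1 / \<delta>) * ((NN t. ennreal ((V t)\<^sup>2)) * ennreal \<delta>) = (ennreal (1 / \<delta>) * ennreal \<delta>) * (NN t. ennreal ((V t)\<^sup>2))"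
  by (simp only: mult_ac)
 also have "ennreal (1 / \<delta>) * ennreal \<delta> = 1" using d by (simp flip: ennreal_mult)
 also have "1 * (NN t. ennreal ((V t)\<^sup>2)) \<le> ennreal (pi\<^sup>2) * (NN t. ennreal ((w t)\<^sup>2))"
  unfolding V_def mult_1 by (rule conv_conj_poisson_L2[OF e w W w0])
 finally show ?thesis .
qed

section \<open>Logarithmic energy of the Abel transform\<close>

text \<open>Dominates \<open>ln |x - y|\<close>, its smooth versions and a remainder of size 1 on
  the square over \<open>{a..b}\<close>; the inverse square roots absorb the logarithmic singularity
  and keep the majorant integrable.\<close>

definition log_majorant :: "real \<Rightarrow> real \<Rightarrow> real \<times> real \<Rightarrow> real" where
 "log_majorant a b p = indicator {a..b} (fst p) * indicator {a..b} (snd p) *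
   (1 + (b - a) + (b - a)\<^sup>2 + 2 * abel (fst p - snd p) + 2 * abel (snd p - fst p))"

lemma integrable_abel_square:
 "integrable lborel2 (\<lambda>p. indicator {a..b} (fst p) * indicator {a..b} (snd p) * abel (fst p - snd p))"
proof (rule integrableI_bounded)
 have inner: "(NN y. ennreal (norm (indicator {a..b} x * indicator {a..b} y * abel (x - y)))) \<le> ennreal (2 * sqrt (\<bar>b - a\<bar> + 1)) * indicator {a..b} x" for x
 proof -
  have "(NN y. ennreal (norm (indicator {a..b} x * indicator {a..b} y * abel (x - y))))
   \<le> (NN y. (ennreal (abel (x - y)) * indicator {0<..<\<bar>b - a\<bar> + 1} (x - y)) * indicator {a..b} x)"
   by (intro nn_integral_mono) (auto simp: indicator_def abel_def)
  also have "\<dots> = (NN y. ennreal (abel (x - y)) * indicator {0<..<\<bar>b - a\<bar> + 1} (x - y)) * indicator {a..b} x"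
   by (rule nn_integral_multc) measurable
  also have "(NN y. ennreal (abel (x - y)) * indicator {0<..<\<bar>b - a\<bar> + 1} (x - y)) = (NN y. ennreal (abel y) * indicator {0<..<\<bar>b - a\<bar> + 1} y)"
   by (rule nn_integral_reflect_shift[of "\<lambda>s. ennreal (abel s) * indicator {0<..<\<bar>b - a\<bar> + 1} s" x]) measurable
  also have "\<dots> = ennreal (2 * sqrt (\<bar>b - a\<bar> + 1))" by (rule nn_integral_abel) simp
  finally show ?thesis .
 qed
 have "(\<integral>\<^sup>+p. ennreal (norm (indicator {a..b} (fst p) * indicator {a..b} (snd p) * abel (fst p - snd p))) \<partial>lborel2) =
   (NN x. (NN y. ennreal (norm (indicator {a..b} x * indicator {a..b} y * abel (x - y)))))"
 proof -
  have m: "(\<lambda>p. ennreal (norm (indicator {a..b} (fst p) * indicator {a..b} (snd p) * abel (fst p - snd p)))) \<in> borel_measurable lborel2"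
   by measurable
  show ?thesis by (subst lborel.nn_integral_fst[OF m, symmetric]) (simp only: fst_conv snd_conv)
 qed
 also have "\<dots> \<le> (NN x. ennreal (2 * sqrt (\<bar>b - a\<bar> + 1)) * indicator {a..b} x)"
  by (intro nn_integral_mono inner)
 also have "\<dots> = ennreal (2 * sqrt (\<bar>b - a\<bar> + 1)) * emeasure lborel {a..b}" by (rule nn_integral_cmult_indicator) simp
 also have "\<dots> < \<infinity>" by (simp add: ennreal_mult_less_top emeasure_lborel_Icc_eq)
 finally show "(\<integral>\<^sup>+p. ennreal (norm (indicator {a..b} (fst p) * indicator {a..b} (snd p) * abel (fst p - snd p))) \<partial>lborel2) < \<infinity>" .
qed measurable

lemma integrable_log_majorant: "integrable lborel2 (log_majorant a b)"
proof -
 have 1: "integrable lborel2 (\<lambda>p. indicator {a..b} (fst p) * indicator {a..b} (snd p) * abel (snd p - fst p))"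
  using lborel_pair.integrable_product_swap[OF integrable_abel_square[of a b]] by (simp add: split_beta' mult.commute)
 have 2: "integrable lborel2 (\<lambda>p. indicator {a..b} (fst p) * indicator {a..b} (snd p) :: real)"
  by (rule integrable_lborel2_mult(1)) (rule integrable_indicator_Icc)+
 have "integrable lborel2 (\<lambda>p. indicator {a..b} (fst p) * indicator {a..b} (snd p) * (1 + (b - a) + (b - a)\<^sup>2) +
   (2 * (indicator {a..b} (fst p) * indicator {a..b} (snd p) * abel (fst p - snd p)) +
   2 * (indicator {a..b} (fst p) * indicator {a..b} (snd p) * abel (snd p - fst p))))"
  by (intro Bochner_Integration.integrable_add integrable_mult_right integrable_mult_left 1 2 integrable_abel_square)
 then show ?thesis
  by (rule Bochner_Integration.integrable_cong[THEN iffD1, rotated 2]) (auto simp: log_majorant_def algebra_simps)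
qed

lemma log_majorant_nonneg: "0 \<le> log_majorant a b p"
 by (cases "fst p \<in> {a..b} \<and> snd p \<in> {a..b}") (auto simp: log_majorant_def abel_nonneg)

lemma abs_ln_abs_le: assumes "r \<noteq> 0" shows "\<bar>ln \<bar>r\<bar>\<bar> \<le> \<bar>r\<bar> + 2 * abel r + 2 * abel (- r)"
proof -
 have s: "2 * abel r + 2 * abel (- r) = 2 * (1 / sqrt \<bar>r\<bar>)" using assms by (auto simp: abel_def abs_if)
 have "ln \<bar>r\<bar> \<le> \<bar>r\<bar>" using ln_le_minus_one[of "\<bar>r\<bar>"] assms by simp
 moreover have "- ln \<bar>r\<bar> = 2 * ln (1 / sqrt \<bar>r\<bar>)" using assms by (simp add: ln_div ln_sqrt)
 moreover have "ln (1 / sqrt \<bar>r\<bar>) \<le> 1 / sqrt \<bar>r\<bar>" using ln_le_minus_one[of "1 / sqrt \<bar>r\<bar>"] assms by simp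
 moreover have "0 \<le> 1 / sqrt \<bar>r\<bar>" by simp
 ultimately show ?thesis using s by linarith
qed

lemma abs_log_kernel_le:
 assumes "r \<noteq> 0" "0 < e" "e \<le> 1" shows "\<bar>log_kernel e r\<bar> \<le> \<bar>r\<bar> + r\<^sup>2 + 2 * abel r + 2 * abel (- r)"
proof -
 have r2: "0 < r\<^sup>2" using assms by simp
 have e2: "e\<^sup>2 \<le> 1" using assms by (simp add: power_le_one)
 have "ln (r\<^sup>2 + e\<^sup>2) \<le> r\<^sup>2 + e\<^sup>2 - 1" using sum_squares_pos[OF assms(2), of r] by (intro ln_le_minus_one)
 then have up: "log_kernel e r \<le> r\<^sup>2" using e2 r2 unfolding log_kernel_def by linarith
 have "ln (r\<^sup>2) \<le> ln (r\<^sup>2 + e\<^sup>2)" using sum_squares_pos[OF assms(2), of r] r2 by simp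
 moreover have "ln (r\<^sup>2) = 2 * ln \<bar>r\<bar>" using ln_realpow[of "\<bar>r\<bar>" 2] assms by simp
 ultimately have lo: "ln \<bar>r\<bar> \<le> log_kernel e r" by (simp add: log_kernel_def)
 have n: "0 \<le> abel r" "0 \<le> abel (- r)" by (rule abel_nonneg)+
 show ?thesis using up lo abs_ln_abs_le[OF assms(1)] r2 n by (intro abs_leI; linarith)
qed

lemma log_majorant_bound:
 fixes w :: "real \<Rightarrow> real"
 assumes W: "\<And>t. \<bar>w t\<bar> \<le> W" and w0: "\<forall>t. t \<notin> {a..b} \<longrightarrow> w t = 0"
  and K: "fst p \<in> {a..b} \<Longrightarrow> snd p \<in> {a..b} \<Longrightarrow> \<bar>K\<bar> \<le> 1 + \<bar>fst p - snd p\<bar> + (fst p - snd p)\<^sup>2 + 2 * abel (fst p - snd p) + 2 * abel (snd p - fst p)"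
 shows "\<bar>w (fst p) * w (snd p) * K\<bar> \<le> W\<^sup>2 * log_majorant a b p"
proof (cases "fst p \<in> {a..b} \<and> snd p \<in> {a..b}")
 case True
 have W0: "0 \<le> W" using W[of 0] by (simp add: order_trans[OF abs_ge_zero])
 have d: "\<bar>fst p - snd p\<bar> \<le> b - a" using True by auto
 have "(fst p - snd p)\<^sup>2 \<le> (b - a)\<^sup>2" using d by (simp add: abs_le_square_iff[symmetric])
 then have "\<bar>K\<bar> \<le> log_majorant a b p" using K True d by (auto simp: log_majorant_def)
 moreover have "\<bar>w (fst p) * w (snd p)\<bar> \<le> W\<^sup>2"
  unfolding abs_mult power2_eq_square by (intro mult_mono W W0) auto
 ultimately have "\<bar>w (fst p) * w (snd p)\<bar> * \<bar>K\<bar> \<le> W\<^sup>2 * log_majorant a b p" by (intro mult_mono) auto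
 then show ?thesis by (simp add: abs_mult)
next
 case False
 then have z: "w (fst p) * w (snd p) = 0" using w0 by auto
 show ?thesis unfolding z using log_majorant_nonneg[of a b p] by simp
qed

text \<open>Off the diagonal the smooth kernels tend to \<open>ln |x - y|\<close> under one
  majorant. The uniform bound in the second statement becomes the majorant when energies of slices
  are integrated over \<open>z\<close>.\<close>

lemma log_kernel_energy:
 fixes w :: "real \<Rightarrow> real"
 assumes w [measurable]: "w \<in> borel_fun" and W: "\<And>t. \<bar>w t\<bar> \<le> W" and w0: "\<forall>t. t \<notin> {a..b} \<longrightarrow> w t = 0"
 shows "0 < e \<Longrightarrow> e \<le> 1 \<Longrightarrow> (LB x. w x * conv (log_kernel e) w x) = (LINT p|lborel2. w (fst p) * w (snd p) * log_kernel e (fst p - snd p))"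
  and "0 < e \<Longrightarrow> e \<le> 1 \<Longrightarrow> \<bar>LB x. w x * conv (log_kernel e) w x\<bar> \<le> W\<^sup>2 * (LINT p|lborel2. log_majorant a b p)"
  and "(\<lambda>n. LB x. w x * conv (log_kernel (1 / real (Suc n))) w x) \<longlonglongrightarrow> (LINT p|lborel2. w (fst p) * w (snd p) * ln \<bar>fst p - snd p\<bar>)"
proof -
 have bd: "AE p in lborel2. norm (w (fst p) * w (snd p) * log_kernel e (fst p - snd p)) \<le> W\<^sup>2 * log_majorant a b p"
  if e: "0 < e" "e \<le> 1" for e
  using AE_lborel2_neq
 proof eventually_elim
  case (elim p)
  then show ?case using abs_log_kernel_le[OF _ e, of "fst p - snd p"]
   unfolding real_norm_def by (intro log_majorant_bound[OF W w0]) auto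
 qed
 have mi: "integrable lborel2 (\<lambda>p. W\<^sup>2 * log_majorant a b p)" by (intro integrable_mult_right integrable_log_majorant)
 have int: "integrable lborel2 (\<lambda>p. w (fst p) * w (snd p) * log_kernel e (fst p - snd p))" if e: "0 < e" "e \<le> 1" for e
  using bd[OF e] log_majorant_nonneg
  by (intro Bochner_Integration.integrable_bound[OF mi]) (auto elim!: eventually_mono)
 have eq: "(LB x. w x * conv (log_kernel e) w x) = (LINT p|lborel2. w (fst p) * w (snd p) * log_kernel e (fst p - snd p))"
  if e: "0 < e" "e \<le> 1" for e
  using lborel_pair.integral_fst'[OF int[OF e]]
  by (simp add: conv_def mult_ac flip: integral_mult_right_zero)
 then show "0 < e \<Longrightarrow> e \<le> 1 \<Longrightarrow> (LB x. w x * conv (log_kernel e) w x) = (LINT p|lborel2. w (fst p) * w (snd p) * log_kernel e (fst p - snd p))" .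
 show "\<bar>LB x. w x * conv (log_kernel e) w x\<bar> \<le> W\<^sup>2 * (LINT p|lborel2. log_majorant a b p)" if e: "0 < e" "e \<le> 1"
 proof -
  have "norm (LINT p|lborel2. w (fst p) * w (snd p) * log_kernel e (fst p - snd p)) \<le> (LINT p|lborel2. W\<^sup>2 * log_majorant a b p)"
   by (rule order_trans[OF integral_norm_bound integral_mono_AE[OF integrable_norm[OF int[OF e]] mi bd[OF e]]])
  then show ?thesis using eq[OF e] by simp
 qed
 have "(\<lambda>n. LINT p|lborel2. w (fst p) * w (snd p) * log_kernel (1 / real (Suc n)) (fst p - snd p)) \<longlonglongrightarrow> (LINT p|lborel2. w (fst p) * w (snd p) * ln \<bar>fst p - snd p\<bar>)"
 proof (rule integral_dominated_convergence[OF _ _ mi])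
  show "AE p in lborel2. norm (w (fst p) * w (snd p) * log_kernel (1 / real (Suc n)) (fst p - snd p)) \<le> W\<^sup>2 * log_majorant a b p" for n
   by (rule bd) auto
  show "AE p in lborel2. (\<lambda>n. w (fst p) * w (snd p) * log_kernel (1 / real (Suc n)) (fst p - snd p)) \<longlonglongrightarrow> w (fst p) * w (snd p) * ln \<bar>fst p - snd p\<bar>"
   using AE_lborel2_neq
  proof eventually_elim
   case (elim p)
   define r where "r = fst p - snd p"
   have r: "r \<noteq> 0" using elim by (simp add: r_def)
   have "(\<lambda>n. ln (r\<^sup>2 + (1 / real (Suc n))\<^sup>2) / 2) \<longlonglongrightarrow> ln (r\<^sup>2 + 0\<^sup>2) / 2"
    using LIMSEQ_inverse_real_of_nat r unfolding inverse_eq_divide by (intro tendsto_intros) auto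
   also have "ln (r\<^sup>2 + 0\<^sup>2) / 2 = ln \<bar>r\<bar>" using ln_realpow[of "\<bar>r\<bar>" 2] r by simp
   finally show ?case unfolding log_kernel_def r_def by (intro tendsto_mult tendsto_const)
  qed
 qed measurable
 moreover have "(LB x. w x * conv (log_kernel (1 / real (Suc n))) w x) =
   (LINT p|lborel2. w (fst p) * w (snd p) * log_kernel (1 / real (Suc n)) (fst p - snd p))" for n
  by (rule eq) auto
 ultimately show "(\<lambda>n. LB x. w x * conv (log_kernel (1 / real (Suc n))) w x) \<longlonglongrightarrow> (LINT p|lborel2. w (fst p) * w (snd p) * ln \<bar>fst p - snd p\<bar>)"
  by simp
qed

text \<open>The primitive is \<open>2 * ln (sqrt (t - x) + sqrt (t - y))\<close>. At the upper end
  \<open>M\<close> it grows like \<open>ln (4 * M)\<close>; at the lower end it contributes exactly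
  \<open>- ln |x - y|\<close>.\<close>

lemma nn_integral_abel_correlation:
 assumes "x \<noteq> y" "x < M" "y < M"
 shows "(NN t. ennreal (abel (t - x) * abel (t - y) * indicator {..<M} t)) = ennreal (2 * ln (sqrt (M - x) + sqrt (M - y)) - ln \<bar>x - y\<bar>)"
proof -
 have main: "(NN t. ennreal (abel (t - x) * abel (t - y) * indicator {..<M} t)) = ennreal (2 * ln (sqrt (M - x) + sqrt (M - y)) - ln \<bar>x - y\<bar>)"
  if xy: "x < y" "y < M" for x y
 proof -
  have "(NN t. ennreal (abel (t - x) * abel (t - y)) * indicator {y<..<M} t) =
    ennreal (2 * ln (sqrt (M - x) + sqrt (M - y)) - 2 * ln (sqrt (y - x) + sqrt (y - y)))"
  proof (rule nn_integral_FTC_interior[of "{}"])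
   fix t assume t: "y < t" "t < M"
   define p q where "p = sqrt (t - x)" and "q = sqrt (t - y)"
   have pq: "p > 0" "q > 0" using t xy by (auto simp: p_def q_def)
   have d1: "((\<lambda>t. sqrt (t - x)) has_real_derivative inverse p / 2) (at t)"
    unfolding p_def using t xy by (auto intro!: derivative_eq_intros)
   have d2: "((\<lambda>t. sqrt (t - y)) has_real_derivative inverse q / 2) (at t)"
    unfolding q_def using t xy by (auto intro!: derivative_eq_intros)
   have "(ln has_real_derivative 1 / (p + q)) (at (sqrt (t - x) + sqrt (t - y)))"
    unfolding p_def[symmetric] q_def[symmetric] using pq by (intro DERIV_ln_divide) simp
   from DERIV_cmult[OF DERIV_chain2[OF this DERIV_add[OF d1 d2]], of 2]
   have "((\<lambda>t. 2 * ln (sqrt (t - x) + sqrt (t - y))) has_real_derivative 2 * ((inverse p / 2 + inverse q / 2) / (p + q))) (at t)"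
    by simp
   moreover have "2 * ((inverse p / 2 + inverse q / 2) / (p + q)) = 1 / (p * q)"
   proof -
    have "inverse p / 2 + inverse q / 2 = (p + q) / (2 * (p * q))" using pq by (simp add: field_simps)
    then show ?thesis using pq by simp
   qed
   ultimately show "((\<lambda>t. 2 * ln (sqrt (t - x) + sqrt (t - y))) has_real_derivative abel (t - x) * abel (t - y)) (at t)"
    using t xy by (simp add: abel_def p_def q_def)
  next
   have "sqrt (t - x) + sqrt (t - y) \<noteq> 0" if "y \<le> t" for t
    using xy that by (intro less_imp_neq[THEN not_sym] add_pos_nonneg) auto
   then show "continuous_on {y..M} (\<lambda>t. 2 * ln (sqrt (t - x) + sqrt (t - y)))" by (intro continuous_intros) auto
  qed (use xy in \<open>auto simp: abel_nonneg\<close>)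
  moreover have "2 * ln (sqrt (y - x) + sqrt (y - y)) = ln \<bar>x - y\<bar>" using xy by (simp add: ln_sqrt)
  moreover have "(NN t. ennreal (abel (t - x) * abel (t - y) * indicator {..<M} t)) = (NN t. ennreal (abel (t - x) * abel (t - y)) * indicator {y<..<M} t)"
   using xy by (intro nn_integral_cong) (auto simp: abel_def indicator_def)
  ultimately show ?thesis by simp
 qed
 show ?thesis
 proof (cases "x < y")
  case False
  then show ?thesis using main[of y x] assms by (simp add: mult.commute add.commute abs_minus_commute)
 qed (use main assms in simp)
qed

text \<open>Both roots lie between \<open>sqrt (M / 2)\<close> and \<open>sqrt (2 * M)\<close>, so
  the square of their sum is within a factor 2 of \<open>4 * M\<close>, an error of at most
  \<open>ln 2\<close>.\<close>

lemma abs_log_sum_sqrt_le: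
 assumes "\<bar>x\<bar> \<le> c" "\<bar>y\<bar> \<le> c" "2 * c < M" "0 \<le> c"
 shows "\<bar>2 * ln (sqrt (M - x) + sqrt (M - y)) - ln (4 * M)\<bar> \<le> 1"
proof -
 have M: "M > 0" using assms by linarith
 define u where "u = sqrt (M - x) + sqrt (M - y)"
 have lo: "sqrt (M / 2) \<le> sqrt (M - x)" "sqrt (M / 2) \<le> sqrt (M - y)" using assms by (intro real_sqrt_le_mono; linarith)+
 have hi: "sqrt (M - x) \<le> sqrt (2 * M)" "sqrt (M - y) \<le> sqrt (2 * M)" using assms M by (intro real_sqrt_le_mono; linarith)+
 have u: "2 * sqrt (M / 2) \<le> u" "u \<le> 2 * sqrt (2 * M)" unfolding u_def using lo hi by linarith+
 have u0: "0 < u" using u(1) M by (smt (verit) real_sqrt_gt_zero half_gt_zero)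
 have "(2 * sqrt (M / 2))\<^sup>2 \<le> u\<^sup>2" using u(1) M by (intro power_mono) auto
 then have 1: "2 * M \<le> u\<^sup>2" using M by (simp add: power_mult_distrib)
 have "u\<^sup>2 \<le> (2 * sqrt (2 * M))\<^sup>2" using u(2) u0 by (intro power_mono) auto
 then have 2: "u\<^sup>2 \<le> 8 * M" using M by (simp add: power_mult_distrib)
 have "ln (2 * M) \<le> ln (u\<^sup>2)" "ln (u\<^sup>2) \<le> ln (8 * M)" using 1 2 M u0 by (auto simp: ln_le_cancel_iff)
 moreover have "ln (u\<^sup>2) = 2 * ln u" using u0 by (simp add: ln_realpow)
 moreover have "ln (4 * M) = ln 2 + ln (2 * M)" using M ln_mult[of 2 "2 * M"] by simp
 moreover have "ln (8 * M) = ln 2 + ln (4 * M)" using M ln_mult[of 2 "4 * M"] by simp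
 moreover have "ln 2 \<le> (1 :: real)" using ln_le_minus_one[of "2 :: real"] by simp
 ultimately show ?thesis unfolding u_def[symmetric] by linarith
qed

lemma integrable_abel_mult:
 fixes w :: "real \<Rightarrow> real"
 assumes w [measurable]: "w \<in> borel_fun" and W: "\<And>t. \<bar>w t\<bar> \<le> W" and w0: "\<forall>t. t < a \<longrightarrow> w t = 0"
 shows "integrable lborel (\<lambda>x. abel (t - x) * w x)"
proof -
 have "integrable lborel (\<lambda>x. abel (t - x) * indicator {0<..<\<bar>t - a\<bar> + 1} (t - x))"
 proof (rule integrableI_nonneg)
  have "(NN x. ennreal (abel (t - x) * indicator {0<..<\<bar>t - a\<bar> + 1} (t - x))) = (NN x. ennreal (abel x * indicator {0<..<\<bar>t - a\<bar> + 1} x))"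
   by (rule nn_integral_reflect_shift[of "\<lambda>s. ennreal (abel s * indicator {0<..<\<bar>t - a\<bar> + 1} s)"]) measurable
  also have "\<dots> = (NN x. ennreal (abel x) * indicator {0<..<\<bar>t - a\<bar> + 1} x)"
   by (intro nn_integral_cong) (auto simp: indicator_def)
  also have "\<dots> < \<infinity>" by (subst nn_integral_abel) auto
  finally show "(NN x. ennreal (abel (t - x) * indicator {0<..<\<bar>t - a\<bar> + 1} (t - x))) < \<infinity>" .
 qed (auto simp: abel_nonneg)
 then have "integrable lborel (\<lambda>x. w x * (abel (t - x) * indicator {0<..<\<bar>t - a\<bar> + 1} (t - x)))"
  by (rule integrable_mult_bounded[OF _ _ W]) simp
 moreover have "w x * (abel (t - x) * indicator {0<..<\<bar>t - a\<bar> + 1} (t - x)) = abel (t - x) * w x" for x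
  using w0 by (cases "x < a") (auto simp: indicator_def abel_def)
 ultimately show ?thesis by simp
qed

text \<open>Up to height \<open>M\<close>, the squared norm is the double integral of
  \<open>w x * w y\<close> against \<open>R + ln (4 * M) - ln |x - y|\<close>. Mean zero removes the
  divergent constant, \<open>R\<close> tends to 0 under a uniform bound, and monotone convergence
  lets the window grow.\<close>

lemma abel_energy:
 fixes w :: "real \<Rightarrow> real"
 assumes w [measurable]: "w \<in> borel_fun" and W: "\<And>t. \<bar>w t\<bar> \<le> W" and w0: "\<forall>t. t \<notin> {a..b} \<longrightarrow> w t = 0"
  and mean: "(LB x. w x) = 0"
 shows "(NN t. ennreal ((conv w abel t)\<^sup>2)) = ennreal (- (LINT p|lborel2. w (fst p) * w (snd p) * ln \<bar>fst p - snd p\<bar>))"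
  and "0 \<le> - (LINT p|lborel2. w (fst p) * w (snd p) * ln \<bar>fst p - snd p\<bar>)"
proof -
 have wi: "integrable lborel w" by (rule integrable_bounded_support[OF w W w0])
 define c where "c = max \<bar>a\<bar> \<bar>b\<bar>"
 have c: "\<bar>x\<bar> \<le> c" if "x \<in> {a..b}" for x using that by (auto simp: c_def)
 have c0: "0 \<le> c" by (simp add: c_def)
 \<comment> \<open>The offset keeps the end of every window beyond \<open>2 * c\<close>, well past
   the support of \<open>w\<close>.\<close>
 obtain n0 where n0: "2 * c < real n0" using reals_Archimedean2 by blast
 define M where "M n = real (n + n0)" for n
 have M: "2 * c < M n" for n using n0 by (simp add: M_def)
 define \<kappa> where "\<kappa> n p = (LB t. abel (t - fst p) * abel (t - snd p) * indicator {..<M n} t)" for n p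
 define R where "R n p = 2 * ln (sqrt (M n - fst p) + sqrt (M n - snd p)) - ln (4 * M n)" for n and p :: "real \<times> real"
 have Rb: "\<bar>R n p\<bar> \<le> 1" if "fst p \<in> {a..b}" "snd p \<in> {a..b}" for n p
  unfolding R_def by (rule abs_log_sum_sqrt_le[OF c[OF that(1)] c[OF that(2)] M c0])
 have lt: "x < M n" if "x \<in> {a..b}" for x n using c[OF that] M[of n] c0 by linarith
 have corr: "(NN t. ennreal (abel (t - fst p) * abel (t - snd p) * indicator {..<M n} t)) = ennreal (R n p + ln (4 * M n) - ln \<bar>fst p - snd p\<bar>)"
  if "fst p \<noteq> snd p" "fst p \<in> {a..b}" "snd p \<in> {a..b}" for n p
  using nn_integral_abel_correlation[OF that(1) lt[OF that(2)] lt[OF that(3)]] by (simp add: R_def)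
 \<comment> \<open>\<open>ennreal\<close> sends negative reals to 0, so the correlation becomes an
   equation between reals only once its sign is known.\<close>
 have corr_nn: "0 \<le> R n p + ln (4 * M n) - ln \<bar>fst p - snd p\<bar>" if p: "fst p \<noteq> snd p" "fst p \<in> {a..b}" "snd p \<in> {a..b}" for n p
 proof -
  have "\<bar>fst p - snd p\<bar> \<le> 2 * c" using c[OF p(2)] c[OF p(3)] by linarith
  then have "ln \<bar>fst p - snd p\<bar> \<le> ln (M n)" using M[of n] p(1) by (subst ln_le_cancel_iff) auto
  moreover have "0 < M n" using M[of n] c0 by linarith
  then have "ln (4 * M n) = ln 4 + ln (M n)" using ln_mult[of 4 "M n"] by simp
  moreover have "ln 4 = 2 * ln (2 :: real)" using ln_realpow[of "2 :: real" 2] by simp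
  moreover have "1 \<le> 2 * ln (2 :: real)" using ln_ge_iff[of 2 "1/2"] exp_half_le2 by simp
  ultimately show ?thesis using Rb[OF p(2,3), of n] by linarith
 qed
 have \<kappa>: "\<kappa> n p = R n p + ln (4 * M n) - ln \<bar>fst p - snd p\<bar>" if "fst p \<noteq> snd p" "fst p \<in> {a..b}" "snd p \<in> {a..b}" for n p
  unfolding \<kappa>_def using corr[OF that] corr_nn[OF that]
  by (subst integral_eq_nn_integral) (auto simp: abel_nonneg)
 have mi: "integrable lborel2 (\<lambda>p. W\<^sup>2 * log_majorant a b p)" by (intro integrable_mult_right integrable_log_majorant)
 have bd: "AE p in lborel2. norm (w (fst p) * w (snd p) * (R n p - ln \<bar>fst p - snd p\<bar>)) \<le> W\<^sup>2 * log_majorant a b p" for n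
  using AE_lborel2_neq
 proof eventually_elim
  case (elim p)
  show ?case unfolding real_norm_def
  proof (rule log_majorant_bound[OF W w0])
   assume "fst p \<in> {a..b}" "snd p \<in> {a..b}"
   then have "\<bar>R n p\<bar> \<le> 1" by (rule Rb)
   moreover have "\<bar>ln \<bar>fst p - snd p\<bar>\<bar> \<le> \<bar>fst p - snd p\<bar> + 2 * abel (fst p - snd p) + 2 * abel (snd p - fst p)"
    using abs_ln_abs_le[of "fst p - snd p"] elim by simp
   moreover have "0 \<le> (fst p - snd p)\<^sup>2" by simp
   ultimately show "\<bar>R n p - ln \<bar>fst p - snd p\<bar>\<bar> \<le> 1 + \<bar>fst p - snd p\<bar> + (fst p - snd p)\<^sup>2 + 2 * abel (fst p - snd p) + 2 * abel (snd p - fst p)"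
    by linarith
  qed
 qed
 have Rmeas [measurable]: "R n \<in> borel_measurable lborel2" for n unfolding R_def [abs_def] by measurable
 have int: "integrable lborel2 (\<lambda>p. w (fst p) * w (snd p) * (R n p - ln \<bar>fst p - snd p\<bar>))" for n
  using bd log_majorant_nonneg by (intro Bochner_Integration.integrable_bound[OF mi]) (auto elim!: eventually_mono)
 have ww: "integrable lborel2 (\<lambda>p. w (fst p) * w (snd p))" "(LINT p|lborel2. w (fst p) * w (snd p)) = 0"
  using integrable_lborel2_mult[OF wi wi] mean by auto
 have part: "(NN t. ennreal ((conv abel w t)\<^sup>2) * indicator {..<M n} t) =
   ennreal (LINT p|lborel2. w (fst p) * w (snd p) * (R n p - ln \<bar>fst p - snd p\<bar>))"
  and part_nn: "0 \<le> (LINT p|lborel2. w (fst p) * w (snd p) * (R n p - ln \<bar>fst p - snd p\<bar>))" for n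
 proof -
  have fin: "(\<integral>\<^sup>+p. ennreal \<bar>w (fst p) * w (snd p)\<bar> * (NN t. ennreal \<bar>abel (t - fst p) * abel (t - snd p)\<bar> * indicator {..<M n} t) \<partial>lborel2) < \<infinity>"
  proof -
   have "(\<integral>\<^sup>+p. ennreal \<bar>w (fst p) * w (snd p)\<bar> * (NN t. ennreal \<bar>abel (t - fst p) * abel (t - snd p)\<bar> * indicator {..<M n} t) \<partial>lborel2)
    \<le> (\<integral>\<^sup>+p. ennreal (norm (w (fst p) * w (snd p) * (R n p - ln \<bar>fst p - snd p\<bar>) + ln (4 * M n) * (w (fst p) * w (snd p)))) \<partial>lborel2)"
   proof (rule nn_integral_mono_AE)
    show "AE p in lborel2. ennreal \<bar>w (fst p) * w (snd p)\<bar> * (NN t. ennreal \<bar>abel (t - fst p) * abel (t - snd p)\<bar> * indicator {..<M n} t)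
     \<le> ennreal (norm (w (fst p) * w (snd p) * (R n p - ln \<bar>fst p - snd p\<bar>) + ln (4 * M n) * (w (fst p) * w (snd p))))"
     using AE_lborel2_neq
    proof eventually_elim
     case (elim p)
     show ?case
     proof (cases "fst p \<in> {a..b} \<and> snd p \<in> {a..b}")
      case True
      have "(NN t. ennreal \<bar>abel (t - fst p) * abel (t - snd p)\<bar> * indicator {..<M n} t) = (NN t. ennreal (abel (t - fst p) * abel (t - snd p) * indicator {..<M n} t))"
       by (intro nn_integral_cong) (auto simp: indicator_def abel_nonneg abs_mult)
      also have "\<dots> = ennreal (R n p + ln (4 * M n) - ln \<bar>fst p - snd p\<bar>)" using corr elim True by blast
      finally have "ennreal \<bar>w (fst p) * w (snd p)\<bar> * (NN t. ennreal \<bar>abel (t - fst p) * abel (t - snd p)\<bar> * indicator {..<M n} t) =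
        ennreal (\<bar>w (fst p) * w (snd p)\<bar> * (R n p + ln (4 * M n) - ln \<bar>fst p - snd p\<bar>))"
       using corr_nn[of p n] elim True by (simp add: ennreal_mult)
      also have "\<bar>w (fst p) * w (snd p)\<bar> * (R n p + ln (4 * M n) - ln \<bar>fst p - snd p\<bar>) = norm (w (fst p) * w (snd p) * (R n p + ln (4 * M n) - ln \<bar>fst p - snd p\<bar>))"
       using corr_nn[of p n] elim True by (simp add: abs_mult)
      also have "w (fst p) * w (snd p) * (R n p + ln (4 * M n) - ln \<bar>fst p - snd p\<bar>) = w (fst p) * w (snd p) * (R n p - ln \<bar>fst p - snd p\<bar>) + ln (4 * M n) * (w (fst p) * w (snd p))"
       by (simp add: algebra_simps)
      finally show ?thesis by simp
     next
      case False
      then have z: "w (fst p) * w (snd p) = 0" using w0 by auto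
      show ?thesis unfolding z by simp
     qed
    qed
   qed
   also have "\<dots> < \<infinity>"
    using Bochner_Integration.integrable_add[OF int[of n] integrable_mult_right[OF ww(1), of "ln (4 * M n)"]] unfolding integrable_iff_bounded by blast
   finally show ?thesis .
  qed
  have kint: "integrable lborel (\<lambda>x. abel (t - x) * w x)" for t
   by (rule integrable_abel_mult[OF w W, of a]) (use w0 in auto)
  have 1: "(NN t. ennreal ((conv abel w t)\<^sup>2) * indicator {..<M n} t) = ennreal (LINT p|lborel2. w (fst p) * w (snd p) * \<kappa> n p)"
   and 2: "0 \<le> (LINT p|lborel2. w (fst p) * w (snd p) * \<kappa> n p)"
   using conv_square_integral[OF kernel_measurable(2) w _ kint fin] unfolding \<kappa>_def by auto
  have "(LINT p|lborel2. w (fst p) * w (snd p) * \<kappa> n p) =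
    (LINT p|lborel2. w (fst p) * w (snd p) * (R n p - ln \<bar>fst p - snd p\<bar>) + ln (4 * M n) * (w (fst p) * w (snd p)))"
  proof (rule integral_cong_AE)
   show "(\<lambda>p. w (fst p) * w (snd p) * \<kappa> n p) \<in> borel_measurable lborel2" unfolding \<kappa>_def by measurable
   show "AE p in lborel2. w (fst p) * w (snd p) * \<kappa> n p = w (fst p) * w (snd p) * (R n p - ln \<bar>fst p - snd p\<bar>) + ln (4 * M n) * (w (fst p) * w (snd p))"
    using AE_lborel2_neq
   proof eventually_elim
    case (elim p)
    show ?case
    proof (cases "fst p \<in> {a..b} \<and> snd p \<in> {a..b}")
     case True
     then have k: "\<kappa> n p = R n p + ln (4 * M n) - ln \<bar>fst p - snd p\<bar>" using \<kappa>[of p n] elim by blast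
     show ?thesis unfolding k by (simp add: algebra_simps)
    next
     case False
     then have z: "w (fst p) * w (snd p) = 0" using w0 by auto
     show ?thesis unfolding z by simp
    qed
   qed
  qed measurable
  also have "\<dots> = (LINT p|lborel2. w (fst p) * w (snd p) * (R n p - ln \<bar>fst p - snd p\<bar>))"
   using ww int[of n] by (subst Bochner_Integration.integral_add) auto
  finally have 3: "(LINT p|lborel2. w (fst p) * w (snd p) * \<kappa> n p) = (LINT p|lborel2. w (fst p) * w (snd p) * (R n p - ln \<bar>fst p - snd p\<bar>))" .
  show "(NN t. ennreal ((conv abel w t)\<^sup>2) * indicator {..<M n} t) =
    ennreal (LINT p|lborel2. w (fst p) * w (snd p) * (R n p - ln \<bar>fst p - snd p\<bar>))"
   and "0 \<le> (LINT p|lborel2. w (fst p) * w (snd p) * (R n p - ln \<bar>fst p - snd p\<bar>))"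
   using 1 2 unfolding 3 .
 qed
 have l0: "(\<lambda>n. LINT p|lborel2. w (fst p) * w (snd p) * (R n p - ln \<bar>fst p - snd p\<bar>)) \<longlonglongrightarrow> (LINT p|lborel2. w (fst p) * w (snd p) * (0 - ln \<bar>fst p - snd p\<bar>))"
 proof (rule integral_dominated_convergence[OF _ _ mi _ bd])
  show "AE p in lborel2. (\<lambda>n. w (fst p) * w (snd p) * (R n p - ln \<bar>fst p - snd p\<bar>)) \<longlonglongrightarrow> w (fst p) * w (snd p) * (0 - ln \<bar>fst p - snd p\<bar>)"
  proof (intro always_eventually allI tendsto_mult tendsto_diff tendsto_const)
   fix p :: "real \<times> real"
   have "((\<lambda>M. 2 * ln (sqrt (M - fst p) + sqrt (M - snd p)) - (2 * ln 2 + ln M)) \<longlongrightarrow> 0) at_top" by real_asymp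
   moreover have "\<forall>\<^sub>F M in at_top. 2 * ln (sqrt (M - fst p) + sqrt (M - snd p)) - (2 * ln 2 + ln M) =
     2 * ln (sqrt (M - fst p) + sqrt (M - snd p)) - ln (4 * M)"
    using eventually_gt_at_top[of 0]
   proof eventually_elim
    case (elim M)
    then show ?case using ln_mult[of 4 M] ln_realpow[of "2 :: real" 2] by simp
   qed
   ultimately have "((\<lambda>M. 2 * ln (sqrt (M - fst p) + sqrt (M - snd p)) - ln (4 * M)) \<longlongrightarrow> 0) at_top"
    by (rule Lim_transform_eventually)
   moreover have "filterlim M at_top sequentially" unfolding M_def by real_asymp
   ultimately show "(\<lambda>n. R n p) \<longlonglongrightarrow> 0" unfolding R_def by (rule filterlim_compose)
  qed
 qed measurable
 have "0 \<le> (LINT p|lborel2. w (fst p) * w (snd p) * (0 - ln \<bar>fst p - snd p\<bar>))"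
  by (rule LIMSEQ_le_const[OF l0]) (use part_nn in auto)
 then show "0 \<le> - (LINT p|lborel2. w (fst p) * w (snd p) * ln \<bar>fst p - snd p\<bar>)" by simp
 from l0 have l1: "(\<lambda>n. ennreal (LINT p|lborel2. w (fst p) * w (snd p) * (R n p - ln \<bar>fst p - snd p\<bar>))) \<longlonglongrightarrow> ennreal (- (LINT p|lborel2. w (fst p) * w (snd p) * ln \<bar>fst p - snd p\<bar>))"
  by (intro tendsto_ennrealI) simp
 have l2: "(\<lambda>n. \<integral>\<^sup>+t. ennreal ((conv abel w t)\<^sup>2) * indicator {..<M n} t \<partial>lborel) \<longlonglongrightarrow> (NN t. ennreal ((conv abel w t)\<^sup>2))"
 proof (rule nn_integral_LIMSEQ)
  show "incseq (\<lambda>n t. ennreal ((conv abel w t)\<^sup>2) * indicator {..<M n} t)"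
   by (auto simp: incseq_def le_fun_def indicator_def M_def)
  fix t
  obtain m where m: "t < real m" using reals_Archimedean2 by blast
  have "\<forall>\<^sub>F n in sequentially. ennreal ((conv abel w t)\<^sup>2) = ennreal ((conv abel w t)\<^sup>2) * indicator {..<M n} t"
   using eventually_ge_at_top[of m] by eventually_elim (use m in \<open>auto simp: indicator_def M_def\<close>)
  then show "(\<lambda>n. ennreal ((conv abel w t)\<^sup>2) * indicator {..<M n} t) \<longlonglongrightarrow> ennreal ((conv abel w t)\<^sup>2)"
   by (rule Lim_transform_eventually[OF tendsto_const])
 qed measurable
 show "(NN t. ennreal ((conv w abel t)\<^sup>2)) = ennreal (- (LINT p|lborel2. w (fst p) * w (snd p) * ln \<bar>fst p - snd p\<bar>))"
  using LIMSEQ_unique[OF l2[unfolded part] l1] by (simp add: conv_commute[of w])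
qed

lemma conv_abel_difference_quotient:
 fixes h :: "real \<Rightarrow> real"
 assumes h [measurable]: "h \<in> borel_fun" and B: "\<And>t. \<bar>h t\<bar> \<le> B" and h0: "\<forall>t. t \<notin> {-c..c} \<longrightarrow> h t = 0"
 shows "conv (\<lambda>t. (h (t + \<delta>) - h t) / \<delta>) abel t = (conv h abel (t + \<delta>) - conv h abel t) / \<delta>"
proof -
 have i: "integrable lborel (\<lambda>s. h (t - s) * abel s)" for t
 proof -
  have "integrable lborel (\<lambda>x. abel (t - x) * h x)"
   by (rule integrable_abel_mult[OF h B, of "-c"]) (use h0 in auto)
  then have "integrable lborel (\<lambda>x. abel (t - (t + (-1) * x)) * h (t + (-1) * x))"
   by (rule lborel_integrable_real_affine) simp
  then show ?thesis by (simp add: mult.commute)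
 qed
 have "conv (\<lambda>t. (h (t + \<delta>) - h t) / \<delta>) abel t = (LB s. h (t + \<delta> - s) * abel s - h (t - s) * abel s) / \<delta>"
  unfolding conv_def by (subst integral_divide_zero[symmetric]) (auto intro!: Bochner_Integration.integral_cong simp: algebra_simps diff_divide_distrib)
 also have "\<dots> = (conv h abel (t + \<delta>) - conv h abel t) / \<delta>"
  unfolding conv_def by (subst Bochner_Integration.integral_diff[OF i i]) simp
 finally show ?thesis .
qed

text \<open>Moving the difference quotient from the second copy of \<open>w\<close> onto the kernel
  writes the energy as a limit of pairings of \<open>w\<close> with \<open>diff_log_kernel\<close>
  convolved with \<open>h\<close>, the pairings which the commutator estimate bounds. The energy is
  invariant under reflection, so both one-sided Abel transforms share the value
  \<open>E\<close>.\<close>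

lemma difference_quotient_energy:
 fixes h :: "real \<Rightarrow> real"
 assumes h [measurable]: "h \<in> borel_fun" and B: "\<And>t. \<bar>h t\<bar> \<le> B" and h0: "\<forall>t. t \<notin> {-c..c} \<longrightarrow> h t = 0"
  and d: "\<delta> > 0"
 defines "w \<equiv> \<lambda>t. (h (t + \<delta>) - h t) / \<delta>"
  and "w' \<equiv> \<lambda>t. (h (- (t + \<delta>)) - h (- t)) / \<delta>"
 defines "E \<equiv> - (LINT p|lborel2. w (fst p) * w (snd p) * ln \<bar>fst p - snd p\<bar>)"
 shows "(NN t. ennreal ((conv w abel t)\<^sup>2)) = ennreal E" "0 \<le> E"
  and "(NN t. ennreal ((conv w' abel t)\<^sup>2)) = ennreal E"
  and "(\<lambda>n. - (LB x. w x * conv (diff_log_kernel \<delta> (1 / real (Suc n))) h x)) \<longlonglongrightarrow> E"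
  and "\<And>n. \<bar>LB x. w x * conv (diff_log_kernel \<delta> (1 / real (Suc n))) h x\<bar> \<le> (2 * B / \<delta>)\<^sup>2 * (LINT p|lborel2. log_majorant (- (c + \<delta>)) (c + \<delta>) p)"
proof -
 have wm [measurable]: "w \<in> borel_fun" "w' \<in> borel_fun" unfolding w_def w'_def by measurable
 have b: "\<bar>h x - h y\<bar> / \<delta> \<le> 2 * B / \<delta>" for x y
  using B[of x] B[of y] d by (intro divide_right_mono) linarith+
 have W: "\<bar>w t\<bar> \<le> 2 * B / \<delta>" "\<bar>w' t\<bar> \<le> 2 * B / \<delta>" for t
  using b[of "t + \<delta>" t] b[of "- (t + \<delta>)" "- t"] d unfolding w_def w'_def by (simp_all add: abs_divide)
 have w0: "\<forall>t. t \<notin> {- (c + \<delta>)..c + \<delta>} \<longrightarrow> w t = 0" "\<forall>t. t \<notin> {- (c + \<delta>)..c + \<delta>} \<longrightarrow> w' t = 0"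
  using h0 d unfolding w_def w'_def by auto
 have hi: "integrable lborel h" by (rule integrable_bounded_support[OF h B h0])
 have w'w: "w' t = - w (- t - \<delta>)" for t
 proof -
  have e: "- (t + \<delta>) = - t - \<delta>" "- t - \<delta> + \<delta> = - t" by auto
  show ?thesis unfolding w_def w'_def by (simp only: e minus_divide_left minus_diff_eq)
 qed
 have mean: "(LB x. w x) = 0"
 proof -
  have "integrable lborel (\<lambda>t. h (t + \<delta>))" using lborel_integrable_real_affine[OF hi, of 1 \<delta>] by (simp add: add.commute)
  moreover have "(LB t. h (t + \<delta>)) = (LB t. h t)"
   by (subst (2) lborel_integral_real_affine[of 1 _ \<delta>]) (auto simp: add.commute)
  ultimately show ?thesis unfolding w_def using hi by simp
 qed
 have mean': "(LB x. w' x) = 0"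
  using mean unfolding w'w by (subst (asm) lborel_integral_real_affine[of "-1" _ "- \<delta>"]) (auto simp: algebra_simps)
 show "(NN t. ennreal ((conv w abel t)\<^sup>2)) = ennreal E" "0 \<le> E"
  unfolding E_def by (rule abel_energy[OF wm(1) W(1) w0(1) mean])+
 have lim: "(\<lambda>n. - (LB x. w x * conv (log_kernel (1 / real (Suc n))) w x)) \<longlonglongrightarrow> E"
  unfolding E_def by (intro tendsto_minus log_kernel_energy(3)[OF wm(1) W(1) w0(1)])
 \<comment> \<open>\<open>w'\<close> is, up to sign, \<open>w\<close> reflected and shifted, and
   \<open>log_kernel\<close> is even.\<close>
 have refl: "(LB x. w' x * conv (log_kernel e) w' x) = (LB x. w x * conv (log_kernel e) w x)" for e
 proof -
  have lk: "log_kernel e (- r) = log_kernel e r" for r by (simp add: log_kernel_def)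
  have "conv (log_kernel e) w' x = - conv (log_kernel e) w (- x - \<delta>)" for x
  proof -
   have eq: "- x - \<delta> - s = - (x + \<delta> + s)" for s by simp
   have "conv (log_kernel e) w' x = (LB s. log_kernel e (x + \<delta> + s) * - w s)"
    unfolding conv_def w'w by (subst lborel_integral_real_affine[of "-1" _ "- \<delta>"]) (auto simp: algebra_simps)
   then show ?thesis unfolding conv_def eq lk by simp
  qed
  then have "(LB x. w' x * conv (log_kernel e) w' x) = (LB x. w (- x - \<delta>) * conv (log_kernel e) w (- x - \<delta>))"
   by (simp add: w'w)
  also have "\<dots> = (LB x. w x * conv (log_kernel e) w x)"
   by (subst (2) lborel_integral_real_affine[of "-1" _ "- \<delta>"]) (auto simp: algebra_simps)
  finally show ?thesis .
 qed
 have "(\<lambda>n. - (LB x. w' x * conv (log_kernel (1 / real (Suc n))) w' x)) \<longlonglongrightarrow> - (LINT p|lborel2. w' (fst p) * w' (snd p) * ln \<bar>fst p - snd p\<bar>)"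
  by (intro tendsto_minus log_kernel_energy(3)[OF wm(2) W(2) w0(2)])
 then have "- (LINT p|lborel2. w' (fst p) * w' (snd p) * ln \<bar>fst p - snd p\<bar>) = E"
  using lim unfolding refl by (rule LIMSEQ_unique)
 then show "(NN t. ennreal ((conv w' abel t)\<^sup>2)) = ennreal E"
  using abel_energy(1)[OF wm(2) W(2) w0(2) mean'] by simp
 have swap: "conv (log_kernel e) w x = conv (diff_log_kernel \<delta> e) h x" if e: "e > 0" for e x
 proof -
  have i: "integrable lborel (\<lambda>s. log_kernel e (y - s) * h s)" for y
   by (rule integrable_continuous_mult[OF _ h B h0]) (intro continuous_on_compose2[OF log_kernel_continuous[OF e]] continuous_intros, auto)
  have i': "integrable lborel (\<lambda>s. log_kernel e (x - s) * h (s + \<delta>))"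
   using lborel_integrable_real_affine[OF i[of "x + \<delta>"], of 1 \<delta>] by (simp add: algebra_simps)
  have "conv (log_kernel e) w x = (LB s. log_kernel e (x - s) * h (s + \<delta>) - log_kernel e (x - s) * h s) / \<delta>"
   unfolding conv_def w_def by (subst integral_divide_zero[symmetric]) (auto intro!: Bochner_Integration.integral_cong simp: algebra_simps diff_divide_distrib)
  also have "\<dots> = ((LB s. log_kernel e (x - s) * h (s + \<delta>)) - (LB s. log_kernel e (x - s) * h s)) / \<delta>"
   by (subst Bochner_Integration.integral_diff[OF i' i]) simp
  also have "(LB s. log_kernel e (x - s) * h (s + \<delta>)) = (LB s. log_kernel e (x + \<delta> - s) * h s)"
   by (subst (2) lborel_integral_real_affine[of 1 _ \<delta>]) (auto simp: algebra_simps)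
  also have "((LB s. log_kernel e (x + \<delta> - s) * h s) - (LB s. log_kernel e (x - s) * h s)) / \<delta> =
   (LB s. log_kernel e (x + \<delta> - s) * h s - log_kernel e (x - s) * h s) / \<delta>"
   by (subst Bochner_Integration.integral_diff[OF i i]) simp
  also have "\<dots> = conv (diff_log_kernel \<delta> e) h x"
   unfolding conv_def diff_log_kernel_def by (subst integral_divide_zero[symmetric]) (auto intro!: Bochner_Integration.integral_cong simp: algebra_simps diff_divide_distrib)
  finally show ?thesis .
 qed
 show "(\<lambda>n. - (LB x. w x * conv (diff_log_kernel \<delta> (1 / real (Suc n))) h x)) \<longlonglongrightarrow> E"
  using lim by (simp add: swap)
 show "\<bar>LB x. w x * conv (diff_log_kernel \<delta> (1 / real (Suc n))) h x\<bar> \<le> (2 * B / \<delta>)\<^sup>2 * (LINT p|lborel2. log_majorant (- (c + \<delta>)) (c + \<delta>) p)" for n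
  using log_kernel_energy(2)[OF wm(1) W(1) w0(1), of "1 / real (Suc n)"] by (simp add: swap)
qed

section \<open>Shears of the Heisenberg group\<close>

text \<open>Common form of left translations, horizontal flows and vertical translations: the
  vertical shift depends on \<open>z\<close> only. Such maps preserve Lebesgue measure and commute
  with vertical translations and vertical convolutions.\<close>

definition shear :: "'a::euclidean_space \<Rightarrow> ('a \<Rightarrow> real) \<Rightarrow> 'a \<times> real \<Rightarrow> 'a \<times> real" where
 "shear z0 c p = (fst p + z0, snd p + c (fst p))"

lemma borel_measurable_slice:
 fixes f :: "'a::euclidean_space \<times> real \<Rightarrow> 'b::topological_space"
 assumes "f \<in> borel_fun"
 shows "(\<lambda>t. f (z, t)) \<in> borel_fun"
 by (rule measurable_compose[OF _ assms]) (auto intro!: borel_measurable_continuous_onI continuous_intros)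

lemma borel_prod_pair: "(borel :: ('a::euclidean_space \<times> real) measure) = borel \<Otimes>\<^sub>M borel"
 by (simp add: borel_prod)

lemma lborel_prod_pair: "(lborel :: ('a::euclidean_space \<times> real) measure) = lborel \<Otimes>\<^sub>M lborel"
 by (simp add: lborel_prod)

lemma nn_integral_lborel_slices:
 fixes f :: "'a::euclidean_space \<times> real \<Rightarrow> ennreal"
 assumes "f \<in> borel_fun"
 shows "(NN p. f p) = (NN z. (NN t. f (z, t)))"
 unfolding lborel_prod_pair using assms by (subst lborel.nn_integral_fst) (auto simp: borel_prod_pair)

lemma integral_lborel_slices:
 fixes f :: "'a::euclidean_space \<times> real \<Rightarrow> real"
 assumes "integrable lborel f"
 shows "(LB p. f p) = (LB z. (LB t. f (z, t)))"
  and "integrable lborel (\<lambda>z. LB t. f (z, t))"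
  and "AE z in lborel. integrable lborel (\<lambda>t. f (z, t))"
proof -
 have i: "integrable (lborel \<Otimes>\<^sub>M lborel) f" using assms by (simp add: lborel_prod)
 show "(LB p. f p) = (LB z. (LB t. f (z, t)))"
  using lborel_pair.integral_fst'[OF i] by (simp add: lborel_prod)
 show "integrable lborel (\<lambda>z. LB t. f (z, t))" by (rule lborel_pair.integrable_fst'[OF i])
 show "AE z in lborel. integrable lborel (\<lambda>t. f (z, t))" by (rule lborel_pair.AE_integrable_fst'[OF i])
qed

lemma shear_measurable [measurable]:
 fixes z0 :: "'a::euclidean_space"
 assumes [measurable]: "c \<in> borel_fun"
 shows "shear z0 c \<in> borel_fun"
 unfolding shear_def [abs_def] borel_prod_pair by measurable

lemma nn_integral_lborel_translation:
 fixes f :: "'a::euclidean_space \<Rightarrow> ennreal"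
 assumes [measurable]: "f \<in> borel_fun"
 shows "(NN z. f (z + z0)) = (NN z. f z)"
 by (subst lborel_distr_plus[of z0, symmetric], subst nn_integral_distr) (auto simp: add.commute)

lemma nn_integral_shear:
 fixes f :: "'a::euclidean_space \<times> real \<Rightarrow> ennreal"
 assumes c [measurable]: "c \<in> borel_fun" and f [measurable]: "f \<in> borel_fun"
 shows "(NN p. f (shear z0 c p)) = (NN p. f p)"
proof -
 have [measurable]: "f \<in> borel_measurable (borel \<Otimes>\<^sub>M borel)" using f by (simp add: borel_prod)
 have "(\<lambda>p. f (shear z0 c p)) \<in> borel_fun" by measurable
 then have "(NN p. f (shear z0 c p)) = (NN z. (NN t. f (z + z0, t + c z)))"
  by (subst nn_integral_lborel_slices) (auto simp: shear_def)
 also have "\<dots> = (NN z. (NN t. f (z + z0, t)))"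
  by (intro nn_integral_cong nn_integral_lborel_translation borel_measurable_slice f)
 also have "\<dots> = (NN z. (NN t. f (z, t)))"
  by (rule nn_integral_lborel_translation) measurable
 also have "\<dots> = (NN p. f p)" by (rule nn_integral_lborel_slices[OF f, symmetric])
 finally show ?thesis .
qed

lemma distr_shear:
 fixes z0 :: "'a::euclidean_space"
 assumes [measurable]: "c \<in> borel_fun"
 shows "distr lborel lborel (shear z0 c) = lborel"
proof (rule measure_eqI)
 fix A assume "A \<in> sets (distr lborel lborel (shear z0 c))"
 then have [measurable]: "A \<in> sets borel" by simp
 have "emeasure (distr lborel lborel (shear z0 c)) A = (\<integral>\<^sup>+p. indicator A p \<partial>distr lborel lborel (shear z0 c))"
  by (subst nn_integral_indicator) auto
 also have "\<dots> = (NN p. indicator A (shear z0 c p))" by (subst nn_integral_distr) auto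
 also have "\<dots> = (NN p. indicator A p)" by (rule nn_integral_shear) measurable
 finally show "emeasure (distr lborel lborel (shear z0 c)) A = emeasure lborel A" by simp
qed simp

lemma integral_shear:
 fixes f :: "'a::euclidean_space \<times> real \<Rightarrow> real"
 assumes c [measurable]: "c \<in> borel_fun" and f [measurable]: "f \<in> borel_fun"
 shows "(LB p. f (shear z0 c p)) = (LB p. f p)"
  and "integrable lborel (\<lambda>p. f (shear z0 c p)) \<longleftrightarrow> integrable lborel f"
proof -
 have "integral\<^sup>L (distr lborel lborel (shear z0 c)) f = (LB p. f (shear z0 c p))"
  by (rule integral_distr) auto
 then show "(LB p. f (shear z0 c p)) = (LB p. f p)" by (simp add: distr_shear)
 have "integrable (distr lborel lborel (shear z0 c)) f \<longleftrightarrow> integrable lborel (\<lambda>p. f (shear z0 c p))"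
  by (rule integrable_distr_eq) auto
 then show "integrable lborel (\<lambda>p. f (shear z0 c p)) \<longleftrightarrow> integrable lborel f" by (simp add: distr_shear)
qed

text \<open>Time-\<open>s\<close> maps of the horizontal fields. Each field is constant along its
  own integral curves, so these are straight lines in the coordinates.\<close>

definition moveX :: "'n::finite \<Rightarrow> real \<Rightarrow> 'n heis \<Rightarrow> 'n heis" where "moveX i s p = p + s *\<^sub>R X_field i p"
definition moveY :: "'n::finite \<Rightarrow> real \<Rightarrow> 'n heis \<Rightarrow> 'n heis" where "moveY i s p = p + s *\<^sub>R Y_field i p"
definition lift :: "real \<Rightarrow> 'n::finite heis \<Rightarrow> 'n heis" where "lift r p = (fst p, snd p + r)"

lemma moveX_eq: "moveX i s ((x, y), t) = ((x + s *\<^sub>R axis i 1, y), t - s * (y $ i) / 2)"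
 and moveY_eq: "moveY i s ((x, y), t) = ((x, y + s *\<^sub>R axis i 1), t + s * (x $ i) / 2)"
 by (auto simp: moveX_def moveY_def X_field_def Y_field_def)

lemma moveX_shear: "moveX i s = shear (s *\<^sub>R axis i 1, 0) (\<lambda>z. - s * (snd z $ i) / 2)"
 and moveY_shear: "moveY i s = shear (0, s *\<^sub>R axis i 1) (\<lambda>z. s * (fst z $ i) / 2)"
 and lift_shear: "lift r = shear 0 (\<lambda>z. r)"
 by (auto simp: fun_eq_iff shear_def moveX_eq moveY_eq lift_def)

lemma move_coeff_measurable [measurable]:
 "(\<lambda>z :: 'n::finite plane. - s * (snd z $ i) / 2) \<in> borel_fun"
 "(\<lambda>z :: 'n::finite plane. s * (fst z $ i) / 2) \<in> borel_fun"
 by (auto intro!: borel_measurable_continuous_onI continuous_intros)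

lemma shear_shear: "shear z0 c (shear z1 d p) = shear (z1 + z0) (\<lambda>z. d z + c (z + z1)) p"
 by (simp add: shear_def add.assoc)

definition is_shear :: "('n::finite heis \<Rightarrow> 'n heis) \<Rightarrow> bool" where
 "is_shear T \<longleftrightarrow> (\<exists>z0 c. c \<in> borel_fun \<and> T = shear z0 c)"

lemma is_shear_comp:
 assumes "is_shear T" "is_shear U" shows "is_shear (\<lambda>p. T (U p))"
proof -
 obtain z0 c z1 d where [measurable]: "c \<in> borel_fun" "d \<in> borel_fun"
  and T: "T = shear z0 c" and U: "U = shear z1 d" using assms by (auto simp: is_shear_def)
 have "(\<lambda>z. d z + c (z + z1)) \<in> borel_fun" by measurable
 then show ?thesis unfolding is_shear_def T U shear_shear by blast
qed

lemma is_shear_move: "is_shear (moveX i s)" "is_shear (moveY i s)" "is_shear (lift r)"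
 unfolding moveX_shear moveY_shear lift_shear is_shear_def
 by (rule exI, rule exI, rule conjI[OF _ refl], measurable)+

lemma is_shear_measurable: "is_shear T \<Longrightarrow> T \<in> borel_fun"
 unfolding is_shear_def using shear_measurable by blast

lemma is_shear_lift: "is_shear T \<Longrightarrow> T (lift r p) = lift r (T p)"
 by (auto simp: is_shear_def shear_def lift_def)

lemma is_shear_nn_integral:
 "is_shear T \<Longrightarrow> f \<in> borel_fun \<Longrightarrow> (NN p. f (T p)) = (NN p. f p)"
 unfolding is_shear_def using nn_integral_shear by blast

lemma is_shear_integral:
 fixes f :: "'n::finite heis \<Rightarrow> real"
 assumes "is_shear T" "f \<in> borel_fun"
 shows "(LB p. f (T p)) = (LB p. f p)" "integrable lborel (\<lambda>p. f (T p)) \<longleftrightarrow> integrable lborel f"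
 using assms integral_shear unfolding is_shear_def by blast+

lemma move_inverse: "moveX i (- s) (moveX i s p) = p" "moveX i s (moveX i (- s) p) = p"
 "moveY i (- s) (moveY i s p) = p" "moveY i s (moveY i (- s) p) = p"
 by (cases p; cases "fst p"; simp add: moveX_eq moveY_eq)+

text \<open>The bracket of the fields \<open>X\<close> and \<open>Y\<close> with the same index is
  the vertical derivative. As the group has step two, the commutator of the flows has no further
  terms and is a translation by exactly \<open>s^2\<close>.\<close>

lemma move_commutator: "moveY i s (moveX i s p) = lift (s\<^sup>2) (moveX i s (moveY i s p))"
proof -
 obtain x y t where p: "p = ((x, y), t)" by (metis prod.collapse)
 show ?thesis by (simp add: p moveX_eq moveY_eq lift_def power2_eq_square field_simps)
qed

section \<open>Vertical convolution and the commutator pairing\<close>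

definition vconv :: "(real \<Rightarrow> real) \<Rightarrow> ('n::finite heis \<Rightarrow> real) \<Rightarrow> 'n heis \<Rightarrow> real" where
 "vconv k f p = conv k (\<lambda>t. f (fst p, t)) (snd p)"

lemma vconv_measurable:
 fixes f :: "'n::finite heis \<Rightarrow> real"
 assumes [measurable]: "k \<in> borel_fun" and f: "f \<in> borel_fun"
 shows "vconv k f \<in> borel_fun"
proof -
 have [measurable]: "f \<in> borel_measurable (borel \<Otimes>\<^sub>M borel)" using f by (simp add: borel_prod)
 have "(\<lambda>p. LB s. k (snd p - s) * f (fst p, s)) \<in> borel_measurable (borel \<Otimes>\<^sub>M borel)" by measurable
 then show ?thesis by (simp add: vconv_def [abs_def] conv_def borel_prod)
qed

lemma vconv_shear:
 assumes "is_shear T" shows "vconv k f (T p) = vconv k (\<lambda>q. f (T q)) p"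
proof -
 obtain z0 c where T: "T = shear z0 c" using assms by (auto simp: is_shear_def)
 show ?thesis
  unfolding T vconv_def conv_def shear_def fst_conv snd_conv
  by (subst lborel_integral_real_affine[of 1 _ "c (fst p)"]) (auto simp: algebra_simps)
qed

text \<open>The bound \<open>c\<close> on the vertical support may depend on \<open>z\<close>,
  because a shear moves each line by its own amount; this makes the class stable under
  shears.\<close>

definition slab :: "real \<Rightarrow> ('n::finite heis \<Rightarrow> real) \<Rightarrow> bool" where
 "slab B f \<longleftrightarrow> f \<in> borel_fun \<and> (\<forall>p. \<bar>f p\<bar> \<le> B) \<and> (\<forall>z. \<exists>c. \<forall>t. t \<notin> {-c..c} \<longrightarrow> f (z, t) = 0)"

lemma slabD:
 assumes "slab B f"
 shows "f \<in> borel_fun" "\<bar>f p\<bar> \<le> B" "\<exists>c. \<forall>t. t \<notin> {-c..c} \<longrightarrow> f (z, t) = 0"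
 using assms unfolding slab_def by blast+

lemma slab_shear:
 assumes "slab B f" "is_shear T" shows "slab B (\<lambda>p. f (T p))"
proof -
 obtain z0 d where T: "T = shear z0 d" using assms by (auto simp: is_shear_def)
 have "\<exists>c. \<forall>t. t \<notin> {-c..c} \<longrightarrow> f (T (z, t)) = 0" for z
 proof -
  obtain c where c: "\<forall>t. t \<notin> {-c..c} \<longrightarrow> f (z + z0, t) = 0" using assms(1) unfolding slab_def by blast
  show ?thesis
  proof (intro exI[of _ "\<bar>c\<bar> + \<bar>d z\<bar>"] allI impI)
   fix t assume "t \<notin> {- (\<bar>c\<bar> + \<bar>d z\<bar>)..\<bar>c\<bar> + \<bar>d z\<bar>}"
   then have "t + d z \<notin> {-c..c}" by auto
   then show "f (T (z, t)) = 0" using c by (simp add: T shear_def)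
  qed
 qed
 moreover have "(\<lambda>p. f (T p)) \<in> borel_fun"
  by (rule measurable_compose[OF is_shear_measurable[OF assms(2)] slabD(1)[OF assms(1)]])
 ultimately show ?thesis using assms(1) unfolding slab_def by blast
qed

lemma slab_diff:
 assumes "slab B f" "slab C g" shows "slab (B + C) (\<lambda>p. f p - g p)"
proof -
 have "\<exists>c. \<forall>t. t \<notin> {-c..c} \<longrightarrow> f (z, t) - g (z, t) = 0" for z
 proof -
  obtain c d where c: "\<forall>t. t \<notin> {-c..c} \<longrightarrow> f (z, t) = 0" and d: "\<forall>t. t \<notin> {-d..d} \<longrightarrow> g (z, t) = 0"
   using assms unfolding slab_def by metis
  show ?thesis
  proof (intro exI[of _ "\<bar>c\<bar> + \<bar>d\<bar>"] allI impI)
   fix t assume "t \<notin> {- (\<bar>c\<bar> + \<bar>d\<bar>)..\<bar>c\<bar> + \<bar>d\<bar>}"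
   then have "t \<notin> {-c..c}" "t \<notin> {-d..d}" by auto
   then show "f (z, t) - g (z, t) = 0" using c d by simp
  qed
 qed
 moreover have "\<bar>f p - g p\<bar> \<le> B + C" for p using slabD(2)[OF assms(1), of p] slabD(2)[OF assms(2), of p] by linarith
 moreover have "(\<lambda>p. f p - g p) \<in> borel_fun" using slabD(1)[OF assms(1)] slabD(1)[OF assms(2)] by measurable
 ultimately show ?thesis unfolding slab_def by blast
qed

lemma vconv_diff:
 assumes f: "slab B f" and g: "slab C g" and k: "continuous_on UNIV k"
 shows "vconv k f p - vconv k g p = vconv k (\<lambda>q. f q - g q) p"
proof -
 have i: "integrable lborel (\<lambda>s. k (snd p - s) * u (fst p, s))" if u: "slab A u" for A u
 proof -
  obtain c where c: "\<forall>t. t \<notin> {-c..c} \<longrightarrow> u (fst p, t) = 0" using u unfolding slab_def by blast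
  have "continuous_on UNIV (\<lambda>s. k (snd p - s))"
   by (intro continuous_on_compose2[OF k] continuous_intros) auto
  then show ?thesis
   by (rule integrable_continuous_mult[OF _ borel_measurable_slice[OF slabD(1)[OF u]] slabD(2)[OF u] c])
 qed
 show ?thesis unfolding vconv_def conv_def
  by (subst Bochner_Integration.integral_diff[OF i[OF f] i[OF g], symmetric]) (simp add: right_diff_distrib)
qed

text \<open>Isolates what the commutator argument uses of \<open>diff_log_kernel\<close>;
  \<open>A\<close> bounds the square of the operator norm.\<close>

definition L2_bounded_kernel :: "real \<Rightarrow> (real \<Rightarrow> real) \<Rightarrow> bool" where
 "L2_bounded_kernel A k \<longleftrightarrow> continuous_on UNIV k \<and> 0 \<le> A \<and>
  (\<forall>w B c. w \<in> borel_fun \<longrightarrow> (\<forall>t. \<bar>w t\<bar> \<le> B) \<longrightarrow> (\<forall>t. t \<notin> {-c..c} \<longrightarrow> w t = 0) \<longrightarrow>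
    (NN t. ennreal ((conv k w t)\<^sup>2)) \<le> ennreal A * (NN t. ennreal ((w t)\<^sup>2)))"

lemma L2_bounded_diff_log_kernel:
 "0 < e \<Longrightarrow> 0 < \<delta> \<Longrightarrow> L2_bounded_kernel (pi\<^sup>2) (diff_log_kernel \<delta> e)"
 unfolding L2_bounded_kernel_def
 by (auto intro!: conv_diff_log_kernel_L2 diff_log_kernel_continuous)

lemma vconv_L2:
 fixes f :: "'n::finite heis \<Rightarrow> real"
 assumes k: "L2_bounded_kernel A k" and f: "slab B f"
 shows "(NN p. ennreal ((vconv k f p)\<^sup>2)) \<le> ennreal A * (NN p. ennreal ((f p)\<^sup>2))"
proof -
 have km: "k \<in> borel_fun" using k by (auto simp: L2_bounded_kernel_def intro: borel_measurable_continuous_onI)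
 have fm [measurable]: "f \<in> borel_fun" using f by (simp add: slab_def)
 note [measurable] = vconv_measurable[OF km fm]
 have "(NN p. ennreal ((vconv k f p)\<^sup>2)) = (NN z. (NN t. ennreal ((conv k (\<lambda>t. f (z, t)) t)\<^sup>2)))"
 proof -
  have m: "(\<lambda>p. ennreal ((vconv k f p)\<^sup>2)) \<in> borel_fun" by measurable
  show ?thesis by (subst nn_integral_lborel_slices[OF m]) (simp add: vconv_def)
 qed
 also have "\<dots> \<le> (NN z. ennreal A * (NN t. ennreal ((f (z, t))\<^sup>2)))"
 proof (rule nn_integral_mono)
  fix z
  obtain c where "\<forall>t. t \<notin> {-c..c} \<longrightarrow> f (z, t) = 0" using f unfolding slab_def by blast
  then show "(NN t. ennreal ((conv k (\<lambda>t. f (z, t)) t)\<^sup>2)) \<le> ennreal A * (NN t. ennreal ((f (z, t))\<^sup>2))"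
   using k f borel_measurable_slice[OF fm, of z] unfolding L2_bounded_kernel_def slab_def by blast
 qed
 also have "\<dots> = ennreal A * (NN z. (NN t. ennreal ((f (z, t))\<^sup>2)))"
 proof (rule nn_integral_cmult)
  have [measurable]: "f \<in> borel_measurable (borel \<Otimes>\<^sub>M borel)" using fm by (simp add: borel_prod)
  show "(\<lambda>z. \<integral>\<^sup>+t. ennreal ((f (z, t))\<^sup>2) \<partial>lborel) \<in> borel_measurable lborel" by measurable
 qed
 also have "\<dots> = ennreal A * (NN p. ennreal ((f p)\<^sup>2))" using nn_integral_lborel_slices[of "\<lambda>p. ennreal ((f p)\<^sup>2)"] by simp
 finally show ?thesis .
qed

text \<open>Cauchy-Schwarz with the arithmetic mean in place of the geometric one. The factors to be
  paired have squared norms of the same order, so this costs only a constant.\<close>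

lemma integrable_mult_L2:
 fixes u v :: "'a \<Rightarrow> real"
 assumes [measurable]: "u \<in> borel_measurable M" "v \<in> borel_measurable M"
  and u: "(\<integral>\<^sup>+x. ennreal ((u x)\<^sup>2) \<partial>M) \<le> ennreal a" and v: "(\<integral>\<^sup>+x. ennreal ((v x)\<^sup>2) \<partial>M) \<le> ennreal b"
  and ab: "0 \<le> a" "0 \<le> b"
 shows "integrable M (\<lambda>x. u x * v x)" "\<bar>LINT x|M. u x * v x\<bar> \<le> (a + b) / 2"
proof -
 have "(\<integral>\<^sup>+x. ennreal (norm (u x * v x)) \<partial>M) \<le> (\<integral>\<^sup>+x. ennreal (1/2) * (ennreal ((u x)\<^sup>2) + ennreal ((v x)\<^sup>2)) \<partial>M)"
 proof (rule nn_integral_mono)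
  fix x
  have "norm (u x * v x) \<le> 1/2 * ((u x)\<^sup>2 + (v x)\<^sup>2)"
   using sum_squares_bound[of "\<bar>u x\<bar>" "\<bar>v x\<bar>"] by (simp add: abs_mult mult.assoc)
  then have "ennreal (norm (u x * v x)) \<le> ennreal (1/2 * ((u x)\<^sup>2 + (v x)\<^sup>2))" by (rule ennreal_leI)
  also have "\<dots> = ennreal (1/2) * (ennreal ((u x)\<^sup>2) + ennreal ((v x)\<^sup>2))"
   by (subst ennreal_mult) (auto simp: ennreal_plus)
  finally show "ennreal (norm (u x * v x)) \<le> ennreal (1/2) * (ennreal ((u x)\<^sup>2) + ennreal ((v x)\<^sup>2))" .
 qed
 also have "\<dots> = ennreal (1/2) * ((\<integral>\<^sup>+x. ennreal ((u x)\<^sup>2) \<partial>M) + (\<integral>\<^sup>+x. ennreal ((v x)\<^sup>2) \<partial>M))"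
  by (subst nn_integral_cmult) (auto simp: nn_integral_add)
 also have "\<dots> \<le> ennreal (1/2) * (ennreal a + ennreal b)" by (intro mult_left_mono add_mono u v) auto
 also have "\<dots> = ennreal (1/2 * (a + b))" using ab by (subst ennreal_mult) (auto simp: ennreal_plus)
 also have "1/2 * (a + b) = (a + b) / 2" by simp
 finally have le: "(\<integral>\<^sup>+x. ennreal (norm (u x * v x)) \<partial>M) \<le> ennreal ((a + b) / 2)" .
 show i: "integrable M (\<lambda>x. u x * v x)"
  by (rule integrableI_bounded) (use le_less_trans[OF le] in auto)
 have "ennreal \<bar>LINT x|M. u x * v x\<bar> \<le> ennreal ((a + b) / 2)"
  using order_trans[OF integral_norm_bound_ennreal[OF i] le] by simp
 then show "\<bar>LINT x|M. u x * v x\<bar> \<le> (a + b) / 2" using ab by (simp add: ennreal_le_iff)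
qed

text \<open>The difference vanishes off the preimages of \<open>S\<close> under \<open>T\<close> and
  \<open>U\<close>, each of measure at most \<open>\<mu>\<close>; hence the factor 2.\<close>

lemma nn_integral_difference_le:
 fixes f :: "'n::finite heis \<Rightarrow> real"
 assumes f: "slab B f" and S [measurable]: "S \<in> sets borel" and fS: "\<And>p. p \<notin> S \<Longrightarrow> f p = 0" and \<mu>: "emeasure lborel S \<le> ennreal \<mu>" "0 \<le> \<mu>"
  and T: "is_shear T" and U: "is_shear U" and le: "\<And>p. \<bar>f (T p) - f (U p)\<bar> \<le> a"
 shows "(NN p. ennreal ((f (T p) - f (U p))\<^sup>2)) \<le> ennreal (2 * a\<^sup>2 * \<mu>)"
proof -
 note [measurable] = is_shear_measurable[OF T] is_shear_measurable[OF U]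
 have a: "0 \<le> a" using le[of undefined] by linarith
 have "(NN p. ennreal ((f (T p) - f (U p))\<^sup>2)) \<le> (NN p. ennreal (a\<^sup>2) * (indicator S (T p) + indicator S (U p)))"
 proof (rule nn_integral_mono)
  fix p
  have sq: "(f (T p) - f (U p))\<^sup>2 \<le> a\<^sup>2" using le[of p] a by (simp add: abs_le_square_iff[symmetric])
  show "ennreal ((f (T p) - f (U p))\<^sup>2) \<le> ennreal (a\<^sup>2) * (indicator S (T p) + indicator S (U p))"
  proof (cases "T p \<in> S \<or> U p \<in> S")
   case True
   then have "1 \<le> (indicator S (T p) + indicator S (U p) :: ennreal)" by (auto simp: indicator_def)
   then have "ennreal (a\<^sup>2) * 1 \<le> ennreal (a\<^sup>2) * (indicator S (T p) + indicator S (U p))" by (rule mult_left_mono) simp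
   then show ?thesis using order_trans[OF ennreal_leI[OF sq]] by simp
  qed (simp add: fS)
 qed
 also have "\<dots> = ennreal (a\<^sup>2) * ((NN p. indicator S (T p)) + (NN p. indicator S (U p)))"
  by (subst nn_integral_cmult) (auto simp: nn_integral_add)
 also have "(NN p. indicator S (T p)) = emeasure lborel S"
  by (subst is_shear_nn_integral[OF T, of "indicator S"]) auto
 also have "(NN p. indicator S (U p)) = emeasure lborel S"
  by (subst is_shear_nn_integral[OF U, of "indicator S"]) auto
 also have "ennreal (a\<^sup>2) * (emeasure lborel S + emeasure lborel S) \<le> ennreal (a\<^sup>2) * (ennreal \<mu> + ennreal \<mu>)"
  by (intro mult_left_mono add_mono \<mu>) simp
 also have "\<dots> = ennreal (2 * a\<^sup>2 * \<mu>)"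
  using \<mu>(2) by (simp add: ennreal_plus[symmetric] ennreal_mult[symmetric] mult_ac del: ennreal_plus)
 finally show ?thesis .
qed

text \<open>One pair of directions with the same index already generates the vertical translations,
  so a single \<open>i\<close> is recorded.\<close>

definition horizontally_lipschitz :: "'n::finite \<Rightarrow> real \<Rightarrow> ('n heis \<Rightarrow> real) \<Rightarrow> bool" where
 "horizontally_lipschitz i L f \<longleftrightarrow> (\<forall>s p. \<bar>f (moveX i s p) - f p\<bar> \<le> L * \<bar>s\<bar> \<and> \<bar>f (moveY i s p) - f p\<bar> \<le> L * \<bar>s\<bar>)"

lemma vconv_L2_le:
 fixes f :: "'n::finite heis \<Rightarrow> real"
 assumes k: "L2_bounded_kernel A k" and f: "slab B f" and le: "(NN p. ennreal ((f p)\<^sup>2)) \<le> ennreal M" and M: "0 \<le> M"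
 shows "(NN p. ennreal ((vconv k f p)\<^sup>2)) \<le> ennreal (A * M)"
proof -
 have A: "0 \<le> A" using k by (simp add: L2_bounded_kernel_def)
 have "(NN p. ennreal ((vconv k f p)\<^sup>2)) \<le> ennreal A * (NN p. ennreal ((f p)\<^sup>2))"
  by (rule vconv_L2[OF k f])
 also have "\<dots> \<le> ennreal A * ennreal M" by (rule mult_left_mono[OF le]) simp
 also have "\<dots> = ennreal (A * M)" by (rule ennreal_mult[OF A M, symmetric])
 finally show ?thesis .
qed

text \<open>Two pairings, each at most half the sum of \<open>2 * (L * s)^2 * \<mu>\<close> for the
  plain factor and \<open>pi^2 * (2 * (5 * (L * s))^2 * \<mu>)\<close> for the convolved
  one.\<close>

definition commutator_const :: real where "commutator_const = 2 + 50 * pi\<^sup>2"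

lemma commutator_const_pos: "0 < commutator_const"
 unfolding commutator_const_def by (intro add_pos_nonneg) auto

text \<open>The vertical translation by \<open>s\<^sup>2\<close> is the commutator of the two horizontal translations by
 \<open>s\<close>. After moving one difference operator from each of the two resulting second differences to
 the other factor, both factors are of size \<open>s\<close> in \<open>L\<^sup>2\<close>; convolution in the vertical
 variable commutes with the translations.\<close>

lemma commutator_pairing:
 fixes f :: "'n::finite heis \<Rightarrow> real"
 assumes f: "slab B f" and S: "S \<in> sets borel" and fS: "\<And>p. p \<notin> S \<Longrightarrow> f p = 0"
  and \<mu>: "emeasure lborel S \<le> ennreal \<mu>" "0 \<le> \<mu>"
  and L: "horizontally_lipschitz i L f" and s: "0 < s" and k: "L2_bounded_kernel (pi\<^sup>2) k"
 shows "integrable lborel (\<lambda>p. (f (lift (s\<^sup>2) p) - f p) * vconv k f p)"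
  and "\<bar>LB p. (f (lift (s\<^sup>2) p) - f p) * vconv k f p\<bar> \<le> commutator_const * L\<^sup>2 * \<mu> * s\<^sup>2"
proof -
 have kc: "continuous_on UNIV k" using k by (simp add: L2_bounded_kernel_def)
 have km: "k \<in> borel_fun" using kc by (rule borel_measurable_continuous_onI)
 have fm [measurable]: "f \<in> borel_fun" using slabD[OF f] by simp
 have idS: "is_shear (\<lambda>p. p)" using is_shear_move(3)[of 0] by (simp add: lift_def [abs_def])
 have LX: "\<bar>f (moveX i r p) - f p\<bar> \<le> L * \<bar>r\<bar>" and LY: "\<bar>f (moveY i r p) - f p\<bar> \<le> L * \<bar>r\<bar>" for r p
  using L unfolding horizontally_lipschitz_def by blast+
 have fin: "(NN p. ennreal ((f p)\<^sup>2)) \<le> ennreal (B\<^sup>2 * \<mu>)"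
 proof -
  have "(NN p. ennreal ((f p)\<^sup>2)) \<le> (NN p. ennreal (B\<^sup>2) * indicator S p)"
  proof (rule nn_integral_mono)
   fix p
   have "(f p)\<^sup>2 \<le> B\<^sup>2" using slabD(2)[OF f, of p] by (simp add: abs_le_square_iff[symmetric])
   then show "ennreal ((f p)\<^sup>2) \<le> ennreal (B\<^sup>2) * indicator S p"
    using fS[of p] by (cases "p \<in> S") (auto intro: ennreal_leI)
  qed
  also have "\<dots> = ennreal (B\<^sup>2) * emeasure lborel S" using S by (intro nn_integral_cmult_indicator) auto
  also have "\<dots> \<le> ennreal (B\<^sup>2) * ennreal \<mu>" by (intro mult_left_mono \<mu>) simp
  also have "\<dots> = ennreal (B\<^sup>2 * \<mu>)" using \<mu>(2) by (intro ennreal_mult[symmetric]) auto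
  finally show ?thesis .
 qed
 define T where "T p = moveX i s (moveY i s p)" for p
 have T: "is_shear T" unfolding T_def [abs_def] by (rule is_shear_comp[OF is_shear_move(1) is_shear_move(2)])
 define G where "G = vconv k f"
 have Gm [measurable]: "G \<in> borel_fun" unfolding G_def by (rule vconv_measurable[OF km fm])
 have G2: "(NN p. ennreal ((G p)\<^sup>2)) \<le> ennreal (pi\<^sup>2 * (B\<^sup>2 * \<mu>))"
  unfolding G_def by (rule vconv_L2_le[OF k f fin]) (use \<mu> in auto)
 define \<alpha> where "\<alpha> p = f (moveX i s p) - f p" for p
 define \<beta> where "\<beta> p = f (moveY i s p) - f p" for p
 note [measurable] = is_shear_measurable[OF is_shear_move(1)[of i]] is_shear_measurable[OF is_shear_move(2)[of i]]
  is_shear_measurable[OF T] is_shear_measurable[OF is_shear_move(3)]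
 have \<alpha>m [measurable]: "\<alpha> \<in> borel_fun" and \<beta>m [measurable]: "\<beta> \<in> borel_fun"
  unfolding \<alpha>_def [abs_def] \<beta>_def [abs_def] by measurable
 have \<alpha>2: "(NN p. ennreal ((\<alpha> p)\<^sup>2)) \<le> ennreal (2 * (L * s)\<^sup>2 * \<mu>)"
  unfolding \<alpha>_def by (rule nn_integral_difference_le[OF f S fS \<mu> is_shear_move(1) idS]) (use LX[of s] s in auto)
 have \<beta>2: "(NN p. ennreal ((\<beta> p)\<^sup>2)) \<le> ennreal (2 * (L * s)\<^sup>2 * \<mu>)"
  unfolding \<beta>_def by (rule nn_integral_difference_le[OF f S fS \<mu> is_shear_move(2) idS]) (use LY[of s] s in auto)
 define eX where "eX p = f (T (moveX i (- s) p)) - f (T p)" for p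
 define eY where "eY p = f (T (moveY i (- s) p)) - f (T p)" for p
 have TX: "is_shear (\<lambda>p. T (moveX i (- s) p))" and TY: "is_shear (\<lambda>p. T (moveY i (- s) p))"
  by (rule is_shear_comp[OF T is_shear_move(1)], rule is_shear_comp[OF T is_shear_move(2)])
 have Tb: "\<bar>f (T p) - f p\<bar> \<le> L * s + L * s" for p
  using LX[of s "moveY i s p"] LY[of s p] s unfolding T_def by linarith
 have LX': "\<bar>f (moveX i (- s) p) - f p\<bar> \<le> L * s" and LY': "\<bar>f (moveY i (- s) p) - f p\<bar> \<le> L * s" for p
  using LX[of "- s" p] LY[of "- s" p] s by auto
 \<comment> \<open>\<open>T\<close> does not commute with the moves. Passing from
   \<open>T (moveX i (- s) p)\<close> through \<open>moveX i (- s) p\<close> and \<open>p\<close> to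
   \<open>T p\<close> takes 2 + 1 + 2 = 5 moves of length \<open>s\<close>.\<close>
 have eXb: "\<bar>eX p\<bar> \<le> 5 * (L * s)" and eYb: "\<bar>eY p\<bar> \<le> 5 * (L * s)" for p
  unfolding eX_def eY_def
  using Tb[of p] Tb[of "moveX i (- s) p"] Tb[of "moveY i (- s) p"] LX'[of p] LY'[of p] by linarith+
 have eX2: "(NN p. ennreal ((eX p)\<^sup>2)) \<le> ennreal (2 * (5 * (L * s))\<^sup>2 * \<mu>)"
  unfolding eX_def by (rule nn_integral_difference_le[OF f S fS \<mu> TX T]) (use eXb in \<open>auto simp: eX_def\<close>)
 have eY2: "(NN p. ennreal ((eY p)\<^sup>2)) \<le> ennreal (2 * (5 * (L * s))\<^sup>2 * \<mu>)"
  unfolding eY_def by (rule nn_integral_difference_le[OF f S fS \<mu> TY T]) (use eYb in \<open>auto simp: eY_def\<close>)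
 have sX: "slab (B + B) eX" and sY: "slab (B + B) eY"
  unfolding eX_def eY_def by (intro slab_diff slab_shear[OF f] TX TY T)+
 have VX2: "(NN p. ennreal ((vconv k eX p)\<^sup>2)) \<le> ennreal (pi\<^sup>2 * (2 * (5 * (L * s))\<^sup>2 * \<mu>))"
  by (rule vconv_L2_le[OF k sX eX2]) (use \<mu> in auto)
 have VY2: "(NN p. ennreal ((vconv k eY p)\<^sup>2)) \<le> ennreal (pi\<^sup>2 * (2 * (5 * (L * s))\<^sup>2 * \<mu>))"
  by (rule vconv_L2_le[OF k sY eY2]) (use \<mu> in auto)
 have VXm: "vconv k eX \<in> borel_fun" and VYm: "vconv k eY \<in> borel_fun"
  using vconv_measurable[OF km] slabD(1)[OF sX] slabD(1)[OF sY] by auto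
 define G' where "G' p = G (T p)" for p
 have G'm [measurable]: "G' \<in> borel_fun" unfolding G'_def [abs_def] by measurable
 have G'2: "(NN p. ennreal ((G' p)\<^sup>2)) \<le> ennreal (pi\<^sup>2 * (B\<^sup>2 * \<mu>))"
  unfolding G'_def using is_shear_nn_integral[OF T, of "\<lambda>p. ennreal ((G p)\<^sup>2)"] G2 by simp
 \<comment> \<open>Vertical convolution commutes with shears, so a difference of \<open>G'\<close>
   is the convolution of the corresponding difference of \<open>f\<close>.\<close>
 have shift: "G' (U p) - G' p = vconv k (\<lambda>q. f (T (U q)) - f (T q)) p" if U: "is_shear (\<lambda>p. T (U p))" for U p
 proof -
  have a: "vconv k f (T (U p)) = vconv k (\<lambda>q. f (T (U q))) p" by (rule vconv_shear[OF U])
  have b: "vconv k f (T p) = vconv k (\<lambda>q. f (T q)) p" by (rule vconv_shear[OF T])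
  show ?thesis unfolding G'_def G_def a b by (rule vconv_diff[OF slab_shear[OF f U] slab_shear[OF f T] kc])
 qed
 have GX: "G' (moveX i (- s) p) - G' p = vconv k eX p" and GY: "G' (moveY i (- s) p) - G' p = vconv k eY p" for p
  using shift[OF TX] shift[OF TY] by (simp_all add: eX_def [abs_def] eY_def [abs_def])
 have pos: "0 \<le> 2 * (L * s)\<^sup>2 * \<mu>" "0 \<le> pi\<^sup>2 * (B\<^sup>2 * \<mu>)" "0 \<le> pi\<^sup>2 * (2 * (5 * (L * s))\<^sup>2 * \<mu>)" using \<mu> by auto
 \<comment> \<open>Discrete integration by parts: a measure-preserving change of variables moves the
   difference operator from \<open>u\<close> to \<open>G'\<close>.\<close>
 have part: "integrable lborel (\<lambda>p. (u (U p) - u p) * G' p) \<and> \<bar>LB p. (u (U p) - u p) * G' p\<bar> \<le> (2 * (L * s)\<^sup>2 * \<mu> + pi\<^sup>2 * (2 * (5 * (L * s))\<^sup>2 * \<mu>)) / 2"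
  if u [measurable]: "u \<in> borel_fun" and u2: "(NN p. ennreal ((u p)\<^sup>2)) \<le> ennreal (2 * (L * s)\<^sup>2 * \<mu>)"
   and U: "is_shear U" and inv: "\<And>p. U' (U p) = p"
   and V: "\<And>p. G' (U' p) - G' p = V p" and Vm [measurable]: "V \<in> borel_fun"
   and V2: "(NN p. ennreal ((V p)\<^sup>2)) \<le> ennreal (pi\<^sup>2 * (2 * (5 * (L * s))\<^sup>2 * \<mu>))" for u V U U'
 proof -
  note [measurable] = is_shear_measurable[OF U]
  have G'eq: "G' (U' p) = G' p + V p" for p using V[of p] by simp
  have i1: "integrable lborel (\<lambda>p. u p * G' p)" by (rule integrable_mult_L2(1)[OF _ _ u2 G'2 pos(1,2)]) auto
  have i2: "integrable lborel (\<lambda>p. u p * V p)" and v: "\<bar>LB p. u p * V p\<bar> \<le> (2 * (L * s)\<^sup>2 * \<mu> + pi\<^sup>2 * (2 * (5 * (L * s))\<^sup>2 * \<mu>)) / 2"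
   by (rule integrable_mult_L2[OF _ _ u2 V2 pos(1,3)]; auto)+
  have i3: "integrable lborel (\<lambda>p. u p * (G' p + V p))" using i1 i2 by (simp add: distrib_left)
  have i4: "integrable lborel (\<lambda>p. u (U p) * (G' (U p) + V (U p)))"
   using is_shear_integral(2)[OF U, of "\<lambda>p. u p * (G' p + V p)"] i3 by simp
  have eq: "(u (U p) - u p) * G' p = u (U p) * (G' (U p) + V (U p)) - u p * G' p" for p
   using G'eq[of "U p"] inv[of p] by (simp add: left_diff_distrib)
  have "(LB p. (u (U p) - u p) * G' p) = (LB p. u (U p) * (G' (U p) + V (U p))) - (LB p. u p * G' p)"
   unfolding eq by (rule Bochner_Integration.integral_diff[OF i4 i1])
  also have "(LB p. u (U p) * (G' (U p) + V (U p))) = (LB p. u p * (G' p + V p))"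
   by (rule is_shear_integral(1)[OF U, of "\<lambda>p. u p * (G' p + V p)"]) measurable
  also have "\<dots> = (LB p. u p * G' p) + (LB p. u p * V p)"
   unfolding distrib_left by (rule Bochner_Integration.integral_add[OF i1 i2])
  finally show ?thesis using v eq Bochner_Integration.integrable_diff[OF i4 i1] by simp
 qed
 have pX: "integrable lborel (\<lambda>p. (\<beta> (moveX i s p) - \<beta> p) * G' p) \<and> \<bar>LB p. (\<beta> (moveX i s p) - \<beta> p) * G' p\<bar> \<le> (2 * (L * s)\<^sup>2 * \<mu> + pi\<^sup>2 * (2 * (5 * (L * s))\<^sup>2 * \<mu>)) / 2"
  by (rule part[OF \<beta>m \<beta>2 is_shear_move(1) move_inverse(1) GX VXm VX2])
 have pY: "integrable lborel (\<lambda>p. (\<alpha> (moveY i s p) - \<alpha> p) * G' p) \<and> \<bar>LB p. (\<alpha> (moveY i s p) - \<alpha> p) * G' p\<bar> \<le> (2 * (L * s)\<^sup>2 * \<mu> + pi\<^sup>2 * (2 * (5 * (L * s))\<^sup>2 * \<mu>)) / 2"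
  by (rule part[OF \<alpha>m \<alpha>2 is_shear_move(2) move_inverse(3) GY VYm VY2])
 define F where "F p = (f (lift (s\<^sup>2) p) - f p) * G p" for p
 have Fm: "F \<in> borel_fun" unfolding F_def [abs_def] by measurable
 \<comment> \<open>The two mixed second differences share all terms except the one in which both
   moves are applied; these two terms are the values of \<open>f\<close> at the two ends of the
   commutator.\<close>
 have FT: "F (T p) = (\<beta> (moveX i s p) - \<beta> p) * G' p - (\<alpha> (moveY i s p) - \<alpha> p) * G' p" for p
 proof -
  have "f (lift (s\<^sup>2) (T p)) - f (T p) = (\<beta> (moveX i s p) - \<beta> p) - (\<alpha> (moveY i s p) - \<alpha> p)"
   unfolding T_def move_commutator[of i s p, symmetric] \<alpha>_def \<beta>_def by simp
  then show ?thesis by (simp add: F_def G'_def left_diff_distrib)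
 qed
 have "integrable lborel (\<lambda>p. F (T p))" unfolding FT using pX pY by (intro Bochner_Integration.integrable_diff) auto
 then show "integrable lborel (\<lambda>p. (f (lift (s\<^sup>2) p) - f p) * vconv k f p)"
  using is_shear_integral(2)[OF T Fm] by (simp add: F_def [abs_def] G_def)
 have "(LB p. F p) = (LB p. F (T p))" by (rule is_shear_integral(1)[OF T Fm, symmetric])
 also have "\<dots> = (LB p. (\<beta> (moveX i s p) - \<beta> p) * G' p) - (LB p. (\<alpha> (moveY i s p) - \<alpha> p) * G' p)"
  unfolding FT using pX pY by (intro Bochner_Integration.integral_diff) auto
 finally have eq: "(LB p. F p) = (LB p. (\<beta> (moveX i s p) - \<beta> p) * G' p) - (LB p. (\<alpha> (moveY i s p) - \<alpha> p) * G' p)" .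
 have arith: "I = x - y \<Longrightarrow> \<bar>x\<bar> \<le> N / 2 \<Longrightarrow> \<bar>y\<bar> \<le> N / 2 \<Longrightarrow> \<bar>I\<bar> \<le> N" for I x y N :: real by linarith
 have "\<bar>LB p. F p\<bar> \<le> 2 * (L * s)\<^sup>2 * \<mu> + pi\<^sup>2 * (2 * (5 * (L * s))\<^sup>2 * \<mu>)"
  by (rule arith[OF eq conjunct2[OF pX] conjunct2[OF pY]])
 also have "\<dots> = commutator_const * L\<^sup>2 * \<mu> * s\<^sup>2"
  by (simp add: commutator_const_def power2_eq_square algebra_simps)
 finally show "\<bar>LB p. (f (lift (s\<^sup>2) p) - f p) * vconv k f p\<bar> \<le> commutator_const * L\<^sup>2 * \<mu> * s\<^sup>2"
  by (simp add: F_def G_def)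
qed

section \<open>A square-integrable vertical derivative of the Abel transform\<close>

lemma conv_abel_continuous:
 fixes h :: "real \<Rightarrow> real"
 assumes h: "continuous_on UNIV h" and B: "\<And>t. \<bar>h t\<bar> \<le> B" and h0: "\<forall>t. t \<notin> {-c..c} \<longrightarrow> h t = 0"
 shows "continuous_on UNIV (conv h abel)"
 unfolding continuous_on_sequentially comp_def
proof (intro allI impI ballI)
 fix X :: "nat \<Rightarrow> real" and t :: real assume "(\<forall>n. X n \<in> UNIV) \<and> X \<longlonglongrightarrow> t"
 then have X: "X \<longlonglongrightarrow> t" by simp
 have [measurable]: "h \<in> borel_fun" using h by (rule borel_measurable_continuous_onI)
 obtain K where K: "\<And>n. \<bar>X n\<bar> \<le> K" using convergent_imp_Bseq[OF convergentI[OF X]] by (auto simp: Bseq_def)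
 define T where "T = \<bar>K\<bar> + \<bar>c\<bar> + 1"
 have T: "T > 0" by (simp add: T_def)
 have B0: "0 \<le> B" using B[of 0] by (simp add: order_trans[OF abs_ge_zero])
 have "integrable lborel (\<lambda>s. abel s * indicator {0<..<T} s)"
 proof (rule integrableI_nonneg)
  have "(NN s. ennreal (abel s * indicator {0<..<T} s)) = (NN s. ennreal (abel s) * indicator {0<..<T} s)"
   by (intro nn_integral_cong) (auto simp: indicator_def)
  also have "\<dots> < \<infinity>" using T by (subst nn_integral_abel) auto
  finally show "(NN s. ennreal (abel s * indicator {0<..<T} s)) < \<infinity>" .
 qed (auto simp: abel_nonneg)
 then have wi: "integrable lborel (\<lambda>s. B * (abel s * indicator {0<..<T} s))" by (rule integrable_mult_right)
 show "(\<lambda>n. conv h abel (X n)) \<longlonglongrightarrow> conv h abel t"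
  unfolding conv_def
 proof (rule integral_dominated_convergence[OF _ _ wi])
  show "AE s in lborel. (\<lambda>n. h (X n - s) * abel s) \<longlonglongrightarrow> h (t - s) * abel s"
  proof (intro always_eventually allI tendsto_mult tendsto_const)
   fix s show "(\<lambda>n. h (X n - s)) \<longlonglongrightarrow> h (t - s)"
    by (rule continuous_on_tendsto_compose[OF h tendsto_diff[OF X tendsto_const]]) auto
  qed
  show "AE s in lborel. norm (h (X n - s) * abel s) \<le> B * (abel s * indicator {0<..<T} s)" for n
  proof (intro always_eventually allI)
   fix s
   show "norm (h (X n - s) * abel s) \<le> B * (abel s * indicator {0<..<T} s)"
   proof (cases "0 < s \<and> s < T")
    case True
    then show ?thesis using B[of "X n - s"] by (simp add: abs_mult abel_nonneg mult_right_mono)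
   next
    case False
    then have "X n - s < - c \<or> s \<le> 0" using K[of n] by (auto simp: T_def)
    then have z: "h (X n - s) * abel s = 0" using h0 by (auto simp: abel_def)
    show ?thesis unfolding z using B0 by (simp add: abel_nonneg)
   qed
  qed
 qed measurable
qed

text \<open>A finite liminf gives one bound for infinitely many steps. The Abel transform vanishes
  at \<open>- c\<close>, which fixes the constant of integration.\<close>

lemma half_primitive_exists:
 fixes h :: "real \<Rightarrow> real"
 assumes h: "continuous_on UNIV h" and B: "\<And>t. \<bar>h t\<bar> \<le> B" and h0: "\<forall>t. t \<notin> {-c..c} \<longrightarrow> h t = 0" and c: "0 < c"
  and fin: "liminf (\<lambda>m. \<integral>\<^sup>+t. ennreal (((conv h abel (t + 1 / real (Suc m)) - conv h abel t) / (1 / real (Suc m)))\<^sup>2) \<partial>lborel) < \<infinity>"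
 shows "\<exists>g. half_primitive c h g"
proof -
 define J where "J = conv h abel"
 have J: "continuous_on UNIV J" unfolding J_def by (rule conv_abel_continuous[OF h B h0])
 have [measurable]: "J \<in> borel_fun" using J by (rule borel_measurable_continuous_onI)
 define Q where "Q m = (NN t. ennreal (((J (t + 1 / real (Suc m)) - J t) / (1 / real (Suc m)))\<^sup>2))" for m
 obtain C where C: "liminf Q < C" "C < \<infinity>" using fin dense unfolding Q_def J_def by blast
 have freq: "\<exists>\<^sub>F m in sequentially. Q m < C"
 proof (rule ccontr)
  assume "\<not> (\<exists>\<^sub>F m in sequentially. Q m < C)"
  then have "\<forall>\<^sub>F m in sequentially. C \<le> Q m" by (simp add: frequently_def not_less)
  then have "C \<le> liminf Q" by (rule Liminf_bounded)
  with C show False by simp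
 qed
 have le: "(LINT t:{-c..c}|lborel. (real (Suc m) * (J (t + 1 / real (Suc m)) - J t))\<^sup>2) \<le> enn2real C" if "Q m < C" for m
 proof -
  have "(LINT t:{-c..c}|lborel. (real (Suc m) * (J (t + 1 / real (Suc m)) - J t))\<^sup>2) =
   enn2real (NN t. ennreal (indicator {-c..c} t *\<^sub>R (real (Suc m) * (J (t + 1 / real (Suc m)) - J t))\<^sup>2))"
   unfolding set_lebesgue_integral_def by (rule integral_eq_nn_integral) auto
  also have "\<dots> \<le> enn2real C"
  proof (rule enn2real_mono)
   have "(NN t. ennreal (indicator {-c..c} t *\<^sub>R (real (Suc m) * (J (t + 1 / real (Suc m)) - J t))\<^sup>2)) \<le> Q m"
    unfolding Q_def by (intro nn_integral_mono ennreal_leI) (auto simp: indicator_def mult.commute)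
   then show "(NN t. ennreal (indicator {-c..c} t *\<^sub>R (real (Suc m) * (J (t + 1 / real (Suc m)) - J t))\<^sup>2)) \<le> C"
    using that by simp
  qed (use C in auto)
  finally show ?thesis .
 qed
 have "\<exists>\<^sub>F m in sequentially. (LINT t:{-c..c}|lborel. (real (Suc m) * (J (t + 1 / real (Suc m)) - J t))\<^sup>2) \<le> enn2real C"
  by (rule frequently_elim1[OF freq le])
 from bounded_difference_quotients_imp_integral[OF J _ this] c obtain g where g: "integrable lborel g"
  "\<forall>t. t \<notin> {-c..c} \<longrightarrow> g t = 0" "\<And>x y. -c \<le> x \<Longrightarrow> x \<le> y \<Longrightarrow> y \<le> c \<Longrightarrow> (LINT t:{x..y}|lborel. g t) = J y - J x" by auto
 have "J (- c) = (LINT s|(lborel :: real measure). 0)"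
  unfolding J_def conv_def using h0 by (intro Bochner_Integration.integral_cong) (auto simp: abel_def)
 then show ?thesis using g c by (intro exI[of _ g]) (auto simp: half_primitive_def J_def)
qed

lemma slice_continuous:
 fixes f :: "'a::euclidean_space \<times> real \<Rightarrow> real"
 assumes "continuous_on UNIV f" shows "continuous_on UNIV (\<lambda>t. f (z, t))"
 by (intro continuous_on_compose2[OF assms] continuous_intros) auto

lemma slice_conv_abel_measurable:
 fixes f :: "'a::euclidean_space \<times> real \<Rightarrow> real"
 assumes "f \<in> borel_fun"
 shows "(\<lambda>p. conv (\<lambda>t. f (fst p, t)) abel (snd p)) \<in> borel_measurable (borel \<Otimes>\<^sub>M borel)"
  and "(\<lambda>p. conv (\<lambda>t. f (fst p, - t)) abel (snd p)) \<in> borel_measurable (borel \<Otimes>\<^sub>M borel)"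
proof -
 have [measurable]: "f \<in> borel_measurable (borel \<Otimes>\<^sub>M borel)" using assms by (simp add: borel_prod)
 show "(\<lambda>p. conv (\<lambda>t. f (fst p, t)) abel (snd p)) \<in> borel_measurable (borel \<Otimes>\<^sub>M borel)"
  and "(\<lambda>p. conv (\<lambda>t. f (fst p, - t)) abel (snd p)) \<in> borel_measurable (borel \<Otimes>\<^sub>M borel)"
  unfolding conv_def by measurable
qed

text \<open>Integrated over \<open>z\<close>, the regularised energies are
  \<open>- 1 / \<delta>\<close> times the commutator pairing on the whole group. With step
  \<open>s = sqrt \<delta>\<close> that pairing is of order \<open>s^2 = \<delta>\<close>, so the
  bound does not depend on \<open>\<delta>\<close>. The reflected quotient has the same energy on
  each line.\<close>

lemma vertical_difference_quotient_L2:
 fixes f :: "'n::finite heis \<Rightarrow> real"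
 assumes f [measurable]: "f \<in> borel_fun" and B: "\<And>p. \<bar>f p\<bar> \<le> B"
  and fS: "\<And>z t. norm z > \<rho> \<or> \<bar>t\<bar> > c \<Longrightarrow> f (z, t) = 0"
  and \<mu>: "emeasure lborel (cball 0 \<rho> \<times> {-c..c} :: 'n heis set) \<le> ennreal \<mu>" "0 \<le> \<mu>"
  and L: "horizontally_lipschitz i L f" and d: "0 < \<delta>"
 shows "(NN z. (NN t. ennreal (((conv (\<lambda>t. f (z, t)) abel (t + \<delta>) - conv (\<lambda>t. f (z, t)) abel t) / \<delta>)\<^sup>2))) \<le> ennreal (commutator_const * L\<^sup>2 * \<mu>)"
  and "(NN z. (NN t. ennreal (((conv (\<lambda>t. f (z, - t)) abel (t + \<delta>) - conv (\<lambda>t. f (z, - t)) abel t) / \<delta>)\<^sup>2))) \<le> ennreal (commutator_const * L\<^sup>2 * \<mu>)"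
proof -
 have off: "f (z, t) = 0 \<and> f (z, - t) = 0" if "t \<notin> {-c..c}" for z t
 proof -
  have "\<bar>t\<bar> > c" "\<bar>- t\<bar> > c" using that by auto
  then show ?thesis using fS by blast
 qed
 define h where "h z t = f (z, t)" for z t
 have hm [measurable]: "h z \<in> borel_fun" for z unfolding h_def using borel_measurable_slice[OF f] .
 have hB: "\<bar>h z t\<bar> \<le> B" for z t unfolding h_def by (rule B)
 have h0: "\<forall>t. t \<notin> {-c..c} \<longrightarrow> h z t = 0" for z unfolding h_def using off by blast
 have h0': "\<forall>t. t \<notin> {-c..c} \<longrightarrow> h z (- t) = 0" for z unfolding h_def using off by blast
 define w where "w z t = (h z (t + \<delta>) - h z t) / \<delta>" for z t
 define w' where "w' z t = (h z (- (t + \<delta>)) - h z (- t)) / \<delta>" for z t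
 define E where "E z = - (LINT p|lborel2. w z (fst p) * w z (snd p) * ln \<bar>fst p - snd p\<bar>)" for z
 define k where "k n = diff_log_kernel \<delta> (1 / real (Suc n))" for n
 define En where "En n z = - (LB x. w z x * conv (k n) (h z) x)" for n z
 define K where "K = (2 * B / \<delta>)\<^sup>2 * (LINT p|lborel2. log_majorant (- (c + \<delta>)) (c + \<delta>) p)"
 note en = difference_quotient_energy[OF hm hB h0 d]
 have E1: "(NN t. ennreal ((conv (w z) abel t)\<^sup>2)) = ennreal (E z)"
  and E0: "0 \<le> E z"
  and E2: "(NN t. ennreal ((conv (w' z) abel t)\<^sup>2)) = ennreal (E z)"
  and Elim: "(\<lambda>n. En n z) \<longlonglongrightarrow> E z"
  and EK: "\<bar>En n z\<bar> \<le> K" for z n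
  unfolding w_def [abs_def] w'_def [abs_def] E_def En_def k_def K_def using en[of z] by auto
 define s where "s = sqrt \<delta>"
 have s: "0 < s" "s\<^sup>2 = \<delta>" using d by (auto simp: s_def)
 define S where "S = (cball 0 \<rho> \<times> {-c..c} :: 'n heis set)"
 have Sm: "S \<in> sets borel" unfolding S_def by (intro borel_closed closed_Times) auto
 have fS': "f p = 0" if "p \<notin> S" for p
 proof -
  have "norm (fst p) > \<rho> \<or> snd p \<notin> {-c..c}" using that by (cases p) (auto simp: S_def)
  then have "f (fst p, snd p) = 0" using fS off by blast
  then show ?thesis by simp
 qed
 have sl: "slab B f" unfolding slab_def
 proof (intro conjI allI f B)
  show "\<exists>c. \<forall>t. t \<notin> {-c..c} \<longrightarrow> f (z, t) = 0" for z using off by blast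
 qed
 have L2: "L2_bounded_kernel (pi\<^sup>2) (k n)" for n unfolding k_def using d by (intro L2_bounded_diff_log_kernel) auto
 define F where "F n p = (f (lift (s\<^sup>2) p) - f p) * vconv (k n) f p" for n p
 have Fi: "integrable lborel (F n)" and Fb: "\<bar>LB p. F n p\<bar> \<le> commutator_const * L\<^sup>2 * \<mu> * s\<^sup>2" for n
  unfolding F_def by (rule commutator_pairing[OF sl Sm fS' _ _ L s(1) L2]; use \<mu> in \<open>simp add: S_def\<close>)+
 have En_eq: "En n z = - (1 / \<delta>) * (LB t. F n (z, t))" for n z
 proof -
  have "(LB x. w z x * conv (k n) (h z) x) = (LB x. 1 / \<delta> * F n (z, x))"
   by (intro Bochner_Integration.integral_cong) (auto simp: w_def F_def s lift_def vconv_def h_def [abs_def])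
  then show ?thesis by (simp add: En_def)
 qed
 have Eni: "integrable lborel (En n)" for n
  unfolding En_eq by (intro integrable_mult_right integral_lborel_slices(2) Fi)
 have EnI: "(LB z. En n z) \<le> commutator_const * L\<^sup>2 * \<mu>" for n
 proof -
  have "(LB z. En n z) = - (1 / \<delta>) * (LB p. F n p)"
   unfolding En_eq integral_mult_right_zero integral_lborel_slices(1)[OF Fi] ..
  also have "\<dots> = 1 / \<delta> * (- (LB p. F n p))" by simp
  also have "\<dots> \<le> 1 / \<delta> * \<bar>LB p. F n p\<bar>" using d by (intro mult_left_mono) auto
  also have "\<dots> \<le> 1 / \<delta> * (commutator_const * L\<^sup>2 * \<mu> * \<delta>)" using Fb[of n] d s by (intro mult_left_mono) auto
  finally show ?thesis using d by simp
 qed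
 \<comment> \<open>\<open>K\<close> depends on \<open>\<delta>\<close>, which stays fixed while the
   regularisation of the kernel is removed.\<close>
 have ci: "integrable lborel (\<lambda>z :: 'n plane. K * indicator (cball 0 \<rho>) z)"
  by (intro integrable_mult_right integrable_real_indicator emeasure_lborel_cball_finite) auto
 have EnK: "norm (En n z) \<le> K * indicator (cball 0 \<rho>) z" for n z
 proof (cases "norm z \<le> \<rho>")
  case False
  then have "w z x = 0" for x using fS by (simp add: w_def h_def)
  then show ?thesis using False by (simp add: En_def)
 qed (use EK in simp)
 have Em [measurable]: "E \<in> borel_fun"
 proof (rule borel_measurable_LIMSEQ_real[of _ En])
  show "(\<lambda>n. En n z) \<longlonglongrightarrow> E z" for z by (rule Elim)
  show "En n \<in> borel_fun" for n using borel_measurable_integrable[OF Eni] by simp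
 qed
 have Ei: "integrable lborel E" and lim: "(\<lambda>n. LB z. En n z) \<longlonglongrightarrow> (LB z. E z)"
 proof -
  have 1: "AE z in lborel. (\<lambda>n. En n z) \<longlonglongrightarrow> E z" using Elim by simp
  have 2: "AE z in lborel. norm (En n z) \<le> K * indicator (cball 0 \<rho>) z" for n using EnK by simp
  have m: "E \<in> borel_measurable lborel" "\<And>n. En n \<in> borel_measurable lborel" using Em borel_measurable_integrable[OF Eni] by auto
  show "integrable lborel E" by (rule integrable_dominated_convergence[OF m ci 1 2])
  show "(\<lambda>n. LB z. En n z) \<longlonglongrightarrow> (LB z. E z)" by (rule integral_dominated_convergence[OF m ci 1 2])
 qed
 have "(LB z. E z) \<le> commutator_const * L\<^sup>2 * \<mu>"
  by (rule LIMSEQ_le_const2[OF lim]) (use EnI in auto)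
 then have EN: "(NN z. ennreal (E z)) \<le> ennreal (commutator_const * L\<^sup>2 * \<mu>)"
  using nn_integral_eq_integral[OF Ei] E0 by (simp add: ennreal_leI)
 have c1: "conv (w z) abel t = (conv (\<lambda>t. f (z, t)) abel (t + \<delta>) - conv (\<lambda>t. f (z, t)) abel t) / \<delta>" for z t
  unfolding w_def [abs_def] using conv_abel_difference_quotient[OF hm hB h0, of z \<delta> t] by (simp add: h_def [abs_def])
 have c2: "conv (w' z) abel t = (conv (\<lambda>t. f (z, - t)) abel (t + \<delta>) - conv (\<lambda>t. f (z, - t)) abel t) / \<delta>" for z t
 proof -
  have "(\<lambda>t. h z (- t)) \<in> borel_fun" by measurable
  from conv_abel_difference_quotient[OF this hB h0', of \<delta> t]
  show ?thesis unfolding w'_def [abs_def] by (simp add: h_def)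
 qed
 show "(NN z. (NN t. ennreal (((conv (\<lambda>t. f (z, t)) abel (t + \<delta>) - conv (\<lambda>t. f (z, t)) abel t) / \<delta>)\<^sup>2))) \<le> ennreal (commutator_const * L\<^sup>2 * \<mu>)"
  using EN unfolding c1[symmetric] E1 .
 show "(NN z. (NN t. ennreal (((conv (\<lambda>t. f (z, - t)) abel (t + \<delta>) - conv (\<lambda>t. f (z, - t)) abel t) / \<delta>)\<^sup>2))) \<le> ennreal (commutator_const * L\<^sup>2 * \<mu>)"
  using EN unfolding c2[symmetric] E2 .
qed

section \<open>Half-derivatives of compactly supported functions\<close>

abbreviation lim0 :: "(real \<Rightarrow> real) \<Rightarrow> real" where "lim0 \<equiv> Lim (at_right 0)"

lemma lim0_eq: "(u \<longlongrightarrow> l) (at_right 0) \<Longrightarrow> lim0 u = l"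
 by (rule tendsto_Lim[OF trivial_limit_at_right_real])

text \<open>Cauchy's criterion along rationals is a countable condition, so the existence of the
  limit becomes measurable in a parameter.\<close>

lemma limit_at_right_0_iff_rat:
 fixes F :: "real \<Rightarrow> real"
 assumes cont: "continuous_on {0<..} F"
 shows "(\<exists>l. (F \<longlongrightarrow> l) (at_right 0)) \<longleftrightarrow> (\<forall>k::nat. \<exists>m::nat. \<forall>(p::rat) (q::rat).
   0 < p \<and> real_of_rat p < 1 / real (Suc m) \<and> 0 < q \<and> real_of_rat q < 1 / real (Suc m) \<longrightarrow> \<bar>F (real_of_rat p) - F (real_of_rat q)\<bar> \<le> 1 / real (Suc k))"
  (is "?L \<longleftrightarrow> ?R")
proof
 assume ?L
 then obtain l where l: "(F \<longlongrightarrow> l) (at_right 0)" ..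
 show ?R
 proof
  fix k :: nat
  have "\<forall>\<^sub>F x in at_right 0. dist (F x) l < 1 / (2 * real (Suc k))" by (rule tendstoD[OF l]) simp
  then obtain d where d: "d > 0" "\<And>x. 0 < x \<Longrightarrow> x < d \<Longrightarrow> dist (F x) l < 1 / (2 * real (Suc k))"
   by (auto simp: eventually_at_right_field)
  obtain m where m: "1 / real (Suc m) < d" using nat_approx_posE[OF d(1)] by auto
  show "\<exists>m::nat. \<forall>(p::rat) (q::rat). 0 < p \<and> real_of_rat p < 1 / real (Suc m) \<and> 0 < q \<and> real_of_rat q < 1 / real (Suc m) \<longrightarrow> \<bar>F (real_of_rat p) - F (real_of_rat q)\<bar> \<le> 1 / real (Suc k)"
  proof (intro exI[of _ m] allI impI)
   fix p q :: rat assume *: "0 < p \<and> real_of_rat p < 1 / real (Suc m) \<and> 0 < q \<and> real_of_rat q < 1 / real (Suc m)"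
   have "dist (F (real_of_rat p)) l < 1 / (2 * real (Suc k))" "dist (F (real_of_rat q)) l < 1 / (2 * real (Suc k))"
   proof -
    have "0 < real_of_rat p" "0 < real_of_rat q" using * by simp_all
    moreover have "real_of_rat p < d" "real_of_rat q < d" using * m by linarith+
    ultimately show "dist (F (real_of_rat p)) l < 1 / (2 * real (Suc k))" "dist (F (real_of_rat q)) l < 1 / (2 * real (Suc k))"
     using d(2) by blast+
   qed
   then have "dist (F (real_of_rat p)) (F (real_of_rat q)) < 2 * (1 / (2 * real (Suc k)))"
    using dist_triangle_less_add[of "F (real_of_rat p)" l "1 / (2 * real (Suc k))" "F (real_of_rat q)" "1 / (2 * real (Suc k))"] by simp
   also have "2 * (1 / (2 * real (Suc k))) = 1 / real (Suc k)" by (simp del: of_nat_Suc)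
   finally show "\<bar>F (real_of_rat p) - F (real_of_rat q)\<bar> \<le> 1 / real (Suc k)" by (simp add: dist_real_def)
  qed
 qed
next
 assume R: ?R
 have near: "\<exists>r::rat. 0 < r \<and> real_of_rat r < d \<and> \<bar>F (real_of_rat r) - F x\<bar> < e" if x: "0 < x" "x < d" and e: "0 < e" for x d e
 proof -
  have "isCont F x" using cont x by (simp add: continuous_on_eq_continuous_at)
  then obtain \<eta> where \<eta>: "\<eta> > 0" "\<And>y. \<bar>y - x\<bar> < \<eta> \<Longrightarrow> \<bar>F y - F x\<bar> < e"
   using e unfolding continuous_at_eps_delta dist_real_def by metis
  have "x < min d (x + \<eta>)" using x \<eta> by simp
  then obtain r where r: "x < real_of_rat r" "real_of_rat r < min d (x + \<eta>)" using of_rat_dense by blast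
  moreover have "0 < real_of_rat r" using r(1) x(1) by linarith
  ultimately show ?thesis using \<eta>(2)[of "real_of_rat r"] by (intro exI[of _ r]) auto
 qed
 have C: "\<exists>d>0. \<forall>x y. 0 < x \<and> x < d \<and> 0 < y \<and> y < d \<longrightarrow> \<bar>F x - F y\<bar> < e" if e: "0 < e" for e
 proof -
  obtain k where k: "1 / real (Suc k) < e / 2" using nat_approx_posE[of "e / 2"] e by auto
  obtain m where m: "\<And>p q. 0 < p \<Longrightarrow> real_of_rat p < 1 / real (Suc m) \<Longrightarrow> 0 < q \<Longrightarrow> real_of_rat q < 1 / real (Suc m) \<Longrightarrow> \<bar>F (real_of_rat p) - F (real_of_rat q)\<bar> \<le> 1 / real (Suc k)"
   using R by blast
  show ?thesis
  proof (intro exI[of _ "1 / real (Suc m)"] conjI allI impI)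
   fix x y assume *: "0 < x \<and> x < 1 / real (Suc m) \<and> 0 < y \<and> y < 1 / real (Suc m)"
   obtain p where p: "0 < p" "real_of_rat p < 1 / real (Suc m)" "\<bar>F (real_of_rat p) - F x\<bar> < e / 4" using near[of x _ "e / 4"] * e by auto
   obtain q where q: "0 < q" "real_of_rat q < 1 / real (Suc m)" "\<bar>F (real_of_rat q) - F y\<bar> < e / 4" using near[of y _ "e / 4"] * e by auto
   have "\<bar>F (real_of_rat p) - F (real_of_rat q)\<bar> < e / 2" using m[OF p(1,2) q(1,2)] k by linarith
   then show "\<bar>F x - F y\<bar> < e" using p(3) q(3) by linarith
  qed simp
 qed
 have "Cauchy (\<lambda>n. F (1 / real (Suc n)))"
 proof (rule CauchyI)
  fix e :: real assume "0 < e"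
  from C[OF this] obtain d where d: "d > 0" "\<And>x y. 0 < x \<Longrightarrow> x < d \<Longrightarrow> 0 < y \<Longrightarrow> y < d \<Longrightarrow> \<bar>F x - F y\<bar> < e" by blast
  obtain n0 where n0: "1 / real (Suc n0) < d" using nat_approx_posE[OF d(1)] by auto
  have "1 / real (Suc n) < d" if "n \<ge> n0" for n
   using that n0 by (intro le_less_trans[OF _ n0]) (simp add: frac_le)
  then show "\<exists>M. \<forall>m\<ge>M. \<forall>n\<ge>M. norm (F (1 / real (Suc m)) - F (1 / real (Suc n))) < e"
   unfolding real_norm_def by (intro exI[of _ n0] allI impI d(2)) auto
 qed
 then obtain l where l: "(\<lambda>n. F (1 / real (Suc n))) \<longlonglongrightarrow> l" using Cauchy_convergent convergent_def by blast
 have "(F \<longlongrightarrow> l) (at_right 0)"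
 proof (rule tendstoI)
  fix e :: real assume e: "0 < e"
  from C[of "e / 2"] e obtain d where d: "d > 0" "\<And>x y. 0 < x \<Longrightarrow> x < d \<Longrightarrow> 0 < y \<Longrightarrow> y < d \<Longrightarrow> \<bar>F x - F y\<bar> < e / 2" by auto
  have "\<forall>\<^sub>F n in sequentially. dist (F (1 / real (Suc n))) l < e / 2" using l e by (intro tendstoD) auto
  moreover have "\<forall>\<^sub>F n in sequentially. 1 / real (Suc n) < d"
   using d(1) by (intro order_tendstoD(2)[OF LIMSEQ_inverse_real_of_nat[unfolded inverse_eq_divide]])
  ultimately have "\<forall>\<^sub>F n in sequentially. dist (F (1 / real (Suc n))) l < e / 2 \<and> 1 / real (Suc n) < d" by (rule eventually_conj)
  then obtain n where n: "dist (F (1 / real (Suc n))) l < e / 2" "1 / real (Suc n) < d"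
   using eventually_happens'[OF sequentially_bot] by blast
  have "dist (F x) l < e" if "0 < x" "x < d" for x
  proof -
   have "\<bar>F x - F (1 / real (Suc n))\<bar> < e / 2" by (rule d(2)[OF that _ n(2)]) simp
   moreover have "\<bar>F (1 / real (Suc n)) - l\<bar> < e / 2" using n(1) unfolding dist_real_def .
   ultimately show ?thesis unfolding dist_real_def by linarith
  qed
  then show "\<forall>\<^sub>F x in at_right 0. dist (F x) l < e" using d(1) by (auto simp: eventually_at_right_field)
 qed
 then show ?L ..
qed

lemma lim0_measurable:
 fixes F :: "'a \<Rightarrow> real \<Rightarrow> real"
 assumes cont: "\<And>x. continuous_on {0<..} (F x)" and m: "\<And>eps. 0 < eps \<Longrightarrow> (\<lambda>x. F x eps) \<in> borel_measurable M"
 shows "Measurable.pred M (\<lambda>x. \<exists>l. (F x \<longlongrightarrow> l) (at_right 0))" "(\<lambda>x. lim0 (F x)) \<in> borel_measurable M"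
proof -
 have m' [measurable]: "(\<lambda>x. F x (max eps (1 / real (Suc n)))) \<in> borel_measurable M" for eps n by (rule m) (simp add: less_max_iff_disj)
 have mr: "Measurable.pred M (\<lambda>x. 0 < p \<and> real_of_rat p < 1 / real (Suc j) \<and> 0 < q \<and> real_of_rat q < 1 / real (Suc j) \<longrightarrow> \<bar>F x (real_of_rat p) - F x (real_of_rat q)\<bar> \<le> 1 / real (Suc k))" for p q :: rat and j k :: nat
 proof (cases "0 < p \<and> 0 < q")
  case True
  then have [measurable]: "(\<lambda>x. F x (real_of_rat p)) \<in> borel_measurable M" "(\<lambda>x. F x (real_of_rat q)) \<in> borel_measurable M" by (auto intro!: m)
  show ?thesis by measurable
 next
  case False
  then have "(\<lambda>x. 0 < p \<and> real_of_rat p < 1 / real (Suc j) \<and> 0 < q \<and> real_of_rat q < 1 / real (Suc j) \<longrightarrow> \<bar>F x (real_of_rat p) - F x (real_of_rat q)\<bar> \<le> 1 / real (Suc k)) = (\<lambda>x. True)" by auto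
  then show ?thesis by simp
 qed
 show E [measurable]: "Measurable.pred M (\<lambda>x. \<exists>l. (F x \<longlongrightarrow> l) (at_right 0))"
  unfolding limit_at_right_0_iff_rat[OF cont]
  by (intro pred_intros_countable mr)
 have seq: "filterlim (\<lambda>n. 1 / real (Suc n)) (at_right 0) sequentially"
  unfolding filterlim_at using LIMSEQ_inverse_real_of_nat by (auto simp: inverse_eq_divide)
 \<comment> \<open>Where there is no limit, \<open>Lim\<close> has the fixed value
   \<open>THE l. False\<close>, so the function is measurable on the whole space.\<close>
 have eq: "lim0 (F x) = (if \<exists>l. (F x \<longlongrightarrow> l) (at_right 0) then lim (\<lambda>n. F x (1 / real (Suc n))) else (THE l. False))" for x
 proof (cases "\<exists>l. (F x \<longlongrightarrow> l) (at_right 0)")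
  case True
  then obtain l where l: "(F x \<longlongrightarrow> l) (at_right 0)" ..
  then show ?thesis using limI[OF filterlim_compose[OF l seq]] lim0_eq[OF l] by auto
 next
  case False
  then have "\<And>l. (F x \<longlongrightarrow> l) (at_right 0) \<longleftrightarrow> False" by blast
  then show ?thesis using False unfolding Topological_Spaces.t2_space_class.Lim_def by simp
 qed
 have [measurable]: "(\<lambda>x. lim (\<lambda>n. F x (1 / real (Suc n)))) \<in> borel_measurable M"
  by (rule borel_measurable_lim_metric) (rule m, simp)
 show "(\<lambda>x. lim0 (F x)) \<in> borel_measurable M" unfolding eq by measurable
qed

text \<open>Changing the truncation from \<open>x\<close> to \<open>y\<close> changes the kernel by
  mass \<open>|4 / sqrt x - 4 / sqrt y|\<close>, while the increments of \<open>h\<close> are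
  bounded by \<open>2 * B\<close>.\<close>

lemma half_trunc_continuous:
 fixes h :: "real \<Rightarrow> real"
 assumes h [measurable]: "h \<in> borel_fun" and B: "\<And>t. \<bar>h t\<bar> \<le> B"
 shows "continuous_on {0<..} (half_trunc h t)"
proof -
 have main: "\<bar>half_trunc h t x - half_trunc h t y\<bar> \<le> 2 * B * \<bar>4 / sqrt x - 4 / sqrt y\<bar>" if xy: "0 < x" "x \<le> y" for x y
 proof -
  have y: "0 < y" using xy by simp
  have i: "integrable lborel (\<lambda>r. sym_marchaud x r - sym_marchaud y r)"
   using integrable_sym_marchaud(1)[OF xy(1)] integrable_sym_marchaud(1)[OF y] by simp
  have nn: "0 \<le> sym_marchaud x r - sym_marchaud y r" for r
  proof -
   have "marchaud y s \<le> marchaud x s" for s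
    using xy by (auto simp: marchaud_def intro!: divide_nonneg_nonneg mult_nonneg_nonneg)
   then show ?thesis unfolding sym_marchaud_def using add_mono[of "marchaud y r" "marchaud x r" "marchaud y (- r)" "marchaud x (- r)"] by simp
  qed
  have b: "\<bar>h (t + r) - h t\<bar> \<le> 2 * B" for r using B[of "t + r"] B[of t] by linarith
  have "half_trunc h t x - half_trunc h t y = (LB r. (h (t + r) - h t) * (sym_marchaud x r - sym_marchaud y r))"
   unfolding half_trunc_eq_sym_marchaud[OF xy(1)] half_trunc_eq_sym_marchaud[OF y]
   by (subst Bochner_Integration.integral_diff[OF half_trunc_integrable[OF h B xy(1)] half_trunc_integrable[OF h B y], symmetric]) (simp add: right_diff_distrib)
  then have "\<bar>half_trunc h t x - half_trunc h t y\<bar> \<le> (LB r. \<bar>(h (t + r) - h t) * (sym_marchaud x r - sym_marchaud y r)\<bar>)"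
   by (simp add: integral_abs_bound)
  also have "\<dots> \<le> (LB r. 2 * B * (sym_marchaud x r - sym_marchaud y r))"
  proof (rule integral_mono)
   show "integrable lborel (\<lambda>r. \<bar>(h (t + r) - h t) * (sym_marchaud x r - sym_marchaud y r)\<bar>)"
    by (intro integrable_abs integrable_mult_bounded[OF i _ b]) measurable
   show "\<bar>(h (t + r) - h t) * (sym_marchaud x r - sym_marchaud y r)\<bar> \<le> 2 * B * (sym_marchaud x r - sym_marchaud y r)" for r
    unfolding abs_mult abs_of_nonneg[OF nn] by (intro mult_right_mono b nn)
  qed (intro integrable_mult_right i)
  also have "\<dots> = 2 * B * (4 / sqrt x - 4 / sqrt y)"
   using integrable_sym_marchaud[OF xy(1)] integrable_sym_marchaud[OF y] by simp
  also have "\<dots> \<le> 2 * B * \<bar>4 / sqrt x - 4 / sqrt y\<bar>"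
   using B[of 0] by (intro mult_left_mono) (auto simp: order_trans[OF abs_ge_zero])
  finally show ?thesis .
 qed
 have main': "\<bar>half_trunc h t x - half_trunc h t y\<bar> \<le> 2 * B * \<bar>4 / sqrt x - 4 / sqrt y\<bar>" if "0 < x" "0 < y" for x y
  using main[of x y] main[of y x] that by (cases "x \<le> y") (auto simp: abs_minus_commute)
 show ?thesis
  unfolding continuous_on_def
 proof
  fix x :: real assume x: "x \<in> {0<..}"
  have "((\<lambda>y. 2 * B * \<bar>4 / sqrt y - 4 / sqrt x\<bar>) \<longlongrightarrow> 2 * B * \<bar>4 / sqrt x - 4 / sqrt x\<bar>) (at x within {0<..})"
   using x by (intro tendsto_intros) auto
  then have l: "((\<lambda>y. 2 * B * \<bar>4 / sqrt y - 4 / sqrt x\<bar>) \<longlongrightarrow> 0) (at x within {0<..})" by simp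
  have "((\<lambda>y. half_trunc h t y - half_trunc h t x) \<longlongrightarrow> 0) (at x within {0<..})"
  proof (rule Lim_null_comparison[OF _ l])
   show "\<forall>\<^sub>F y in at x within {0<..}. norm (half_trunc h t y - half_trunc h t x) \<le> 2 * B * \<bar>4 / sqrt y - 4 / sqrt x\<bar>"
    unfolding eventually_at_filter using main' x by auto
  qed
  then show "(half_trunc h t \<longlongrightarrow> half_trunc h t x) (at x within {0<..})" by (rule LIM_zero_cancel)
 qed
qed

lemma lim0_half_trunc_measurable:
 fixes h :: "real \<Rightarrow> real"
 assumes h [measurable]: "h \<in> borel_fun" and B: "\<And>t. \<bar>h t\<bar> \<le> B"
 shows "(\<lambda>t. lim0 (half_trunc h t)) \<in> borel_fun"
proof (rule lim0_measurable(2)[OF half_trunc_continuous[OF h B]])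
 fix eps :: real assume e: "0 < eps"
 show "(\<lambda>t. half_trunc h t eps) \<in> borel_fun" unfolding half_trunc_eq_sym_marchaud[OF e] by measurable
qed

text \<open>Expresses the squared derivative through countably many difference quotients, to which
  Fatou's lemma applies both in \<open>t\<close> and in \<open>z\<close>.\<close>

lemma DERIV_imp_liminf_square:
 fixes J :: "real \<Rightarrow> real"
 assumes "(J has_real_derivative g) (at t)"
 shows "ennreal (g\<^sup>2) = liminf (\<lambda>m. ennreal (((J (t + 1 / real (Suc m)) - J t) / (1 / real (Suc m)))\<^sup>2))"
proof -
 have "((\<lambda>h. (J (t + h) - J t) / h) \<longlongrightarrow> g) (at 0)" using assms unfolding DERIV_def .
 moreover have "filterlim (\<lambda>m. 1 / real (Suc m)) (at 0) sequentially"
  unfolding filterlim_at using LIMSEQ_inverse_real_of_nat by (auto simp: inverse_eq_divide)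
 ultimately have "(\<lambda>m. (J (t + 1 / real (Suc m)) - J t) / (1 / real (Suc m))) \<longlonglongrightarrow> g" by (rule filterlim_compose)
 then have "(\<lambda>m. ennreal (((J (t + 1 / real (Suc m)) - J t) / (1 / real (Suc m)))\<^sup>2)) \<longlonglongrightarrow> ennreal (g\<^sup>2)"
  by (intro tendsto_ennrealI tendsto_power)
 then show ?thesis by (intro lim_imp_Liminf[symmetric]) auto
qed

text \<open>Fatou twice: over \<open>z\<close> it makes the liminf of the squared norms finite on
  almost every line, so half-primitives exist; over \<open>t\<close> it bounds their L2 norms by
  that liminf. \<open>g\<close> and \<open>g'\<close> are chosen for each \<open>z\<close>
  separately and enter the final integral only through their squares, rewritten as liminfs. The
  factor 4 is 2 for the square of a sum times 2 for the two sides.\<close>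

lemma half_trunc_slices:
 fixes f :: "'n::finite heis \<Rightarrow> real"
 assumes f: "continuous_on UNIV f" and B: "\<And>p. \<bar>f p\<bar> \<le> B"
  and fS: "\<And>z t. norm z > \<rho> \<or> \<bar>t\<bar> > c \<Longrightarrow> f (z, t) = 0" and c: "0 < c"
  and \<mu>: "emeasure lborel (cball 0 \<rho> \<times> {-c..c} :: 'n heis set) \<le> ennreal \<mu>" "0 \<le> \<mu>"
  and L: "horizontally_lipschitz i L f"
 shows "AE z in lborel. AE t in lborel. -c < t \<and> t < c \<longrightarrow> (\<exists>l. (half_trunc (\<lambda>s. f (z, s)) t \<longlongrightarrow> l) (at_right 0))"
  and "AE z in lborel. \<forall>\<phi> C. continuous_on UNIV \<phi> \<longrightarrow> (\<forall>t. \<bar>\<phi> t\<bar> \<le> C) \<longrightarrow> (\<forall>t. t \<notin> {-c<..<c} \<longrightarrow> \<phi> t = 0) \<longrightarrow>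
    ((\<lambda>eps. LB t. \<phi> t * half_trunc (\<lambda>s. f (z, s)) t eps) \<longlongrightarrow>
     (LB t. \<phi> t * lim0 (half_trunc (\<lambda>s. f (z, s)) t))) (at_right 0)"
  and "(NN z. (NN t. ennreal ((lim0 (half_trunc (\<lambda>s. f (z, s)) t))\<^sup>2) * indicator {-c<..<c} t))
    \<le> ennreal (4 * (trunc_const / pi)\<^sup>2 * (commutator_const * L\<^sup>2 * \<mu>))"
proof -
 have fm: "f \<in> borel_fun" using f by (rule borel_measurable_continuous_onI)
 define N where "N = commutator_const * L\<^sup>2 * \<mu>"
 have N: "0 \<le> N" using \<mu> commutator_const_pos by (simp add: N_def)
 define h where "h z t = f (z, t)" for z t
 have hc: "continuous_on UNIV (h z)" for z unfolding h_def [abs_def] by (rule slice_continuous[OF f])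
 have hm [measurable]: "h z \<in> borel_fun" for z using hc by (rule borel_measurable_continuous_onI)
 have hB: "\<bar>h z t\<bar> \<le> B" for z t unfolding h_def by (rule B)
 have off: "h z t = 0 \<and> h z (- t) = 0" if "t \<notin> {-c..c}" for z t
 proof -
  have "\<bar>t\<bar> > c" "\<bar>- t\<bar> > c" using that by auto
  then show ?thesis using fS unfolding h_def by blast
 qed
 have h0: "\<forall>t. t \<notin> {-c..c} \<longrightarrow> h z t = 0" and h0': "\<forall>t. t \<notin> {-c..c} \<longrightarrow> h z (- t) = 0" for z using off by blast+
 define J where "J z = conv (h z) abel" for z
 define J' where "J' z = conv (\<lambda>t. h z (- t)) abel" for z
 have Jp: "(\<lambda>p. J (fst p) (snd p)) \<in> borel_measurable (borel \<Otimes>\<^sub>M borel)" and J'p: "(\<lambda>p. J' (fst p) (snd p)) \<in> borel_measurable (borel \<Otimes>\<^sub>M borel)"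
  using slice_conv_abel_measurable[OF fm] unfolding J_def J'_def h_def [abs_def] by auto
 have Jz [measurable]: "J z \<in> borel_fun" "J' z \<in> borel_fun" for z
  unfolding J_def J'_def by measurable
 define q where "q m z t = ennreal (((J z (t + 1 / real (Suc m)) - J z t) / (1 / real (Suc m)))\<^sup>2)" for m z t
 define q' where "q' m z t = ennreal (((J' z (t + 1 / real (Suc m)) - J' z t) / (1 / real (Suc m)))\<^sup>2)" for m z t
 have qm [measurable]: "q m z \<in> borel_fun" "q' m z \<in> borel_fun" for m z
  unfolding q_def [abs_def] q'_def [abs_def] by measurable
 define Q where "Q m z = (NN t. q m z t)" for m z
 define Q' where "Q' m z = (NN t. q' m z t)" for m z
 have Qm [measurable]: "Q m \<in> borel_fun" "Q' m \<in> borel_fun" for m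
 proof -
  have comp: "(\<lambda>(z, t). K z (t + a)) \<in> borel_measurable (borel \<Otimes>\<^sub>M borel)"
   if "(\<lambda>p. K (fst p) (snd p)) \<in> borel_measurable (borel \<Otimes>\<^sub>M borel)" for a and K :: "'n plane \<Rightarrow> real \<Rightarrow> real"
  proof -
   have "(\<lambda>p. (fst p, snd p + a)) \<in> (borel \<Otimes>\<^sub>M borel) \<rightarrow>\<^sub>M ((borel :: 'n plane measure) \<Otimes>\<^sub>M borel)" by measurable
   from measurable_compose[OF this that] show ?thesis by (simp add: split_beta')
  qed
  have [measurable]: "(\<lambda>(z, t). J z (t + a)) \<in> borel_measurable (borel \<Otimes>\<^sub>M borel)" "(\<lambda>(z, t). J' z (t + a)) \<in> borel_measurable (borel \<Otimes>\<^sub>M borel)" for a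
   by (rule comp[OF Jp], rule comp[OF J'p])
  have "(\<lambda>(z, t). ennreal (((J z (t + 1 / real (Suc m)) - J z (t + 0)) / (1 / real (Suc m)))\<^sup>2)) \<in> borel_measurable (borel \<Otimes>\<^sub>M lborel)"
   "(\<lambda>(z, t). ennreal (((J' z (t + 1 / real (Suc m)) - J' z (t + 0)) / (1 / real (Suc m)))\<^sup>2)) \<in> borel_measurable (borel \<Otimes>\<^sub>M lborel)"
   by measurable
  from this[THEN lborel.borel_measurable_nn_integral] show "Q m \<in> borel_fun" "Q' m \<in> borel_fun"
   unfolding Q_def [abs_def] Q'_def [abs_def] q_def q'_def by simp_all
 qed
 have QN: "(NN z. Q m z) \<le> ennreal N" "(NN z. Q' m z) \<le> ennreal N" for m
  unfolding Q_def Q'_def q_def q'_def J_def J'_def N_def h_def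
  by (rule vertical_difference_quotient_L2[OF fm B fS \<mu> L]; simp)+
 have liminfN: "(NN z. liminf (\<lambda>m. R m z)) \<le> ennreal N"
  if [measurable]: "\<And>m. R m \<in> borel_fun" and RN: "\<And>m. (NN z. R m z) \<le> ennreal N" for R :: "nat \<Rightarrow> 'n plane \<Rightarrow> ennreal"
 proof -
  have "(NN z. liminf (\<lambda>m. R m z)) \<le> liminf (\<lambda>m. \<integral>\<^sup>+z. R m z \<partial>lborel)" by (rule nn_integral_liminf) simp
  also have "\<dots> \<le> ennreal N" by (rule order_trans[OF Liminf_mono[of _ "\<lambda>_. ennreal N"]]) (use RN in \<open>auto simp: Liminf_const\<close>)
  finally show ?thesis .
 qed
 have lQ: "(NN z. liminf (\<lambda>m. Q m z)) \<le> ennreal N" and lQ': "(NN z. liminf (\<lambda>m. Q' m z)) \<le> ennreal N"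
  by (rule liminfN[OF Qm(1) QN(1)], rule liminfN[OF Qm(2) QN(2)])
 have "AE z in lborel. liminf (\<lambda>m. Q m z) \<noteq> \<infinity>" by (rule nn_integral_PInf_AE) (use lQ in \<open>auto simp: top_unique\<close>)
 moreover have "AE z in lborel. liminf (\<lambda>m. Q' m z) \<noteq> \<infinity>" by (rule nn_integral_PInf_AE) (use lQ' in \<open>auto simp: top_unique\<close>)
 ultimately have good: "AE z in lborel. \<exists>g g'. half_primitive c (h z) g \<and> half_primitive c (\<lambda>t. h z (- t)) g'"
 proof eventually_elim
  case (elim z)
  have "\<exists>g. half_primitive c (h z) g"
   by (rule half_primitive_exists[OF hc hB h0 c]) (use elim in \<open>simp add: Q_def q_def J_def less_top\<close>)
  moreover have "\<exists>g. half_primitive c (\<lambda>t. h z (- t)) g"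
  proof (rule half_primitive_exists[OF _ hB h0' c])
   show "continuous_on UNIV (\<lambda>t. h z (- t))" by (intro continuous_on_compose2[OF hc[of z]] continuous_intros) auto
  qed (use elim in \<open>simp add: Q'_def q'_def J'_def less_top\<close>)
  ultimately show ?case by blast
 qed
 have AEt: "AE t in lborel. -c < t \<and> t < c \<longrightarrow>
   (half_trunc (h z) t \<longlongrightarrow> - (trunc_const / pi) * (g t + g' (- t))) (at_right 0) \<and>
   lim0 (half_trunc (h z) t) = - (trunc_const / pi) * (g t + g' (- t)) \<and>
   ennreal ((g t)\<^sup>2) = liminf (\<lambda>m. q m z t) \<and> ennreal ((g' (- t))\<^sup>2) = liminf (\<lambda>m. q' m z (- t))"
  if g: "half_primitive c (h z) g" "half_primitive c (\<lambda>t. h z (- t)) g'" for z g g'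
  using half_trunc_limit_AE[OF hm hB h0 g]
 proof eventually_elim
  case (elim t)
  show ?case
  proof
   assume t: "-c < t \<and> t < c"
   with elim have 1: "(half_trunc (h z) t \<longlongrightarrow> - (trunc_const / pi) * (g t + g' (- t))) (at_right 0)"
    and 2: "(J z has_real_derivative g t) (at t)" and 3: "(J' z has_real_derivative g' (- t)) (at (- t))"
    unfolding J_def J'_def by auto
   show "(half_trunc (h z) t \<longlongrightarrow> - (trunc_const / pi) * (g t + g' (- t))) (at_right 0) \<and>
    lim0 (half_trunc (h z) t) = - (trunc_const / pi) * (g t + g' (- t)) \<and>
    ennreal ((g t)\<^sup>2) = liminf (\<lambda>m. q m z t) \<and> ennreal ((g' (- t))\<^sup>2) = liminf (\<lambda>m. q' m z (- t))"
    using 1 lim0_eq[OF 1] DERIV_imp_liminf_square[OF 2] DERIV_imp_liminf_square[OF 3] unfolding q_def q'_def by blast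
  qed
 qed
 have hf: "(\<lambda>s. f (z, s)) = h z" for z by (simp add: h_def [abs_def])
 show "AE z in lborel. AE t in lborel. -c < t \<and> t < c \<longrightarrow> (\<exists>l. (half_trunc (\<lambda>s. f (z, s)) t \<longlongrightarrow> l) (at_right 0))"
  unfolding hf using good
 proof eventually_elim
  case (elim z)
  then obtain g g' where g: "half_primitive c (h z) g" "half_primitive c (\<lambda>t. h z (- t)) g'" by blast
  from AEt[OF g] show ?case by eventually_elim blast
 qed
 show "AE z in lborel. \<forall>\<phi> C. continuous_on UNIV \<phi> \<longrightarrow> (\<forall>t. \<bar>\<phi> t\<bar> \<le> C) \<longrightarrow> (\<forall>t. t \<notin> {-c<..<c} \<longrightarrow> \<phi> t = 0) \<longrightarrow>
    ((\<lambda>eps. LB t. \<phi> t * half_trunc (\<lambda>s. f (z, s)) t eps) \<longlongrightarrow>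
     (LB t. \<phi> t * lim0 (half_trunc (\<lambda>s. f (z, s)) t))) (at_right 0)"
  unfolding hf using good
 proof eventually_elim
  case (elim z)
  then obtain g g' where g: "half_primitive c (h z) g" "half_primitive c (\<lambda>t. h z (- t)) g'" by blast
  show ?case
  proof (intro allI impI)
   fix \<phi> :: "real \<Rightarrow> real" and C assume \<phi>: "continuous_on UNIV \<phi>" and C: "\<forall>t. \<bar>\<phi> t\<bar> \<le> C" and \<phi>0: "\<forall>t. t \<notin> {-c<..<c} \<longrightarrow> \<phi> t = 0"
   have lim: "((\<lambda>eps. LB t. \<phi> t * half_trunc (h z) t eps) \<longlongrightarrow> (LB t. \<phi> t * (- (trunc_const / pi) * (g t + g' (- t))))) (at_right 0)"
    by (rule half_trunc_weak_limit[OF hm hB h0 g \<phi> _ \<phi>0]) (use C in blast)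
   have gm [measurable]: "g \<in> borel_fun" "g' \<in> borel_fun"
    using g borel_measurable_integrable unfolding half_primitive_def by fastforce+
   have [measurable]: "\<phi> \<in> borel_fun" using \<phi> by (rule borel_measurable_continuous_onI)
   have ae: "AE t in lborel. \<phi> t * lim0 (half_trunc (h z) t) = \<phi> t * (- (trunc_const / pi) * (g t + g' (- t)))"
    using AEt[OF g]
   proof eventually_elim
    case (elim t)
    show ?case using elim \<phi>0 by (cases "t \<in> {-c<..<c}") auto
   qed
   have "(LB t. \<phi> t * (- (trunc_const / pi) * (g t + g' (- t)))) = (LB t. \<phi> t * lim0 (half_trunc (h z) t))"
   proof (rule integral_cong_AE)
    show "(\<lambda>t. \<phi> t * lim0 (half_trunc (h z) t)) \<in> borel_measurable lborel"
     using lim0_half_trunc_measurable[OF hm hB] by measurable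
   qed (use ae in \<open>auto elim: eventually_mono\<close>)
   with lim show "((\<lambda>eps. LB t. \<phi> t * half_trunc (h z) t eps) \<longlongrightarrow> (LB t. \<phi> t * lim0 (half_trunc (h z) t))) (at_right 0)" by simp
  qed
 qed
 define a where "a = ennreal (2 * (trunc_const / pi)\<^sup>2)"
 have "(NN z. (NN t. ennreal ((lim0 (half_trunc (h z) t))\<^sup>2) * indicator {-c<..<c} t))
   \<le> (NN z. a * (liminf (\<lambda>m. Q m z) + liminf (\<lambda>m. Q' m z)))"
 proof (rule nn_integral_mono_AE)
  show "AE z in lborel. (NN t. ennreal ((lim0 (half_trunc (h z) t))\<^sup>2) * indicator {-c<..<c} t) \<le> a * (liminf (\<lambda>m. Q m z) + liminf (\<lambda>m. Q' m z))"
   using good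
  proof eventually_elim
   case (elim z)
   then obtain g g' where g: "half_primitive c (h z) g" "half_primitive c (\<lambda>t. h z (- t)) g'" by blast
   have "(NN t. ennreal ((lim0 (half_trunc (h z) t))\<^sup>2) * indicator {-c<..<c} t) \<le>
     (NN t. a * (liminf (\<lambda>m. q m z t) + liminf (\<lambda>m. q' m z (- t))))"
   proof (rule nn_integral_mono_AE)
    show "AE t in lborel. ennreal ((lim0 (half_trunc (h z) t))\<^sup>2) * indicator {-c<..<c} t \<le> a * (liminf (\<lambda>m. q m z t) + liminf (\<lambda>m. q' m z (- t)))"
     using AEt[OF g]
    proof eventually_elim
     case (elim t)
     show ?case
     proof (cases "-c < t \<and> t < c")
      case True
      have sq: "(- x * (u + v))\<^sup>2 \<le> 2 * x\<^sup>2 * (u\<^sup>2 + v\<^sup>2)" for x u v :: real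
      proof -
       have "(u + v)\<^sup>2 \<le> 2 * (u\<^sup>2 + v\<^sup>2)" using sum_squares_bound[of u v] by (simp add: power2_sum)
       then have "x\<^sup>2 * (u + v)\<^sup>2 \<le> x\<^sup>2 * (2 * (u\<^sup>2 + v\<^sup>2))" by (intro mult_left_mono) auto
       moreover have "(- x * (u + v))\<^sup>2 = x\<^sup>2 * (u + v)\<^sup>2" by (simp add: power_mult_distrib)
       moreover have "x\<^sup>2 * (2 * (u\<^sup>2 + v\<^sup>2)) = 2 * x\<^sup>2 * (u\<^sup>2 + v\<^sup>2)" by (simp only: mult_ac)
       ultimately show ?thesis by metis
      qed
      have "ennreal ((lim0 (half_trunc (h z) t))\<^sup>2) \<le> ennreal (2 * (trunc_const / pi)\<^sup>2 * ((g t)\<^sup>2 + (g' (- t))\<^sup>2))"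
      proof -
       have l: "lim0 (half_trunc (h z) t) = - (trunc_const / pi) * (g t + g' (- t))" using elim True by blast
       show ?thesis unfolding l by (intro ennreal_leI sq)
      qed
      also have "\<dots> = a * (ennreal ((g t)\<^sup>2) + ennreal ((g' (- t))\<^sup>2))"
       unfolding a_def by (subst ennreal_mult) (auto simp: ennreal_plus)
      finally show ?thesis using elim True by simp
     qed simp
    qed
   qed
   also have "\<dots> = a * ((NN t. liminf (\<lambda>m. q m z t)) + (NN t. liminf (\<lambda>m. q' m z (- t))))"
    by (subst nn_integral_cmult) (auto simp: nn_integral_add)
   also have "\<dots> \<le> a * (liminf (\<lambda>m. Q m z) + liminf (\<lambda>m. Q' m z))"
   proof (intro mult_left_mono add_mono)
    show "(NN t. liminf (\<lambda>m. q m z t)) \<le> liminf (\<lambda>m. Q m z)" unfolding Q_def by (rule nn_integral_liminf) simp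
    have "(NN t. liminf (\<lambda>m. q' m z (- t))) \<le> liminf (\<lambda>m. \<integral>\<^sup>+t. q' m z (- t) \<partial>lborel)" by (rule nn_integral_liminf) simp
    also have "(\<lambda>m. \<integral>\<^sup>+t. q' m z (- t) \<partial>lborel) = (\<lambda>m. Q' m z)"
     unfolding Q'_def using nn_integral_reflect_shift[OF qm(2), where t = 0] by simp
    finally show "(NN t. liminf (\<lambda>m. q' m z (- t))) \<le> liminf (\<lambda>m. Q' m z)" .
   qed simp
   finally show ?case .
  qed
 qed
 also have "\<dots> = a * ((NN z. liminf (\<lambda>m. Q m z)) + (NN z. liminf (\<lambda>m. Q' m z)))"
  by (subst nn_integral_cmult) (auto simp: nn_integral_add)
 also have "\<dots> \<le> a * (ennreal N + ennreal N)" by (intro mult_left_mono add_mono lQ lQ') simp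
 also have "\<dots> = ennreal (4 * (trunc_const / pi)\<^sup>2 * N)"
 proof -
  have "ennreal N + ennreal N = ennreal (N + N)" by (rule ennreal_plus[OF N N, symmetric])
  then have "a * (ennreal N + ennreal N) = ennreal (2 * (trunc_const / pi)\<^sup>2 * (N + N))"
   unfolding a_def by (simp only:) (rule ennreal_mult[symmetric], use N in auto)
  also have "2 * (trunc_const / pi)\<^sup>2 * (N + N) = 4 * (trunc_const / pi)\<^sup>2 * N" by simp
  finally show ?thesis .
 qed
 finally show "(NN z. (NN t. ennreal ((lim0 (half_trunc (\<lambda>s. f (z, s)) t))\<^sup>2) * indicator {-c<..<c} t))
    \<le> ennreal (4 * (trunc_const / pi)\<^sup>2 * (commutator_const * L\<^sup>2 * \<mu>))"
  unfolding hf N_def .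
qed

section \<open>Lipschitz functions and the horizontal gradient\<close>

lemma hmult_eq: "hmult ((x, y), t) ((x', y'), t') = ((x + x', y + y'), t + t' + (x \<bullet> y' - y \<bullet> x') / 2)"
 by (simp add: hmult_def inner_vec_def sum_subtractf)

lemma hmult_assoc: "hmult (hmult p q) r = hmult p (hmult q r)"
proof -
 obtain x y t x' y' t' x'' y'' t'' where "p = ((x, y), t)" "q = ((x', y'), t')" "r = ((x'', y''), t'')"
  by (metis prod.collapse)
 then show ?thesis by (simp add: hmult_eq inner_simps field_simps)
qed

lemma hmult_0: "hmult 0 p = p" "hmult p 0 = p"
 by (cases p; cases "fst p"; simp add: zero_prod_def hmult_eq)+

lemma hmult_cancel: "hmult (hinv p) (hmult p a) = a" "hmult p (hmult (hinv p) a) = a"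
 by (simp_all add: hmult_assoc[symmetric] hmult_hinv hmult_0)

lemma hdist_hmult: "hdist (hmult p a) p = hnorm a"
 by (simp add: hdist_def hmult_cancel)

lemma hmult_hdist: obtains a where "q = hmult p a" "hdist q p = hnorm a"
 using hdist_hmult hmult_cancel(2) by metis

lemma hnorm_eq: "hnorm (z, t) = root 4 (norm z ^ 4 + 16 * t\<^sup>2)"
 by (simp add: hnorm_def)

lemma hnorm_nonneg: "0 \<le> hnorm p"
 by (cases p) (simp add: hnorm_eq)

lemma hnorm_power4: "hnorm (z, t) ^ 4 = norm z ^ 4 + 16 * t\<^sup>2"
 by (simp add: hnorm_eq real_root_pow_pos2)

lemma norm_le_hnorm: "norm z \<le> hnorm (z, t)"
 by (rule power_le_imp_le_base[of _ 3]) (simp_all add: hnorm_power4 hnorm_nonneg)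

lemma abs_le_hnorm: "\<bar>t\<bar> \<le> (hnorm (z, t))\<^sup>2 / 4"
proof -
 have "(4 * \<bar>t\<bar>)\<^sup>2 \<le> ((hnorm (z, t))\<^sup>2)\<^sup>2" using hnorm_power4[of z t] by (simp add: power_mult_distrib)
 then have "4 * \<bar>t\<bar> \<le> (hnorm (z, t))\<^sup>2" by (rule power2_le_imp_le) simp
 then show ?thesis by simp
qed

lemma hnorm_le: assumes "norm z ^ 4 + 16 * t\<^sup>2 \<le> r ^ 4" "0 \<le> r" shows "hnorm (z, t) \<le> r"
 by (rule power_le_imp_le_base[of _ 3]) (use assms in \<open>simp_all add: hnorm_power4\<close>)

lemma hnorm_continuous: "continuous_on UNIV (hnorm :: 'n::finite heis \<Rightarrow> real)"
 unfolding hnorm_def case_prod_beta by (intro continuous_intros)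

lemma hmult_continuous: "continuous_on UNIV (\<lambda>q. hmult p q)" "continuous_on UNIV (\<lambda>q. hmult q p)"
proof -
 obtain x y t where p: "p = ((x, y), t)" by (metis prod.collapse)
 have e1: "(\<lambda>q. hmult p q) = (\<lambda>q. ((x + fst (fst q), y + snd (fst q)), t + snd q + (x \<bullet> snd (fst q) - y \<bullet> fst (fst q)) / 2))"
  and e2: "(\<lambda>q. hmult q p) = (\<lambda>q. ((fst (fst q) + x, snd (fst q) + y), snd q + t + (fst (fst q) \<bullet> y - snd (fst q) \<bullet> x) / 2))"
  by (auto simp: p hmult_eq fun_eq_iff)
 show "continuous_on UNIV (\<lambda>q. hmult p q)" unfolding e1 by (intro continuous_intros) auto
 show "continuous_on UNIV (\<lambda>q. hmult q p)" unfolding e2 by (intro continuous_intros) auto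
qed

text \<open>The horizontal fields are left invariant, so their flows are right multiplications and
  commute with left translations; a move of length \<open>s\<close> is then a step of Koranyi length
  \<open>|s|\<close>.\<close>

lemma moveX_hmult: "moveX i s p = hmult p ((s *\<^sub>R axis i 1, 0), 0)"
 and moveY_hmult: "moveY i s p = hmult p ((0, s *\<^sub>R axis i 1), 0)"
 and lift_hmult: "lift r p = hmult p ((0, 0), r)"
 by (cases p; cases "fst p"; simp add: hmult_eq moveX_eq moveY_eq lift_def inner_axis)+

lemma hnorm_move: "hnorm ((s *\<^sub>R axis i 1, 0), 0) = \<bar>s\<bar>" "hnorm ((0, s *\<^sub>R axis i 1), 0) = \<bar>s\<bar>"
proof -
 have "root 4 (\<bar>s\<bar> ^ 4) = \<bar>s\<bar>" by (rule real_root_power_cancel) auto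
 then show "hnorm ((s *\<^sub>R axis i 1, 0), 0) = \<bar>s\<bar>" "hnorm ((0, s *\<^sub>R axis i 1), 0) = \<bar>s\<bar>"
  by (simp_all add: hnorm_eq norm_Pair)
qed

section \<open>Lipschitz functions for the Koranyi distance\<close>

definition hlipschitz :: "real \<Rightarrow> ('n::finite heis \<Rightarrow> real) \<Rightarrow> bool" where
 "hlipschitz L f \<longleftrightarrow> 0 \<le> L \<and> (\<forall>p q. \<bar>f p - f q\<bar> \<le> L * hdist p q)"

lemma hlipschitz_hmult: "hlipschitz L f \<Longrightarrow> \<bar>f (hmult p a) - f p\<bar> \<le> L * hnorm a"
 unfolding hlipschitz_def by (metis hdist_hmult)

lemma hlipschitz_move:
 assumes "hlipschitz L f"
 shows "\<bar>f (moveX i s p) - f p\<bar> \<le> L * \<bar>s\<bar>" "\<bar>f (moveY i s p) - f p\<bar> \<le> L * \<bar>s\<bar>"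
 using hlipschitz_hmult[OF assms] hnorm_move unfolding moveX_hmult moveY_hmult by metis+

text \<open>\<open>continuous_on\<close> refers to the Euclidean topology; the link is that
  \<open>hnorm\<close> and the product are Euclidean continuous.\<close>

lemma hlipschitz_continuous:
 fixes f :: "'n::finite heis \<Rightarrow> real"
 assumes f: "hlipschitz L f" shows "continuous_on UNIV f"
 unfolding continuous_on_def
proof
 fix p :: "'n heis"
 have "continuous_on UNIV (\<lambda>q. L * hnorm (hmult (hinv p) q))"
  by (intro continuous_intros continuous_on_compose2[OF hnorm_continuous hmult_continuous(1)]) auto
 then have "((\<lambda>q. L * hnorm (hmult (hinv p) q)) \<longlongrightarrow> L * hnorm (hmult (hinv p) p)) (at p within UNIV)"
  unfolding continuous_on_def by blast
 moreover have "hnorm (hmult (hinv p) p) = 0" by (simp add: hmult_hinv zero_prod_def hnorm_eq)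
 ultimately have l: "((\<lambda>q. L * hnorm (hmult (hinv p) q)) \<longlongrightarrow> 0) (at p within UNIV)" by simp
 have "((\<lambda>q. f q - f p) \<longlongrightarrow> 0) (at p within UNIV)"
  by (rule Lim_null_comparison[OF always_eventually l]) (use f[unfolded hlipschitz_def hdist_def] in \<open>unfold real_norm_def, blast\<close>)
 then show "(f \<longlongrightarrow> f p) (at p within UNIV)" by (rule LIM_zero_cancel)
qed

lemma hlipschitz_left: "hlipschitz L f \<Longrightarrow> hlipschitz L (\<lambda>q. f (hmult p q))"
proof -
 have "hdist (hmult p q) (hmult p r) = hdist q r" for q r
  using hmult_hdist[of q r] hdist_hmult hmult_assoc by metis
 then show "hlipschitz L f \<Longrightarrow> hlipschitz L (\<lambda>q. f (hmult p q))" unfolding hlipschitz_def by metis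
qed

lemma W1inf_iff: "f \<in> W1inf \<longleftrightarrow> bounded (range f) \<and> (\<exists>L. hlipschitz L f)"
proof -
 have "hlipschitz \<bar>L\<bar> f" if "\<forall>p q. \<bar>f p - f q\<bar> \<le> L * hdist p q" for L
 proof -
  have "L * hdist p q \<le> \<bar>L\<bar> * hdist p q" for p q by (intro mult_right_mono) (auto simp: hdist_def hnorm_nonneg)
  then show ?thesis using that unfolding hlipschitz_def by (meson abs_ge_zero order_trans)
 qed
 then have "(\<exists>L. \<forall>p q. \<bar>f p - f q\<bar> \<le> L * hdist p q) \<longleftrightarrow> (\<exists>L. hlipschitz L f)" unfolding hlipschitz_def by blast
 then show ?thesis unfolding W1inf_def mem_Collect_eq by (simp only:)
qed

section \<open>From the gradient to the Lipschitz constant\<close>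

lemma AE_closed_imp_UNIV:
 fixes C :: "'a::euclidean_space set"
 assumes "AE p in lborel. p \<in> C" "closed C" shows "p \<in> C"
proof (rule ccontr)
 assume p: "p \<notin> C"
 have "{x \<in> space lborel. x \<notin> C} \<in> null_sets lborel"
 proof (rule AE_iff_null[THEN iffD1, OF _ assms(1)])
  have "{x \<in> space lborel. x \<notin> C} = - C" by auto
  then show "{x \<in> space lborel. x \<notin> C} \<in> sets lborel" using assms(2) by (simp add: borel_open open_Compl)
 qed
 then have "- C \<in> null_sets lebesgue" by (intro null_sets_completionI) (simp add: Compl_eq)
 then have "negligible (- C)" unfolding negligible_iff_null_sets .
 then show False using open_not_negligible[of "- C"] assms(2) p by auto
qed

text \<open>Each flow map preserves measure, so by Fubini almost every integral curve meets the
  exceptional null set in a null set of times, and the one-dimensional bound holds along it.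
  Continuity extends the estimate from almost every \<open>p\<close> to all. \<open>L\<close> only
  provides the qualitative Lipschitz property along the curves.\<close>

lemma along_bound_imp_lipschitz:
 fixes f :: "'n::finite heis \<Rightarrow> real" and V :: "'n heis \<Rightarrow> 'n heis"
 assumes V: "continuous_on UNIV V" and inv: "\<And>s p. V (p + s *\<^sub>R V p) = V p" and sh: "\<And>s. is_shear (\<lambda>p. p + s *\<^sub>R V p)"
  and lip: "\<And>s p. \<bar>f (p + s *\<^sub>R V p) - f p\<bar> \<le> L * \<bar>s\<bar>" and f: "continuous_on UNIV f"
  and M: "AE p in lebesgue. \<bar>along V f p\<bar> \<le> M"
 shows "\<bar>f (p + s *\<^sub>R V p) - f p\<bar> \<le> M * \<bar>s\<bar>"
proof -
 have "AE p in lborel. \<bar>along V f p\<bar> \<le> M" using M by (simp add: AE_completion_iff)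
 then obtain N where N: "{p. \<not> \<bar>along V f p\<bar> \<le> M} \<subseteq> N" "N \<in> null_sets lborel"
  by (auto elim!: eventually_ae_filter[THEN iffD1, THEN bexE])
 have Ns [measurable]: "N \<in> sets borel" using N(2) by auto
 have mv: "(\<lambda>(p, s). p + s *\<^sub>R V p) \<in> borel_measurable (borel :: ('n heis \<times> real) measure)"
  unfolding case_prod_beta' by (intro borel_measurable_continuous_onI continuous_intros continuous_on_compose2[OF V]) auto
 have im: "(\<lambda>(p, s). indicator N (p + s *\<^sub>R V p) :: ennreal) \<in> borel_measurable (lborel \<Otimes>\<^sub>M lborel)"
  using measurable_compose[OF mv borel_measurable_indicator[OF Ns]] unfolding case_prod_beta' by (simp add: borel_prod lborel_prod)
 have "(NN p. (NN s. indicator N (p + s *\<^sub>R V p))) = (NN s. (NN p. indicator N (p + s *\<^sub>R V p)))"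
  by (rule lborel_pair.Fubini'[OF im, symmetric])
 also have "\<dots> = (\<integral>\<^sup>+s. 0 \<partial>(lborel :: real measure))"
 proof (rule nn_integral_cong)
  fix s
  have "(NN p. indicator N (p + s *\<^sub>R V p)) = (NN p. indicator N p)"
   by (rule is_shear_nn_integral[OF sh]) measurable
  then show "(NN p. indicator N (p + s *\<^sub>R V p)) = 0" using N(2) by auto
 qed
 finally have 0: "(NN p. (NN s. indicator N (p + s *\<^sub>R V p))) = 0" by simp
 have m1: "(\<lambda>p. \<integral>\<^sup>+s. indicator N (p + s *\<^sub>R V p) \<partial>lborel) \<in> borel_measurable lborel"
  using lborel.borel_measurable_nn_integral_fst[OF im] by simp
 have m2: "(\<lambda>s. indicator N (p + s *\<^sub>R V p) :: ennreal) \<in> borel_measurable lborel" for p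
  using measurable_compose[OF measurable_Pair1' im, of p] by simp
 have "AE p in lborel. (NN s. indicator N (p + s *\<^sub>R V p)) = 0"
  using 0 nn_integral_0_iff_AE[OF m1] by simp
 then have "AE p in lborel. \<forall>s. \<bar>f (p + s *\<^sub>R V p) - f p\<bar> \<le> M * \<bar>s\<bar>"
 proof eventually_elim
  case (elim p)
  then have "AE s in lborel. indicator N (p + s *\<^sub>R V p) = (0 :: ennreal)"
   using nn_integral_0_iff_AE[OF m2] by simp
  then have AEs: "AE s in lborel. p + s *\<^sub>R V p \<notin> N" by eventually_elim (auto simp: indicator_def split: if_splits)
  define \<phi> where "\<phi> s = f (p + s *\<^sub>R V p)" for s
  have shift: "(p + s *\<^sub>R V p) + u *\<^sub>R V (p + s *\<^sub>R V p) = p + (s + u) *\<^sub>R V p" for s u by (simp add: inv scaleR_add_left)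
  have lip': "\<bar>\<phi> s - \<phi> u\<bar> \<le> L * \<bar>s - u\<bar>" for s u
   using lip[of "p + u *\<^sub>R V p" "s - u"] unfolding shift \<phi>_def by simp
  \<comment> \<open>\<open>V\<close> is constant on this line, so differentiating along the field at
    one of its points is differentiating \<open>\<phi>\<close> there.\<close>
  have al: "along V f (p + s *\<^sub>R V p) = deriv \<phi> s" for s
   unfolding along_def shift deriv_def \<phi>_def[symmetric] using DERIV_shift[of \<phi> _ 0 s] by (simp add: add.commute)
  from AEs have D: "AE s in lborel. \<bar>deriv \<phi> s\<bar> \<le> M"
  proof eventually_elim
   case (elim s)
   then have "\<bar>along V f (p + s *\<^sub>R V p)\<bar> \<le> M" using N(1) by blast
   then show ?case unfolding al .
  qed
  show ?case
  proof
   fix s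
   show "\<bar>f (p + s *\<^sub>R V p) - f p\<bar> \<le> M * \<bar>s\<bar>"
    using lipschitz_le_AE_deriv_bound[OF lip' D, of 0 s] lipschitz_le_AE_deriv_bound[OF lip' D, of s 0]
    by (cases "0 \<le> s") (auto simp: \<phi>_def abs_minus_commute)
  qed
 qed
 then have "AE p in lborel. p \<in> {p. \<bar>f (p + s *\<^sub>R V p) - f p\<bar> \<le> M * \<bar>s\<bar>}" by eventually_elim auto
 moreover have "closed {p. \<bar>f (p + s *\<^sub>R V p) - f p\<bar> \<le> M * \<bar>s\<bar>}"
  by (intro closed_Collect_le continuous_intros continuous_on_compose2[OF f] f V) auto
 ultimately show ?thesis using AE_closed_imp_UNIV by blast
qed

lemma hgrad_bound_imp_move_lipschitz:
 fixes f :: "'n::finite heis \<Rightarrow> real"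
 assumes f: "hlipschitz L f" and M: "AE p in lebesgue. norm (hgrad f p) \<le> M"
 shows "\<bar>f (moveX i s p) - f p\<bar> \<le> M * \<bar>s\<bar>" "\<bar>f (moveY i s p) - f p\<bar> \<le> M * \<bar>s\<bar>"
proof -
 have c: "\<bar>along (X_field i) f p\<bar> \<le> norm (hgrad f p)" "\<bar>along (Y_field i) f p\<bar> \<le> norm (hgrad f p)" for p
 proof -
  define u v where "u = (\<chi> i. along (X_field i) f p)" and "v = (\<chi> i. along (Y_field i) f p)"
  have "\<bar>u $ i\<bar> \<le> norm u" "norm u \<le> norm (u, v)" "\<bar>v $ i\<bar> \<le> norm v" "norm v \<le> norm (u, v)"
   by (auto intro: component_le_norm_cart norm_fst_le norm_snd_le)
  then have "\<bar>u $ i\<bar> \<le> norm (u, v)" "\<bar>v $ i\<bar> \<le> norm (u, v)" by linarith+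
  then show "\<bar>along (X_field i) f p\<bar> \<le> norm (hgrad f p)" "\<bar>along (Y_field i) f p\<bar> \<le> norm (hgrad f p)"
   by (simp_all add: hgrad_def u_def v_def)
 qed
 have VX: "X_field i = (\<lambda>p. ((axis i 1, 0), - (snd (fst p) $ i / 2)))" and VY: "Y_field i = (\<lambda>p. ((0, axis i 1), fst (fst p) $ i / 2))"
  by (auto simp: X_field_def Y_field_def fun_eq_iff)
 have mX: "(\<lambda>p. p + s *\<^sub>R X_field i p) = moveX i s" and mY: "(\<lambda>p. p + s *\<^sub>R Y_field i p) = moveY i s" for s
  by (auto simp: moveX_def moveY_def)
 have contf: "continuous_on UNIV f" by (rule hlipschitz_continuous[OF f])
 have "\<bar>f (p + s *\<^sub>R X_field i p) - f p\<bar> \<le> M * \<bar>s\<bar>"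
 proof (rule along_bound_imp_lipschitz[OF _ _ _ _ contf])
  show "continuous_on UNIV (X_field i)" unfolding VX by (intro continuous_intros) auto
  show "X_field i (p + s *\<^sub>R X_field i p) = X_field i p" for s p by (simp add: VX)
  show "is_shear (\<lambda>p. p + s *\<^sub>R X_field i p)" for s unfolding mX by (rule is_shear_move)
  show "\<bar>f (p + s *\<^sub>R X_field i p) - f p\<bar> \<le> L * \<bar>s\<bar>" for s p using hlipschitz_move(1)[OF f, of i s p] by (simp add: moveX_def)
  show "AE p in lebesgue. \<bar>along (X_field i) f p\<bar> \<le> M" using M by eventually_elim (rule order_trans[OF c(1)])
 qed
 then show "\<bar>f (moveX i s p) - f p\<bar> \<le> M * \<bar>s\<bar>" by (simp add: moveX_def)
 have "\<bar>f (p + s *\<^sub>R Y_field i p) - f p\<bar> \<le> M * \<bar>s\<bar>"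
 proof (rule along_bound_imp_lipschitz[OF _ _ _ _ contf])
  show "continuous_on UNIV (Y_field i)" unfolding VY by (intro continuous_intros) auto
  show "Y_field i (p + s *\<^sub>R Y_field i p) = Y_field i p" for s p by (simp add: VY)
  show "is_shear (\<lambda>p. p + s *\<^sub>R Y_field i p)" for s unfolding mY by (rule is_shear_move)
  show "\<bar>f (p + s *\<^sub>R Y_field i p) - f p\<bar> \<le> L * \<bar>s\<bar>" for s p using hlipschitz_move(2)[OF f, of i s p] by (simp add: moveY_def)
  show "AE p in lebesgue. \<bar>along (Y_field i) f p\<bar> \<le> M" using M by eventually_elim (rule order_trans[OF c(2)])
 qed
 then show "\<bar>f (moveY i s p) - f p\<bar> \<le> M * \<bar>s\<bar>" by (simp add: moveY_def)
qed

text \<open>An increment of Koranyi length \<open>h\<close> splits into n moves along the fields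
  \<open>X\<close>, n along the fields \<open>Y\<close>, each of length at most \<open>h\<close>,
  and a vertical translation by \<open>\<tau>\<close>. The latter is a commutator of four moves of
  length \<open>sqrt |\<tau>| \<le> h\<close>, whence \<open>2 * n + 4\<close>.\<close>

lemma hgrad_bound_imp_hlipschitz:
 fixes f :: "'n::finite heis \<Rightarrow> real"
 assumes f: "hlipschitz L f" and M: "AE p in lebesgue. norm (hgrad f p) \<le> M" and M0: "0 \<le> M"
 shows "hlipschitz ((2 * real CARD('n) + 4) * M) f"
proof -
 note X = hgrad_bound_imp_move_lipschitz(1)[OF f M] and Y = hgrad_bound_imp_move_lipschitz(2)[OF f M]
 have horX: "\<bar>f (hmult p ((\<Sum>i\<in>I. x $ i *\<^sub>R axis i 1, 0), 0)) - f p\<bar> \<le> M * (\<Sum>i\<in>I. \<bar>x $ i\<bar>)" if "finite I" for I :: "'n set" and x p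
  using that
 proof (induction I)
  case (insert i I)
  have "hmult (hmult p ((\<Sum>i\<in>I. x $ i *\<^sub>R axis i 1, 0), 0)) ((x $ i *\<^sub>R axis i 1, 0), 0) = hmult p ((\<Sum>i\<in>insert i I. x $ i *\<^sub>R axis i 1, 0), 0)"
   using insert by (simp add: hmult_assoc hmult_eq[of _ 0 0 _ 0 0] add.commute)
  then have "moveX i (x $ i) (hmult p ((\<Sum>i\<in>I. x $ i *\<^sub>R axis i 1, 0), 0)) = hmult p ((\<Sum>i\<in>insert i I. x $ i *\<^sub>R axis i 1, 0), 0)"
   by (simp add: moveX_hmult)
  then have "\<bar>f (hmult p ((\<Sum>i\<in>insert i I. x $ i *\<^sub>R axis i 1, 0), 0)) - f p\<bar> \<le> M * (\<Sum>i\<in>I. \<bar>x $ i\<bar>) + M * \<bar>x $ i\<bar>"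
   using X[of i "x $ i" "hmult p ((\<Sum>i\<in>I. x $ i *\<^sub>R axis i 1, 0), 0)"] insert.IH by simp
  then show ?case using insert by (simp add: distrib_left)
 qed (simp add: hmult_0[unfolded zero_prod_def])
 have horY: "\<bar>f (hmult p ((0, \<Sum>i\<in>I. x $ i *\<^sub>R axis i 1), 0)) - f p\<bar> \<le> M * (\<Sum>i\<in>I. \<bar>x $ i\<bar>)" if "finite I" for I :: "'n set" and x p
  using that
 proof (induction I)
  case (insert i I)
  have "hmult (hmult p ((0, \<Sum>i\<in>I. x $ i *\<^sub>R axis i 1), 0)) ((0, x $ i *\<^sub>R axis i 1), 0) = hmult p ((0, \<Sum>i\<in>insert i I. x $ i *\<^sub>R axis i 1), 0)"
   using insert by (simp add: hmult_assoc hmult_eq[of 0 _ 0 0 _ 0] add.commute)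
  then have "moveY i (x $ i) (hmult p ((0, \<Sum>i\<in>I. x $ i *\<^sub>R axis i 1), 0)) = hmult p ((0, \<Sum>i\<in>insert i I. x $ i *\<^sub>R axis i 1), 0)"
   by (simp add: moveY_hmult)
  then have "\<bar>f (hmult p ((0, \<Sum>i\<in>insert i I. x $ i *\<^sub>R axis i 1), 0)) - f p\<bar> \<le> M * (\<Sum>i\<in>I. \<bar>x $ i\<bar>) + M * \<bar>x $ i\<bar>"
   using Y[of i "x $ i" "hmult p ((0, \<Sum>i\<in>I. x $ i *\<^sub>R axis i 1), 0)"] insert.IH by simp
  then show ?case using insert by (simp add: distrib_left)
 qed (simp add: hmult_0[unfolded zero_prod_def])
 have expand: "(\<Sum>i\<in>UNIV. x $ i *\<^sub>R axis i 1) = x" for x :: "real ^ 'n"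
  using basis_expansion[of x] by (simp add: scalar_mult_eq_scaleR)
 have vert1: "\<bar>f (lift (s\<^sup>2) q) - f q\<bar> \<le> 4 * (M * \<bar>s\<bar>)" for s q
 proof -
  \<comment> \<open>Any direction will do; index types are inhabited, so there is one.\<close>
  fix i :: 'n
  define p where "p = moveY i (- s) (moveX i (- s) q)"
  have q: "q = moveX i s (moveY i s p)" by (simp add: p_def move_inverse)
  have "\<bar>f (moveY i s (moveX i s p)) - f (moveX i s p)\<bar> \<le> M * \<bar>s\<bar>" "\<bar>f (moveX i s p) - f p\<bar> \<le> M * \<bar>s\<bar>"
   "\<bar>f (moveX i s (moveY i s p)) - f (moveY i s p)\<bar> \<le> M * \<bar>s\<bar>" "\<bar>f (moveY i s p) - f p\<bar> \<le> M * \<bar>s\<bar>"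
   by (rule X Y)+
  then show ?thesis unfolding q move_commutator[symmetric] by linarith
 qed
 have vert: "\<bar>f (lift r q) - f q\<bar> \<le> 4 * (M * sqrt \<bar>r\<bar>)" for r q
 proof (cases "0 \<le> r")
  case True
  then show ?thesis using vert1[of "sqrt r" q] by simp
 next
  case False
  have "lift (- r) (lift r q) = q" by (simp add: lift_def)
  then show ?thesis using vert1[of "sqrt (- r)" "lift r q"] False by (simp add: abs_minus_commute)
 qed
 have "\<bar>f q - f p\<bar> \<le> (2 * real CARD('n) + 4) * M * hdist q p" for p q
 proof -
  obtain a where a: "q = hmult p a" "hdist q p = hnorm a" by (rule hmult_hdist)
  obtain x y t where xyt: "a = ((x, y), t)" by (metis prod.collapse)
  define h where "h = hnorm a"
  have h: "0 \<le> h" by (simp add: h_def hnorm_nonneg)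
  define p1 where "p1 = hmult p ((x, 0), 0)"
  define p2 where "p2 = hmult p1 ((0, y), 0)"
  \<comment> \<open>Multiplying the \<open>x\<close>-part by the \<open>y\<close>-part already
    produces the height \<open>(x \<bullet> y) / 2\<close>.\<close>
  define \<tau> where "\<tau> = t - (x \<bullet> y) / 2"
  have q: "q = lift \<tau> p2"
   unfolding lift_hmult p2_def p1_def a(1) xyt hmult_assoc \<tau>_def by (simp add: hmult_eq)
  have nz: "norm (x, y) \<le> h" unfolding h_def xyt by (rule norm_le_hnorm)
  have nx: "norm x \<le> h" and ny: "norm y \<le> h" using nz norm_fst_le[of x y] norm_snd_le[of y x] by linarith+
  have sum: "(\<Sum>i\<in>UNIV. \<bar>u $ i\<bar>) \<le> real CARD('n) * h" if "norm u \<le> h" for u :: "real ^ 'n"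
   using sum_bounded_above[of UNIV "\<lambda>i. \<bar>u $ i\<bar>" h] component_le_norm_cart[of u] that by (auto intro: order_trans)
  have "\<bar>f p1 - f p\<bar> \<le> M * (real CARD('n) * h)"
   using horX[of UNIV p x] mult_left_mono[OF sum[OF nx] M0] unfolding expand p1_def by simp
  moreover have "\<bar>f p2 - f p1\<bar> \<le> M * (real CARD('n) * h)"
   using horY[of UNIV p1 y] mult_left_mono[OF sum[OF ny] M0] unfolding expand p2_def by simp
  moreover have "\<bar>f q - f p2\<bar> \<le> 4 * (M * h)"
  proof -
   have "\<bar>x \<bullet> y\<bar> \<le> h * h" using Cauchy_Schwarz_ineq2[of x y] mult_mono[OF nx ny h norm_ge_zero] by linarith
   moreover have "\<bar>t\<bar> \<le> h\<^sup>2 / 4" unfolding h_def xyt by (rule abs_le_hnorm)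
   ultimately have "\<bar>\<tau>\<bar> \<le> h\<^sup>2" unfolding \<tau>_def power2_eq_square by (auto simp: abs_le_iff field_simps)
   then have "sqrt \<bar>\<tau>\<bar> \<le> h" using h by (intro real_le_lsqrt) auto
   then have "4 * (M * sqrt \<bar>\<tau>\<bar>) \<le> 4 * (M * h)" using M0 by (intro mult_left_mono) auto
   then show ?thesis using vert[of \<tau> p2] unfolding q by linarith
  qed
  ultimately have "\<bar>f q - f p\<bar> \<le> M * (real CARD('n) * h) + M * (real CARD('n) * h) + 4 * (M * h)" by linarith
  also have "\<dots> = (2 * real CARD('n) + 4) * M * h" by (simp add: algebra_simps)
  finally show ?thesis by (simp add: a(2) h_def)
 qed
 then show ?thesis unfolding hlipschitz_def using M0 by auto
qed

section \<open>Localization and mean oscillation\<close>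

lemma half_trunc_diff:
 fixes h k :: "real \<Rightarrow> real"
 assumes h [measurable]: "h \<in> borel_fun" and hB: "\<And>t. \<bar>h t\<bar> \<le> B"
  and k [measurable]: "k \<in> borel_fun" and kB: "\<And>t. \<bar>k t\<bar> \<le> B'"
  and e: "0 < eps" and c: "\<And>r. \<bar>(h (t + r) - h t) - (k (t' + r) - k t')\<bar> \<le> c"
 shows "\<bar>half_trunc h t eps - half_trunc k t' eps\<bar> \<le> 4 * c / sqrt eps"
proof -
 have "half_trunc h t eps - half_trunc k t' eps = half_trunc (\<lambda>s. h (t + s) - k (t' + s)) 0 eps"
  unfolding half_trunc_eq_sym_marchaud[OF e]
  by (subst Bochner_Integration.integral_diff[OF half_trunc_integrable[OF h hB e] half_trunc_integrable[OF k kB e], symmetric])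
   (auto intro!: Bochner_Integration.integral_cong simp: algebra_simps)
 also have "\<bar>\<dots>\<bar> \<le> 4 * c / sqrt eps"
 proof (rule half_trunc_abs_le[OF _ e])
  show "\<bar>h (t + (0 + r)) - k (t' + (0 + r)) - (h (t + 0) - k (t' + 0))\<bar> \<le> c" for r
   using c[of r] by (simp add: algebra_simps)
 qed measurable
 finally show ?thesis .
qed

text \<open>The increments agree up to distance \<open>\<rho>\<close>, and beyond it the kernel does
  not depend on \<open>eps\<close>; hence the difference of the truncated integrals is the same for
  every \<open>eps \<le> \<rho>\<close>.\<close>

lemma half_trunc_local:
 fixes h k :: "real \<Rightarrow> real"
 assumes h [measurable]: "h \<in> borel_fun" and hB: "\<And>t. \<bar>h t\<bar> \<le> B"
  and k [measurable]: "k \<in> borel_fun" and kB: "\<And>t. \<bar>k t\<bar> \<le> B'"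
  and eq: "\<And>r. \<bar>r\<bar> \<le> \<rho> \<Longrightarrow> h (t + r) - h t = k (t + r) - k t" and e: "0 < eps" "eps \<le> \<rho>"
 shows "half_trunc h t eps = half_trunc k t eps + (half_trunc h t \<rho> - half_trunc k t \<rho>)"
proof -
 have p: "0 < \<rho>" using e by simp
 have far: "sym_marchaud eps r = sym_marchaud \<rho> r" if "\<not> \<bar>r\<bar> \<le> \<rho>" for r
  using that e by (auto simp: sym_marchaud_def marchaud_def)
 have d: "half_trunc g t eps - half_trunc g t \<rho> = (LB r. (g (t + r) - g t) * (sym_marchaud eps r - sym_marchaud \<rho> r))"
  if g: "g \<in> borel_fun" "\<And>t. \<bar>g t\<bar> \<le> b" for g b
  unfolding half_trunc_eq_sym_marchaud[OF e(1)] half_trunc_eq_sym_marchaud[OF p] right_diff_distrib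
  by (rule Bochner_Integration.integral_diff[OF half_trunc_integrable[OF g e(1)] half_trunc_integrable[OF g p], symmetric])
 have "(h (t + r) - h t) * (sym_marchaud eps r - sym_marchaud \<rho> r) = (k (t + r) - k t) * (sym_marchaud eps r - sym_marchaud \<rho> r)" for r
  using eq[of r] far[of r] by (cases "\<bar>r\<bar> \<le> \<rho>") auto
 then have "half_trunc h t eps - half_trunc h t \<rho> = half_trunc k t eps - half_trunc k t \<rho>"
  unfolding d[OF h hB] d[OF k kB] by (intro Bochner_Integration.integral_cong refl)
 then show ?thesis by simp
qed

lemma half_trunc_local_limit:
 fixes h k :: "real \<Rightarrow> real"
 assumes h: "h \<in> borel_fun" and hB: "\<And>t. \<bar>h t\<bar> \<le> B"
  and k: "k \<in> borel_fun" and kB: "\<And>t. \<bar>k t\<bar> \<le> B'"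
  and eq: "\<And>r. \<bar>r\<bar> \<le> \<rho> \<Longrightarrow> h (t + r) - h t = k (t + r) - k t" and p: "0 < \<rho>"
  and l: "(half_trunc k t \<longlongrightarrow> l) (at_right 0)"
 shows "(half_trunc h t \<longlongrightarrow> l + (half_trunc h t \<rho> - half_trunc k t \<rho>)) (at_right 0)"
proof -
 have "((\<lambda>eps. half_trunc k t eps + (half_trunc h t \<rho> - half_trunc k t \<rho>)) \<longlongrightarrow> l + (half_trunc h t \<rho> - half_trunc k t \<rho>)) (at_right 0)"
  by (intro tendsto_intros l)
 moreover have "\<forall>\<^sub>F eps in at_right 0. half_trunc k t eps + (half_trunc h t \<rho> - half_trunc k t \<rho>) = half_trunc h t eps"
  unfolding eventually_at_right_field
 proof (intro exI[of _ \<rho>] conjI allI impI p)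
  fix eps assume "0 < eps" "eps < \<rho>"
  then show "half_trunc k t eps + (half_trunc h t \<rho> - half_trunc k t \<rho>) = half_trunc h t eps"
   by (intro half_trunc_local[OF h hB k kB eq, symmetric]) auto
 qed
 ultimately show ?thesis by (rule Lim_transform_eventually)
qed

lemma T_half_trunc_eq: "T_half_trunc f p = half_trunc (\<lambda>s. f (fst p, s)) (snd p)"
 by (cases p) (simp add: T_half_trunc_def half_trunc_def fun_eq_iff)

lemma T_half_trunc_lift: "T_half_trunc f p eps = (LINT r:{r. \<bar>r\<bar> > eps}|lborel. (f (lift r p) - f p) / \<bar>r\<bar> powr (3/2))"
 by (cases p) (simp add: T_half_trunc_def lift_def)

text \<open>The operator uses only vertical translations, which commute with shears. Left invariance
  is the special case of left translations.\<close>

lemma T_half_trunc_shear: "is_shear T \<Longrightarrow> T_half_trunc f (T p) = T_half_trunc (\<lambda>q. f (T q)) p"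
 by (rule ext) (simp add: T_half_trunc_lift is_shear_lift)

lemma T_half_shear: "is_shear T \<Longrightarrow> T_half f (T p) = T_half (\<lambda>q. f (T q)) p"
 by (simp add: T_half_def T_half_trunc_shear)

lemma T_half_measurable:
 fixes f :: "'n::finite heis \<Rightarrow> real"
 assumes f: "continuous_on UNIV f" and B: "\<And>p. \<bar>f p\<bar> \<le> B"
 shows "Measurable.pred borel (\<lambda>p. \<exists>l. (T_half_trunc f p \<longlongrightarrow> l) (at_right 0))" "T_half f \<in> borel_fun"
  and "0 < eps \<Longrightarrow> (\<lambda>p. T_half_trunc f p eps) \<in> borel_fun"
proof -
 have c: "continuous_on {0<..} (T_half_trunc f p)" for p
  unfolding T_half_trunc_eq
  by (rule half_trunc_continuous[OF borel_measurable_continuous_onI[OF slice_continuous[OF f]]]) (rule B)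
 have m: "(\<lambda>p. T_half_trunc f p eps) \<in> borel_fun" if e: "0 < eps" for eps
 proof -
  have [measurable]: "(\<lambda>q. f (fst (fst q), snd (fst q) + snd q) - f (fst (fst q), snd (fst q))) \<in> borel_measurable ((borel :: 'n heis measure) \<Otimes>\<^sub>M borel)"
   unfolding borel_prod by (intro borel_measurable_continuous_onI continuous_intros continuous_on_compose2[OF f]) auto
  have "(\<lambda>(p, r). (f (fst p, snd p + r) - f (fst p, snd p)) * sym_marchaud eps r) \<in> borel_measurable ((borel :: 'n heis measure) \<Otimes>\<^sub>M lborel)"
   unfolding case_prod_beta' by measurable
  from lborel.borel_measurable_lebesgue_integral[OF this] show ?thesis
   unfolding T_half_trunc_eq half_trunc_eq_sym_marchaud[OF e] by simp
 qed
 show "Measurable.pred borel (\<lambda>p. \<exists>l. (T_half_trunc f p \<longlongrightarrow> l) (at_right 0))" by (rule lim0_measurable(1)[OF c m])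
 show "T_half f \<in> borel_fun" using lim0_measurable(2)[OF c m] by (simp add: T_half_def [abs_def])
 show "0 < eps \<Longrightarrow> (\<lambda>p. T_half_trunc f p eps) \<in> borel_fun" by (rule m)
qed

section \<open>Cutoff at scale R\<close>

definition clip :: "real \<Rightarrow> real" where "clip x = max 0 (min 1 x)"

lemma clip_lipschitz: "\<bar>x - y\<bar> \<le> d \<Longrightarrow> \<bar>clip x - clip y\<bar> \<le> d"
 by (auto simp: clip_def max_def min_def abs_le_iff)

text \<open>The scales \<open>R\<close> and \<open>R^2\<close> follow the dilations of the group, so
  that horizontal difference quotients are of order \<open>1 / R\<close>.\<close>

definition cutoff :: "real \<Rightarrow> 'n::finite heis \<Rightarrow> real" where
 "cutoff R p = clip (2 - norm (fst p) / R) * clip (2 - \<bar>snd p\<bar> / R\<^sup>2)"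

lemma cutoff_bounds: "0 \<le> cutoff R p" "cutoff R p \<le> 1"
 by (auto simp: cutoff_def clip_def intro!: mult_nonneg_nonneg mult_le_one)

lemma cutoff_eq_1: "0 < R \<Longrightarrow> norm z \<le> R \<Longrightarrow> \<bar>t\<bar> \<le> R\<^sup>2 \<Longrightarrow> cutoff R (z, t) = 1"
 by (simp add: cutoff_def clip_def min_def max_def field_simps)

lemma cutoff_eq_0: "0 < R \<Longrightarrow> norm z \<ge> 2 * R \<or> \<bar>t\<bar> \<ge> 2 * R\<^sup>2 \<Longrightarrow> cutoff R (z, t) = 0"
proof -
 assume R: "0 < R" and o: "norm z \<ge> 2 * R \<or> \<bar>t\<bar> \<ge> 2 * R\<^sup>2"
 have c: "clip x = 0" if "x \<le> 0" for x using that by (simp add: clip_def)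
 from o show ?thesis
 proof
  assume "norm z \<ge> 2 * R"
  then have "2 - norm z / R \<le> 0" using R by (simp add: le_divide_eq)
  then show ?thesis by (simp add: cutoff_def c)
 next
  assume "\<bar>t\<bar> \<ge> 2 * R\<^sup>2"
  then have "2 - \<bar>t\<bar> / R\<^sup>2 \<le> 0" using R by (simp add: le_divide_eq)
  then show ?thesis by (simp add: cutoff_def c)
 qed
qed

lemma cutoff_continuous: "0 < R \<Longrightarrow> continuous_on UNIV (cutoff R)"
 unfolding cutoff_def [abs_def] clip_def by (intro continuous_intros) auto

lemma cutoff_diff:
 assumes R: "0 < R" and z: "\<bar>norm z' - norm z\<bar> \<le> s" and t: "\<bar>\<bar>t'\<bar> - \<bar>t\<bar>\<bar> \<le> s * R"
 shows "\<bar>cutoff R (z', t') - cutoff R (z, t)\<bar> \<le> 2 * s / R"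
proof -
 have prod: "\<bar>a' * b' - a * b\<bar> \<le> u + v" if "\<bar>a' - a\<bar> \<le> u" "\<bar>b' - b\<bar> \<le> v" "0 \<le> a" "a \<le> 1" "0 \<le> b'" "b' \<le> 1" for a a' b b' u v :: real
 proof -
  have "a' * b' - a * b = (a' - a) * b' + a * (b' - b)" by (simp add: algebra_simps)
  moreover have "\<bar>(a' - a) * b'\<bar> \<le> u * 1" unfolding abs_mult using that by (intro mult_mono) auto
  moreover have "\<bar>a * (b' - b)\<bar> \<le> 1 * v" unfolding abs_mult using that by (intro mult_mono) auto
  ultimately show ?thesis by linarith
 qed
 have "\<bar>(2 - norm z' / R) - (2 - norm z / R)\<bar> = \<bar>norm z' - norm z\<bar> / R" "\<bar>(2 - \<bar>t'\<bar> / R\<^sup>2) - (2 - \<bar>t\<bar> / R\<^sup>2)\<bar> = \<bar>\<bar>t'\<bar> - \<bar>t\<bar>\<bar> / R\<^sup>2"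
  using R by (simp_all add: diff_divide_distrib[symmetric] abs_minus_commute)
 moreover have "\<bar>norm z' - norm z\<bar> / R \<le> s / R" using z R by (intro divide_right_mono) auto
 moreover have "\<bar>\<bar>t'\<bar> - \<bar>t\<bar>\<bar> / R\<^sup>2 \<le> s * R / R\<^sup>2" using t by (intro divide_right_mono) auto
 moreover have "s * R / R\<^sup>2 = s / R" using R by (simp add: power2_eq_square)
 ultimately have a: "\<bar>clip (2 - norm z' / R) - clip (2 - norm z / R)\<bar> \<le> s / R" "\<bar>clip (2 - \<bar>t'\<bar> / R\<^sup>2) - clip (2 - \<bar>t\<bar> / R\<^sup>2)\<bar> \<le> s / R"
  by (auto intro!: clip_lipschitz)
 have "\<bar>cutoff R (z', t') - cutoff R (z, t)\<bar> \<le> s / R + s / R"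
  unfolding cutoff_def fst_conv snd_conv by (rule prod[OF a]) (auto simp: clip_def)
 then show ?thesis by simp
qed

text \<open>The vertical coefficient of a field is half a coordinate, at most \<open>R\<close> when
  \<open>norm (fst p) \<le> 2 * R\<close>. A move of length \<open>|s|\<close> thus changes the
  height by at most \<open>|s| * R\<close>, which relative to \<open>R^2\<close> is
  \<open>|s| / R\<close>, like the planar change.\<close>

lemma cutoff_move:
 assumes R: "0 < R" and p: "norm (fst p) \<le> 2 * R"
 shows "\<bar>cutoff R (moveX i s p) - cutoff R p\<bar> \<le> 2 * \<bar>s\<bar> / R" "\<bar>cutoff R (moveY i s p) - cutoff R p\<bar> \<le> 2 * \<bar>s\<bar> / R"
proof -
 obtain x y t where xyt: "p = ((x, y), t)" by (metis prod.collapse)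
 have n: "\<bar>norm (x + s *\<^sub>R axis i 1, y) - norm (x, y)\<bar> \<le> \<bar>s\<bar>" "\<bar>norm (x, y + s *\<^sub>R axis i 1) - norm (x, y)\<bar> \<le> \<bar>s\<bar>"
  using norm_triangle_ineq3[of "(x + s *\<^sub>R axis i 1, y)" "(x, y)"] norm_triangle_ineq3[of "(x, y + s *\<^sub>R axis i 1)" "(x, y)"]
  by (simp_all add: norm_Pair)
 have c: "\<bar>x $ i\<bar> \<le> 2 * R" "\<bar>y $ i\<bar> \<le> 2 * R"
  using component_le_norm_cart[of x i] component_le_norm_cart[of y i] norm_fst_le[of x y] norm_snd_le[of y x] p unfolding xyt by auto
 have t: "\<bar>\<bar>t - s * (y $ i) / 2\<bar> - \<bar>t\<bar>\<bar> \<le> \<bar>s\<bar> * R" "\<bar>\<bar>t + s * (x $ i) / 2\<bar> - \<bar>t\<bar>\<bar> \<le> \<bar>s\<bar> * R"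
 proof -
  have "\<bar>s * (y $ i)\<bar> \<le> \<bar>s\<bar> * (2 * R)" "\<bar>s * (x $ i)\<bar> \<le> \<bar>s\<bar> * (2 * R)" unfolding abs_mult by (intro mult_left_mono c; simp)+
  then show "\<bar>\<bar>t - s * (y $ i) / 2\<bar> - \<bar>t\<bar>\<bar> \<le> \<bar>s\<bar> * R" "\<bar>\<bar>t + s * (x $ i) / 2\<bar> - \<bar>t\<bar>\<bar> \<le> \<bar>s\<bar> * R" by linarith+
 qed
 show "\<bar>cutoff R (moveX i s p) - cutoff R p\<bar> \<le> 2 * \<bar>s\<bar> / R" "\<bar>cutoff R (moveY i s p) - cutoff R p\<bar> \<le> 2 * \<bar>s\<bar> / R"
  unfolding xyt moveX_eq moveY_eq by (rule cutoff_diff[OF R n(1) t(1)], rule cutoff_diff[OF R n(2) t(2)])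
qed

text \<open>The half-derivative does not see constants; subtracting \<open>f 0\<close> makes the
  size of the localized function \<open>L * R\<close>, instead of the supremum of
  \<open>f\<close>.\<close>

definition localize :: "real \<Rightarrow> ('n::finite heis \<Rightarrow> real) \<Rightarrow> 'n heis \<Rightarrow> real" where
 "localize R f p = cutoff R p * (f p - f 0)"

lemma localize_eq: "0 < R \<Longrightarrow> norm z \<le> R \<Longrightarrow> \<bar>t\<bar> \<le> R\<^sup>2 \<Longrightarrow> localize R f (z, t) = f (z, t) - f 0"
 by (simp add: localize_def cutoff_eq_1)

lemma localize_eq_0: "0 < R \<Longrightarrow> norm z > 2 * R \<or> \<bar>t\<bar> > 2 * R\<^sup>2 \<Longrightarrow> localize R f (z, t) = 0"
 by (auto simp: localize_def cutoff_eq_0)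

lemma localize_continuous: "0 < R \<Longrightarrow> hlipschitz L f \<Longrightarrow> continuous_on UNIV (localize R f)"
 unfolding localize_def [abs_def] by (intro continuous_intros cutoff_continuous hlipschitz_continuous)

text \<open>On the doubled cylinder the fourth power of the Koranyi norm is at most
  \<open>(16 + 16 * 4) * R^4 = 80 * R^4\<close>, below \<open>(3 * R)^4\<close>.\<close>

lemma diff_0_le:
 assumes f: "hlipschitz L f" and R: "0 < R" and p: "norm z \<le> 2 * R" "\<bar>t\<bar> \<le> 2 * R\<^sup>2"
 shows "\<bar>f (z, t) - f 0\<bar> \<le> 3 * L * R"
proof -
 have "norm z ^ 4 \<le> (2 * R) ^ 4" using p by (intro power_mono) auto
 moreover have "\<bar>t\<bar>\<^sup>2 \<le> (2 * R\<^sup>2)\<^sup>2" using p by (intro power_mono) auto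
 then have "t\<^sup>2 \<le> 4 * R ^ 4" by (simp add: power_mult_distrib)
 moreover have "0 \<le> R ^ 4" using R by simp
 moreover have "(2 * R) ^ 4 = 16 * R ^ 4" "(3 * R) ^ 4 = 81 * R ^ 4" by (simp_all add: power_mult_distrib)
 ultimately have "norm z ^ 4 + 16 * t\<^sup>2 \<le> (3 * R) ^ 4" by linarith
 then have "hnorm (z, t) \<le> 3 * R" using R by (intro hnorm_le) auto
 then have "L * hnorm (z, t) \<le> L * (3 * R)" using f unfolding hlipschitz_def by (intro mult_left_mono) auto
 then show ?thesis using hlipschitz_hmult[OF f, of 0 "(z, t)"] by (simp add: hmult_0)
qed

lemma localize_abs_le:
 assumes f: "hlipschitz L f" and R: "0 < R"
 shows "\<bar>localize R f p\<bar> \<le> 3 * L * R"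
proof (cases "norm (fst p) \<le> 2 * R \<and> \<bar>snd p\<bar> \<le> 2 * R\<^sup>2")
 case True
 then have "\<bar>f p - f 0\<bar> \<le> 3 * L * R" using diff_0_le[OF f R, of "fst p" "snd p"] by simp
 then have "\<bar>cutoff R p\<bar> * \<bar>f p - f 0\<bar> \<le> 1 * (3 * L * R)" using cutoff_bounds[of R p] by (intro mult_mono) auto
 then show ?thesis by (simp add: localize_def abs_mult)
next
 case False
 then have "localize R f p = 0" using localize_eq_0[OF R, of "fst p" "snd p" f] by auto
 then show ?thesis using f R by (simp add: hlipschitz_def)
qed

text \<open>By the product rule \<open>f\<close> contributes \<open>L\<close> and the cutoff
  \<open>(2 / R) * (3 * L * R) = 6 * L\<close>. A move that starts outside \<open>S\<close> and ends
  inside is estimated backwards.\<close>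

lemma localize_horizontally_lipschitz:
 fixes f :: "'n::finite heis \<Rightarrow> real"
 assumes f: "hlipschitz L f" and R: "0 < R"
 shows "horizontally_lipschitz i (7 * L) (localize R f)"
proof -
 define S where "S = {p :: 'n heis. norm (fst p) \<le> 2 * R \<and> \<bar>snd p\<bar> \<le> 2 * R\<^sup>2}"
 have out: "localize R f p = 0" if "p \<notin> S" for p
  using that localize_eq_0[OF R, of "fst p" "snd p" f] by (auto simp: S_def)
 have one: "\<bar>localize R f q - localize R f p\<bar> \<le> 7 * L * s"
  if p: "p \<in> S" and c: "\<bar>cutoff R q - cutoff R p\<bar> \<le> 2 * s / R" and d: "\<bar>f q - f p\<bar> \<le> L * s" for p q s
 proof -
  have "localize R f q - localize R f p = cutoff R q * (f q - f p) + (cutoff R q - cutoff R p) * (f p - f 0)"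
   by (simp add: localize_def algebra_simps)
  moreover have "\<bar>cutoff R q * (f q - f p)\<bar> \<le> 1 * (L * s)"
   unfolding abs_mult using d cutoff_bounds[of R q] by (intro mult_mono) auto
  moreover have "\<bar>(cutoff R q - cutoff R p) * (f p - f 0)\<bar> \<le> (2 * s / R) * (3 * L * R)"
   unfolding abs_mult using c diff_0_le[OF f R, of "fst p" "snd p"] p by (intro mult_mono) (auto simp: S_def)
  moreover have "(2 * s / R) * (3 * L * R) = 6 * (L * s)" using R by simp
  ultimately have "\<bar>localize R f q - localize R f p\<bar> \<le> 7 * (L * s)" by linarith
  then show ?thesis by (simp add: mult.assoc)
 qed
 have X: "\<bar>localize R f (moveX i s p) - localize R f p\<bar> \<le> 7 * L * \<bar>s\<bar>" if "p \<in> S" for s p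
  by (rule one[OF that cutoff_move(1)[OF R] hlipschitz_move(1)[OF f]]) (use that in \<open>simp add: S_def\<close>)
 have Y: "\<bar>localize R f (moveY i s p) - localize R f p\<bar> \<le> 7 * L * \<bar>s\<bar>" if "p \<in> S" for s p
  by (rule one[OF that cutoff_move(2)[OF R] hlipschitz_move(2)[OF f]]) (use that in \<open>simp add: S_def\<close>)
 have nn: "0 \<le> 7 * L * \<bar>s\<bar>" for s using f by (simp add: hlipschitz_def)
 have "\<bar>localize R f (moveX i s p) - localize R f p\<bar> \<le> 7 * L * \<bar>s\<bar>" for s p
  using X[of p s] X[of "moveX i s p" "- s"] out[of p] out[of "moveX i s p"] nn[of s] unfolding move_inverse
  by (cases "p \<in> S"; cases "moveX i s p \<in> S") (auto simp: abs_minus_commute)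
 moreover have "\<bar>localize R f (moveY i s p) - localize R f p\<bar> \<le> 7 * L * \<bar>s\<bar>" for s p
  using Y[of p s] Y[of "moveY i s p" "- s"] out[of p] out[of "moveY i s p"] nn[of s] unfolding move_inverse
  by (cases "p \<in> S"; cases "moveY i s p \<in> S") (auto simp: abs_minus_commute)
 ultimately show ?thesis unfolding horizontally_lipschitz_def by blast
qed

section \<open>Mean oscillation on balls\<close>

text \<open>The mean of \<open>g\<close> is within \<open>a\<close> of \<open>c\<close>, so passing
  from \<open>c\<close> to the mean at most doubles the bound.\<close>

lemma mean_oscillation_le:
 fixes g :: "'a \<Rightarrow> real"
 assumes [measurable]: "g \<in> borel_measurable M" "B \<in> sets M" and B: "0 < emeasure M B" "emeasure M B < \<infinity>"
  and a: "(\<integral>\<^sup>+x\<in>B. ennreal \<bar>g x - c\<bar> \<partial>M) \<le> ennreal a * emeasure M B" "0 \<le> a"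
 shows "(\<integral>\<^sup>+x\<in>B. ennreal \<bar>g x - (LINT x:B|M. g x) / measure M B\<bar> \<partial>M) \<le> ennreal (2 * a) * emeasure M B"
  and "set_integrable M B g"
proof -
 define m where "m = measure M B"
 have em: "emeasure M B = ennreal m" unfolding m_def using B(2) by (intro emeasure_eq_ennreal_measure) auto
 have m: "0 < m" using B(1) unfolding em by simp
 have nn: "(\<integral>\<^sup>+x. ennreal (norm (indicator B x *\<^sub>R (g x - c))) \<partial>M) \<le> ennreal (a * m)"
 proof -
  have "(\<integral>\<^sup>+x. ennreal (norm (indicator B x *\<^sub>R (g x - c))) \<partial>M) = (\<integral>\<^sup>+x\<in>B. ennreal \<bar>g x - c\<bar> \<partial>M)"
   by (intro nn_integral_cong) (simp add: indicator_def)
  also have "\<dots> \<le> ennreal (a * m)" using a m unfolding em by (simp add: ennreal_mult)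
  finally show ?thesis .
 qed
 have i: "integrable M (\<lambda>x. indicator B x *\<^sub>R (g x - c))"
  by (rule integrableI_bounded) (use nn in \<open>auto intro: le_less_trans\<close>)
 have ic: "integrable M (\<lambda>x. indicator B x *\<^sub>R c)" using B(2) by (intro integrable_scaleR_left integrable_real_indicator) auto
 have ig: "integrable M (\<lambda>x. indicator B x *\<^sub>R g x)"
  using Bochner_Integration.integrable_add[OF i ic] by (simp add: algebra_simps)
 then show "set_integrable M B g" by (simp add: set_integrable_def)
 have "(LINT x|M. indicator B x *\<^sub>R (g x - c)) = (LINT x:B|M. g x) - c * m"
 proof -
  have "(LINT x|M. indicator B x *\<^sub>R (g x - c)) = (LINT x|M. indicator B x *\<^sub>R g x) - (LINT x|M. indicator B x *\<^sub>R c)"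
   using Bochner_Integration.integral_diff[OF ig ic] by (simp add: algebra_simps)
  also have "(LINT x|M. indicator B x *\<^sub>R c) = c * m" using B(2) by (simp add: m_def)
  finally show ?thesis by (simp add: set_lebesgue_integral_def)
 qed
 moreover have "ennreal (norm (LINT x|M. indicator B x *\<^sub>R (g x - c))) \<le> ennreal (a * m)"
  using integral_norm_bound_ennreal[OF i] nn by (rule order_trans)
 then have "norm (LINT x|M. indicator B x *\<^sub>R (g x - c)) \<le> a * m" using a(2) m by (simp add: ennreal_le_iff)
 ultimately have I: "\<bar>(LINT x:B|M. g x) - c * m\<bar> \<le> a * m" by simp
 define \<beta> where "\<beta> = (LINT x:B|M. g x) / m"
 have "\<beta> - c = ((LINT x:B|M. g x) - c * m) / m" using m by (simp add: \<beta>_def field_simps)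
 then have \<beta>: "\<bar>\<beta> - c\<bar> \<le> a" using I m by (simp add: divide_le_eq)
 have "(\<integral>\<^sup>+x\<in>B. ennreal \<bar>g x - \<beta>\<bar> \<partial>M) \<le> (\<integral>\<^sup>+x. ennreal \<bar>g x - c\<bar> * indicator B x + ennreal a * indicator B x \<partial>M)"
 proof (rule nn_integral_mono)
  fix x
  have "\<bar>g x - \<beta>\<bar> \<le> \<bar>g x - c\<bar> + a" using \<beta> by linarith
  then have "ennreal \<bar>g x - \<beta>\<bar> \<le> ennreal (\<bar>g x - c\<bar> + a)" by (rule ennreal_leI)
  also have "\<dots> = ennreal \<bar>g x - c\<bar> + ennreal a" by (rule ennreal_plus[OF abs_ge_zero a(2)])
  finally have "ennreal \<bar>g x - \<beta>\<bar> \<le> ennreal \<bar>g x - c\<bar> + ennreal a" .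
  then show "ennreal \<bar>g x - \<beta>\<bar> * indicator B x \<le> ennreal \<bar>g x - c\<bar> * indicator B x + ennreal a * indicator B x"
   by (auto simp: indicator_def)
 qed
 also have "\<dots> = (\<integral>\<^sup>+x\<in>B. ennreal \<bar>g x - c\<bar> \<partial>M) + ennreal a * emeasure M B"
  by (subst nn_integral_add) (auto simp: nn_integral_cmult_indicator)
 also have "\<dots> \<le> ennreal a * emeasure M B + ennreal a * emeasure M B" using a by (intro add_mono) auto
 also have "\<dots> = ennreal (2 * a) * emeasure M B"
  unfolding distrib_right[symmetric] ennreal_plus[OF a(2) a(2), symmetric] by simp
 finally show "(\<integral>\<^sup>+x\<in>B. ennreal \<bar>g x - (LINT x:B|M. g x) / measure M B\<bar> \<partial>M) \<le> ennreal (2 * a) * emeasure M B"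
  unfolding \<beta>_def m_def .
qed

lemma is_shear_hmult: "is_shear (hmult p)"
proof -
 obtain x y t where p: "p = ((x, y), t)" by (metis prod.collapse)
 have "hmult p = shear (x, y) (\<lambda>z. t + (x \<bullet> snd z - y \<bullet> fst z) / 2)"
  by (auto simp: p hmult_eq shear_def fun_eq_iff algebra_simps)
 moreover have "(\<lambda>z. t + (x \<bullet> snd z - y \<bullet> fst z) / 2) \<in> borel_fun"
  by (intro borel_measurable_continuous_onI continuous_intros) auto
 ultimately show ?thesis unfolding is_shear_def by blast
qed

lemma hball_0: "hball 0 R = {q. hnorm q < R}"
proof -
 have "hdist q 0 = hnorm q" for q :: "'a heis" using hdist_hmult[of 0 q] by (simp add: hmult_0)
 then show ?thesis by (simp add: hball_def)
qed

lemma hmult_in_hball: "hmult p q \<in> hball p R \<longleftrightarrow> q \<in> hball 0 R"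
 unfolding hball_0 by (simp add: hball_def hdist_hmult)

lemma hball_borel: "hball p R \<in> sets borel"
proof -
 have "open {q. hnorm (hmult (hinv p) q) < R}"
  by (intro open_Collect_less continuous_intros continuous_on_compose2[OF hnorm_continuous hmult_continuous(1)]) auto
 then show ?thesis unfolding hball_def hdist_def by (rule borel_open)
qed

lemma hball_0_subset: "q \<in> hball 0 R \<Longrightarrow> norm (fst q) < R \<and> \<bar>snd q\<bar> \<le> R\<^sup>2 / 4"
proof -
 assume q: "q \<in> hball 0 R"
 then have h: "hnorm (fst q, snd q) < R" by (simp add: hball_0)
 then have "(hnorm (fst q, snd q))\<^sup>2 \<le> R\<^sup>2" using h by (intro power_mono hnorm_nonneg) simp
 then show ?thesis using h norm_le_hnorm[of "fst q" "snd q"] abs_le_hnorm[of "snd q" "fst q"] by auto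
qed

text \<open>The ball contains the cylinder of radius \<open>R / 2\<close> and half-height
  \<open>R^2 / 8\<close>. Compared with it, the support of the cutoff is larger by
  \<open>4 ^ d\<close> in the plane and by 16 vertically. Left translation preserves measure and
  carries balls about 0 to balls about \<open>p\<close>.\<close>

lemma emeasure_hball:
 fixes p :: "'n::finite heis"
 assumes R: "0 < R"
 shows "emeasure lborel (cball 0 (2 * R) \<times> {-(2 * R\<^sup>2)..2 * R\<^sup>2} :: 'n heis set)
   \<le> ennreal (16 * 4 ^ DIM('n plane)) * emeasure lborel (hball 0 R :: 'n heis set)"
  and "emeasure lborel (hball p R) = emeasure lborel (hball 0 R :: 'n heis set)"
  and "0 < emeasure lborel (hball 0 R :: 'n heis set)" "emeasure lborel (hball 0 R :: 'n heis set) < \<infinity>"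
proof -
 let ?d = "DIM('n plane)"
 let ?in = "ball 0 (R / 2) \<times> {-(R\<^sup>2 / 8)<..<R\<^sup>2 / 8} :: 'n heis set"
 let ?out = "cball 0 (2 * R) \<times> {-(2 * R\<^sup>2)..2 * R\<^sup>2} :: 'n heis set"
 define d where "d = ?d"
 define V where "V = unit_ball_vol (real d)"
 have V: "0 < V" by (simp add: V_def)
 have eb: "emeasure lborel (ball (0 :: 'n plane) r) = ennreal (V * r ^ d)"
  "emeasure lborel (cball (0 :: 'n plane) r) = ennreal (V * r ^ d)" if "0 \<le> r" for r
  unfolding V_def d_def using that by (rule emeasure_ball, rule emeasure_cball)
 have times: "emeasure lborel (A \<times> I :: 'n heis set) = emeasure lborel A * emeasure lborel I" if "A \<in> sets borel" "I \<in> sets borel" for A I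
  unfolding lborel_prod_pair using that by (intro lborel.emeasure_pair_measure_Times) auto
 have ein: "emeasure lborel ?in = ennreal (V * (R / 2) ^ d * (R\<^sup>2 / 4))"
 proof -
  have "emeasure lborel ?in = ennreal (V * (R / 2) ^ d) * emeasure lborel {-(R\<^sup>2 / 8)<..<R\<^sup>2 / 8}"
   by (subst times) (use R in \<open>simp_all only: eb, auto\<close>)
  also have "emeasure lborel {-(R\<^sup>2 / 8)<..<R\<^sup>2 / 8} = ennreal (R\<^sup>2 / 4)" by simp
  also have "ennreal (V * (R / 2) ^ d) * ennreal (R\<^sup>2 / 4) = ennreal (V * (R / 2) ^ d * (R\<^sup>2 / 4))"
   using V R by (intro ennreal_mult[symmetric]) auto
  finally show ?thesis .
 qed
 have eout: "emeasure lborel ?out = ennreal (V * (2 * R) ^ d * (4 * R\<^sup>2))"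
 proof -
  have "emeasure lborel ?out = ennreal (V * (2 * R) ^ d) * emeasure lborel {-(2 * R\<^sup>2)..2 * R\<^sup>2}"
   by (subst times) (use R in \<open>simp_all only: eb, auto\<close>)
  also have "emeasure lborel {-(2 * R\<^sup>2)..2 * R\<^sup>2} = ennreal (4 * R\<^sup>2)" by simp
  also have "ennreal (V * (2 * R) ^ d) * ennreal (4 * R\<^sup>2) = ennreal (V * (2 * R) ^ d * (4 * R\<^sup>2))"
   using V R by (intro ennreal_mult[symmetric]) auto
  finally show ?thesis .
 qed
 have "?in \<subseteq> hball 0 R"
 proof
  fix q :: "'n heis" assume "q \<in> ?in"
  then have q: "norm (fst q) < R / 2" "\<bar>snd q\<bar> < R\<^sup>2 / 8" by (auto simp: abs_less_iff)
  have "norm (fst q) ^ 4 \<le> (R / 2) ^ 4" using q by (intro power_mono) auto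
  moreover have "\<bar>snd q\<bar>\<^sup>2 \<le> (R\<^sup>2 / 8)\<^sup>2" using q by (intro power_mono) auto
  moreover have "(R / 2) ^ 4 = R ^ 4 / 16" "(R\<^sup>2 / 8)\<^sup>2 = R ^ 4 / 64" by (simp_all add: power_divide)
  moreover have "0 < R ^ 4" using R by simp
  ultimately have "norm (fst q) ^ 4 + 16 * (snd q)\<^sup>2 < R ^ 4" unfolding power2_abs by linarith
  then have "hnorm (fst q, snd q) ^ 4 < R ^ 4" unfolding hnorm_power4 .
  then have "hnorm (fst q, snd q) < R" by (rule power_less_imp_less_base) (use R in simp)
  then show "q \<in> hball 0 R" by (simp add: hball_0)
 qed
 then have le: "emeasure lborel ?in \<le> emeasure lborel (hball 0 R :: 'n heis set)" by (intro emeasure_mono) (auto simp: hball_borel)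
 have "emeasure lborel ?out = ennreal (16 * 4 ^ ?d) * emeasure lborel ?in"
 proof -
  have "(2 * R) ^ d = 4 ^ d * (R / 2) ^ d" unfolding power_mult_distrib[symmetric] by simp
  then have "V * (2 * R) ^ d * (4 * R\<^sup>2) = (16 * 4 ^ d) * (V * (R / 2) ^ d * (R\<^sup>2 / 4))" by simp
  moreover have "ennreal ((16 * 4 ^ d) * (V * (R / 2) ^ d * (R\<^sup>2 / 4))) = ennreal (16 * 4 ^ d) * ennreal (V * (R / 2) ^ d * (R\<^sup>2 / 4))"
   using V R by (intro ennreal_mult) auto
  ultimately show ?thesis unfolding ein eout d_def[symmetric] by (simp only:)
 qed
 then show "emeasure lborel ?out \<le> ennreal (16 * 4 ^ ?d) * emeasure lborel (hball 0 R :: 'n heis set)"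
  using le by (simp add: mult_left_mono)
 have "(NN q. indicator (hball p R) (hmult p q)) = (NN q. indicator (hball p R) q)"
  by (rule is_shear_nn_integral[OF is_shear_hmult]) (use hball_borel[of p R] in measurable)
 moreover have "indicator (hball p R) (hmult p q) = (indicator (hball 0 R) q :: ennreal)" for q
  using hmult_in_hball[of p q R] by (simp add: indicator_def)
 ultimately show "emeasure lborel (hball p R) = emeasure lborel (hball 0 R :: 'n heis set)" by (simp add: hball_borel)
 have "0 < emeasure lborel ?in" unfolding ein using V R by simp
 with le show "0 < emeasure lborel (hball 0 R :: 'n heis set)" by (rule less_le_trans[rotated])
 have "hball 0 R \<subseteq> ?out"
 proof
  fix q :: "'n heis" assume "q \<in> hball 0 R"
  from hball_0_subset[OF this] have "norm (fst q) < R" "\<bar>snd q\<bar> \<le> R\<^sup>2 / 4" by auto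
  then have "norm (fst q) \<le> 2 * R" "\<bar>snd q\<bar> \<le> 2 * R\<^sup>2" using R zero_le_power2[of R] by linarith+
  then show "q \<in> ?out" by (cases q) auto
 qed
 then have "emeasure lborel (hball 0 R :: 'n heis set) \<le> emeasure lborel ?out" by (intro emeasure_mono) (auto intro!: borel_closed closed_Times)
 then show "emeasure lborel (hball 0 R :: 'n heis set) < \<infinity>" unfolding eout by (auto intro: le_less_trans)
qed

text \<open>Starting at height at most \<open>R^2 / 4\<close>, a vertical shift by up to
  \<open>R^2 / 4\<close> stays where the cutoff is 1, and there the increments of \<open>f\<close>
  and of its localization coincide.\<close>

lemma localize_half_trunc:
 fixes f :: "'n::finite heis \<Rightarrow> real"
 assumes f: "hlipschitz L f" and B: "\<And>p. \<bar>f p\<bar> \<le> B" and R: "0 < R" and p: "norm (fst p) \<le> R" "\<bar>snd p\<bar> \<le> R\<^sup>2 / 4"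
 shows "0 < eps \<Longrightarrow> eps \<le> R\<^sup>2 / 4 \<Longrightarrow> T_half_trunc f p eps = T_half_trunc (localize R f) p eps + (T_half_trunc f p (R\<^sup>2 / 4) - T_half_trunc (localize R f) p (R\<^sup>2 / 4))"
  and "(T_half_trunc (localize R f) p \<longlongrightarrow> l) (at_right 0) \<Longrightarrow>
   (T_half_trunc f p \<longlongrightarrow> l + (T_half_trunc f p (R\<^sup>2 / 4) - T_half_trunc (localize R f) p (R\<^sup>2 / 4))) (at_right 0)"
proof -
 define h k where "h = (\<lambda>s. f (fst p, s))" and "k = (\<lambda>s. localize R f (fst p, s))"
 have h: "h \<in> borel_fun" and k: "k \<in> borel_fun" unfolding h_def k_def
  by (intro borel_measurable_continuous_onI slice_continuous hlipschitz_continuous[OF f] localize_continuous[OF R f])+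
 have hB: "\<bar>h t\<bar> \<le> B" and kB: "\<bar>k t\<bar> \<le> 3 * L * R" for t unfolding h_def k_def by (rule B, rule localize_abs_le[OF f R])
 have eq: "h (snd p + r) - h (snd p) = k (snd p + r) - k (snd p)" if "\<bar>r\<bar> \<le> R\<^sup>2 / 4" for r
 proof -
  have "\<bar>snd p + r\<bar> \<le> R\<^sup>2" "\<bar>snd p\<bar> \<le> R\<^sup>2" using that p zero_le_power2[of R] by linarith+
  then have "k (snd p + r) = h (snd p + r) - f 0" "k (snd p) = h (snd p) - f 0"
   unfolding h_def k_def using localize_eq[OF R p(1), of "snd p + r" f] localize_eq[OF R p(1), of "snd p" f] by blast+
  then show ?thesis by simp
 qed
 show "0 < eps \<Longrightarrow> eps \<le> R\<^sup>2 / 4 \<Longrightarrow> T_half_trunc f p eps = T_half_trunc (localize R f) p eps + (T_half_trunc f p (R\<^sup>2 / 4) - T_half_trunc (localize R f) p (R\<^sup>2 / 4))"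
  unfolding T_half_trunc_eq h_def[symmetric] k_def[symmetric] by (rule half_trunc_local[OF h hB k kB eq])
 show "(T_half_trunc (localize R f) p \<longlongrightarrow> l) (at_right 0) \<Longrightarrow>
   (T_half_trunc f p \<longlongrightarrow> l + (T_half_trunc f p (R\<^sup>2 / 4) - T_half_trunc (localize R f) p (R\<^sup>2 / 4))) (at_right 0)"
  unfolding T_half_trunc_eq h_def[symmetric] k_def[symmetric] by (rule half_trunc_local_limit[OF h hB k kB eq]) (use R in auto)
qed

text \<open>Vertical elements are central: \<open>lift r p\<close> is \<open>lift r 0\<close>
  multiplied on the right by \<open>p\<close>. Hence increments at \<open>p\<close> and at 0 differ
  by at most \<open>2 * (L * R)\<close>, and the kernel beyond \<open>R^2 / 4\<close> has mass
  \<open>8 / R\<close>.\<close>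

lemma T_half_trunc_tail_diff:
 fixes f :: "'n::finite heis \<Rightarrow> real"
 assumes f: "hlipschitz L f" and B: "\<And>p. \<bar>f p\<bar> \<le> B" and R: "0 < R" and p: "hnorm p \<le> R"
 shows "\<bar>T_half_trunc f p (R\<^sup>2 / 4) - T_half_trunc f 0 (R\<^sup>2 / 4)\<bar> \<le> 16 * L"
proof -
 have L: "0 \<le> L" using f by (simp add: hlipschitz_def)
 have m: "(\<lambda>s. f (z, s)) \<in> borel_fun" for z
  by (intro borel_measurable_continuous_onI slice_continuous hlipschitz_continuous[OF f])
 have e: "0 < R\<^sup>2 / 4" using R by simp
 have c: "\<bar>f (lift r p) - f (lift r 0)\<bar> \<le> L * R" for r
 proof -
  have "lift r p = hmult (lift r 0) p" by (cases p; cases "fst p") (simp add: lift_def zero_prod_def hmult_eq add.commute)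
  then have "\<bar>f (lift r p) - f (lift r 0)\<bar> \<le> L * hnorm p" using hlipschitz_hmult[OF f, of "lift r 0" p] by simp
  also have "\<dots> \<le> L * R" using p L by (rule mult_left_mono)
  finally show ?thesis .
 qed
 have "\<bar>(f (fst p, snd p + r) - f (fst p, snd p)) - (f (fst 0, snd 0 + r) - f (fst 0, snd 0))\<bar> \<le> 2 * (L * R)" for r
  using c[of r] c[of 0] by (simp add: lift_def)
 then have "\<bar>half_trunc (\<lambda>s. f (fst p, s)) (snd p) (R\<^sup>2 / 4) - half_trunc (\<lambda>s. f (fst 0, s)) (snd 0) (R\<^sup>2 / 4)\<bar> \<le> 4 * (2 * (L * R)) / sqrt (R\<^sup>2 / 4)"
  by (intro half_trunc_diff[OF m B m B e])
 also have "\<dots> = 16 * L" using R by (simp add: real_sqrt_divide)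
 finally show ?thesis unfolding T_half_trunc_eq .
qed

lemma T_half_trunc_localize_tail:
 fixes f :: "'n::finite heis \<Rightarrow> real"
 assumes f: "hlipschitz L f" and R: "0 < R"
 shows "\<bar>T_half_trunc (localize R f) p (R\<^sup>2 / 4)\<bar> \<le> 48 * L"
proof -
 have m: "(\<lambda>s. localize R f (z, s)) \<in> borel_fun" for z
  by (intro borel_measurable_continuous_onI slice_continuous localize_continuous[OF R f])
 have e: "0 < R\<^sup>2 / 4" using R by simp
 have b: "\<bar>localize R f (z, s) - localize R f (z, t)\<bar> \<le> 6 * (L * R)" for z s t
  using localize_abs_le[OF f R, of "(z, s)"] localize_abs_le[OF f R, of "(z, t)"] by linarith
 have "\<bar>half_trunc (\<lambda>s. localize R f (fst p, s)) (snd p) (R\<^sup>2 / 4)\<bar> \<le> 4 * (6 * (L * R)) / sqrt (R\<^sup>2 / 4)"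
  by (rule half_trunc_abs_le[OF m e b])
 also have "\<dots> = 48 * L" using R by (simp add: real_sqrt_divide)
 finally show ?thesis unfolding T_half_trunc_eq .
qed

text \<open>\<open>i\<close> selects the horizontal pair for the commutator estimate. Joint
  measurability of the limit allows Fubini to turn statements on almost every line into statements
  on the group.\<close>

lemma localize_slices:
 fixes f :: "'n::finite heis \<Rightarrow> real" and i :: 'n
 assumes f: "hlipschitz L f" and R: "0 < R"
  and \<mu>: "emeasure lborel (cball 0 (2 * R) \<times> {-(2 * R\<^sup>2)..2 * R\<^sup>2} :: 'n heis set) \<le> ennreal \<mu>" "0 \<le> \<mu>"
 shows "AE p in lborel. \<bar>snd p\<bar> < 2 * R\<^sup>2 \<longrightarrow> (\<exists>l. (T_half_trunc (localize R f) p \<longlongrightarrow> l) (at_right 0))"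
  and "(NN p. ennreal ((T_half (localize R f) p)\<^sup>2) * indicator {-(2 * R\<^sup>2)<..<2 * R\<^sup>2} (snd p))
   \<le> ennreal (4 * (trunc_const / pi)\<^sup>2 * (commutator_const * (7 * L)\<^sup>2 * \<mu>))"
  and "AE z in lborel. AE t in lborel. -(2 * R\<^sup>2) < t \<and> t < 2 * R\<^sup>2 \<longrightarrow> (\<exists>l. (half_trunc (\<lambda>s. localize R f (z, s)) t \<longlongrightarrow> l) (at_right 0))"
  and "AE z in lborel. \<forall>\<phi> C. continuous_on UNIV \<phi> \<longrightarrow> (\<forall>t. \<bar>\<phi> t\<bar> \<le> C) \<longrightarrow> (\<forall>t. t \<notin> {-(2 * R\<^sup>2)<..<2 * R\<^sup>2} \<longrightarrow> \<phi> t = 0) \<longrightarrow>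
    ((\<lambda>eps. LB t. \<phi> t * half_trunc (\<lambda>s. localize R f (z, s)) t eps) \<longlongrightarrow>
     (LB t. \<phi> t * lim0 (half_trunc (\<lambda>s. localize R f (z, s)) t))) (at_right 0)"
proof -
 define u where "u = localize R f"
 have u: "continuous_on UNIV u" unfolding u_def by (rule localize_continuous[OF R f])
 have uB: "\<bar>u p\<bar> \<le> 3 * L * R" for p unfolding u_def by (rule localize_abs_le[OF f R])
 have u0: "u (z, t) = 0" if "norm z > 2 * R \<or> \<bar>t\<bar> > 2 * R\<^sup>2" for z t unfolding u_def by (rule localize_eq_0[OF R that])
 have c: "0 < 2 * R\<^sup>2" using R by simp
 have hl: "horizontally_lipschitz i (7 * L) u" unfolding u_def by (rule localize_horizontally_lipschitz[OF f R])
 have s1: "AE z in lborel. AE t in lborel. -(2 * R\<^sup>2) < t \<and> t < 2 * R\<^sup>2 \<longrightarrow> (\<exists>l. (half_trunc (\<lambda>s. u (z, s)) t \<longlongrightarrow> l) (at_right 0))"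
  by (rule half_trunc_slices(1)[OF u uB _ c \<mu> hl]) (rule u0)
 show "AE z in lborel. AE t in lborel. -(2 * R\<^sup>2) < t \<and> t < 2 * R\<^sup>2 \<longrightarrow> (\<exists>l. (half_trunc (\<lambda>s. localize R f (z, s)) t \<longlongrightarrow> l) (at_right 0))"
  using s1 unfolding u_def .
 show "AE z in lborel. \<forall>\<phi> C. continuous_on UNIV \<phi> \<longrightarrow> (\<forall>t. \<bar>\<phi> t\<bar> \<le> C) \<longrightarrow> (\<forall>t. t \<notin> {-(2 * R\<^sup>2)<..<2 * R\<^sup>2} \<longrightarrow> \<phi> t = 0) \<longrightarrow>
    ((\<lambda>eps. LB t. \<phi> t * half_trunc (\<lambda>s. localize R f (z, s)) t eps) \<longlongrightarrow>
     (LB t. \<phi> t * lim0 (half_trunc (\<lambda>s. localize R f (z, s)) t))) (at_right 0)"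
  unfolding u_def[symmetric] by (rule half_trunc_slices(2)[OF u uB _ c \<mu> hl]) (rule u0)
 have s3: "(NN z. (NN t. ennreal ((lim0 (half_trunc (\<lambda>s. u (z, s)) t))\<^sup>2) * indicator {-(2 * R\<^sup>2)<..<2 * R\<^sup>2} t))
    \<le> ennreal (4 * (trunc_const / pi)\<^sup>2 * (commutator_const * (7 * L)\<^sup>2 * \<mu>))"
  by (rule half_trunc_slices(3)[OF u uB _ c \<mu> hl]) (rule u0)
 have m [measurable]: "Measurable.pred borel (\<lambda>p. \<exists>l. (T_half_trunc u p \<longlongrightarrow> l) (at_right 0))" "T_half u \<in> borel_fun"
  by (rule T_half_measurable[OF u uB])+
 have sets: "{p \<in> space (lborel \<Otimes>\<^sub>M lborel). \<bar>snd p\<bar> < 2 * R\<^sup>2 \<longrightarrow> (\<exists>l. (T_half_trunc u p \<longlongrightarrow> l) (at_right 0))} \<in> sets (lborel \<Otimes>\<^sub>M (lborel :: real measure))"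
 proof -
  have "{p :: 'n heis. \<bar>snd p\<bar> < 2 * R\<^sup>2 \<longrightarrow> (\<exists>l. (T_half_trunc u p \<longlongrightarrow> l) (at_right 0))} \<in> sets borel"
  proof -
   have "Measurable.pred borel (\<lambda>p :: 'n heis. \<bar>snd p\<bar> < 2 * R\<^sup>2)" unfolding borel_prod_pair by measurable
   then have "Measurable.pred borel (\<lambda>p. \<bar>snd p\<bar> < 2 * R\<^sup>2 \<longrightarrow> (\<exists>l. (T_half_trunc u p \<longlongrightarrow> l) (at_right 0)))" using m by measurable
   then show ?thesis by (simp add: pred_def)
  qed
  then show ?thesis unfolding lborel_prod by simp
 qed
 have "AE p in lborel \<Otimes>\<^sub>M (lborel :: real measure). \<bar>snd p\<bar> < 2 * R\<^sup>2 \<longrightarrow> (\<exists>l. (T_half_trunc u p \<longlongrightarrow> l) (at_right 0))"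
 proof (rule lborel_pair.AE_pair_measure[OF sets])
  show "AE z in lborel. AE t in lborel. \<bar>snd (z, t)\<bar> < 2 * R\<^sup>2 \<longrightarrow> (\<exists>l. (T_half_trunc u (z, t) \<longlongrightarrow> l) (at_right 0))"
   using s1 unfolding T_half_trunc_eq fst_conv snd_conv abs_less_iff
   by (elim eventually_mono) auto
 qed
 then show "AE p in lborel. \<bar>snd p\<bar> < 2 * R\<^sup>2 \<longrightarrow> (\<exists>l. (T_half_trunc (localize R f) p \<longlongrightarrow> l) (at_right 0))"
  unfolding lborel_prod u_def .
 have "(\<lambda>p :: 'n heis. indicator {-(2 * R\<^sup>2)<..<2 * R\<^sup>2} (snd p) :: ennreal) \<in> borel_fun" unfolding borel_prod_pair by measurable
 then have im: "(\<lambda>p. ennreal ((T_half u p)\<^sup>2) * indicator {-(2 * R\<^sup>2)<..<2 * R\<^sup>2} (snd p)) \<in> borel_fun" using m(2) by measurable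
 show "(NN p. ennreal ((T_half (localize R f) p)\<^sup>2) * indicator {-(2 * R\<^sup>2)<..<2 * R\<^sup>2} (snd p))
   \<le> ennreal (4 * (trunc_const / pi)\<^sup>2 * (commutator_const * (7 * L)\<^sup>2 * \<mu>))"
  unfolding u_def[symmetric] nn_integral_lborel_slices[OF im]
  using s3 by (simp only: T_half_def T_half_trunc_eq fst_conv snd_conv)
qed

text \<open>\<open>65 = 1 + 16 + 48\<close>: the linear term in
  \<open>|l| \<le> L + l^2 / L\<close>, the variation of the tail of \<open>f\<close>, and the tail
  of the localized function. In the second summand 49 is the square of the Lipschitz factor 7, and
  \<open>16 * 4 ^ d\<close> compares the cylinder with the ball.\<close>

definition osc_const :: "nat \<Rightarrow> real" where
 "osc_const d = 65 + 4 * (trunc_const / pi)\<^sup>2 * (commutator_const * 49 * (16 * 4 ^ d))"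

lemma osc_const_pos: "0 < osc_const d"
 unfolding osc_const_def using commutator_const_pos by (intro add_pos_nonneg mult_nonneg_nonneg) auto

text \<open>The constant is the tail at the centre. On the ball \<open>T_half f - c\<close> is the
  half-derivative \<open>l\<close> of the localized function plus tail terms of order
  \<open>L\<close>. The bound \<open>|l| \<le> L + l^2 / L\<close> brings in the L2 estimate, which
  is \<open>L^2\<close> times a multiple of the measure of the ball, so every term is of order
  \<open>L\<close> times that measure.\<close>

lemma T_half_oscillation_0:
 fixes f :: "'n::finite heis \<Rightarrow> real"
 assumes f: "hlipschitz L f" and L: "0 < L" and B: "\<And>p. \<bar>f p\<bar> \<le> B" and R: "0 < R"
 shows "\<exists>c. (\<integral>\<^sup>+p\<in>hball 0 R. ennreal \<bar>T_half f p - c\<bar> \<partial>lborel)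
   \<le> ennreal (osc_const (DIM('n plane)) * L) * emeasure lborel (hball 0 R :: 'n heis set)"
proof -
 let ?d = "DIM('n plane)"
 let ?out = "cball 0 (2 * R) \<times> {-(2 * R\<^sup>2)..2 * R\<^sup>2} :: 'n heis set"
 define E where "E = emeasure lborel (hball 0 R :: 'n heis set)"
 define u where "u = localize R f"
 define c where "c = T_half_trunc f 0 (R\<^sup>2 / 4)"
 define \<mu> where "\<mu> = measure lborel ?out"
 have out: "emeasure lborel ?out < \<infinity>"
  by (rule emeasure_bounded_finite) (intro bounded_Times bounded_cball bounded_closed_interval)
 then have \<mu>: "emeasure lborel ?out = ennreal \<mu>" "0 \<le> \<mu>" unfolding \<mu>_def by (simp_all add: emeasure_eq_ennreal_measure)
 note slices = localize_slices[OF f R eq_refl[OF \<mu>(1)] \<mu>(2), folded u_def]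
 have u: "continuous_on UNIV u" unfolding u_def by (rule localize_continuous[OF R f])
 have uB: "\<bar>u p\<bar> \<le> 3 * L * R" for p unfolding u_def by (rule localize_abs_le[OF f R])
 have [measurable]: "T_half u \<in> borel_fun" by (rule T_half_measurable(2)[OF u uB])
 have [measurable]: "(hball 0 R :: 'n heis set) \<in> sets borel" by (rule hball_borel)
 define a where "a = 4 * (trunc_const / pi)\<^sup>2 * (commutator_const * 49 * L)"
 have a: "0 \<le> a" unfolding a_def using commutator_const_pos L by (intro mult_nonneg_nonneg) auto
 have "(\<integral>\<^sup>+p\<in>hball 0 R. ennreal \<bar>T_half f p - c\<bar> \<partial>lborel) \<le>
   (NN p. ennreal (65 * L) * indicator (hball 0 R) p + ennreal (1 / L) * (ennreal ((T_half u p)\<^sup>2) * indicator {-(2 * R\<^sup>2)<..<2 * R\<^sup>2} (snd p)))"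
 proof (rule nn_integral_mono_AE)
  show "AE p in lborel. ennreal \<bar>T_half f p - c\<bar> * indicator (hball 0 R) p \<le>
   ennreal (65 * L) * indicator (hball 0 R) p + ennreal (1 / L) * (ennreal ((T_half u p)\<^sup>2) * indicator {-(2 * R\<^sup>2)<..<2 * R\<^sup>2} (snd p))"
   using slices(1)
  proof eventually_elim
   case (elim p)
   show ?case
   proof (cases "p \<in> hball 0 R")
    case True
    from hball_0_subset[OF True] have p: "norm (fst p) \<le> R" "\<bar>snd p\<bar> \<le> R\<^sup>2 / 4" by auto
    have h: "hnorm p \<le> R" using True by (simp add: hball_0)
    have s: "\<bar>snd p\<bar> < 2 * R\<^sup>2" using p R zero_less_power[OF R, of 2] by linarith
    with elim obtain l where l: "(T_half_trunc u p \<longlongrightarrow> l) (at_right 0)" by blast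
    have Tu: "T_half u p = l" unfolding T_half_def by (rule lim0_eq[OF l])
    have Tf: "T_half f p = l + (T_half_trunc f p (R\<^sup>2 / 4) - T_half_trunc u p (R\<^sup>2 / 4))"
     unfolding T_half_def u_def by (rule lim0_eq[OF localize_half_trunc(2)[OF f B R p l[unfolded u_def]]])
    have sq: "\<bar>l\<bar> \<le> L + 1 / L * l\<^sup>2"
    proof -
     have "2 * L * \<bar>l\<bar> \<le> L\<^sup>2 + \<bar>l\<bar>\<^sup>2" by (rule sum_squares_bound)
     moreover have "0 \<le> L * \<bar>l\<bar>" using L by simp
     ultimately have "L * \<bar>l\<bar> \<le> L\<^sup>2 + l\<^sup>2" unfolding power2_abs by linarith
     also have "\<dots> = L * (L + 1 / L * l\<^sup>2)" using L by (simp add: field_simps power2_eq_square)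
     finally show ?thesis using L by simp
    qed
    have "\<bar>T_half f p - c\<bar> \<le> 65 * L + 1 / L * l\<^sup>2"
     using sq T_half_trunc_tail_diff[OF f B R h, folded c_def] T_half_trunc_localize_tail[OF f R, of p, folded u_def] unfolding Tf by linarith
    then have "ennreal \<bar>T_half f p - c\<bar> \<le> ennreal (65 * L + 1 / L * l\<^sup>2)" by (rule ennreal_leI)
    also have "\<dots> = ennreal (65 * L) + ennreal (1 / L * l\<^sup>2)" using L by (intro ennreal_plus) auto
    also have "ennreal (1 / L * l\<^sup>2) = ennreal (1 / L) * ennreal (l\<^sup>2)" using L by (intro ennreal_mult) auto
    finally show ?thesis using True s by (simp add: Tu abs_less_iff)
   qed simp
  qed
 qed
 also have "\<dots> = ennreal (65 * L) * E + ennreal (1 / L) * (NN p. ennreal ((T_half u p)\<^sup>2) * indicator {-(2 * R\<^sup>2)<..<2 * R\<^sup>2} (snd p))"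
 proof -
  have [measurable]: "(\<lambda>p :: 'n heis. indicator {-(2 * R\<^sup>2)<..<2 * R\<^sup>2} (snd p) :: ennreal) \<in> borel_fun" unfolding borel_prod_pair by measurable
  show ?thesis unfolding E_def
   by (subst nn_integral_add) (auto simp: nn_integral_cmult nn_integral_cmult_indicator)
 qed
 also have "\<dots> \<le> ennreal (65 * L) * E + ennreal (1 / L) * ennreal (4 * (trunc_const / pi)\<^sup>2 * (commutator_const * (7 * L)\<^sup>2 * \<mu>))"
  using slices(2) by (intro add_left_mono mult_left_mono) auto
 also have "ennreal (1 / L) * ennreal (4 * (trunc_const / pi)\<^sup>2 * (commutator_const * (7 * L)\<^sup>2 * \<mu>)) = ennreal a * ennreal \<mu>"
 proof -
  have "1 / L * (4 * (trunc_const / pi)\<^sup>2 * (commutator_const * (7 * L)\<^sup>2 * \<mu>)) = a * \<mu>"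
   unfolding a_def using L by (simp add: power2_eq_square)
  moreover have "0 \<le> 4 * (trunc_const / pi)\<^sup>2 * (commutator_const * (7 * L)\<^sup>2 * \<mu>)" using commutator_const_pos \<mu>(2) by (intro mult_nonneg_nonneg) auto
  ultimately show ?thesis using L a \<mu>(2) by (metis ennreal_mult divide_nonneg_pos zero_le_one)
 qed
 also have "ennreal a * ennreal \<mu> \<le> ennreal a * (ennreal (16 * 4 ^ ?d) * E)"
  unfolding \<mu>(1)[symmetric] E_def by (intro mult_left_mono emeasure_hball(1)[OF R]) simp
 also have "ennreal (65 * L) * E + ennreal a * (ennreal (16 * 4 ^ ?d) * E) = ennreal (osc_const ?d * L) * E"
 proof -
  have e: "osc_const ?d * L = 65 * L + a * (16 * 4 ^ ?d)" by (simp add: osc_const_def a_def algebra_simps)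
  have "ennreal (osc_const ?d * L) = ennreal (65 * L) + ennreal (a * (16 * 4 ^ ?d))" unfolding e using L a by (intro ennreal_plus) auto
  also have "ennreal (a * (16 * 4 ^ ?d)) = ennreal a * ennreal (16 * 4 ^ ?d)" using a by (intro ennreal_mult) auto
  finally show ?thesis by (simp only: distrib_right mult.assoc)
 qed
 finally show ?thesis unfolding E_def by (intro exI[of _ c]) (simp add: add_left_mono)
qed

lemma T_half_oscillation:
 fixes f :: "'n::finite heis \<Rightarrow> real"
 assumes f: "hlipschitz L f" and L: "0 < L" and B: "\<And>p. \<bar>f p\<bar> \<le> B" and R: "0 < R"
 shows "\<exists>c. (\<integral>\<^sup>+p\<in>hball p0 R. ennreal \<bar>T_half f p - c\<bar> \<partial>lborel)
   \<le> ennreal (osc_const (DIM('n plane)) * L) * emeasure lborel (hball p0 R)"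
proof -
 define g where "g = (\<lambda>q. f (hmult p0 q))"
 have g: "hlipschitz L g" unfolding g_def by (rule hlipschitz_left[OF f])
 have gB: "\<bar>g p\<bar> \<le> B" for p unfolding g_def by (rule B)
 obtain c where c: "(\<integral>\<^sup>+p\<in>hball 0 R. ennreal \<bar>T_half g p - c\<bar> \<partial>lborel)
   \<le> ennreal (osc_const (DIM('n plane)) * L) * emeasure lborel (hball 0 R :: 'n heis set)"
  using T_half_oscillation_0[OF g L gB R] by blast
 have [measurable]: "T_half f \<in> borel_fun" by (rule T_half_measurable(2)[OF hlipschitz_continuous[OF f] B])
 have [measurable]: "hball p0 R \<in> sets borel" by (rule hball_borel)
 have "(NN p. ennreal \<bar>T_half f p - c\<bar> * indicator (hball p0 R) p)
   = (NN q. ennreal \<bar>T_half f (hmult p0 q) - c\<bar> * indicator (hball p0 R) (hmult p0 q))"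
  by (rule is_shear_nn_integral[OF is_shear_hmult, symmetric]) measurable
 also have "\<dots> = (\<integral>\<^sup>+p\<in>hball 0 R. ennreal \<bar>T_half g p - c\<bar> \<partial>lborel)"
  unfolding T_half_shear[OF is_shear_hmult] g_def[symmetric] indicator_def hmult_in_hball ..
 finally have eq: "(\<integral>\<^sup>+p\<in>hball p0 R. ennreal \<bar>T_half f p - c\<bar> \<partial>lborel) = (\<integral>\<^sup>+p\<in>hball 0 R. ennreal \<bar>T_half g p - c\<bar> \<partial>lborel)" .
 show ?thesis using c unfolding emeasure_hball(2)[OF R, of p0] eq[symmetric] by blast
qed

lemma bmo_norm_T_half_le:
 fixes f :: "'n::finite heis \<Rightarrow> real"
 assumes f: "hlipschitz L f" and L: "0 < L" and B: "\<And>p. \<bar>f p\<bar> \<le> B"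
 shows "bmo_norm (T_half f) \<le> ennreal (2 * osc_const (DIM('n plane)) * L)"
  and "T_half f \<in> L1_loc"
proof -
 define K where "K = osc_const (DIM('n plane)) * L"
 have K: "0 \<le> K" unfolding K_def using osc_const_pos L by (simp add: less_imp_le)
 have [measurable]: "T_half f \<in> borel_fun" by (rule T_half_measurable(2)[OF hlipschitz_continuous[OF f] B])
 have em: "emeasure lebesgue (hball p R) = emeasure lborel (hball p R)" for p :: "'n heis" and R by (simp add: hball_borel)
 have pos: "0 < emeasure lebesgue (hball p R)" "emeasure lebesgue (hball p R) < \<infinity>" if "0 < R" for p :: "'n heis" and R
  unfolding em emeasure_hball(2)[OF that, of p] by (rule emeasure_hball(3,4)[OF that])+
 have gm: "T_half f \<in> borel_measurable lebesgue" by (rule measurable_completion) simp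
 have hs: "hball p R \<in> sets lebesgue" for p :: "'n heis" and R by (rule sets_completionI_sets) (simp add: hball_borel)
 have osc: "\<exists>c. (\<integral>\<^sup>+p\<in>hball p0 R. ennreal \<bar>T_half f p - c\<bar> \<partial>lebesgue) \<le> ennreal K * emeasure lebesgue (hball p0 R)" if "0 < R" for p0 R
  unfolding em nn_integral_completion K_def by (rule T_half_oscillation[OF f L B that])
 show "bmo_norm (T_half f) \<le> ennreal (2 * osc_const (DIM('n plane)) * L)"
  unfolding bmo_norm_def
 proof (rule SUP_least)
  fix S :: "'n heis set" assume "S \<in> {hball p r |p r. 0 < r}"
  then obtain p R where S: "S = hball p R" and R: "0 < R" by blast
  obtain c where "(\<integral>\<^sup>+q\<in>hball p R. ennreal \<bar>T_half f q - c\<bar> \<partial>lebesgue) \<le> ennreal K * emeasure lebesgue (hball p R)" using osc[OF R] by blast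
  from mean_oscillation_le(1)[OF gm hs pos[OF R] this K]
  have "(\<integral>\<^sup>+q\<in>S. ennreal \<bar>T_half f q - average (T_half f) S\<bar> \<partial>lebesgue) \<le> ennreal (2 * K) * emeasure lebesgue S"
   unfolding S average_def .
  then show "(\<integral>\<^sup>+q\<in>S. ennreal \<bar>T_half f q - average (T_half f) S\<bar> \<partial>lebesgue) / emeasure lebesgue S
    \<le> ennreal (2 * osc_const (DIM('n plane)) * L)"
   using pos(1)[OF R] unfolding S K_def by (intro divide_le_posI_ennreal) (auto simp: mult_ac)
 qed
 show "T_half f \<in> L1_loc"
  unfolding L1_loc_def mem_Collect_eq
 proof (intro allI impI)
  fix S :: "'n heis set" assume S: "compact S"
  then have "compact (hnorm ` S)" by (intro compact_continuous_image continuous_on_subset[OF hnorm_continuous]) auto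
  then obtain b where b: "\<And>x. x \<in> S \<Longrightarrow> \<bar>hnorm x\<bar> \<le> b" using compact_imp_bounded bounded_real by (metis image_eqI)
  define R where "R = \<bar>b\<bar> + 1"
  have R: "0 < R" by (simp add: R_def)
  \<comment> \<open>A compact set lies in a Koranyi ball about 0, on which finite deviation from a
    constant gives integrability.\<close>
  have sub: "S \<subseteq> hball 0 R" using b unfolding hball_0 R_def by fastforce
  obtain c where "(\<integral>\<^sup>+q\<in>hball 0 R. ennreal \<bar>T_half f q - c\<bar> \<partial>lebesgue) \<le> ennreal K * emeasure lebesgue (hball 0 R :: 'n heis set)" using osc[OF R] by blast
  from mean_oscillation_le(2)[OF gm hs pos[OF R] this K]
  show "set_integrable lebesgue S (T_half f)"
   by (rule set_integrable_subset[OF _ fmeasurableD[OF lmeasurable_compact[OF S]] sub])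
 qed
qed

text \<open>Countably many radii exhaust the group, so one null set serves them all.\<close>

lemma T_half_exists_AE:
 fixes f :: "'n::finite heis \<Rightarrow> real"
 assumes f: "hlipschitz L f" and B: "\<And>p. \<bar>f p\<bar> \<le> B"
 shows "AE p in lborel. \<exists>l. (T_half_trunc f p \<longlongrightarrow> l) (at_right 0)"
proof -
 have "AE p in lborel. \<bar>snd p\<bar> < 2 * (real (Suc n))\<^sup>2 \<longrightarrow> (\<exists>l. (T_half_trunc (localize (real (Suc n)) f) p \<longlongrightarrow> l) (at_right 0))" for n
 proof -
  have R: "0 < real (Suc n)" by simp
  let ?out = "cball 0 (2 * real (Suc n)) \<times> {-(2 * (real (Suc n))\<^sup>2)..2 * (real (Suc n))\<^sup>2} :: 'n heis set"
  have "emeasure lborel ?out < \<infinity>"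
   by (rule emeasure_bounded_finite) (intro bounded_Times bounded_cball bounded_closed_interval)
  then have "emeasure lborel ?out \<le> ennreal (measure lborel ?out)" by (simp add: emeasure_eq_ennreal_measure)
  from localize_slices(1)[OF f R this measure_nonneg] show ?thesis .
 qed
 then have "AE p in lborel. \<forall>n. \<bar>snd p\<bar> < 2 * (real (Suc n))\<^sup>2 \<longrightarrow> (\<exists>l. (T_half_trunc (localize (real (Suc n)) f) p \<longlongrightarrow> l) (at_right 0))"
  unfolding AE_all_countable by blast
 then show ?thesis
 proof eventually_elim
  case (elim p)
  \<comment> \<open>The factor 4, with \<open>real n \<le> R^2\<close> for \<open>R = Suc n\<close>,
    places the height of \<open>p\<close> below \<open>R^2 / 4\<close>.\<close>
  obtain n where n: "norm (fst p) + 4 * \<bar>snd p\<bar> < real n" using reals_Archimedean2 by blast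
  have R: "0 < real (Suc n)" by simp
  have "real n \<le> real (Suc n)" "real (Suc n) \<le> (real (Suc n))\<^sup>2" by (simp_all add: power2_eq_square)
  then have p: "norm (fst p) \<le> real (Suc n)" "\<bar>snd p\<bar> \<le> (real (Suc n))\<^sup>2 / 4" "\<bar>snd p\<bar> < 2 * (real (Suc n))\<^sup>2"
   using n norm_ge_zero[of "fst p"] abs_ge_zero[of "snd p"] by linarith+
  then show ?case using elim localize_half_trunc(2)[OF f B R p(1,2)] by blast
 qed
qed

section \<open>The distributional identity\<close>

lemma dominated_convergence_at_right_0:
 fixes s :: "real \<Rightarrow> 'a \<Rightarrow> real"
 assumes m: "f \<in> borel_measurable M" "\<And>eps. 0 < eps \<Longrightarrow> s eps \<in> borel_measurable M" and w: "integrable M w"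
  and lim: "\<And>x. ((\<lambda>eps. s eps x) \<longlongrightarrow> f x) (at_right 0)" and b: "\<And>eps x. 0 < eps \<Longrightarrow> \<bar>s eps x\<bar> \<le> w x"
 shows "((\<lambda>eps. LINT x|M. s eps x) \<longlongrightarrow> (LINT x|M. f x)) (at_right 0)"
proof (rule tendsto_at_right_sequentially[of 0 1])
 fix S :: "nat \<Rightarrow> real" assume S: "\<And>n. 0 < S n" "S \<longlonglongrightarrow> 0"
 have "S n \<noteq> 0" for n using S(1)[of n] by simp
 then have "filterlim S (at_right 0) sequentially" unfolding filterlim_at using S by auto
 from filterlim_compose[OF lim this] have "(\<lambda>n. s (S n) x) \<longlonglongrightarrow> f x" for x .
 then show "(\<lambda>n. LINT x|M. s (S n) x) \<longlonglongrightarrow> (LINT x|M. f x)"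
  by (intro integral_dominated_convergence[OF _ _ w]) (use m b S in auto)
qed simp

lemma sym_marchaud_eq: "0 \<le> eps \<Longrightarrow> sym_marchaud eps r = (if \<bar>r\<bar> > eps then 1 / (\<bar>r\<bar> * sqrt \<bar>r\<bar>) else 0)"
 by (auto simp: sym_marchaud_def marchaud_def abs_if)

lemma integrable_abel_local: "integrable lborel (\<lambda>r. abel r * indicator {0<..<2} r)"
proof (rule integrableI_bounded)
 have "(NN r. ennreal (norm (abel r * indicator {0<..<2} r))) = (NN r. ennreal (abel r) * indicator {0<..<2} r)"
  by (intro nn_integral_cong) (auto simp: indicator_def abel_nonneg)
 also have "\<dots> < \<infinity>" by (subst nn_integral_abel) auto
 finally show "(NN r. ennreal (norm (abel r * indicator {0<..<2} r))) < \<infinity>" .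
qed measurable

text \<open>For a bounded Lipschitz function the integrand is of order -1/2 in \<open>|r|\<close>
  near 0 and of order -3/2 far away; this sum dominates both, whatever the truncation. The windows
  reach 2, so that \<open>|r| = 1\<close> is covered.\<close>

definition lipschitz_majorant :: "real \<Rightarrow> real" where
 "lipschitz_majorant r = abel r * indicator {0<..<2} r + abel (- r) * indicator {0<..<2} (- r) + 2 * sym_marchaud 1 r"

lemma integrable_lipschitz_majorant: "integrable lborel lipschitz_majorant"
proof -
 have "integrable lborel (\<lambda>r. abel (0 + (-1) * r) * indicator {0<..<2} (0 + (-1) * r))"
  by (subst lborel_integrable_real_affine_iff) (use integrable_abel_local in auto)
 then show ?thesis unfolding lipschitz_majorant_def [abs_def]
  using integrable_abel_local integrable_sym_marchaud(1)[of 1] by (intro Bochner_Integration.integrable_add integrable_mult_right) auto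
qed

lemma lipschitz_majorant:
 assumes e: "0 \<le> eps" and C: "0 \<le> C" and d: "\<bar>d\<bar> \<le> C * \<bar>r\<bar>" "\<bar>d\<bar> \<le> 2 * C"
 shows "\<bar>d * sym_marchaud eps r\<bar> \<le> C * lipschitz_majorant r"
proof (cases "\<bar>r\<bar> > eps")
 case False
 have "0 \<le> C * lipschitz_majorant r" unfolding lipschitz_majorant_def
  using C by (intro mult_nonneg_nonneg add_nonneg_nonneg) (auto simp: abel_nonneg sym_marchaud_nonneg)
 then show ?thesis using False e by (simp add: sym_marchaud_eq)
next
 case True
 then have r: "0 < \<bar>r\<bar>" using e by simp
 have s: "sym_marchaud eps r = 1 / (\<bar>r\<bar> * sqrt \<bar>r\<bar>)" using True e by (simp add: sym_marchaud_eq)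
 show ?thesis
 proof (cases "\<bar>r\<bar> > 1")
  case big: True
  have "0 \<le> abel r * indicator {0<..<2} r + abel (- r) * indicator {0<..<2} (- r)" by (simp add: abel_nonneg)
  moreover have "sym_marchaud 1 r = 1 / (\<bar>r\<bar> * sqrt \<bar>r\<bar>)" using big by (simp add: sym_marchaud_eq)
  ultimately have "2 * (1 / (\<bar>r\<bar> * sqrt \<bar>r\<bar>)) \<le> lipschitz_majorant r" unfolding lipschitz_majorant_def by linarith
  then have "C * (2 * (1 / (\<bar>r\<bar> * sqrt \<bar>r\<bar>))) \<le> C * lipschitz_majorant r" using C by (rule mult_left_mono)
  moreover have "\<bar>d * sym_marchaud eps r\<bar> \<le> 2 * C * (1 / (\<bar>r\<bar> * sqrt \<bar>r\<bar>))"
   unfolding s abs_mult using d by (intro mult_mono) auto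
  moreover have "2 * C * (1 / (\<bar>r\<bar> * sqrt \<bar>r\<bar>)) = C * (2 * (1 / (\<bar>r\<bar> * sqrt \<bar>r\<bar>)))" by (simp only: mult_ac)
  ultimately show ?thesis by (metis order_trans)
 next
  case False
  have "1 / sqrt \<bar>r\<bar> \<le> lipschitz_majorant r"
   using False r by (cases "0 < r") (auto simp: lipschitz_majorant_def abel_def sym_marchaud_nonneg indicator_def)
  then have "C * (1 / sqrt \<bar>r\<bar>) \<le> C * lipschitz_majorant r" using C by (rule mult_left_mono)
  moreover have "\<bar>d * sym_marchaud eps r\<bar> \<le> (C * \<bar>r\<bar>) * (1 / (\<bar>r\<bar> * sqrt \<bar>r\<bar>))"
   unfolding s abs_mult using d by (intro mult_mono) auto
  moreover have "(C * \<bar>r\<bar>) * (1 / (\<bar>r\<bar> * sqrt \<bar>r\<bar>)) = C * (1 / sqrt \<bar>r\<bar>)" using r by simp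
  ultimately show ?thesis by linarith
 qed
qed

text \<open>Integrable bound for the half-derivative of a function supported in
  \<open>{-c..c}\<close>. For \<open>|t| > 2 * c\<close> only shifts of size at least
  \<open>|t| / 2\<close> reach the support; they form an interval of length \<open>2 * c\<close>
  with values at most \<open>C\<close> and kernel at most \<open>4 * sym_marchaud c t\<close>,
  whence \<open>8 * c * C\<close>.\<close>

definition half_majorant :: "real \<Rightarrow> real \<Rightarrow> real \<Rightarrow> real" where
 "half_majorant C c t = C * (LB r. lipschitz_majorant r) * indicator {-(2 * c)..2 * c} t + 8 * c * C * sym_marchaud c t"

lemma integrable_half_majorant: "0 < c \<Longrightarrow> integrable lborel (half_majorant C c)"
 unfolding half_majorant_def [abs_def]
 by (intro Bochner_Integration.integrable_add integrable_mult_right integrable_indicator_Icc integrable_sym_marchaud(1))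

lemma half_trunc_lipschitz_compact:
 fixes \<phi> :: "real \<Rightarrow> real"
 assumes m [measurable]: "\<phi> \<in> borel_fun" and b: "\<And>t. \<bar>\<phi> t\<bar> \<le> C" and lip: "\<And>s t. \<bar>\<phi> s - \<phi> t\<bar> \<le> C * \<bar>s - t\<bar>"
  and \<phi>0: "\<And>t. \<bar>t\<bar> > c \<Longrightarrow> \<phi> t = 0" and c: "0 < c"
 shows "(half_trunc \<phi> t \<longlongrightarrow> lim0 (half_trunc \<phi> t)) (at_right 0)"
  and "0 < eps \<Longrightarrow> \<bar>half_trunc \<phi> t eps\<bar> \<le> half_majorant C c t"
  and "\<bar>lim0 (half_trunc \<phi> t)\<bar> \<le> half_majorant C c t"
proof -
 have C: "0 \<le> C" using b[of 0] by linarith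
 have w: "integrable lborel (\<lambda>r. C * lipschitz_majorant r)" using integrable_lipschitz_majorant by simp
 have dom: "\<bar>(\<phi> (t + r) - \<phi> t) * sym_marchaud eps r\<bar> \<le> C * lipschitz_majorant r" if "0 \<le> eps" for t r eps
 proof (rule lipschitz_majorant[OF that C])
  show "\<bar>\<phi> (t + r) - \<phi> t\<bar> \<le> C * \<bar>r\<bar>" using lip[of "t + r" t] by simp
  show "\<bar>\<phi> (t + r) - \<phi> t\<bar> \<le> 2 * C" using b[of "t + r"] b[of t] by linarith
 qed
 have "((\<lambda>eps. LB r. (\<phi> (t + r) - \<phi> t) * sym_marchaud eps r) \<longlongrightarrow> (LB r. (\<phi> (t + r) - \<phi> t) * sym_marchaud 0 r)) (at_right 0)"
 proof (rule dominated_convergence_at_right_0[OF _ _ w])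
  fix r
  show "((\<lambda>eps. (\<phi> (t + r) - \<phi> t) * sym_marchaud eps r) \<longlongrightarrow> (\<phi> (t + r) - \<phi> t) * sym_marchaud 0 r) (at_right 0)"
  proof (cases "r = 0")
   case False
   have "\<forall>\<^sub>F eps in at_right 0. (\<phi> (t + r) - \<phi> t) * sym_marchaud 0 r = (\<phi> (t + r) - \<phi> t) * sym_marchaud eps r"
    unfolding eventually_at_right_field using False by (intro exI[of _ "\<bar>r\<bar>"]) (auto simp: sym_marchaud_eq)
   then show ?thesis by (rule Lim_transform_eventually[OF tendsto_const])
  qed simp
 qed (use dom in auto)
 moreover have "\<forall>\<^sub>F eps in at_right 0. (LB r. (\<phi> (t + r) - \<phi> t) * sym_marchaud eps r) = half_trunc \<phi> t eps"
  by (auto simp: eventually_at_filter half_trunc_eq_sym_marchaud)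
 ultimately have "(half_trunc \<phi> t \<longlongrightarrow> (LB r. (\<phi> (t + r) - \<phi> t) * sym_marchaud 0 r)) (at_right 0)"
  by (rule Lim_transform_eventually)
 then show l: "(half_trunc \<phi> t \<longlongrightarrow> lim0 (half_trunc \<phi> t)) (at_right 0)" using lim0_eq by metis
 show bd: "\<bar>half_trunc \<phi> t eps\<bar> \<le> half_majorant C c t" if e: "0 < eps" for eps
 proof (cases "\<bar>t\<bar> \<le> 2 * c")
  case True
  have "\<bar>half_trunc \<phi> t eps\<bar> \<le> (LB r. \<bar>(\<phi> (t + r) - \<phi> t) * sym_marchaud eps r\<bar>)"
   unfolding half_trunc_eq_sym_marchaud[OF e] by (rule integral_abs_bound)
  also have "\<dots> \<le> (LB r. C * lipschitz_majorant r)"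
   by (rule integral_mono[OF integrable_abs[OF half_trunc_integrable[OF m b e]] w]) (rule dom, use e in simp)
  also have "\<dots> \<le> half_majorant C c t"
   using True c C sym_marchaud_nonneg[of c t] by (simp add: half_majorant_def abs_le_iff)
  finally show ?thesis .
 next
  case False
  then have t: "2 * c < \<bar>t\<bar>" by simp
  have \<phi>t: "\<phi> t = 0" using \<phi>0 t c by simp
  have pw: "\<bar>(\<phi> (t + r) - \<phi> t) * sym_marchaud eps r\<bar> \<le> C * (4 * sym_marchaud c t) * indicator {-c - t..c - t} r" for r
  proof (cases "r \<in> {-c - t..c - t}")
   case in_r: True
   then have r: "\<bar>t\<bar> / 2 \<le> \<bar>r\<bar>" using t by (auto simp: abs_if split: if_splits)
   have "0 \<le> sym_marchaud eps r" using e by (simp add: sym_marchaud_nonneg)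
   moreover have "sym_marchaud eps r \<le> 4 * sym_marchaud c t"
   proof -
    have t0: "0 < \<bar>t\<bar>" using t c by simp
    have "sym_marchaud eps r \<le> 1 / (\<bar>r\<bar> * sqrt \<bar>r\<bar>)" using e by (simp add: sym_marchaud_eq)
    \<comment> \<open>Taking \<open>|t| / 4\<close> instead of \<open>|t| / 2\<close> under the root
      makes the final factor rational.\<close>
    also have "\<dots> \<le> 1 / ((\<bar>t\<bar> / 2) * sqrt (\<bar>t\<bar> / 4))"
     using r t0 by (intro divide_left_mono mult_mono real_sqrt_le_mono mult_pos_pos) auto
    also have "\<dots> = 4 * (1 / (\<bar>t\<bar> * sqrt \<bar>t\<bar>))" by (simp add: real_sqrt_divide)
    also have "\<dots> = 4 * sym_marchaud c t" using t c by (simp add: sym_marchaud_eq)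
    finally show ?thesis .
   qed
   ultimately show ?thesis using in_r b[of "t + r"] C by (simp add: \<phi>t abs_mult mult_mono)
  next
   case False
   then have "\<bar>t + r\<bar> > c" by auto
   then show ?thesis using \<phi>0 False by (simp add: \<phi>t)
  qed
  have "\<bar>half_trunc \<phi> t eps\<bar> \<le> (LB r. \<bar>(\<phi> (t + r) - \<phi> t) * sym_marchaud eps r\<bar>)"
   unfolding half_trunc_eq_sym_marchaud[OF e] by (rule integral_abs_bound)
  also have "\<dots> \<le> (LB r. C * (4 * sym_marchaud c t) * indicator {-c - t..c - t} r)"
   by (rule integral_mono[OF integrable_abs[OF half_trunc_integrable[OF m b e]] integrable_mult_right[OF integrable_indicator_Icc] pw])
  also have "\<dots> = 8 * c * C * sym_marchaud c t" using c by simp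
  also have "\<dots> = half_majorant C c t" using t by (auto simp: half_majorant_def indicator_def)
  finally show ?thesis .
 qed
 show "\<bar>lim0 (half_trunc \<phi> t)\<bar> \<le> half_majorant C c t"
 proof (rule tendsto_le[OF trivial_limit_at_right_real tendsto_const tendsto_rabs[OF l]])
  show "\<forall>\<^sub>F eps in at_right 0. \<bar>half_trunc \<phi> t eps\<bar> \<le> half_majorant C c t"
   unfolding eventually_at_filter by (rule always_eventually, intro allI impI bd) simp
 qed
qed

text \<open>The truncated kernel is even and integrable, so Fubini with a reflection in
  \<open>r\<close> and a translation in \<open>t\<close> exchanges the two functions; the term with
  \<open>h t * \<phi> t\<close> is common to both sides.\<close>

lemma half_trunc_adjoint:
 fixes \<phi> h :: "real \<Rightarrow> real"
 assumes \<phi>: "integrable lborel \<phi>" and C: "\<And>t. \<bar>\<phi> t\<bar> \<le> C" and h [measurable]: "h \<in> borel_fun" and B: "\<And>t. \<bar>h t\<bar> \<le> B" and e: "0 < eps"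
 shows "(LB t. \<phi> t * half_trunc h t eps) = (LB t. h t * half_trunc \<phi> t eps)"
proof -
 define k where "k = sym_marchaud eps"
 have k: "integrable lborel k" "(LB r. k r) = 4 / sqrt eps" unfolding k_def by (rule integrable_sym_marchaud[OF e])+
 have [measurable]: "\<phi> \<in> borel_fun" "k \<in> borel_fun" using \<phi> k by auto
 have i1: "integrable lborel2 (\<lambda>p. h (snd p + fst p) * (k (fst p) * \<phi> (snd p)))"
  by (rule integrable_mult_bounded[OF integrable_lborel2_mult(1)[OF k(1) \<phi>]]) (use B in auto)
 have i2: "integrable lborel2 (\<lambda>p. h (snd p) * (k (fst p) * \<phi> (snd p + fst p)))"
 proof (rule integrable_mult_bounded[of lborel2 "\<lambda>p. k (fst p) * \<phi> (snd p + fst p)" "\<lambda>p. h (snd p)" B])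
  have sh: "(LB t. \<bar>\<phi> (t + r)\<bar>) = (LB t. \<bar>\<phi> t\<bar>)" for r
   by (subst lborel_integral_real_affine[of 1 "\<lambda>t. \<bar>\<phi> t\<bar>" r]) (auto simp: add.commute)
  have "integrable lborel2 (case_prod (\<lambda>r t. k r * \<phi> (t + r)))"
  proof (rule lborel_pair.Fubini_integrable)
   have "integrable lborel (\<lambda>r. \<bar>k r\<bar> * (LB t. \<bar>\<phi> t\<bar>))" using k(1) by (intro integrable_mult_left integrable_abs)
   then show "integrable lborel (\<lambda>r. LB t. norm (case (r, t) of (r, t) \<Rightarrow> k r * \<phi> (t + r)))"
    by (simp add: abs_mult sh)
   have "integrable lborel (\<lambda>t. \<phi> (r + 1 * t))" for r by (subst lborel_integrable_real_affine_iff) (use \<phi> in auto)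
   then show "AE r in lborel. integrable lborel (\<lambda>t. case (r, t) of (r, t) \<Rightarrow> k r * \<phi> (t + r))" by (simp add: add.commute)
  qed measurable
  then show "integrable lborel2 (\<lambda>p. k (fst p) * \<phi> (snd p + fst p))" by (simp add: case_prod_beta')
 qed (use B in auto)
 have ph: "integrable lborel (\<lambda>t. h t * \<phi> t)" by (rule integrable_mult_bounded[OF \<phi> _ B]) simp
 have hi: "half_trunc g t eps = (LB r. g (t + r) * k r) - g t * (4 / sqrt eps)"
  if [measurable]: "g \<in> borel_fun" and b: "\<And>t. \<bar>g t\<bar> \<le> b" for g b t
 proof -
  have "integrable lborel (\<lambda>r. g (t + r) * k r)" by (rule integrable_mult_bounded[OF k(1) _ b]) measurable
  then show ?thesis
   unfolding half_trunc_eq_sym_marchaud[OF e] k_def[symmetric] left_diff_distrib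
   using k by (subst Bochner_Integration.integral_diff) auto
 qed
 have A: "(LB t. \<phi> t * half_trunc h t eps) = (LB t. (LB r. h (t + r) * (k r * \<phi> t))) - (LB t. h t * \<phi> t) * (4 / sqrt eps)"
 proof -
  have "\<phi> t * half_trunc h t eps = (LB r. h (t + r) * (k r * \<phi> t)) - h t * \<phi> t * (4 / sqrt eps)" for t
  proof -
   have "(LB r. h (t + r) * (k r * \<phi> t)) = \<phi> t * (LB r. h (t + r) * k r)"
    by (subst integral_mult_right_zero[symmetric]) (simp add: mult_ac)
   then show ?thesis unfolding hi[OF h B] by (simp add: right_diff_distrib mult_ac)
  qed
  moreover have "integrable lborel (\<lambda>t. LB r. h (t + r) * (k r * \<phi> t))"
   using lborel_pair.integrable_snd[of "\<lambda>r t. h (t + r) * (k r * \<phi> t)"] i1 by (simp add: case_prod_beta')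
  ultimately show ?thesis using ph by simp
 qed
 have A': "(LB t. h t * half_trunc \<phi> t eps) = (LB t. (LB r. h t * (k r * \<phi> (t + r)))) - (LB t. h t * \<phi> t) * (4 / sqrt eps)"
 proof -
  have "h t * half_trunc \<phi> t eps = (LB r. h t * (k r * \<phi> (t + r))) - h t * \<phi> t * (4 / sqrt eps)" for t
  proof -
   have "(LB r. h t * (k r * \<phi> (t + r))) = h t * (LB r. \<phi> (t + r) * k r)"
    by (subst integral_mult_right_zero[symmetric]) (simp add: mult_ac)
   then show ?thesis unfolding hi[OF \<open>\<phi> \<in> borel_fun\<close> C] by (simp add: right_diff_distrib mult_ac)
  qed
  moreover have "integrable lborel (\<lambda>t. LB r. h t * (k r * \<phi> (t + r)))"
   using lborel_pair.integrable_snd[of "\<lambda>r t. h t * (k r * \<phi> (t + r))"] i2 by (simp add: case_prod_beta')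
  ultimately show ?thesis using ph by simp
 qed
 have "(LB t. (LB r. h (t + r) * (k r * \<phi> t))) = (LB r. (LB t. h (t + r) * (k r * \<phi> t)))"
  using lborel_pair.Fubini_integral[of "\<lambda>r t. h (t + r) * (k r * \<phi> t)"] i1 by (simp add: case_prod_beta')
 also have "\<dots> = (LB r. (LB t. h (t + - r) * (k (- r) * \<phi> t)))"
  by (subst lborel_integral_real_affine[of "-1" _ 0]) auto
 also have "\<dots> = (LB r. (LB t. h t * (k r * \<phi> (t + r))))"
 proof (rule Bochner_Integration.integral_cong[OF refl])
  fix r
  show "(LB t. h (t + - r) * (k (- r) * \<phi> t)) = (LB t. h t * (k r * \<phi> (t + r)))"
   by (subst lborel_integral_real_affine[of 1 _ r]) (auto simp: k_def sym_marchaud_minus add.commute)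
 qed
 also have "\<dots> = (LB t. (LB r. h t * (k r * \<phi> (t + r))))"
  using lborel_pair.Fubini_integral[of "\<lambda>r t. h t * (k r * \<phi> (t + r))"] i2 by (simp add: case_prod_beta')
 finally show ?thesis unfolding A A' by simp
qed

text \<open>The truncated pairings have two limits, which must coincide. On the side of
  \<open>h\<close> the weak limit is known for the localized \<open>k\<close>, and the tail
  difference \<open>D\<close>, free of \<open>eps\<close>, carries it over to \<open>h\<close>. On
  the side of \<open>\<phi>\<close> dominated convergence with \<open>half_majorant\<close>
  applies.\<close>

lemma half_trunc_distributional:
 fixes h k \<phi> :: "real \<Rightarrow> real"
 assumes h: "h \<in> borel_fun" "\<And>t. \<bar>h t\<bar> \<le> B" and k: "k \<in> borel_fun" "\<And>t. \<bar>k t\<bar> \<le> B'"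
  and m: "\<phi> \<in> borel_fun" and b: "\<And>t. \<bar>\<phi> t\<bar> \<le> C" and lip: "\<And>s t. \<bar>\<phi> s - \<phi> t\<bar> \<le> C * \<bar>s - t\<bar>"
  and \<phi>0: "\<And>t. \<bar>t\<bar> > c \<Longrightarrow> \<phi> t = 0" and c: "0 < c" and \<rho>: "0 < \<rho>"
  and eq: "\<And>t r. \<bar>t\<bar> \<le> c \<Longrightarrow> \<bar>r\<bar> \<le> \<rho> \<Longrightarrow> h (t + r) - h t = k (t + r) - k t"
  and lim: "AE t in lborel. \<bar>t\<bar> \<le> c \<longrightarrow> (\<exists>l. (half_trunc k t \<longlongrightarrow> l) (at_right 0))"
  and weak: "((\<lambda>eps. LB t. \<phi> t * half_trunc k t eps) \<longlongrightarrow> (LB t. \<phi> t * lim0 (half_trunc k t))) (at_right 0)"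
  and int: "integrable lborel (\<lambda>t. \<phi> t * lim0 (half_trunc h t))"
 shows "(LB t. \<phi> t * lim0 (half_trunc h t)) = (LB t. h t * lim0 (half_trunc \<phi> t))"
proof -
 define D where "D t = half_trunc h t \<rho> - half_trunc k t \<rho>" for t
 note [measurable] = h(1) k(1) m
 have tm: "(\<lambda>t. half_trunc g t eps) \<in> borel_fun" if [measurable]: "g \<in> borel_fun" and "0 < eps" for g eps
  unfolding half_trunc_eq_sym_marchaud[OF that(2)] by measurable
 have tb: "\<bar>half_trunc g t eps\<bar> \<le> 4 * (2 * a) / sqrt eps" if "g \<in> borel_fun" "\<And>t. \<bar>g t\<bar> \<le> a" "0 < eps" for g a t eps
 proof (rule half_trunc_abs_le[OF that(1,3)])
  show "\<bar>g (t + r) - g t\<bar> \<le> 2 * a" for r using that(2)[of "t + r"] that(2)[of t] by linarith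
 qed
 have \<phi>i: "integrable lborel \<phi>"
 proof -
  have "integrable lborel (\<lambda>t. \<phi> t * indicator {-c..c} t)" by (rule integrable_mult_bounded[OF integrable_indicator_Icc _ b]) simp
  moreover have "\<phi> t * indicator {-c..c} t = \<phi> t" for t using \<phi>0[of t] by (cases "\<bar>t\<bar> > c") (auto simp: indicator_def abs_le_iff not_less)
  ultimately show ?thesis by simp
 qed
 have ik: "integrable lborel (\<lambda>t. \<phi> t * half_trunc g t eps)" if "g \<in> borel_fun" "\<And>t. \<bar>g t\<bar> \<le> a" "0 < eps" for g a eps
  using integrable_mult_bounded[OF \<phi>i _ tb[OF that]] tm[OF that(1,3)] by (simp add: mult.commute)
 have Di: "integrable lborel (\<lambda>t. \<phi> t * D t)"
  unfolding D_def right_diff_distrib by (intro Bochner_Integration.integrable_diff ik[OF h \<rho>] ik[OF k \<rho>])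
 have [measurable]: "(\<lambda>t. lim0 (half_trunc h t)) \<in> borel_fun" "(\<lambda>t. lim0 (half_trunc k t)) \<in> borel_fun"
  by (rule lim0_half_trunc_measurable[OF h], rule lim0_half_trunc_measurable[OF k])
 have Dm [measurable]: "D \<in> borel_fun" unfolding D_def [abs_def] by (intro borel_measurable_diff tm[OF h(1) \<rho>] tm[OF k(1) \<rho>])
 have ae: "AE t in lborel. \<phi> t * lim0 (half_trunc k t) = \<phi> t * lim0 (half_trunc h t) - \<phi> t * D t"
  using lim
 proof eventually_elim
  case (elim t)
  show ?case
  proof (cases "\<bar>t\<bar> \<le> c")
   case True
   with elim obtain l where l: "(half_trunc k t \<longlongrightarrow> l) (at_right 0)" by blast
   have "lim0 (half_trunc h t) = l + D t"
    unfolding D_def by (rule lim0_eq[OF half_trunc_local_limit[OF h k eq[OF True] \<rho> l]])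
   then show ?thesis unfolding lim0_eq[OF l] by (simp add: distrib_left)
  next
   case False
   then show ?thesis using \<phi>0 by simp
  qed
 qed
 have "(LB t. \<phi> t * lim0 (half_trunc k t)) = (LB t. \<phi> t * lim0 (half_trunc h t) - \<phi> t * D t)"
  by (rule integral_cong_AE[OF _ _ ae]) measurable
 also have "\<dots> = (LB t. \<phi> t * lim0 (half_trunc h t)) - (LB t. \<phi> t * D t)"
  by (rule Bochner_Integration.integral_diff[OF int Di])
 finally have K: "(LB t. \<phi> t * lim0 (half_trunc k t)) + (LB t. \<phi> t * D t) = (LB t. \<phi> t * lim0 (half_trunc h t))" by simp
 have "((\<lambda>eps. (LB t. \<phi> t * half_trunc k t eps) + (LB t. \<phi> t * D t)) \<longlongrightarrow> (LB t. \<phi> t * lim0 (half_trunc h t))) (at_right 0)"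
  unfolding K[symmetric] by (intro tendsto_add weak tendsto_const)
 moreover have "\<forall>\<^sub>F eps in at_right 0. (LB t. \<phi> t * half_trunc k t eps) + (LB t. \<phi> t * D t) = (LB t. h t * half_trunc \<phi> t eps)"
  unfolding eventually_at_right_field
 proof (intro exI[of _ \<rho>] conjI allI impI \<rho>)
  fix eps assume e: "0 < eps" "eps < \<rho>"
  have "\<phi> t * half_trunc k t eps + \<phi> t * D t = \<phi> t * half_trunc h t eps" for t
  proof (cases "\<bar>t\<bar> \<le> c")
   case True
   have "half_trunc h t eps = half_trunc k t eps + D t"
    unfolding D_def by (rule half_trunc_local[OF h k eq[OF True] e(1) less_imp_le[OF e(2)]])
   then show ?thesis by (simp add: distrib_left)
  next
   case False
   then show ?thesis using \<phi>0 by simp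
  qed
  then have "(LB t. \<phi> t * half_trunc k t eps) + (LB t. \<phi> t * D t) = (LB t. \<phi> t * half_trunc h t eps)"
   by (simp add: Bochner_Integration.integral_add[OF ik[OF k e(1)] Di, symmetric])
  also have "\<dots> = (LB t. h t * half_trunc \<phi> t eps)" by (rule half_trunc_adjoint[OF \<phi>i b h e(1)])
  finally show "(LB t. \<phi> t * half_trunc k t eps) + (LB t. \<phi> t * D t) = (LB t. h t * half_trunc \<phi> t eps)" .
 qed
 ultimately have l1: "((\<lambda>eps. LB t. h t * half_trunc \<phi> t eps) \<longlongrightarrow> (LB t. \<phi> t * lim0 (half_trunc h t))) (at_right 0)"
  by (rule Lim_transform_eventually)
 have L1: "(half_trunc \<phi> t \<longlongrightarrow> lim0 (half_trunc \<phi> t)) (at_right 0)" for t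
  by (rule half_trunc_lipschitz_compact(1)[OF m b lip _ c]) (rule \<phi>0)
 have L2: "\<bar>half_trunc \<phi> t eps\<bar> \<le> half_majorant C c t" if "0 < eps" for t eps
  by (rule half_trunc_lipschitz_compact(2)[OF m b lip _ c that]) (rule \<phi>0)
 have l2: "((\<lambda>eps. LB t. h t * half_trunc \<phi> t eps) \<longlongrightarrow> (LB t. h t * lim0 (half_trunc \<phi> t))) (at_right 0)"
 proof (rule dominated_convergence_at_right_0)
  show "(\<lambda>t. h t * lim0 (half_trunc \<phi> t)) \<in> borel_measurable lborel" using lim0_half_trunc_measurable[OF m b] by measurable
  show "(\<lambda>t. h t * half_trunc \<phi> t eps) \<in> borel_measurable lborel" if "0 < eps" for eps using tm[OF m that] by measurable
  show "integrable lborel (\<lambda>t. B * half_majorant C c t)" using integrable_half_majorant[OF c] by simp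
  show "((\<lambda>eps. h t * half_trunc \<phi> t eps) \<longlongrightarrow> h t * lim0 (half_trunc \<phi> t)) (at_right 0)" for t by (intro tendsto_mult tendsto_const L1)
  show "\<bar>h t * half_trunc \<phi> t eps\<bar> \<le> B * half_majorant C c t" if "0 < eps" for eps t
   unfolding abs_mult using h(2)[of t] L2[OF that, of t] by (intro mult_mono) auto
 qed
 show ?thesis by (rule tendsto_unique[OF trivial_limit_at_right_real l1 l2])
qed

text \<open>The Lipschitz bound along vertical lines comes from the derivative \<open>d\<close>,
  continuous and hence bounded on the compact support, and zero off it.\<close>

lemma test_function_bounds:
 fixes \<phi> :: "'n::finite heis \<Rightarrow> real"
 assumes "\<phi> \<in> test_functions"
 shows "continuous_on UNIV \<phi>" and "\<exists>C c. 0 < c \<and> (\<forall>p. \<bar>\<phi> p\<bar> \<le> C) \<and> (\<forall>z s t. \<bar>\<phi> (z, s) - \<phi> (z, t)\<bar> \<le> C * \<bar>s - t\<bar>) \<and>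
  (\<forall>z t. norm z > c \<or> \<bar>t\<bar> > c \<longrightarrow> \<phi> (z, t) = 0)"
proof -
 define K where "K = closure (support_on UNIV \<phi>)"
 have Ck: "C_k k \<phi>" for k using assms by (auto simp: test_functions_def)
 have K: "compact K" using assms by (auto simp: test_functions_def K_def)
 show cont: "continuous_on UNIV \<phi>" using Ck[of 0] by simp
 have out: "\<phi> p = 0" if "p \<notin> K" for p
  using that closure_subset[of "support_on UNIV \<phi>"] unfolding K_def by (auto simp: support_on_def)
 have "\<phi> differentiable_on UNIV" using Ck[of "Suc 0"] unfolding C_k.simps by blast
 then have diff: "\<phi> differentiable (at p)" for p unfolding differentiable_on_def by blast
 define d where "d p = frechet_derivative \<phi> (at p) (0, 1)" for p
 have dc: "continuous_on UNIV d" using Ck[of "Suc 0"] unfolding d_def [abs_def] C_k.simps by blast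
 obtain b1 where b1: "\<And>p. p \<in> K \<Longrightarrow> \<bar>\<phi> p\<bar> \<le> b1"
  using compact_imp_bounded[OF compact_continuous_image[OF continuous_on_subset[OF cont subset_UNIV] K]] unfolding bounded_real by blast
 obtain b2 where b2: "\<And>p. p \<in> K \<Longrightarrow> \<bar>d p\<bar> \<le> b2"
  using compact_imp_bounded[OF compact_continuous_image[OF continuous_on_subset[OF dc subset_UNIV] K]] unfolding bounded_real by blast
 obtain b3 where b3: "\<And>p. p \<in> K \<Longrightarrow> norm p \<le> b3" using compact_imp_bounded[OF K] unfolding bounded_iff by blast
 define C where "C = max 0 (max b1 b2)"
 have D: "(\<phi> has_derivative frechet_derivative \<phi> (at p)) (at p)" for p using diff frechet_derivative_works by blast
 have D1: "((\<lambda>s. \<phi> (z, s)) has_real_derivative d (z, s)) (at s)" for z s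
 proof -
  have "((\<lambda>s. \<phi> (z, s)) has_derivative (\<lambda>v. frechet_derivative \<phi> (at (z, s)) (0, v))) (at s)"
   by (rule has_derivative_compose[OF _ D]) (auto intro!: derivative_eq_intros)
  moreover have "frechet_derivative \<phi> (at (z, s)) (0, v) = d (z, s) * v" for v
  proof -
   interpret bounded_linear "frechet_derivative \<phi> (at (z, s))" by (rule has_derivative_bounded_linear[OF D])
   show ?thesis using scaleR[of v "(0, 1)"] by (simp add: d_def mult.commute)
  qed
  ultimately show ?thesis unfolding has_field_derivative_def by (simp add: mult_commute_abs)
 qed
 have dC: "\<bar>d p\<bar> \<le> C" for p
 proof (cases "p \<in> K")
  case True
  then show ?thesis using b2[OF True] by (auto simp: C_def)
 next
  case False
  have op: "open (- K)" using compact_imp_closed[OF K] by blast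
  have zero: "((\<lambda>_. 0 :: real) has_derivative (\<lambda>_. 0)) (at p)" by simp
  have "(\<phi> has_derivative (\<lambda>_. 0)) (at p)"
   by (rule has_derivative_transform_within_open[OF zero op]) (simp_all add: False out)
  from frechet_derivative_at[OF this, symmetric] have "frechet_derivative \<phi> (at p) = (\<lambda>_. 0)" .
  then show ?thesis by (simp add: d_def C_def)
 qed
 have "\<bar>\<phi> p\<bar> \<le> C" for p using b1[of p] out[of p] by (cases "p \<in> K") (auto simp: C_def)
 moreover have "\<bar>\<phi> (z, s) - \<phi> (z, t)\<bar> \<le> C * \<bar>s - t\<bar>" for z s t
  using field_differentiable_bound[of UNIV "\<lambda>s. \<phi> (z, s)" "\<lambda>s. d (z, s)" C s t] D1 dC by auto
 moreover have "\<phi> (z, t) = 0" if far: "norm z > \<bar>b3\<bar> + 1 \<or> \<bar>t\<bar> > \<bar>b3\<bar> + 1" for z t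
 proof (rule out)
  show "(z, t) \<notin> K"
  proof
   assume "(z, t) \<in> K"
   then have "norm (z, t) \<le> b3" by (rule b3)
   then show False using far norm_fst_le[of z t] norm_snd_le[of t z] by auto
  qed
 qed
 moreover have "0 < \<bar>b3\<bar> + 1" by simp
 ultimately show "\<exists>C c. 0 < c \<and> (\<forall>p. \<bar>\<phi> p\<bar> \<le> C) \<and> (\<forall>z s t. \<bar>\<phi> (z, s) - \<phi> (z, t)\<bar> \<le> C * \<bar>s - t\<bar>) \<and>
  (\<forall>z t. norm z > c \<or> \<bar>t\<bar> > c \<longrightarrow> \<phi> (z, t) = 0)"
  by (intro exI[of _ C] exI[of _ "\<bar>b3\<bar> + 1"] conjI allI impI)
qed

text \<open>The left integrand is integrable because \<open>T_half f\<close> is locally so, the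
  right one by \<open>half_majorant\<close>. Equality holds on almost every vertical line and is
  then integrated over \<open>z\<close>.\<close>

lemma T_half_distributional:
 fixes f :: "'n::finite heis \<Rightarrow> real"
 assumes f: "hlipschitz L f" and L: "0 < L" and B: "\<And>p. \<bar>f p\<bar> \<le> B" and \<phi>: "\<phi> \<in> test_functions"
 shows "integrable lebesgue (\<lambda>p. \<phi> p * T_half f p)" "integrable lebesgue (\<lambda>p. f p * T_half \<phi> p)"
  "(LINT p|lebesgue. \<phi> p * T_half f p) = (LINT p|lebesgue. f p * T_half \<phi> p)"
proof -
 obtain C c where *: "0 < c \<and> (\<forall>p. \<bar>\<phi> p\<bar> \<le> C) \<and> (\<forall>z s t. \<bar>\<phi> (z, s) - \<phi> (z, t)\<bar> \<le> C * \<bar>s - t\<bar>) \<and>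
  (\<forall>z t. norm z > c \<or> \<bar>t\<bar> > c \<longrightarrow> \<phi> (z, t) = 0)"
  using test_function_bounds(2)[OF \<phi>] by (elim exE)
 have \<phi>c: "continuous_on UNIV \<phi>" by (rule test_function_bounds(1)[OF \<phi>])
 have c: "0 < c" and b: "\<And>p. \<bar>\<phi> p\<bar> \<le> C" and lip: "\<And>z s t. \<bar>\<phi> (z, s) - \<phi> (z, t)\<bar> \<le> C * \<bar>s - t\<bar>"
  and \<phi>0: "\<And>z t. norm z > c \<or> \<bar>t\<bar> > c \<Longrightarrow> \<phi> (z, t) = 0" using * by blast+
 have fc: "continuous_on UNIV f" by (rule hlipschitz_continuous[OF f])
 have fm [measurable]: "f \<in> borel_fun" and \<phi>m [measurable]: "\<phi> \<in> borel_fun"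
  using fc \<phi>c by (auto intro: borel_measurable_continuous_onI)
 have Tm [measurable]: "T_half f \<in> borel_fun" "T_half \<phi> \<in> borel_fun"
  by (rule T_half_measurable(2)[OF fc B], rule T_half_measurable(2)[OF \<phi>c b])
 let ?S = "cball 0 c \<times> {-c..c} :: 'n heis set"
 have S: "compact ?S" by (intro compact_Times compact_cball compact_Icc)
 have Sb [measurable]: "?S \<in> sets borel" using S by (rule borel_compact)
 have "set_integrable lebesgue ?S (T_half f)" using bmo_norm_T_half_le(2)[OF f L B] S unfolding L1_loc_def by blast
 then have "integrable lborel (\<lambda>p. indicator ?S p *\<^sub>R T_half f p)" unfolding set_integrable_def by (subst (asm) integrable_completion) simp_all
 from integrable_mult_bounded[OF this _ b] have i0: "integrable lborel (\<lambda>p. \<phi> p * (indicator ?S p *\<^sub>R T_half f p))" by simp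
 have i1: "integrable lborel (\<lambda>p. \<phi> p * T_half f p)"
 proof -
  have eq: "\<phi> p * (indicator ?S p *\<^sub>R T_half f p) = \<phi> p * T_half f p" for p
  proof (cases "p \<in> ?S")
   case False
   then have "\<not> (norm (fst p) \<le> c \<and> -c \<le> snd p \<and> snd p \<le> c)" unfolding mem_Times_iff mem_cball_0 atLeastAtMost_iff .
   then have "norm (fst p) > c \<or> \<bar>snd p\<bar> > c" by linarith
   then have "\<phi> p = 0" using \<phi>0[of "fst p" "snd p"] by simp
   then show ?thesis by simp
  qed simp
  show ?thesis using i0 unfolding eq .
 qed
 have \<phi>z: "(\<lambda>s. \<phi> (z, s)) \<in> borel_fun" "continuous_on UNIV (\<lambda>s. \<phi> (z, s))" for z
  by (rule borel_measurable_slice[OF \<phi>m], rule slice_continuous[OF \<phi>c])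
 have \<phi>z0: "\<phi> (z, t) = 0" if "\<bar>t\<bar> > c" for z t using \<phi>0 that by blast
 have T\<phi>: "\<bar>T_half \<phi> (z, t)\<bar> \<le> indicator (cball 0 c) z * half_majorant C c t" for z t
 proof (cases "norm z \<le> c")
  case True
  moreover have "\<bar>lim0 (half_trunc (\<lambda>s. \<phi> (z, s)) t)\<bar> \<le> half_majorant C c t"
   by (rule half_trunc_lipschitz_compact(3)[OF \<phi>z(1) b lip _ c]) (rule \<phi>z0)
  ultimately show ?thesis unfolding T_half_def T_half_trunc_eq fst_conv snd_conv by simp
 next
  case False
  then have "\<phi> (z, s) = 0" for s using \<phi>0 by auto
  then have "half_trunc (\<lambda>s. \<phi> (z, s)) t = (\<lambda>_. 0)" by (auto simp: half_trunc_def)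
  then have "T_half \<phi> (z, t) = lim0 (\<lambda>_. 0)" unfolding T_half_def T_half_trunc_eq fst_conv snd_conv by simp
  also have "\<dots> = 0" by (rule lim0_eq) simp
  finally show ?thesis using False by simp
 qed
 have Gi: "integrable lborel (\<lambda>p :: 'n heis. indicator (cball 0 c) (fst p) * half_majorant C c (snd p))"
 proof (rule integrableI_bounded)
  note G = integrable_half_majorant[OF c, of C]
  have Gm: "half_majorant C c \<in> borel_fun" using borel_measurable_integrable[OF G] by simp
  have m1: "(\<lambda>p :: 'n heis. indicator (cball 0 c) (fst p) :: real) \<in> borel_measurable (borel \<Otimes>\<^sub>M borel)"
   by (rule measurable_compose[OF measurable_fst borel_measurable_indicator]) (simp add: borel_closed)
  have m2: "(\<lambda>p :: 'n heis. half_majorant C c (snd p)) \<in> borel_measurable (borel \<Otimes>\<^sub>M borel)"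
   by (rule measurable_compose[OF measurable_snd Gm])
  have m: "(\<lambda>p :: 'n heis. indicator (cball 0 c) (fst p) * half_majorant C c (snd p)) \<in> borel_fun"
   unfolding borel_prod_pair by (rule borel_measurable_times[OF m1 m2])
  then show "(\<lambda>p :: 'n heis. indicator (cball 0 c) (fst p) * half_majorant C c (snd p)) \<in> borel_measurable lborel" by simp
  have "(\<integral>\<^sup>+p. ennreal (norm (indicator (cball 0 c) (fst p) * half_majorant C c (snd p))) \<partial>(lborel :: 'n heis measure))
    = (\<integral>\<^sup>+z. (NN t. ennreal (norm (indicator (cball 0 c) z * half_majorant C c t))) \<partial>(lborel :: 'n plane measure))"
   by (subst nn_integral_lborel_slices) (use m in \<open>auto intro!: measurable_ennreal borel_measurable_norm simp del: real_norm_def\<close>)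
  also have "\<dots> = (\<integral>\<^sup>+z. indicator (cball 0 c) z * (NN t. ennreal (norm (half_majorant C c t))) \<partial>(lborel :: 'n plane measure))"
  proof (rule nn_integral_cong)
   fix z :: "'n plane"
   show "(NN t. ennreal (norm (indicator (cball 0 c) z * half_majorant C c t))) = indicator (cball 0 c) z * (NN t. ennreal (norm (half_majorant C c t)))"
    by (cases "z \<in> cball 0 c") (simp_all del: mem_cball)
  qed
  also have "\<dots> = (NN t. ennreal (norm (half_majorant C c t))) * emeasure lborel (cball 0 c :: 'n plane set)"
   by (subst mult.commute) (rule nn_integral_cmult_indicator, simp)
  also have "\<dots> < \<infinity>" using G emeasure_bounded_finite[OF bounded_cball] by (auto simp: integrable_iff_bounded ennreal_mult_less_top)
  finally show "(\<integral>\<^sup>+p. ennreal (norm (indicator (cball 0 c) (fst p) * half_majorant C c (snd p))) \<partial>(lborel :: 'n heis measure)) < \<infinity>" .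
 qed
 have i2: "integrable lborel (\<lambda>p. f p * T_half \<phi> p)"
 proof (rule integrable_mult_bounded[OF Bochner_Integration.integrable_bound[OF Gi] _ B])
  show "AE p in lborel. norm (T_half \<phi> p) \<le> norm (indicator (cball 0 c) (fst p) * half_majorant C c (snd p))"
  proof (rule AE_I2)
   fix p :: "'n heis"
   show "norm (T_half \<phi> p) \<le> norm (indicator (cball 0 c) (fst p) * half_majorant C c (snd p))"
    using T\<phi>[of "fst p" "snd p"] unfolding prod.collapse real_norm_def by linarith
  qed
 qed simp_all
 show "integrable lebesgue (\<lambda>p. \<phi> p * T_half f p)" "integrable lebesgue (\<lambda>p. f p * T_half \<phi> p)"
  using i1 i2 by (simp_all add: integrable_completion)
 \<comment> \<open>As \<open>R \<ge> 4\<close>, one has \<open>c \<le> R \<le> R^2 / 4\<close>: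
   vertical shifts by up to \<open>R^2 / 4\<close> from heights at most \<open>c\<close> stay where
   the cutoff is 1.\<close>
 define R where "R = c + 4"
 have R: "0 < R" using c by (simp add: R_def)
 have cR: "c \<le> R" "c \<le> R\<^sup>2 / 4" "c < 2 * R\<^sup>2"
 proof -
  have "4 * R \<le> R * R" using c by (intro mult_right_mono) (auto simp: R_def)
  then show "c \<le> R" "c \<le> R\<^sup>2 / 4" "c < 2 * R\<^sup>2" using c R_def unfolding power2_eq_square by linarith+
 qed
 define u where "u = localize R f"
 have u: "continuous_on UNIV u" unfolding u_def by (rule localize_continuous[OF R f])
 have uB: "\<bar>u p\<bar> \<le> 3 * L * R" for p unfolding u_def by (rule localize_abs_le[OF f R])
 have um: "u \<in> borel_fun" using u by (rule borel_measurable_continuous_onI)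
 let ?out = "cball 0 (2 * R) \<times> {-(2 * R\<^sup>2)..2 * R\<^sup>2} :: 'n heis set"
 have "emeasure lborel ?out < \<infinity>"
  by (rule emeasure_bounded_finite) (intro bounded_Times bounded_cball bounded_closed_interval)
 then have "emeasure lborel ?out \<le> ennreal (measure lborel ?out)" by (simp add: emeasure_eq_ennreal_measure)
 note slices = localize_slices(3,4)[OF f R this measure_nonneg, folded u_def]
 have "AE z in lborel. (LB t. \<phi> (z, t) * T_half f (z, t)) = (LB t. f (z, t) * T_half \<phi> (z, t))"
  using slices integral_lborel_slices(3)[OF i1]
 proof eventually_elim
  case (elim z)
  show ?case
  proof (cases "norm z \<le> R")
   case True
   have *: "(LB t. \<phi> (z, t) * lim0 (half_trunc (\<lambda>s. f (z, s)) t)) = (LB t. f (z, t) * lim0 (half_trunc (\<lambda>s. \<phi> (z, s)) t))"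
   proof (rule half_trunc_distributional[where k = "\<lambda>s. u (z, s)" and \<rho> = "R\<^sup>2 / 4", OF borel_measurable_slice[OF fm] B borel_measurable_slice[OF um] uB \<phi>z(1) b lip \<phi>z0 c])
    show "0 < R\<^sup>2 / 4" using R by simp
    show "f (z, t + r) - f (z, t) = u (z, t + r) - u (z, t)" if "\<bar>t\<bar> \<le> c" "\<bar>r\<bar> \<le> R\<^sup>2 / 4" for t r
    proof -
     have "\<bar>t + r\<bar> \<le> R\<^sup>2" "\<bar>t\<bar> \<le> R\<^sup>2" using that cR zero_le_power2[of R] by linarith+
     then have "u (z, t + r) = f (z, t + r) - f 0" "u (z, t) = f (z, t) - f 0"
      unfolding u_def using localize_eq[OF R True] by blast+
     then show ?thesis by simp
    qed
    show "AE t in lborel. \<bar>t\<bar> \<le> c \<longrightarrow> (\<exists>l. (half_trunc (\<lambda>s. u (z, s)) t \<longlongrightarrow> l) (at_right 0))"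
     using elim(1)
    proof eventually_elim
     case (elim t)
     have "-(2 * R\<^sup>2) < t \<and> t < 2 * R\<^sup>2" if "\<bar>t\<bar> \<le> c" using that cR by linarith
     then show ?case using elim by blast
    qed
    have "\<forall>t. t \<notin> {-(2 * R\<^sup>2)<..<2 * R\<^sup>2} \<longrightarrow> \<phi> (z, t) = 0"
    proof (intro allI impI \<phi>z0)
     fix t assume "t \<notin> {-(2 * R\<^sup>2)<..<2 * R\<^sup>2}"
     then have "\<not> (-(2 * R\<^sup>2) < t \<and> t < 2 * R\<^sup>2)" by simp
     then show "\<bar>t\<bar> > c" using cR by linarith
    qed
    then show "((\<lambda>eps. LB t. \<phi> (z, t) * half_trunc (\<lambda>s. u (z, s)) t eps) \<longlongrightarrow> (LB t. \<phi> (z, t) * lim0 (half_trunc (\<lambda>s. u (z, s)) t))) (at_right 0)"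
     using elim(2) \<phi>z(2) b by blast
    show "integrable lborel (\<lambda>t. \<phi> (z, t) * lim0 (half_trunc (\<lambda>s. f (z, s)) t))"
     using elim(3) unfolding T_half_def T_half_trunc_eq fst_conv snd_conv .
   qed
   then show ?thesis unfolding T_half_def T_half_trunc_eq fst_conv snd_conv .
  next
   case False
   then have "norm z > c" using cR by linarith
   then have "\<phi> (z, t) = 0" "T_half \<phi> (z, t) = 0" for t using \<phi>0 T\<phi>[of z t] by auto
   then show ?thesis by simp
  qed
 qed
 then have "(LB z. (LB t. \<phi> (z, t) * T_half f (z, t))) = (LB z. (LB t. f (z, t) * T_half \<phi> (z, t)))"
  by (intro integral_cong_AE borel_measurable_integrable integral_lborel_slices(2)[OF i1] integral_lborel_slices(2)[OF i2])
 then have "(LB p. \<phi> p * T_half f p) = (LB p. f p * T_half \<phi> p)"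
  unfolding integral_lborel_slices(1)[OF i1] integral_lborel_slices(1)[OF i2] .
 then show "(LINT p|lebesgue. \<phi> p * T_half f p) = (LINT p|lebesgue. f p * T_half \<phi> p)"
  by (simp add: integral_completion)
qed

lemma hlipschitz_mono: "hlipschitz L f \<Longrightarrow> L \<le> L' \<Longrightarrow> hlipschitz L' f"
proof -
 assume f: "hlipschitz L f" and le: "L \<le> L'"
 have "L * hdist p q \<le> L' * hdist p q" for p q :: "'a heis"
  using le by (intro mult_right_mono) (simp_all add: hdist_def hnorm_nonneg)
 then show ?thesis using f le unfolding hlipschitz_def by (meson order_trans)
qed

text \<open>The Lipschitz constant is replaced by \<open>2 * n + 4\<close> times the gradient norm.
  The oscillation bound asks for a positive constant, so \<open>e / K\<close> is added and removed
  at the end, which covers a vanishing gradient. If the gradient norm is infinite, so is the right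
  side, because the factor is positive.\<close>

lemma bmo_norm_T_half_le_hgrad:
 fixes f :: "'n::finite heis \<Rightarrow> real"
 assumes f: "hlipschitz L f" and B: "\<And>p. \<bar>f p\<bar> \<le> B"
 shows "bmo_norm (T_half f) \<le> ennreal (2 * osc_const (DIM('n plane)) * (2 * real CARD('n) + 4)) * hgrad_Linf f"
proof -
 define K where "K = 2 * osc_const (DIM('n plane))"
 define N where "N = 2 * real CARD('n) + 4"
 have K: "0 < K" unfolding K_def using osc_const_pos by simp
 have N: "0 < N" by (simp add: N_def)
 have KN: "0 < K * N" using K N by simp
 show ?thesis
 proof (cases "hgrad_Linf f")
  case top
  then show ?thesis unfolding K_def[symmetric] N_def[symmetric] using K N by (simp add: ennreal_mult_top)
 next
  case (real M)
  have "AE p in lebesgue. ennreal (norm (hgrad f p)) \<le> hgrad_Linf f" unfolding hgrad_Linf_def by (rule esssup_AE)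
  then have "AE p in lebesgue. norm (hgrad f p) \<le> M" unfolding real(2) by eventually_elim (use real(1) in \<open>simp add: ennreal_le_iff\<close>)
  from hgrad_bound_imp_hlipschitz[OF f this real(1)] have fM: "hlipschitz (N * M) f" unfolding N_def .
  have "bmo_norm (T_half f) \<le> ennreal (K * N * M)"
  proof (rule ennreal_le_epsilon)
   fix e :: real assume e: "0 < e"
   have NM: "0 \<le> N * M" using N real(1) by simp
   have ek: "0 < e / K" using e K by simp
   have "hlipschitz (N * M + e / K) f" by (rule hlipschitz_mono[OF fM]) (use ek in linarith)
   moreover have "0 < N * M + e / K" using NM ek by linarith
   ultimately have "bmo_norm (T_half f) \<le> ennreal (K * (N * M + e / K))" unfolding K_def by (rule bmo_norm_T_half_le(1)[OF _ _ B])
   also have "K * (N * M + e / K) = K * N * M + e" using K by (simp add: distrib_left)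
   also have "ennreal (K * N * M + e) = ennreal (K * N * M) + ennreal e" using KN real(1) e by (intro ennreal_plus) auto
   finally show "bmo_norm (T_half f) \<le> ennreal (K * N * M) + ennreal e" .
  qed
  also have "ennreal (K * N * M) = ennreal (K * N) * ennreal M" using KN real(1) by (intro ennreal_mult) auto
  finally show ?thesis unfolding K_def N_def real(2) .
 qed
qed

theorem corollary1p6:
  "\<exists>C::real. C \<ge> 0 \<and> (\<forall>f \<in> (W1inf :: ('n::finite heis \<Rightarrow> real) set).
     (AE p in lebesgue. \<exists>l. (T_half_trunc f p \<longlongrightarrow> l) (at_right 0)) \<and>
     (\<forall>\<phi> \<in> test_functions.
        integrable lebesgue (\<lambda>p. \<phi> p * T_half f p) \<and>
        integrable lebesgue (\<lambda>p. f p * T_half \<phi> p) \<and>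
        (LINT p|lebesgue. \<phi> p * T_half f p) = (LINT p|lebesgue. f p * T_half \<phi> p)) \<and>
     T_half f \<in> BMO \<and>
     bmo_norm (T_half f) \<le> ennreal C * hgrad_Linf f)"
proof (intro exI[of _ "2 * osc_const (DIM('n plane)) * (2 * real CARD('n) + 4)"] conjI ballI)
 show "0 \<le> 2 * osc_const (DIM('n plane)) * (2 * real CARD('n) + 4)"
  using osc_const_pos by (intro mult_nonneg_nonneg) (auto simp: less_imp_le)
 fix f :: "'n heis \<Rightarrow> real" assume "f \<in> W1inf"
 then obtain B L0 where B: "\<And>p. \<bar>f p\<bar> \<le> B" and f0: "hlipschitz L0 f"
  unfolding W1inf_iff bounded_real by blast
 \<comment> \<open>Adding 1 makes the constant positive. It serves for existence, the pairings and
   the finiteness of the norm; the quantitative bound rests on the gradient.\<close>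
 define L where "L = L0 + 1"
 have f: "hlipschitz L f" by (rule hlipschitz_mono[OF f0]) (simp add: L_def)
 have L: "0 < L" using f0 unfolding L_def hlipschitz_def by linarith
 show "AE p in lebesgue. \<exists>l. (T_half_trunc f p \<longlongrightarrow> l) (at_right 0)"
  by (rule AE_completion[OF T_half_exists_AE[OF f B]])
 show "integrable lebesgue (\<lambda>p. \<phi> p * T_half f p)" "integrable lebesgue (\<lambda>p. f p * T_half \<phi> p)"
  "(LINT p|lebesgue. \<phi> p * T_half f p) = (LINT p|lebesgue. f p * T_half \<phi> p)" if "\<phi> \<in> test_functions" for \<phi>
  by (rule T_half_distributional[OF f L B that])+
 show "T_half f \<in> BMO"
  using bmo_norm_T_half_le[OF f L B] unfolding BMO_def by (auto intro: le_less_trans)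
 show "bmo_norm (T_half f) \<le> ennreal (2 * osc_const (DIM('n plane)) * (2 * real CARD('n) + 4)) * hgrad_Linf f"
  by (rule bmo_norm_T_half_le_hgrad[OF f B])
qed

end
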